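(* Let $G$ be a star graph with $N\ge 2$ rays $E_1,\dots,E_N$ and parameters $(p_1,\dots,p_N)\in\,]0,1[^N$, $\sum_{i=1}^N p_i=1$. Let $(\varphi,\mathcal W)$ be a solution of (ISDE) with $\varphi$ a stochastic flow of mappings, and let $K^{\mathcal W}$ be the stochastic flow of kernels such that for all $s\le t$, $x\in G$, a.s. $K^{\mathcal W}_{s,t}(x)=\mathbb E[\delta_{\varphi_{s,t}(x)}\mid\mathcal F^{\mathcal W}_{s,t}]$. Then $K^{\mathcal W}$ is the only stochastic flow of kernels (SFK) solution of (ISDE) if and only if $N=2$.
   Context: **Star graph.** $G=\bigcup_{i=1}^N E_i$ is a locally compact metric space with $E_i\cap E_j=\{0\}$ for $i\ne j$, each $E_i$ isometric to $[0,\infty[$ via $e_i:[0,\infty[\to E_i$ (with $e_i(0)=0$), and metric $d(x,y)=|u-v|$ if $x=e_i(u),y=e_i(v)$ for some $i$, $d(x,y)=d(x,0)+d(y,0)$ otherwise. $G^*=G\setminus\{0\}$. **The class $\mathcal D$.** $C^2_b(G^* )$ is the set of continuous $f:G\to\mathbb R$ such that for all $i$, $f\circ e_i$ is $C^2$ on $]0,\infty[$ with bounded first and second derivatives both having finite limits at $0$. For $x=e_i(r)\in G^*$, $f'(x)=(f\circ e_i)'(r)$, $f''(x)=(f\circ e_i)''(r)$; $f'(0)=\sum_i p_i(f\circ e_i)'(0+)$, $f''(0)=\sum_i p_i(f\circ e_i)''(0+)$. $\mathcal D=\{f\in C_b^2(G^* ): f'(0)=0\}$. **Flows.** A kernel on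 a locally compact metric space $M$ is a measurable map $K:M\to\mathcal P(M)$ (Borel probability measures); $Kf(x)=\int f(y)K(x,dy)$, $K_1K_2(x,dz)=\int K_1(x,dy)K_2(y,dz)$. A stochastic flow of mappings (SFM) is a random family $(\varphi_{s,t})_{s\le t}$ ($s,t\in\mathbb R$) of measurable mappings on $M$ with $\varphi_{s,s}(x)=x$ and: (1) $\varphi_{s+h,t+h}$ is distributed like $\varphi_{s,t}$; (2) for all $s_1\le t_1\le\cdots\le s_n\le t_n$, the family $\{\varphi_{s_i,t_i}\}$ is independent; (3) for all $s\le t\le u$, $x\in M$, a.s. $\varphi_{s,u}(x)=\varphi_{t,u}\circ\varphi_{s,t}(x)$; (4) $(s,t,x)\mapsto\varphi_{s,t}(x)$ is continuous in probability; (5) for all $s\le t$, $\varphi_{s,t}(x)\to\infty$ in probability as $x\to\infty$. A stochastic flow of kernels (SFK) is a random family $(K_{s,t})_{s\le t}$ of measurable kernels with $K_{s,s}(x)=\delta_x$ satisfying the same properties with $\varphi$ replaced by $K$ and $\varphi_{t,u}\circ\varphi_{s,t}$ by $K_{s,t}K_{t,u}$ (in (5): $K_{s,t}f(x)\to0$ in probability as $x\to\infty$ for $f\in C_0(M)$). An SFM is identified with the SFK $\delta_\varphi$. Flows are assumed jointly measurable in $(s,t,x,\omega)$. **White noise.** A real white noise is a family $(W_{s,t})_{s\le t}$ of centered Gaussian variables with variance $t-s$, with $W_{s,u}=W_{s,t}+W_{t,u}$ a.s. and independent increments over disjoint intervals. Integrals $\int_s^t\cdot\,dW_u$ are with respect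 to the Brownian motion $(W_{s,t})_{t\ge s}$, understood to be a Brownian motion in the filtration generated by the flow and the noises from time $s$ on. $\mathcal F^{\mathcal W}_{s,t}$ is the (completed) $\sigma$-field generated by $W^i_{u,v}$, $s\le u\le v\le t$, $1\le i\le N$. **Solutions.** For an SFK $K$ on $G$ and independent real white noises $\mathcal W=(W^i,1\le i\le N)$, $(K,\mathcal W)$ (or simply $K$) solves (ISDE) if for all $s\le t$, $f\in\mathcal D$, $x\in G$, a.s. $$K_{s,t}f(x)=f(x)+\sum_{i=1}^N\int_s^tK_{s,u}(1_{E_i}f')(x)dW^i_u+\frac12\int_s^tK_{s,u}f''(x)du.$$ An SFM $\varphi$ solves (ISDE) if $\delta_\varphi$ does. An SFM solution $(\varphi,\mathcal W)$ exists and is unique in law. *)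

theory Defs
  imports "HOL-Probability.Probability"
begin

section \<open>Star graphs\<close>

definition ray :: "(nat \<Rightarrow> real \<Rightarrow> 'g) \<Rightarrow> nat \<Rightarrow> 'g set" where
  "ray e i = e i ` {0..}"

text \<open>Only the values of \<open>e i\<close> on \<open>{0..}\<close> with \<open>i \<in> {1..N}\<close> are meaningful.\<close>

definition origin :: "(nat \<Rightarrow> real \<Rightarrow> 'g) \<Rightarrow> 'g" where
  "origin e = e 1 0"

definition star_graph :: "nat \<Rightarrow> (nat \<Rightarrow> real \<Rightarrow> 'g::metric_space) \<Rightarrow> bool" where
  "star_graph N e \<longleftrightarrow>
     (UNIV :: 'g set) = (\<Union>i\<in>{1..N}. ray e i) \<and>
     (\<forall>i\<in>{1..N}. e i 0 = origin e) \<and>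
     (\<forall>i\<in>{1..N}. \<forall>j\<in>{1..N}. i \<noteq> j \<longrightarrow> ray e i \<inter> ray e j = {origin e}) \<and>
     (\<forall>i\<in>{1..N}. \<forall>u\<ge>0. \<forall>v\<ge>0. dist (e i u) (e i v) = \<bar>u - v\<bar>) \<and>
     (\<forall>i\<in>{1..N}. \<forall>j\<in>{1..N}. i \<noteq> j \<longrightarrow> (\<forall>x\<in>ray e i. \<forall>y\<in>ray e j.
        dist x y = dist x (origin e) + dist y (origin e)))"

definition C2b :: "nat \<Rightarrow> (nat \<Rightarrow> real \<Rightarrow> 'g::metric_space) \<Rightarrow> ('g \<Rightarrow> real) set" where
  "C2b N e = {f. continuous_on UNIV f \<and> (\<forall>i\<in>{1..N}. let g = (\<lambda>r. f (e i r)) in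
     (\<forall>r>0. g differentiable (at r)) \<and>
     (\<forall>r>0. deriv g differentiable (at r)) \<and>
     continuous_on {0<..} (deriv (deriv g)) \<and>
     bounded (deriv g ` {0<..}) \<and>
     bounded (deriv (deriv g) ` {0<..}) \<and>
     (\<exists>l. (deriv g \<longlongrightarrow> l) (at_right 0)) \<and>
     (\<exists>l. (deriv (deriv g) \<longlongrightarrow> l) (at_right 0)))}"

text \<open>The \<open>k\<close>-th derivative along the rays (used for \<open>k = 1, 2\<close>). A point of a ray \<open>i\<close> other
  than the origin is \<open>e i r\<close>, where \<open>r\<close> is its distance to the origin.\<close>

definition star_deriv ::
  "nat \<Rightarrow> (nat \<Rightarrow> real \<Rightarrow> 'g::metric_space) \<Rightarrow> (nat \<Rightarrow> real) \<Rightarrow> nat \<Rightarrow> ('g \<Rightarrow> real) \<Rightarrow> 'g \<Rightarrow> real" where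
  "star_deriv N e p k f x =
     (if x = origin e
      then \<Sum>i\<in>{1..N}. p i * Lim (at_right 0) ((deriv ^^ k) (\<lambda>r. f (e i r)))
      else (deriv ^^ k) (\<lambda>r. f (e (THE i. i \<in> {1..N} \<and> x \<in> ray e i) r)) (dist x (origin e)))"

definition test_functions ::
  "nat \<Rightarrow> (nat \<Rightarrow> real \<Rightarrow> 'g::metric_space) \<Rightarrow> (nat \<Rightarrow> real) \<Rightarrow> ('g \<Rightarrow> real) set" where
  "test_functions N e p = {f \<in> C2b N e. star_deriv N e p 1 f (origin e) = 0}"


section \<open>Stochastic flows\<close>

text \<open>Random families \<open>X s t x \<omega>\<close> are total functions of \<open>s\<close> and \<open>t\<close>, but only the values with
  \<open>s \<le> t\<close> are meaningful. The law of \<open>X s t\<close>, and the independence of several such random maps, are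
  taken with respect to the \<open>\<sigma>\<close>-field generated by the evaluations at the points \<open>x\<close>.\<close>

definition homogeneous_independent_family ::
  "'w measure \<Rightarrow> 'v measure \<Rightarrow> (real \<Rightarrow> real \<Rightarrow> 'm::topological_space \<Rightarrow> 'w \<Rightarrow> 'v) \<Rightarrow> bool" where
  "homogeneous_independent_family M S X \<longleftrightarrow>
     (\<lambda>(s, t, x, \<omega>). X s t x \<omega>) \<in>
       restrict_space (borel \<Otimes>\<^sub>M (borel \<Otimes>\<^sub>M (borel \<Otimes>\<^sub>M M))) {(s, t, x, \<omega>). s \<le> t} \<rightarrow>\<^sub>M S \<and>
     (\<forall>s t h. s \<le> t \<longrightarrow>
        distr M (\<Pi>\<^sub>M x\<in>UNIV. S) (\<lambda>\<omega> x. X (s + h) (t + h) x \<omega>) =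
        distr M (\<Pi>\<^sub>M x\<in>UNIV. S) (\<lambda>\<omega> x. X s t x \<omega>)) \<and>
     (\<forall>n a b. (\<forall>k<n. a k \<le> b k) \<and> (\<forall>k. Suc k < n \<longrightarrow> b k \<le> a (Suc k)) \<longrightarrow>
        prob_space.indep_vars M (\<lambda>_. \<Pi>\<^sub>M x\<in>UNIV. S) (\<lambda>k \<omega> x. X (a k) (b k) x \<omega>) {..<n})"

definition to_infinity :: "'m::topological_space filter" where
  "to_infinity = (INF C\<in>{C. compact C}. principal (- C))"

definition C0 :: "('m::topological_space \<Rightarrow> real) set" where
  "C0 = {f. continuous_on UNIV f \<and> (f \<longlongrightarrow> 0) to_infinity}"

definition stochastic_flow_of_mappings ::
  "'w measure \<Rightarrow> (real \<Rightarrow> real \<Rightarrow> 'm \<Rightarrow> 'w \<Rightarrow> 'm::{metric_space, second_countable_topology}) \<Rightarrow> bool" where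
  "stochastic_flow_of_mappings M \<phi> \<longleftrightarrow>
     homogeneous_independent_family M borel \<phi> \<and>
     (\<forall>s x. \<forall>\<omega>\<in>space M. \<phi> s s x \<omega> = x) \<and>
     (\<forall>s t u x. s \<le> t \<and> t \<le> u \<longrightarrow> (AE \<omega> in M. \<phi> s u x \<omega> = \<phi> t u (\<phi> s t x \<omega>) \<omega>)) \<and>
     (\<forall>s t x. \<forall>\<epsilon>>0. s \<le> t \<longrightarrow>
        ((\<lambda>(s', t', x'). measure M {\<omega>\<in>space M. \<epsilon> < dist (\<phi> s' t' x' \<omega>) (\<phi> s t x \<omega>)})
           \<longlongrightarrow> 0) (at (s, t, x) within {(s', t', x'). s' \<le> t'})) \<and>
     (\<forall>s t C. s \<le> t \<and> compact C \<longrightarrow>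
        ((\<lambda>x. measure M {\<omega>\<in>space M. \<phi> s t x \<omega> \<in> C}) \<longlongrightarrow> 0) to_infinity)"

text \<open>Kernels take values in \<open>prob_algebra borel\<close>, whose \<open>\<sigma>\<close>-field is the Borel \<open>\<sigma>\<close>-field of the weak
  topology. Continuity in probability refers to this topology, and is expressed through bounded
  continuous functions.\<close>

definition stochastic_flow_of_kernels ::
  "'w measure \<Rightarrow> (real \<Rightarrow> real \<Rightarrow> 'm \<Rightarrow> 'w \<Rightarrow> 'm::{metric_space, second_countable_topology} measure) \<Rightarrow> bool" where
  "stochastic_flow_of_kernels M K \<longleftrightarrow>
     homogeneous_independent_family M (prob_algebra borel) K \<and>
     (\<forall>s x. \<forall>\<omega>\<in>space M. K s s x \<omega> = return borel x) \<and>
     (\<forall>s t u x. s \<le> t \<and> t \<le> u \<longrightarrow>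
        (AE \<omega> in M. K s u x \<omega> = K s t x \<omega> \<bind> (\<lambda>y. K t u y \<omega>))) \<and>
     (\<forall>s t x. \<forall>f :: 'm \<Rightarrow> real. \<forall>\<epsilon>>0. s \<le> t \<and> continuous_on UNIV f \<and> bounded (range f) \<longrightarrow>
        ((\<lambda>(s', t', x'). measure M {\<omega>\<in>space M.
             \<epsilon> < \<bar>(\<integral>y. f y \<partial>K s' t' x' \<omega>) - (\<integral>y. f y \<partial>K s t x \<omega>)\<bar>})
           \<longlongrightarrow> 0) (at (s, t, x) within {(s', t', x'). s' \<le> t'})) \<and>
     (\<forall>s t. \<forall>f\<in>C0. \<forall>\<epsilon>>0. s \<le> t \<longrightarrow>
        ((\<lambda>x. measure M {\<omega>\<in>space M. \<epsilon> < \<bar>\<integral>y. f y \<partial>K s t x \<omega>\<bar>}) \<longlongrightarrow> 0) to_infinity)"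

definition dirac_flow ::
  "(real \<Rightarrow> real \<Rightarrow> 'm \<Rightarrow> 'w \<Rightarrow> 'm::topological_space) \<Rightarrow> real \<Rightarrow> real \<Rightarrow> 'm \<Rightarrow> 'w \<Rightarrow> 'm measure" where
  "dirac_flow \<phi> s t x \<omega> = return borel (\<phi> s t x \<omega>)"


section \<open>White noises\<close>

definition white_noise :: "'w measure \<Rightarrow> (real \<Rightarrow> real \<Rightarrow> 'w \<Rightarrow> real) \<Rightarrow> bool" where
  "white_noise M W \<longleftrightarrow>
     (\<forall>s t. s \<le> t \<longrightarrow> W s t \<in> borel_measurable M) \<and>
     (\<forall>s. AE \<omega> in M. W s s \<omega> = 0) \<and>
     (\<forall>s t. s < t \<longrightarrow>
        distributed M lborel (W s t) (\<lambda>x. ennreal (normal_density 0 (sqrt (t - s)) x))) \<and>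
     (\<forall>s t u. s \<le> t \<and> t \<le> u \<longrightarrow> (AE \<omega> in M. W s u \<omega> = W s t \<omega> + W t u \<omega>)) \<and>
     (\<forall>n a b. (\<forall>k<n. a k \<le> b k) \<and> (\<forall>k. Suc k < n \<longrightarrow> b k \<le> a (Suc k)) \<longrightarrow>
        prob_space.indep_vars M (\<lambda>_. borel) (\<lambda>k. W (a k) (b k)) {..<n})"

definition independent_white_noises ::
  "nat \<Rightarrow> 'w measure \<Rightarrow> (nat \<Rightarrow> real \<Rightarrow> real \<Rightarrow> 'w \<Rightarrow> real) \<Rightarrow> bool" where
  "independent_white_noises N M W \<longleftrightarrow>
     (\<forall>i\<in>{1..N}. white_noise M (W i)) \<and>
     prob_space.indep_vars M (\<lambda>_. \<Pi>\<^sub>M uv\<in>{(u, v). u \<le> v}. borel)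
       (\<lambda>i \<omega>. restrict (\<lambda>(u, v). W i u v \<omega>) {(u, v). u \<le> v}) {1..N}"

text \<open>The completed \<open>\<sigma>\<close>-field of the noises between the times \<open>s\<close> and \<open>t\<close>.\<close>

definition noise_algebra ::
  "nat \<Rightarrow> 'w measure \<Rightarrow> (nat \<Rightarrow> real \<Rightarrow> real \<Rightarrow> 'w \<Rightarrow> real) \<Rightarrow> real \<Rightarrow> real \<Rightarrow> 'w measure" where
  "noise_algebra N M W s t = sigma (space M)
     ({W i u v -` A \<inter> space M | i u v A. i \<in> {1..N} \<and> s \<le> u \<and> u \<le> v \<and> v \<le> t \<and> A \<in> sets borel}
      \<union> null_sets M)"

definition flow_filtration ::
  "nat \<Rightarrow> 'w measure \<Rightarrow> (real \<Rightarrow> real \<Rightarrow> 'm::topological_space \<Rightarrow> 'w \<Rightarrow> 'm measure) \<Rightarrow>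
   (nat \<Rightarrow> real \<Rightarrow> real \<Rightarrow> 'w \<Rightarrow> real) \<Rightarrow> real \<Rightarrow> real \<Rightarrow> 'w measure" where
  "flow_filtration N M K W s t = sigma (space M)
     ({K u v x -` A \<inter> space M | u v x A. s \<le> u \<and> u \<le> v \<and> v \<le> t \<and> A \<in> sets (prob_algebra borel)}
      \<union> {W i u v -` A \<inter> space M | i u v A. i \<in> {1..N} \<and> s \<le> u \<and> u \<le> v \<and> v \<le> t \<and> A \<in> sets borel})"


section \<open>Stochastic integrals\<close>

text \<open>Brownian motion \<open>(B u)\<close>, \<open>u \<ge> s\<close>, in a filtration \<open>(F u)\<close>, \<open>u \<ge> s\<close>. Continuity of the paths
  is not required: the process \<open>u \<mapsto> W s u\<close> obtained from a white noise is defined up to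
  modification only, and neither the law nor the stochastic integral depends on the modification.\<close>

definition brownian_motion_in ::
  "'w measure \<Rightarrow> (real \<Rightarrow> 'w measure) \<Rightarrow> real \<Rightarrow> (real \<Rightarrow> 'w \<Rightarrow> real) \<Rightarrow> bool" where
  "brownian_motion_in M F s B \<longleftrightarrow>
     (AE \<omega> in M. B s \<omega> = 0) \<and>
     (\<forall>u\<ge>s. B u \<in> borel_measurable (F u)) \<and>
     (\<forall>u v. s \<le> u \<and> u < v \<longrightarrow>
        distributed M lborel (\<lambda>\<omega>. B v \<omega> - B u \<omega>)
          (\<lambda>x. ennreal (normal_density 0 (sqrt (v - u)) x)) \<and>
        prob_space.indep_set M (sets (F u))
          (sets (vimage_algebra (space M) (\<lambda>\<omega>. B v \<omega> - B u \<omega>) borel)))"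

definition simple_process ::
  "'w measure \<Rightarrow> (real \<Rightarrow> 'w measure) \<Rightarrow> real \<Rightarrow> real \<Rightarrow> nat \<Rightarrow> (nat \<Rightarrow> real) \<Rightarrow> (nat \<Rightarrow> 'w \<Rightarrow> real) \<Rightarrow> bool" where
  "simple_process M F s t n \<tau> \<xi> \<longleftrightarrow>
     \<tau> 0 = s \<and> \<tau> n = t \<and> (\<forall>k<n. \<tau> k \<le> \<tau> (Suc k)) \<and>
     (\<forall>k<n. \<xi> k \<in> borel_measurable (F (\<tau> k)) \<and> (\<exists>c. \<forall>\<omega>\<in>space M. \<bar>\<xi> k \<omega>\<bar> \<le> c))"

definition simple_value ::
  "nat \<Rightarrow> (nat \<Rightarrow> real) \<Rightarrow> (nat \<Rightarrow> 'w \<Rightarrow> real) \<Rightarrow> real \<Rightarrow> 'w \<Rightarrow> real" where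
  "simple_value n \<tau> \<xi> u \<omega> = (\<Sum>k<n. \<xi> k \<omega> * indicator {\<tau> k<..\<tau> (Suc k)} u)"

definition simple_integral ::
  "(real \<Rightarrow> 'w \<Rightarrow> real) \<Rightarrow> nat \<Rightarrow> (nat \<Rightarrow> real) \<Rightarrow> (nat \<Rightarrow> 'w \<Rightarrow> real) \<Rightarrow> 'w \<Rightarrow> real" where
  "simple_integral B n \<tau> \<xi> \<omega> = (\<Sum>k<n. \<xi> k \<omega> * (B (\<tau> (Suc k)) \<omega> - B (\<tau> k) \<omega>))"

text \<open>\<open>I\<close> is (a version of) the Ito integral of \<open>H\<close> over \<open>[s, t]\<close> with respect to the Brownian motion
  \<open>B\<close> in the filtration \<open>F\<close>: the \<open>L\<^sup>2\<close> limit of the integrals of simple processes converging to \<open>H\<close>.\<close>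

definition has_ito_integral ::
  "'w measure \<Rightarrow> (real \<Rightarrow> 'w measure) \<Rightarrow> (real \<Rightarrow> 'w \<Rightarrow> real) \<Rightarrow> real \<Rightarrow> real \<Rightarrow>
   (real \<Rightarrow> 'w \<Rightarrow> real) \<Rightarrow> ('w \<Rightarrow> real) \<Rightarrow> bool" where
  "has_ito_integral M F B s t H I \<longleftrightarrow>
     (\<lambda>(u, \<omega>). H u \<omega>) \<in> borel_measurable (restrict_space borel {s..t} \<Otimes>\<^sub>M M) \<and>
     I \<in> borel_measurable M \<and>
     (\<exists>n \<tau> \<xi>. (\<forall>m. simple_process M F s t (n m) (\<tau> m) (\<xi> m)) \<and>
        ((\<lambda>m. \<integral>\<^sup>+\<omega>. (\<integral>\<^sup>+u\<in>{s..t}. ennreal ((H u \<omega> - simple_value (n m) (\<tau> m) (\<xi> m) u \<omega>)\<^sup>2) \<partial>lborel) \<partial>M)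
           \<longlonglongrightarrow> 0) \<and>
        ((\<lambda>m. \<integral>\<^sup>+\<omega>. ennreal ((I \<omega> - simple_integral B (n m) (\<tau> m) (\<xi> m) \<omega>)\<^sup>2) \<partial>M)
           \<longlonglongrightarrow> 0))"


section \<open>The interface SDE\<close>

text \<open>Functions in \<open>test_functions\<close> may have linear growth, so the integrability that makes
  \<open>K s t f x\<close> well defined is part of the equation.\<close>

definition solves_ISDE ::
  "nat \<Rightarrow> (nat \<Rightarrow> real \<Rightarrow> 'g::{metric_space, second_countable_topology}) \<Rightarrow> (nat \<Rightarrow> real) \<Rightarrow> 'w measure \<Rightarrow>
   (real \<Rightarrow> real \<Rightarrow> 'g \<Rightarrow> 'w \<Rightarrow> 'g measure) \<Rightarrow> (nat \<Rightarrow> real \<Rightarrow> real \<Rightarrow> 'w \<Rightarrow> real) \<Rightarrow> bool" where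
  "solves_ISDE N e p M K W \<longleftrightarrow>
     independent_white_noises N M W \<and>
     (\<forall>s. \<forall>i\<in>{1..N}. brownian_motion_in M (flow_filtration N M K W s) s (W i s)) \<and>
     (\<forall>s t x. \<forall>f\<in>test_functions N e p. s \<le> t \<longrightarrow>
        (\<exists>I. (\<forall>i\<in>{1..N}. has_ito_integral M (flow_filtration N M K W s) (W i s) s t
                (\<lambda>u \<omega>. \<integral>y. indicator (ray e i) y * star_deriv N e p 1 f y \<partial>K s u x \<omega>) (I i)) \<and>
             (AE \<omega> in M. integrable (K s t x \<omega>) f \<and>
                (\<integral>y. f y \<partial>K s t x \<omega>) = f x + (\<Sum>i\<in>{1..N}. I i \<omega>)
                  + 1 / 2 * (LBINT u:{s..t}. (\<integral>y. star_deriv N e p 2 f y \<partial>K s u x \<omega>)))))"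

text \<open>\<open>\<kappa>\<close> is a version of the random measure \<open>E[\<delta>\<^sub>X | F]\<close>.\<close>

definition is_conditional_law ::
  "'w measure \<Rightarrow> 'w measure \<Rightarrow> ('w \<Rightarrow> 'm::topological_space) \<Rightarrow> ('w \<Rightarrow> 'm measure) \<Rightarrow> bool" where
  "is_conditional_law M F X \<kappa> \<longleftrightarrow>
     (\<forall>A\<in>sets borel. AE \<omega> in M. measure (\<kappa> \<omega>) A = real_cond_exp M F (\<lambda>\<omega>. indicator A (X \<omega>)) \<omega>)"

definition modification ::
  "'w measure \<Rightarrow> (real \<Rightarrow> real \<Rightarrow> 'm \<Rightarrow> 'w \<Rightarrow> 'v) \<Rightarrow> (real \<Rightarrow> real \<Rightarrow> 'm \<Rightarrow> 'w \<Rightarrow> 'v) \<Rightarrow> bool" where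
  "modification M K K' \<longleftrightarrow> (\<forall>s t x. s \<le> t \<longrightarrow> (AE \<omega> in M. K s t x \<omega> = K' s t x \<omega>))"

end

theory Submission
 imports Defs
begin

text \<open>Two kernel solutions driven by the same noise are compared through \<open>E[K f(x) L g(y)]\<close>, which the Ito product
formula turns into a two-point measure on the star with a correlation \<open>\<rho>\<close> between the noises, here 1. For two
rays, testing with exponentials and controlling the occupation near the origin as in Le Gall's argument shows
that this measure does not depend on the solutions, so every solution is the conditional law given the noise.
For three or more rays, uniqueness would make the flow of mappings itself a functional of the noise. Rotating
an independent copy into the noise gives a correlation \<open>\<rho> < 1\<close>; the occupation at the origin then bounds the
probability of separated points below independently of \<open>\<rho>\<close>, which contradicts the continuity of rotations as
\<open>\<rho> \<rightarrow> 1\<close>.\<close>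

text \<open>Solutions are known at fixed times only, up to null sets, and the Ito integrals of
  different times are unrelated versions. Path calculus is therefore replaced by the form
  E[Z * T V], where \<open>T\<close> is an L2 contraction that carries variables adapted to one
  solution to variables adapted to the other and multiplies noise increments by a constant.
  Projection onto the noise is one such \<open>T\<close>; averaging over a rotated noise, Mehler's
  formula, is another; one product formula serves both directions. The coordinate \<open>S\<close>,
  radius over weight of the ray, reduces the gluing condition at the origin to a condition on sums
  of weights, so that cosines and centred sines are test functions. The two-point equation then
  becomes a family of identities indexed by a frequency, and a Gaussian average over the frequency
  gives a Tanaka formula for a smoothed absolute value, whose second derivative measures occupation
  near zero. The number of rays enters through the constant 1-2/N of the separation bound, which is
  zero exactly for two rays.\<close>

notation pair_measure (infixr "><" 80)
notation measurable (infixr "~>" 60)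
notation LIMSEQ (infix "---->" 60)
notation abs ("|_|")

abbreviation (input) "sval \<equiv> simple_value"
abbreviation (input) "sint \<equiv> simple_integral"
abbreviation (input) "sproc \<equiv> simple_process"
abbreviation (input) "FF \<equiv> flow_filtration"
abbreviation (input) "ito_int \<equiv> has_ito_integral"
abbreviation (input) "dfl \<equiv> dirac_flow"
abbreviation (input) "sder \<equiv> star_deriv"
abbreviation (input) "NA \<equiv> noise_algebra"
abbreviation (input) "cor \<equiv> complex_of_real"
abbreviation (input) "PA \<equiv> prob_algebra borel"
abbreviation (input) "NN \<equiv> nn_integral"
abbreviation (input) "gau x \<equiv> exp (- x\<^sup>2/2 :: real)"
notation tendsto (infixr "~~>" 55)
notation scaleR (infixr ".*" 75)
abbreviation (input) "igb \<equiv> integrable"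
notation iff (infixr "<->" 25)
abbreviation (input) "bm \<equiv> borel_measurable"
abbreviation (input) "ind \<equiv> indicator"
abbreviation (input) "time (s::real) t \<equiv> restrict_space lborel {s..t}"
abbreviation (input) "jointly M A X \<equiv> (%(s::real, t::real, x::'m::topological_space, w). X s t x w)
 : restrict_space (borel >< (borel >< (borel >< M))) {(s, t, x, w). s <= t} ~> A"
lemmas p2es = power2_eq_square and algs = algebra_simps and m_comp = measurable_compose
 and sp_pair = space_pair_measure and dom_conv = integral_dominated_convergence
 and bm_int = borel_measurable_integrable and bm_times = borel_measurable_times
 and bm_sum = borel_measurable_sum and bm_const = borel_measurable_const
 and bm_cont = borel_measurable_continuous_onI and sp_restr = space_restrict_space
 and sets_sp = sets_eq_imp_space_eq and set_int_def = set_lebesgue_integral_def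
 and nn_eq = nn_integral_eq_integral and m_restr1 = measurable_restrict_space1
 and m_subalg = measurable_from_subalg and int_restr = integral_restrict_space
 and i_mult_r = integrable_mult_right and m_cong_sets = measurable_cong_sets
 and int_mr0 = integral_mult_right_zero and int_cong_AE = integral_cong_AE and ind_def = indicator_def
 and cpb = case_prod_beta' and fin_pair = finite_measure_pair_measure and ev_mono = eventually_mono
 and fs = field_simps and mlm = mult_left_mono and mrm = mult_right_mono and mcomm = mult.commute
 and massoc = mult.assoc and t_const = tendsto_const and t_mult = tendsto_mult and int_mono = integral_mono
 and sdl = sum_distrib_left and pmd = power_mult_distrib and nn_cong = nn_integral_cong
 and hif_def = homogeneous_independent_family_def and sfm_def = stochastic_flow_of_mappings_def
 and sfk_def = stochastic_flow_of_kernels_def and bmi_def = brownian_motion_in_def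
 and int_0_AE = integral_nonneg_eq_0_iff_AE and suba_def = subalgebra_def and otrans = order_trans
 and m_space = measurable_space and m_sets = measurable_sets and exp_ge1 = exp_ge_add_one_self
 and mult_nn = mult_nonneg_nonneg and pow_mono = power_mono and sproc_def = simple_process_def
lemmas Bint_add = Bochner_Integration.integral_add and Bint_cong = Bochner_Integration.integral_cong
 and Bint_diff = Bochner_Integration.integral_diff and Bint_nonneg = Bochner_Integration.integral_nonneg
 and Bint_sum = Bochner_Integration.integral_sum and Bintble_add = Bochner_Integration.integrable_add
 and Bintble_bound = Bochner_Integration.integrable_bound and Bintble_cong = Bochner_Integration.integrable_cong
 and Bintble_diff = Bochner_Integration.integrable_diff and Bintble_sum = Bochner_Integration.integrable_sum

section \<open>Square integrable and bounded random variables\<close>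

definition sqi :: "'a measure => ('a => real) => bool" where
 "sqi M X <-> X : bm M & igb M (%w. (X w)^2)"

text \<open>The bound holds at every point, so the notion depends on the space and the sets only. It
  can be used for the sigma-fields of a filtration, whose own measure carries no information, and it
  survives sections and compositions without exceptional null sets.\<close>

definition bdm :: "'a measure => ('a => real) => bool" where
 "bdm M X <-> X : bm M & (EX c. ALL w:space M. |X w| <= c)"

lemma sqi_m[measurable_dest]: "sqi M X ==> X : bm M" by(simp add: sqi_def)

lemma sqi_square: "sqi M X ==> igb M (%w. (X w)^2)" by(simp add: sqi_def)

lemma bdm_m[measurable_dest]: "bdm M X ==> X : bm M" by(simp add: bdm_def)

lemma bdm_bound:
 assumes "bdm M X" shows "EX c>=0. ALL w:space M. |X w| <= c"
proof -
 obtain c where "!!w. w : space M ==> |X w| <= c" using assms by(auto simp: bdm_def)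
 hence "ALL w:space M. |X w| <= max 0 c" by(simp add: le_max_iff_disj)
 thus ?thesis by(intro exI[of _ "max 0 c"]) simp
qed

lemma bdmI: "X : bm M ==> (!!w. w : space M ==> |X w| <= c) ==> bdm M X" by(auto simp: bdm_def)

lemma bdm_const[simp]: "bdm M (%_. c)" by(auto simp: bdm_def)

lemma bdm_mult:
 assumes "bdm M X" "bdm M Y" shows "bdm M (%w. X w * Y w)"
proof -
 note [measurable] = assms[THEN bdm_m]
 obtain c where c: "c >= 0" "!!w. w : space M ==> |X w| <= c" using bdm_bound[OF assms(1)] by blast
 obtain d where d: "d >= 0" "!!w. w : space M ==> |Y w| <= d" using bdm_bound[OF assms(2)] by blast
 show ?thesis by(rule bdmI[where c = "c*d"]) (auto simp: abs_mult intro!: mult_mono c d)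
qed

lemma bdm_add:
 assumes "bdm M X" "bdm M Y" shows "bdm M (%w. X w+Y w)"
proof -
 note [measurable] = assms[THEN bdm_m]
 obtain c where c: "c >= 0" "!!w. w : space M ==> |X w| <= c" using bdm_bound[OF assms(1)] by blast
 obtain d where d: "d >= 0" "!!w. w : space M ==> |Y w| <= d" using bdm_bound[OF assms(2)] by blast
 show ?thesis by(rule bdmI[where c = "c+d"]) (auto intro!: otrans[OF abs_triangle_ineq] add_mono c d)
qed

lemma bdm_cmult: "bdm M X ==> bdm M (%w. c*X w)" by(intro bdm_mult) auto

lemma bdm_diff: "bdm M X ==> bdm M Y ==> bdm M (%w. X w-Y w)"
 using bdm_add[of M X "%w. (-1)*Y w"] bdm_cmult[of M Y "-1"] by simp

lemma bdm_sum: "(!!i. i : I ==> bdm M (X i)) ==> bdm M (%w. SUM i:I. X i w)"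
 by(induction I rule: infinite_finite_induct) (auto intro!: bdm_add)

lemma bdm_subalg:
 assumes "subalgebra M F" "bdm F X" shows "bdm M X"
proof -
 have "X : bm M" "space F = space M" using assms m_subalg[OF assms(1)] by(auto simp: bdm_def suba_def)
 thus ?thesis using assms(2) by(simp add: bdm_def)
qed

lemma sqi_mi:
 assumes "sqi M X" "sqi M Y" shows "igb M (%w. X w * Y w)"
proof -
 note [measurable] = assms[THEN sqi_m]
 have ineq: "|x*y| <= x^2+y^2" for x y :: real
 using sum_squares_bound[of x y] sum_squares_bound[of x "-y"] by(cases "x*y >= 0") auto
 show ?thesis by(rule Bintble_bound[where f = "%w. (X w)^2+(Y w)^2"]) (use assms ineq in "auto simp: sqi_def")
qed

lemma sqi_cmult: "sqi M X ==> sqi M (%w. c*X w)" by(auto simp: sqi_def pmd)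

lemma sqi_add:
 assumes "sqi M X" "sqi M Y" shows "sqi M (%w. X w+Y w)"
proof -
 note [measurable] = assms[THEN sqi_m]
 have "igb M (%w. (X w)^2+(Y w)^2+2*(X w * Y w))" using assms sqi_mi[OF assms] by(simp add: sqi_def)
 thus ?thesis by(simp add: sqi_def power2_sum massoc)
qed

lemma sqi_zero[simp]: "sqi M (%_. 0)" by(simp add: sqi_def)

lemma sqi_diff: "sqi M X ==> sqi M Y ==> sqi M (%w. X w-Y w)"
 using sqi_add[of M X "%w. (-1)*Y w"] sqi_cmult[of M Y "-1"] by simp

lemma sqi_sum: "(!!i. i : I ==> sqi M (X i)) ==> sqi M (%w. SUM i:I. X i w)"
 by(induction I rule: infinite_finite_induct) (auto intro!: sqi_add)

lemma sqi_bdm_mult: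
 assumes "bdm M Z" "sqi M X" shows "sqi M (%w. Z w * X w)"
proof -
 note [measurable] = bdm_m[OF assms(1)] sqi_m[OF assms(2)]
 obtain c where c: "c >= 0" "!!w. w : space M ==> |Z w| <= c" using bdm_bound[OF assms(1)] by blast
 have "igb M (%w. (Z w * X w)^2)"
 proof(rule Bintble_bound[where f = "%w. c^2*(X w)^2"])
 show "AE w in M. norm ((Z w * X w)^2) <= norm (c^2*(X w)^2)"
 using c by(intro AE_I2) (auto simp: pmd abs_le_square_iff[symmetric] intro!: mrm)
 qed (use assms in "auto simp: sqi_def")
 thus ?thesis by(auto simp: sqi_def)
qed

lemma sqi_cong_AE:
 assumes "sqi M X" "AE w in M. X w = Y w" "Y : bm M" shows "sqi M Y"
proof -
 have [measurable]: "X : bm M" "Y : bm M" using assms by(auto simp: sqi_def)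
 have "igb M (%w. (X w)^2) = igb M (%w. (Y w)^2)" using assms(2) by(intro integrable_cong_AE) auto
 thus ?thesis using assms by(simp add: sqi_def)
qed

lemma cs_sqi:
 assumes "sqi M X" "sqi M Y" shows "(LINT w|M. X w * Y w)^2 <= (LINT w|M. (X w)^2)*(LINT w|M. (Y w)^2)"
proof -
 define a b c where "a = (LINT w|M. (X w)^2)" "b = (LINT w|M. X w * Y w)" "c = (LINT w|M. (Y w)^2)"
 have q: "0 <= a+2*t*b+t^2*c" for t
 proof -
 have "0 <= (LINT w|M. (X w+t*Y w)^2)" by simp
 also have "... = (LINT w|M. (X w)^2+2*t*(X w * Y w)+t^2*(Y w)^2)"
 by(intro Bint_cong) (auto simp: power2_sum pmd)
 also have "... = a+2*t*b+t^2*c" unfolding a_b_c_def using assms sqi_mi[OF assms]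
 by(subst Bint_add) (auto simp: sqi_def)
 finally show ?thesis .
 qed
 have c0: "c >= 0" unfolding a_b_c_def by simp
 show ?thesis
 proof(cases "c = 0")
 case True
 have "b = 0"
 proof(rule ccontr)
 assume "b ~= 0"
 \<comment> \<open>For \<open>c = 0\<close> the quadratic is the affine function
   \<open>a+2*t*b\<close>, which equals -1 at this \<open>t\<close>.\<close>
 with q[of "- (a+1)/(2*b)"] True show False by(simp add: fs)
 qed
 thus ?thesis using True by(simp add: a_b_c_def[symmetric])
 next
 case False
 have "0 <= (a+2*(-b/c)*b+(-b/c)^2*c)*c" using q[of "-b/c"] c0 by(simp add: mult_nn)
 also have "... = a*c-b^2" using False by(simp add: fs p2es)
 finally show ?thesis by(simp add: a_b_c_def)
 qed
qed

lemma cs_abs: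
 assumes "sqi M X" "sqi M Y"
 shows "|(LINT w|M. X w * Y w)| <= sqrt (LINT w|M. (X w)^2) * sqrt (LINT w|M. (Y w)^2)"
 using cs_sqi[OF assms] real_sqrt_le_mono[OF cs_sqi[OF assms]] by(simp add: real_sqrt_mult)

definition L2lim :: "'a measure => (nat => 'a => real) => ('a => real) => bool" where
 "L2lim M X Y <-> (ALL m. sqi M (X m)) & sqi M Y & (%m. (LINT w|M. (X m w-Y w)^2)) ----> 0"

lemma L2lim_const: "sqi M X ==> L2lim M (%_. X) X" by(simp add: L2lim_def)

lemma L2lim_mult:
 assumes "L2lim M X X'" "L2lim M Y Y'" shows "(%m. (LINT w|M. X m w * Y m w)) ----> (LINT w|M. X' w * Y' w)"
proof -
 have s: "sqi M (X m)" "sqi M (Y m)" "sqi M X'" "sqi M Y'" for m using assms by(auto simp: L2lim_def)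
 define p q where "p m = (LINT w|M. (X m w-X' w)^2)" and "q m = (LINT w|M. (Y m w-Y' w)^2)" for m
 define a b where "a = (LINT w|M. (X' w)^2)" and "b = (LINT w|M. (Y' w)^2)"
 have p: "p ----> 0" and q: "q ----> 0" using assms unfolding L2lim_def p_def q_def by auto
 have "|(LINT w|M. X m w * Y m w)-(LINT w|M. X' w * Y' w)|
 <= sqrt (p m) * sqrt (q m)+sqrt (p m) * sqrt b+sqrt a * sqrt (q m)" for m
 proof -
 have d: "sqi M (%w. X m w-X' w)" "sqi M (%w. Y m w-Y' w)" using s by(auto intro: sqi_diff)
 have "(LINT w|M. X m w * Y m w)-(LINT w|M. X' w * Y' w)
 = (LINT w|M. X m w * Y m w-X' w * Y' w)" using s by(intro Bint_diff[symmetric] sqi_mi)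
 also have "... = (LINT w|M. (X m w-X' w)*(Y m w-Y' w)+((X m w-X' w)*Y' w
 + X' w * (Y m w-Y' w)))" by(intro Bint_cong) (auto simp: algs)
 also have "... = (LINT w|M. (X m w-X' w)*(Y m w-Y' w))+((LINT w|M. (X m w-X' w)*Y' w)
 + (LINT w|M. X' w * (Y m w-Y' w)))" using s d sqi_mi[OF d] sqi_mi[OF d(1) s(4)] sqi_mi[OF s(3) d(2)]
 by(subst Bint_add, simp, simp, subst Bint_add) auto
 finally show ?thesis using cs_abs[OF d] cs_abs[OF d(1) s(4)] cs_abs[OF s(3) d(2)]
 unfolding p_def q_def a_def b_def by linarith
 qed
 hence le: "norm ((LINT w|M. X m w * Y m w)-(LINT w|M. X' w * Y' w))
 <= sqrt (p m) * sqrt (q m)+sqrt (p m) * sqrt b+sqrt a * sqrt (q m)" for m by simp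
 have "(%m. sqrt (p m) * sqrt (q m)+sqrt (p m) * sqrt b+sqrt a * sqrt (q m)) \<longlonglongrightarrow>
 sqrt 0 * sqrt 0+sqrt 0 * sqrt b+sqrt a * sqrt 0" by(intro tendsto_intros p q)
 hence "(%m. sqrt (p m) * sqrt (q m)+sqrt (p m) * sqrt b+sqrt a * sqrt (q m)) ----> 0" by simp
 hence "(%m. (LINT w|M. X m w * Y m w)-(LINT w|M. X' w * Y' w)) ----> 0"
 by(rule Lim_null_comparison[OF always_eventually[OF allI[OF le]]])
 thus ?thesis by(simp add: LIM_zero_iff)
qed

lemma (in finite_measure) sqi_bdm: assumes "bdm M X" shows "sqi M X"
proof -
 note [measurable] = bdm_m[OF assms]
 obtain c where c: "!!w. w : space M ==> |X w| <= c" using bdm_bound[OF assms] by blast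
 have "norm ((X w)^2) <= c^2" if "w : space M" for w using pow_mono[OF c[OF that], of 2] by simp
 hence "igb M (%w. (X w)^2)" by(intro integrable_const_bound[where B = "c^2"] AE_I2) auto
 thus ?thesis by(simp add: sqi_def)
qed

lemma (in finite_measure) sqi_i: assumes "sqi M X" shows "igb M X"
 using sqi_mi[OF assms sqi_bdm[OF bdm_const, of 1]] by simp

lemma (in finite_measure) bdm_i: "bdm M X ==> igb M X" by(intro sqi_i sqi_bdm)

section \<open>Brownian filtrations\<close>

text \<open>Only the martingale property is required here; covariances are added in
  \<open>bmf\<close>. For white noises the covariances of different noises are derived from the
  martingale property, in \<open>cross_cov\<close>, so the two sets of axioms must be available
  separately.\<close>

locale bm_martingales = prob_space M for M :: "'w measure" +
 fixes F :: "real => 'w measure" and s :: real and I :: "nat set" and B :: "nat => real => 'w => real"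
 assumes F_sub: "!!u. s <= u ==> subalgebra M (F u)"
 and F_mono: "!!u v. s <= u ==> u <= v ==> sets (F u) <= sets (F v)"
 and B_meas: "!!i u. i : I ==> s <= u ==> B i u : bm (F u)"
 and B_sqi: "!!i u. i : I ==> s <= u ==> sqi M (B i u)"
 and B_mart: "!!i u v Z. i : I ==> s <= u ==> u <= v ==> bdm (F u) Z ==>
 (LINT w|M. Z w * (B i v w-B i u w)) = 0"
begin

lemma F_space: "s <= u ==> space (F u) = space M" using F_sub[of u] by(simp add: suba_def)

lemma F_subset: "s <= u ==> u <= v ==> X : bm (F u) ==> X : bm (F v)"
 by(rule m_subalg[rotated]) (auto simp: suba_def F_space dest: F_mono)

lemma bdm_F_mono: "s <= u ==> u <= v ==> bdm (F u) X ==> bdm (F v) X"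
 unfolding bdm_def using F_space[of u] F_space[of v] by(auto intro: F_subset)

lemma bdm_F: "s <= u ==> bdm (F u) X ==> bdm M X" by(rule bdm_subalg[OF F_sub])

lemma B_meas_F: "i : I ==> s <= u ==> u <= v ==> B i u : bm (F v)" by(rule F_subset[OF _ _ B_meas])

lemma B_meas_M: "i : I ==> s <= u ==> B i u : bm M" using B_sqi by(simp add: sqi_def)

lemma B_incr_sqi: "i : I ==> s <= u ==> s <= v ==> sqi M (%w. B i v w-B i u w)" by(intro sqi_diff B_sqi)

text \<open>Truncation of \<open>Z\<close> at level n gives bounded variables, and the product of
  \<open>|Z|\<close> with the increment, integrable by Cauchy-Schwarz, dominates.\<close>

lemma B_mart_sqi:
 assumes "i : I" "s <= u" "u <= v" "sqi M Z" and [measurable]: "Z : bm (F u)"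
 shows "(LINT w|M. Z w * (B i v w-B i u w)) = 0"
proof -
 define Zn where "Zn n w = Z w * ind {-real n..real n} (Z w)" for n :: nat and w
 have [measurable]: "Z : bm M" using assms by(simp add: sqi_def)
 have "bdm (F u) (Zn n)" for n unfolding Zn_def by(rule bdmI[where c = "real n"]) (auto simp: ind_def)
 hence 0: "(LINT w|M. Zn n w * (B i v w-B i u w)) = 0" for n using assms by(intro B_mart) auto
 have D: "igb M (%w. Z w * (B i v w-B i u w))" using assms by(intro sqi_mi B_incr_sqi) auto
 note [measurable] = B_meas_M[OF assms(1,2)] B_meas_M[OF assms(1), of v]
 have [measurable]: "B i v : bm M" using assms by(intro B_meas_M) auto
 have "(%n. (LINT w|M. Zn n w * (B i v w-B i u w))) ----> (LINT w|M. Z w * (B i v w-B i u w))"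
 proof(rule dom_conv[where w = "%w. |Z w * (B i v w-B i u w)|"])
 show "igb M (%w. |Z w * (B i v w-B i u w)| )" using D by auto
 show "AE w in M. (%n. Zn n w * (B i v w-B i u w)) ----> Z w * (B i v w-B i u w)"
 proof(intro AE_I2 t_mult t_const)
 fix w
 obtain n0 where "|Z w| <= real n0" using real_arch_simple by blast
 hence "ALL n>=n0. Zn n w = Z w" by(auto simp: Zn_def ind_def)
 thus "(%n. Zn n w) ----> Z w" by(metis (mono_tags, lifting) eventually_sequentially tendsto_eventually)
 qed
 show "AE w in M. norm (Zn n w * (B i v w-B i u w)) <= |Z w * (B i v w-B i u w)|" for n
 by(intro AE_I2) (auto simp: Zn_def ind_def)
 qed (auto simp: Zn_def)
 thus ?thesis using 0 LIMSEQ_unique t_const by(simp add: LIMSEQ_const_iff)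
qed

end

locale bmf = bm_martingales M F s I B
 for M :: "'w measure" and F :: "real => 'w measure" and s :: real and I :: "nat set" and B :: "nat => real => 'w => real" +
 assumes B_cov: "!!i j u v Z. i : I ==> j : I ==> s <= u ==> u <= v ==> bdm (F u) Z ==>
 (LINT w|M. Z w * ((B i v w-B i u w)*(B j v w-B j u w))) = (if i = j then (v-u)*(LINT w|M. Z w) else 0)"
begin

text \<open>Both increments are cut at \<open>a'\<close> and at \<open>m = min b b'\<close>. Pieces
  over disjoint intervals have a product of mean zero, since the later one is a martingale increment
  and all the rest is measurable at its left end. Only the common interval from \<open>a'\<close> to
  \<open>m\<close> contributes.\<close>

lemma incr_mult_le:
 assumes I: "i : I" "j : I" and a: "s <= a" "a <= b" "a <= a'" "a' <= b'"
 and x: "bdm (F a) xi" and x': "bdm (F a') xi'"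
 shows "(LINT w|M. (xi w * (B i b w-B i a w))*(xi' w * (B j b' w-B j a' w)))
 = (if i = j then (LINT w|M. xi w * xi' w) * max 0 (min b b'-a') else 0)" (is "?L = ?R")
proof -
 have s': "s <= a'" "s <= b" "s <= b'" using a by auto
 have xa': "bdm (F a') xi" using x a by(auto intro: bdm_F_mono)
 have xx: "bdm (F a') (%w. xi w * xi' w)" using xa' x' by(rule bdm_mult)
 have xM: "bdm M xi" "bdm M xi'" "bdm M (%w. xi w * xi' w)"
 using bdm_F[of a xi] bdm_F[of a' xi'] bdm_F[of a' "%w. xi w * xi' w"] a s' x x' xx by auto
 note [measurable] = bdm_m[OF xx] bdm_m[OF xa'] bdm_m[OF x']
 show ?thesis
 proof(cases "b <= a'")
 case True
 have [measurable]: "B i b : bm (F a')" "B i a : bm (F a')" using I a s' True by(auto intro: B_meas_F)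
 have "sqi M (%w. xi w * xi' w * (B i b w-B i a w))" using I a s' xM by(intro sqi_bdm_mult B_incr_sqi) auto
 from B_mart_sqi[OF I(2) s'(1) a(4) this] have "?L = 0" by(simp add: mult_ac)
 thus ?thesis using True by simp
 next
 case False
 hence ab: "a' <= b" by simp
 define m where "m = min b b'"
 have m: "a' <= m" "m <= b" "m <= b'" using ab a by(auto simp: m_def)
 have sm: "s <= m" using m s' by auto
 have F1: "(LINT w|M. (xi w * xi' w * (B i a' w-B i a w))*(B j b' w-B j a' w)) = 0"
 proof(rule B_mart_sqi[OF I(2) s'(1) a(4)])
 show "sqi M (%w. xi w * xi' w * (B i a' w-B i a w))" using I a s' xM by(intro sqi_bdm_mult B_incr_sqi) auto
 have [measurable]: "B i a' : bm (F a')" "B i a : bm (F a')" using I a s' by(auto intro: B_meas_F)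
 show "(%w. xi w * xi' w * (B i a' w-B i a w)) : bm (F a')" by measurable
 qed
 have F2: "(LINT w|M. (xi w * xi' w * (B i m w-B i a' w))*(B j b' w-B j m w)) = 0"
 proof(rule B_mart_sqi[OF I(2) sm m(3)])
 show "sqi M (%w. xi w * xi' w * (B i m w-B i a' w))"
 using I a s' sm xM by(intro sqi_bdm_mult B_incr_sqi) auto
 have [measurable]: "B i a' : bm (F m)" "B i m : bm (F m)"
 "xi : bm (F m)" "xi' : bm (F m)" using I a s' sm m xa' x' by(auto intro: B_meas_F F_subset[of a' m])
 show "(%w. xi w * xi' w * (B i m w-B i a' w)) : bm (F m)" by measurable
 qed
 have F3: "(LINT w|M. (xi w * xi' w * (B j m w-B j a' w))*(B i b w-B i m w)) = 0"
 proof(rule B_mart_sqi[OF I(1) sm m(2)])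
 show "sqi M (%w. xi w * xi' w * (B j m w-B j a' w))"
 using I a s' sm xM by(intro sqi_bdm_mult B_incr_sqi) auto
 have [measurable]: "B j a' : bm (F m)" "B j m : bm (F m)"
 "xi : bm (F m)" "xi' : bm (F m)" using I a s' sm m xa' x' by(auto intro: B_meas_F F_subset[of a' m])
 show "(%w. xi w * xi' w * (B j m w-B j a' w)) : bm (F m)" by measurable
 qed
 \<comment> \<open>One of the two factors is zero, because \<open>m\<close> is one of the two end
   points.\<close>
 have F5: "(LINT w|M. (xi w * xi' w * (B i b w-B i m w))*(B j b' w-B j m w)) = 0"
 by(cases "b <= b'") (auto simp: m_def min_def)
 have F4: "(LINT w|M. xi w * xi' w * ((B i m w-B i a' w)*(B j m w-B j a' w)))
 = (if i = j then (m-a')*(LINT w|M. xi w * xi' w) else 0)" using I s' m xx by(intro B_cov) auto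
 have int: "igb M (%w. (xi w * xi' w * (B k y w-B k x w))*(B l y' w-B l x' w))"
 if "k : I" "l : I" "s <= x" "s <= y" "s <= x'" "s <= y'" for k l x y x' y'
 using that xM by(intro sqi_mi sqi_bdm_mult B_incr_sqi) auto
 define X1 X2 X3 X4 X5 where
 "X1 w = (xi w * xi' w * (B i a' w-B i a w))*(B j b' w-B j a' w)"
 and "X2 w = (xi w * xi' w * (B i m w-B i a' w))*(B j b' w-B j m w)"
 and "X3 w = (xi w * xi' w * (B j m w-B j a' w))*(B i b w-B i m w)"
 and "X4 w = (xi w * xi' w * (B i b w-B i m w))*(B j b' w-B j m w)"
 and "X5 w = (xi w * xi' w * (B i m w-B i a' w))*(B j m w-B j a' w)" for w
 have i: "igb M X1" "igb M X2" "igb M X3" "igb M X4" "igb M X5"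
 unfolding X1_def X2_def X3_def X4_def X5_def using I a s' sm by(auto intro!: int)
 have z: "integral\<^sup>L M X1 = 0" "integral\<^sup>L M X2 = 0" "integral\<^sup>L M X3 = 0" "integral\<^sup>L M X4 = 0"
 "integral\<^sup>L M X5 = (if i = j then (m-a')*(LINT w|M. xi w * xi' w) else 0)"
 using F1 F2 F3 F5 F4 unfolding X1_def X2_def X3_def X4_def X5_def by(simp_all add: mult_ac)
 have split: "(x*(p1+p2+p3))*(y*(q2+q3)) = x*y*p1*(q2+q3)+(x*y*p2*q3 +
 (x*y*q2*p3+(x*y*p3*q3+x*y*p2*q2)))" for x y p1 p2 p3 q2 q3 :: real
 by(simp add: distrib_left distrib_right mult_ac)
 have "?L = (LINT w|M. X1 w+(X2 w+(X3 w+(X4 w+X5 w))))"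
 proof(rule Bint_cong[OF refl])
 fix w
 show "(xi w * (B i b w-B i a w))*(xi' w * (B j b' w-B j a' w))
 = X1 w+(X2 w+(X3 w+(X4 w+X5 w)))"
 using split[of "xi w" "B i a' w-B i a w" "B i m w-B i a' w" "B i b w-B i m w"
 "xi' w" "B j m w-B j a' w" "B j b' w-B j m w"] unfolding X1_def X2_def X3_def X4_def X5_def by simp
 qed
 also have "... = integral\<^sup>L M X5" by(simp add: i z(1-4))
 also have "... = (if i = j then (m-a')*(LINT w|M. xi w * xi' w) else 0)" by(rule z(5))
 also have "(m-a')*(LINT w|M. xi w * xi' w) = (LINT w|M. xi w * xi' w) * max 0 (min b b'-a')"
 using m(1) by(simp add: m_def)
 finally show ?thesis .
 qed
qed

lemma incr_mult:
 assumes I: "i : I" "j : I" and a: "s <= a" "a <= b" "s <= a'" "a' <= b'"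
 and x: "bdm (F a) xi" and x': "bdm (F a') xi'"
 shows "(LINT w|M. (xi w * (B i b w-B i a w))*(xi' w * (B j b' w-B j a' w)))
 = (if i = j then (LINT w|M. xi w * xi' w) * max 0 (min b b'-max a a') else 0)"
proof(cases "a <= a'")
 case True
 hence "max a a' = a'" by simp
 thus ?thesis using incr_mult_le[OF I a(1,2) True a(4) x x'] by simp
next
 case False
 hence le: "a' <= a" and "max a a' = a" by auto
 have "(LINT w|M. (xi w * (B i b w-B i a w))*(xi' w * (B j b' w-B j a' w)))
 = (LINT w|M. (xi' w * (B j b' w-B j a' w))*(xi w * (B i b w-B i a w)))" by(simp only: mcomm)
 also have "... = (if j = i then (LINT w|M. xi' w * xi w) * max 0 (min b' b-a) else 0)"
 by(rule incr_mult_le[OF I(2,1) a(3,4) le a(2) x' x])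
 also have "(LINT w|M. xi' w * xi w) = (LINT w|M. xi w * xi' w)" by(simp only: mcomm)
 finally show ?thesis using `max a a' = a` by(simp only: min.commute[of b' b] eq_commute[of j i])
qed

end

section \<open>The Ito pairing\<close>

lemma enn2real_tendsto_0: "(f ~~> 0) F ==> ((%x. enn2real (f x)) ~~> 0) F"
 using tendsto_enn2real[of f 0 F] by simp

lemma integral_sum2:
 fixes f :: "'b => 'c => 'a => real"
 assumes "!!k l. k : A ==> l : B ==> igb M (f k l)"
 shows "(LINT w|M. (SUM k:A. SUM l:B. f k l w)) = (SUM k:A. SUM l:B. (LINT w|M. f k l w))"
 using assms by(simp add: Bint_sum Bintble_sum)

lemma sp_times:
 assumes "sproc M F s t n ta xi" shows "k <= n ==> s <= ta k" "k <= n ==> ta k <= t"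
proof -
 have "k <= n ==> ta 0 <= ta k" for k using assms by(induction k) (auto simp: sproc_def intro: otrans)
 thus "k <= n ==> s <= ta k" using assms by(auto simp: sproc_def)
 have "k <= n ==> ta (n-k) <= ta n" for k
 proof(induction k)
 case (Suc k)
 hence "ta (n-Suc k) <= ta (Suc (n-Suc k))" using assms by(auto simp: sproc_def)
 thus ?case using Suc by(simp add: Suc_diff_Suc)
 qed simp
 from this[of "n-k"] show "k <= n ==> ta k <= t" using assms by(auto simp: sproc_def)
qed

lemma (in bmf) sp_bdm:
 assumes "sproc M F s t n ta xi" "k < n" shows "bdm (F (ta k)) (xi k)" "bdm M (xi k)"
proof -
 have "s <= ta k" using sp_times(1)[OF assms(1)] assms(2) by simp
 thus "bdm (F (ta k)) (xi k)" using assms by(auto simp: sproc_def bdm_def F_space)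
 thus "bdm M (xi k)" using `s \<le> ta k` by(rule bdm_F[rotated])
qed

lemma (in bmf) sv_bdm:
 assumes "sproc M F s t n ta xi" shows "bdm M (sval n ta xi v)" unfolding simple_value_def
 using sp_bdm(2)[OF assms] by(auto intro!: bdm_sum bdm_mult)

lemma (in bmf) st_sqi:
 assumes "sproc M F s t n ta xi" "k < n" "i : I"
 shows "sqi M (%w. xi k w * (B i (ta (Suc k)) w-B i (ta k) w))"
 using assms sp_times(1)[OF assms(1), of k] sp_times(1)[OF assms(1), of "Suc k"]
 by(intro sqi_bdm_mult sp_bdm(2)[OF assms(1)] B_incr_sqi) auto

lemma (in bmf) si_sqi:
 assumes "sproc M F s t n ta xi" "i : I" shows "sqi M (sint (B i) n ta xi)" unfolding simple_integral_def
 using st_sqi[OF assms(1) _ assms(2)] by(intro sqi_sum) auto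

text \<open>Shifting by the bound makes the function nonnegative, so that the induction over
  nonnegative measurable functions applies. The implications \<open>bdm N _ --> P _\<close> carry
  boundedness along: nonnegative summands and increasing approximants of a bounded function are
  bounded.\<close>

lemma bdm_induct[consumes 1, case_names set lin cong lim]:
 fixes f :: "'a => real"
 assumes f: "bdm N f" and set: "!!A. A : sets N ==> P (ind A)"
 and lin: "!!c u v. bdm N u ==> bdm N v ==> P u ==> P v ==> P (%x. u x+c * v x)"
 and cong: "!!u v. bdm N u ==> P u ==> (!!x. x : space N ==> u x = v x) ==> P v"
 and lim: "!!U u c. (!!i. bdm N (U i)) ==> (!!i x. x : space N ==> |U i x| <= c) ==> (!!i. P (U i)) ==>
 (!!x. x : space N ==> (%i. U i x) ----> u x) ==> bdm N u ==> P u" shows "P f"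
proof -
 have ind: "bdm N (ind A :: 'a => real)" if "A : sets N" for A
 using that by(intro bdmI[where c = 1]) (auto simp: ind_def)
 have P0: "P (%_. 0)" using set[of "{}"] by(simp add: ind_def[abs_def])
 have P1: "P (%_. 1)" by(rule cong[OF ind[OF sets.top] set[OF sets.top]]) auto
 obtain c where c: "c >= 0" "!!x. x : space N ==> |f x| <= c" using bdm_bound[OF f] by blast
 note [measurable] = bdm_m[OF f]
 define g where "g x = max 0 (f x+c)" for x
 have gm: "g : bm N" unfolding g_def by measurable
 have gb: "bdm N g" using c by(intro bdmI[OF gm, where c = "2*c"]) (fastforce simp: g_def abs_le_iff)
 have "bdm N g --> P g"
 proof(rule borel_measurable_induct_real[OF gm])
 show "0 <= g x" for x by(simp add: g_def)
 show "bdm N (ind A) --> P (ind A)" if "A : sets N" for A using set[OF that] by simp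
 next
 fix u :: "'a => real" and d :: real
 assume u: "0 <= d" "u : bm N" "bdm N u --> P u"
 show "bdm N (%x. d*u x) --> P (%x. d*u x)"
 proof
 assume b: "bdm N (%x. d*u x)"
 show "P (%x. d*u x)"
 proof(cases "d = 0")
 case False
 hence "bdm N u" using bdm_cmult[OF b, of "1/d"] by simp
 thus ?thesis using lin[OF bdm_const `bdm N u` P0, of d] u(3) by simp
 qed (simp add: P0)
 qed
 next
 fix u v :: "'a => real"
 assume u: "u : bm N" "!!x. 0 <= u x" "bdm N u --> P u" and v: "v : bm N" "!!x. 0 <= v x" "bdm N v --> P v"
 show "bdm N (%x. v x+u x) --> P (%x. v x+u x)"
 proof
 assume b: "bdm N (%x. v x+u x)"
 obtain d where d: "!!x. x : space N ==> |v x+u x| <= d" using bdm_bound[OF b] by blast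
 have "|u x| <= d" "|v x| <= d" if "x : space N" for x using d[OF that] u(2)[of x] v(2)[of x] by auto
 hence "bdm N u" "bdm N v" using u(1) v(1) by(auto simp: bdm_def)
 thus "P (%x. v x+u x)" using lin[of v u 1] u(3) v(3) by simp
 qed
 next
 fix U assume U: "!!i. U i : bm N" "!!i x. 0 <= U i x" "!!i. bdm N (U i) --> P (U i)"
 "incseq U" "!!x. x : space N ==> (%i. U i x) ----> g x"
 have le: "|U i x| <= 2*c" if "x : space N" for i x
 proof -
 have "U i x <= g x" using U(4) by(intro incseq_le[OF _ U(5)[OF that]]) (auto simp: incseq_def le_fun_def)
 also have "g x <= 2*c" using c(1) c(2)[OF that] by(auto simp: g_def)
 finally show ?thesis using U(2)[of i x] by simp
 qed
 hence "bdm N (U i)" for i using U(1) by(intro bdmI[where c = "2*c"]) auto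
 thus "bdm N g --> P g" using lim[of U "2*c" g] le U(3,5) by blast
 qed
 \<comment> \<open>On the space the maximum in \<open>g\<close> is inactive, so subtracting
   \<open>c\<close> gives back \<open>f\<close>.\<close>
 hence "P (%x. g x+(-c)*1)" using gb by(intro lin P1) auto
 show ?thesis
 proof(rule cong[OF _ `P (\<lambda>x. g x + (-c) * 1)`])
 show "bdm N (%x. g x+(-c)*1)" using gb by(intro bdm_add) auto
 show "g x+(-c)*1 = f x" if "x : space N" for x using c(2)[OF that] by(simp add: g_def abs_le_iff max_def)
 qed
qed

text \<open>Dynkin's argument on the generator: complements come from linearity and the constant 1,
  countable disjoint unions from bounded limits of partial sums.\<close>

lemma bdm_induct_generator:
 fixes f :: "'a => real"
 assumes f: "bdm N f" and G: "sets N = sigma_sets (space N) G" "Int_stable G" "G <= Pow (space N)"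
 and gen: "!!A. A : G ==> P (ind A)" and one: "P (%_. 1)"
 and lin: "!!c u v. bdm N u ==> bdm N v ==> P u ==> P v ==> P (%x. u x+c * v x)"
 and cong: "!!u v. bdm N u ==> P u ==> (!!x. x : space N ==> u x = v x) ==> P v"
 and lim: "!!U u c. (!!i. bdm N (U i)) ==> (!!i x. x : space N ==> |U i x| <= c) ==> (!!i. P (U i)) ==>
 (!!x. x : space N ==> (%i. U i x) ----> u x) ==> bdm N u ==> P u" shows "P f"
proof -
 have i: "bdm N (ind A :: 'a => real)" if "A : sets N" for A
 using that by(intro bdmI[where c = 1]) (auto simp: ind_def)
 have P0: "P (%_. 0)" using lin[OF bdm_const bdm_const one one, of "-1"] by simp
 have "P (ind A)" if A: "A : sets N" for A using G(2,3) A[unfolded G(1)]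
 proof(induction rule: sigma_sets_induct_disjoint)
 case (basic A) thus ?case by(rule gen)
 next
 case empty thus ?case using P0 by(simp add: ind_def[abs_def])
 next
 case (compl A)
 have A: "A : sets N" using compl(1) by(simp add: G(1))
 show ?case by(rule cong[OF _ lin[OF bdm_const i[OF A] one compl(2), of "-1"]])
 (intro bdm_add bdm_const bdm_cmult i A, auto simp: ind_def)
 next
 case (union A)
 have A: "A i : sets N" for i using union(2) by(auto simp: G(1))
 have S: "bdm N (%x. SUM i<n. ind (A i) x :: real) & P (%x. SUM i<n. ind (A i) x)" for n
 proof(induction n)
 case 0 thus ?case using P0 by simp
 next
 case (Suc n)
 thus ?case using lin[of "%x. SUM i<n. ind (A i) x" "ind (A n)" 1] union(3)[of n] i[OF A, of n] by(auto intro: bdm_add)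
 qed
 show ?case
 proof(rule lim[of "%n x. SUM i<n. ind (A i) x" 1])
 fix n x
 have "(SUM i<n. ind (A i) x) = (ind (\<Union>i<n. A i) x :: real)"
 using union(1) by(intro indicator_UN_disjoint[symmetric]) (auto intro: disjoint_family_on_mono)
 thus "|SUM i<n. ind (A i) x :: real| <= 1" by(simp add: ind_def)
 show "(%n. SUM i<n. ind (A i) x) ----> (ind (UN i. A i) x :: real)"
 using indicator_sums[of A x] union(1) by(auto simp: sums_def disjoint_family_on_def)
 qed (use S A i in auto)
 qed
 thus ?thesis using lin cong lim by(rule bdm_induct[OF f])
qed

text \<open>The common frame of three cases: the identity, which gives the usual Ito isometry;
  conditional expectation given the noise, with \<open>r = 1\<close>; and the average over a rotated
  noise, with \<open>r\<close> the correlation. The laws hold almost everywhere because conditional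
  expectations are classes. \<open>T_adj\<close> yields measurability of pairings in time and lets
  \<open>T\<close> pass through time integrals.\<close>

locale ito_pairing = F1: bmf M F1 s I B + F2: bmf M F2 s I B
 for M :: "'w measure" and F1 F2 :: "real => 'w measure" and s :: real and I :: "nat set"
 and B :: "nat => real => 'w => real" +
 fixes t :: real and T :: "('w => real) => 'w => real" and r :: real
 assumes T_sqi: "!!V. sqi M V ==> sqi M (T V)"
 and T_contr: "!!V. sqi M V ==> (LINT w|M. (T V w)^2) <= (LINT w|M. (V w)^2)"
 and T_add: "!!V V'. sqi M V ==> sqi M V' ==> AE w in M. T (%w. V w+V' w) w = T V w+T V' w"
 and T_cmult: "!!V c. sqi M V ==> AE w in M. T (%w. c*V w) w = c*T V w"
 and T_one: "AE w in M. T (%_. 1) w = 1" and T_adj: "!!Z. bdm M Z ==> EX Z'. igb M Z' &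
 (ALL V. bdm M V --> (LINT w|M. Z w * T V w) = (LINT w|M. Z' w * V w))"
 and T_adapt: "!!V u. s <= u ==> u <= t ==> bdm (F2 u) V ==> EX V'. bdm (F1 u) V' & (AE w in M. T V w = V' w)"
 and T_incr: "!!i a b xi. i : I ==> s <= a ==> a <= b ==> b <= t ==> bdm (F2 a) xi ==>
 AE w in M. T (%w. xi w * (B i b w-B i a w)) w = r*(T xi w * (B i b w-B i a w))"
begin

lemma T_zero: "AE w in M. T (%_. 0) w = 0" using T_cmult[of "%_. 0" 0] by simp

lemma T_sum:
 assumes "finite J" "!!k. k : J ==> sqi M (V k)"
 shows "AE w in M. T (%w. SUM k:J. V k w) w = (SUM k:J. T (V k) w)" using assms
proof(induction J)
 case empty
 thus ?case using T_zero by simp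
next
 case (insert k J)
 have "AE w in M. T (%w. SUM k:J. V k w) w = (SUM k:J. T (V k) w)" using insert by auto
 moreover have "AE w in M. T (%w. V k w+(SUM k:J. V k w)) w = T (V k) w+T (%w. SUM k:J. V k w) w"
 using insert by(intro T_add sqi_sum) auto
 ultimately show ?case using insert(1,2) by(auto elim!: eventually_elim2)
qed

lemma T_diff:
 assumes "sqi M V" "sqi M V'" shows "AE w in M. T (%w. V w-V' w) w = T V w-T V' w"
 using T_add[OF assms(1) sqi_cmult[OF assms(2), of "-1"]] T_cmult[OF assms(2), of "-1"]
 by(auto elim!: eventually_elim2)

text \<open>\<open>T\<close> acts on functions; the contraction property makes it well defined on
  classes of almost surely equal ones.\<close>

lemma T_AE_cong:
 assumes "sqi M V" "sqi M V'" "AE w in M. V w = V' w" shows "AE w in M. T V w = T V' w"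
proof -
 have d: "sqi M (%w. V w-V' w)" using assms by(intro sqi_diff)
 have "(LINT w|M. (V w-V' w)^2) = (LINT w|M. 0)" using assms by(intro int_cong_AE) (auto simp: sqi_def)
 hence "(LINT w|M. (T (%w. V w-V' w) w)^2) = 0" using T_contr[OF d] by(intro antisym) auto
 hence "AE w in M. (T (%w. V w-V' w) w)^2 = 0" using T_sqi[OF d] by(subst (asm) int_0_AE) (auto simp: sqi_def)
 thus ?thesis using T_diff[OF assms(1,2)] by eventually_elim auto
qed

lemma T_L2lim:
 assumes "L2lim M V V'" shows "L2lim M (%m. T (V m)) (T V')"
proof -
 have s: "sqi M (V m)" "sqi M V'" for m using assms by(auto simp: L2lim_def)
 have le: "(LINT w|M. (T (V m) w-T V' w)^2) <= (LINT w|M. (V m w-V' w)^2)" for m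
 proof -
 have d: "sqi M (%w. V m w-V' w)" using s by(intro sqi_diff)
 have [measurable]: "T (V m) : bm M" "T V' : bm M"
 "T (%w. V m w-V' w) : bm M" using T_sqi[OF s(1)] T_sqi[OF s(2)] T_sqi[OF d] by(auto simp: sqi_def)
 have "(LINT w|M. (T (V m) w-T V' w)^2) = (LINT w|M. (T (%w. V m w-V' w) w)^2)"
 using T_diff[OF s, of m] by(intro int_cong_AE) auto
 thus ?thesis using T_contr[OF d] by simp
 qed
 have "(%m. (LINT w|M. (T (V m) w-T V' w)^2)) ----> 0"
 by(rule tendsto_sandwich[OF _ _ t_const]) (use le assms in "auto simp: L2lim_def")
 thus ?thesis using s T_sqi by(simp add: L2lim_def)
qed

lemma T_integrable: "sqi M Z ==> sqi M V ==> igb M (%w. Z w * T V w)" by(intro sqi_mi T_sqi)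

text \<open>\<open>T\<close> turns the second integrand into a variable adapted to the first
  filtration and scales its increment by \<open>r\<close>, which reduces the claim to
  \<open>incr_mult\<close> in that filtration.\<close>

lemma T_incr_pair:
 assumes I: "i : I" "j : I" and a: "s <= a" "a <= b" "b <= t" "s <= a'" "a' <= b'" "b' <= t"
 and x: "bdm (F1 a) xi" and x': "bdm (F2 a') xi'"
 shows "(LINT w|M. (xi w * (B i b w-B i a w))*T (%w. xi' w * (B j b' w-B j a' w)) w)
 = (if i = j then r*(LINT w|M. xi w * T xi' w) * max 0 (min b b'-max a a') else 0)"
proof -
 obtain V' where V': "bdm (F1 a') V'" "AE w in M. T xi' w = V' w"
 using T_adapt[OF a(4) otrans[OF a(5,6)] x'] by blast
 have sx': "sqi M xi'" by(rule F1.sqi_bdm[OF F2.bdm_F[OF a(4) x']])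
 have sx'B: "sqi M (%w. xi' w * (B j b' w-B j a' w))"
 using I a by(intro sqi_bdm_mult F2.bdm_F[OF a(4) x'] F1.B_incr_sqi) auto
 note [measurable] = bdm_m[OF F1.bdm_F[OF a(1) x]] bdm_m[OF F1.bdm_F[OF a(4) V'(1)]]
 sqi_m[OF T_sqi[OF sx']] sqi_m[OF T_sqi[OF sx'B]]
 sqi_m[OF F1.B_incr_sqi[OF I(1) a(1) otrans[OF a(1,2)]]]
 sqi_m[OF F1.B_incr_sqi[OF I(2) a(4) otrans[OF a(4,5)]]]
 have "(LINT w|M. (xi w * (B i b w-B i a w))*T (%w. xi' w * (B j b' w-B j a' w)) w)
 = (LINT w|M. r*((xi w * (B i b w-B i a w))*(V' w * (B j b' w-B j a' w))))"
 using V'(2) T_incr[OF I(2) a(4-6) x'] by(intro int_cong_AE) auto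
 also have "... = r*(if i = j then (LINT w|M. xi w * V' w) * max 0 (min b b'-max a a') else 0)"
 using F1.incr_mult[OF I a(1,2,4,5) x V'(1)] by simp
 also have "(LINT w|M. xi w * V' w) = (LINT w|M. xi w * T xi' w)" using V'(2) by(intro int_cong_AE) auto
 finally show ?thesis by simp
qed

lemma pairing_sum:
 assumes XY: "ALL k<n. sqi M (X k)" "ALL l<n'. sqi M (Y l)"
 shows "(LINT w|M. (SUM k<n. X k w) * T (%w. SUM l<n'. Y l w) w) = (SUM k<(n::nat). SUM l<(n'::nat). (LINT w|M. X k w * T (Y l) w))"
proof -
 have X: "k < n ==> sqi M (X k)" and Y: "l < n' ==> sqi M (Y l)" and TY: "l < n' ==> sqi M (T (Y l))" for k l
 using XY T_sqi by auto
 have "(LINT w|M. (SUM k<n. X k w) * T (%w. SUM l<n'. Y l w) w) = (LINT w|M. (SUM k<n. SUM l<n'. X k w * T (Y l) w))"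
 proof(rule int_cong_AE)
 have S: "sqi M (%w. SUM k<n. X k w)" "sqi M (T (%w. SUM l<n'. Y l w))" using X Y by(auto intro!: sqi_sum T_sqi)
 show "(%w. (SUM k<n. X k w) * T (%w. SUM l<n'. Y l w) w) : bm M" using S[THEN sqi_m] by measurable
 show "(%w. SUM k<n. SUM l<n'. X k w * T (Y l) w) : bm M"
 using sqi_m[OF X] sqi_m[OF TY] by(intro bm_sum bm_times) auto
 have "AE w in M. T (%w. SUM l<n'. Y l w) w = (SUM l<n'. T (Y l) w)" by(rule T_sum) (simp_all add: Y)
 thus "AE w in M. (SUM k<n. X k w) * T (%w. SUM l<n'. Y l w) w = (SUM k<n. SUM l<n'. X k w * T (Y l) w)"
 by eventually_elim (simp add: sum_product)
 qed
 also have "... = (SUM k<n. SUM l<n'. (LINT w|M. X k w * T (Y l) w))"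
 using X TY by(intro integral_sum2 sqi_mi) auto
 finally show ?thesis .
qed

text \<open>An Ito isometry twisted by \<open>T\<close>. Two grid steps contribute the length of
  their overlap, which is also the time integral of the product of their indicators.\<close>

lemma simple_pair:
 assumes S: "sproc M F1 s t' n ta xi" and S': "sproc M F2 s t' n' ta' xi'"
 and "t' <= t" and I: "i : I" "j : I" shows "(LINT w|M. sint (B i) n ta xi w * T (sint (B j) n' ta' xi') w)
 = (if i = j then r*(LINT v|(time s t'). (LINT w|M. sval n ta xi v w * T (sval n' ta' xi' v) w)) else 0)"
proof -
 define q where "q k l = (LINT w|M. xi k w * T (xi' l) w)" for k l
 define ov where "ov k l = max 0 (min (ta (Suc k)) (ta' (Suc l))-max (ta k) (ta' l))" for k l
 define A where "A k = {ta k<..ta (Suc k)}" for k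
 define A' where "A' l = {ta' l<..ta' (Suc l)}" for l
 note tm = sp_times[OF S] and tm' = sp_times[OF S']
 note xb = F1.sp_bdm[OF S] and yb = F2.sp_bdm[OF S']
 have st: "ALL k<n. sqi M (%w. xi k w * (B i (ta (Suc k)) w-B i (ta k) w))"
 "ALL l<n'. sqi M (%w. xi' l w * (B j (ta' (Suc l)) w-B j (ta' l) w))"
 using F1.st_sqi[OF S _ I(1)] F2.st_sqi[OF S' _ I(2)] by auto
 have "(LINT w|M. sint (B i) n ta xi w * T (sint (B j) n' ta' xi') w)
 = (SUM k<n. SUM l<n'. if i = j then r*q k l * ov k l else 0)"
 unfolding simple_integral_def[abs_def] pairing_sum[OF st]
 proof(intro sum.cong refl)
 fix k l assume kl: "k : {..<n}" "l : {..<n'}"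
 hence "s <= ta k" "ta k <= ta (Suc k)" "ta (Suc k) <= t" "s <= ta' l" "ta' l <= ta' (Suc l)" "ta' (Suc l) <= t"
 using tm[of k] tm[of "Suc k"] tm'[of l] tm'[of "Suc l"] S S' `t' \<le> t` by(auto simp: sproc_def)
 thus "(LINT w|M. (xi k w * (B i (ta (Suc k)) w-B i (ta k) w)) * T (%w. xi' l w * (B j (ta' (Suc l)) w-B j (ta' l) w)) w)
 = (if i = j then r*q k l * ov k l else 0)" unfolding q_def ov_def using kl by(intro T_incr_pair I xb yb) auto
 qed
 moreover have v: "(LINT w|M. sval n ta xi v w * T (sval n' ta' xi' v) w)
 = (SUM k<n. SUM l<n'. q k l*ind (A k Int A' l) v)" for v
 proof -
 have x: "ALL k<n. sqi M (%w. xi k w * ind (A k) v)" and y: "ALL l<n'. sqi M (%w. xi' l w * ind (A' l) v)"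
 using sqi_cmult[OF F1.sqi_bdm[OF xb(2)]] sqi_cmult[OF F1.sqi_bdm[OF yb(2)]] by(auto simp: mcomm[of _ "ind _ _ :: real"])
 show ?thesis unfolding simple_value_def[abs_def] A_def[symmetric] A'_def[symmetric] pairing_sum[OF x y]
 proof(intro sum.cong refl)
 fix k l assume "k : {..<n}" "l : {..<n'}"
 hence s: "sqi M (xi k)" "sqi M (xi' l)" using xb(2) yb(2) F1.sqi_bdm by auto
 have "(LINT w|M. (xi k w * ind (A k) v) * T (%w. xi' l w * ind (A' l) v) w)
 = (LINT w|M. (ind (A k) v * ind (A' l) v) * (xi k w * T (xi' l) w))"
 proof(rule int_cong_AE)
 show "AE w in M. (xi k w * ind (A k) v) * T (%w. xi' l w * ind (A' l) v) w = (ind (A k) v * ind (A' l) v) * (xi k w * T (xi' l) w)"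
 using T_cmult[OF s(2), of "ind (A' l) v"] by eventually_elim (simp add: mult_ac)
 qed (use s(1)[THEN sqi_m] T_sqi[OF s(2), THEN sqi_m] T_sqi[OF y[rule_format], THEN sqi_m] `l : {..<n'}` in auto)
 also have "... = ind (A k) v * ind (A' l) v * q k l" by(simp only: int_mr0 q_def)
 finally show "(LINT w|M. (xi k w * ind (A k) v) * T (%w. xi' l w * ind (A' l) v) w) = q k l*ind (A k Int A' l) v"
 by(simp add: indicator_inter_arith mult_ac)
 qed
 qed
 have ind: "(LINT v|(time s t'). ind (A k Int A' l) v) = ov k l" "igb (time s t') (ind (A k Int A' l) :: real => real)"
 if "k < n" "l < n'" for k l
 proof -
 have e: "A k Int A' l Int {s..t'} = {max (ta k) (ta' l)<..min (ta (Suc k)) (ta' (Suc l))}"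
 using that tm[of k] tm[of "Suc k"] by(auto simp: A_def A'_def)
 have i: "ind {s..t'} v .* ind (A k Int A' l) v = (ind {max (ta k) (ta' l)<..min (ta (Suc k)) (ta' (Suc l))} v :: real)" for v
 unfolding e[symmetric] by(simp add: indicator_inter_arith mult_ac)
 have "(LINT v|(time s t'). ind (A k Int A' l) v) = (LINT v|lborel. (ind {max (ta k) (ta' l)<..min (ta (Suc k)) (ta' (Suc l))} v :: real))"
 unfolding i[symmetric] by(rule int_restr) simp
 thus "(LINT v|(time s t'). ind (A k Int A' l) v) = ov k l" by(auto simp: ov_def measure_def max_def)
 show "igb (time s t') (ind (A k Int A' l) :: real => real)"
 proof(rule integrable_restrict_space[THEN iffD2])
 show "igb lborel (%v. ind {s..t'} v .* (ind (A k Int A' l) v :: real))"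
 unfolding i by(intro integrable_real_indicator emeasure_bounded_finite) auto
 qed simp
 qed
 have "(LINT v|(time s t'). (LINT w|M. sval n ta xi v w * T (sval n' ta' xi' v) w)) = (SUM k<n. SUM l<n'. q k l * ov k l)"
 unfolding v
 proof(subst integral_sum2)
 show "(SUM k<n. SUM l<n'. (LINT v|(time s t'). q k l*ind (A k Int A' l) v)) = (SUM k<n. SUM l<n'. q k l * ov k l)"
 by(intro sum.cong refl) (simp only: int_mr0 ind lessThan_iff)
 qed (intro i_mult_r ind; simp)
 ultimately show ?thesis by(simp add: sdl massoc)
qed

text \<open>\<open>T (V v)\<close> is chosen separately for each \<open>v\<close>, so nothing is
  known about its joint measurability. The adjoint moves \<open>T\<close> onto \<open>Z v\<close>;
  the pairing is then an ordinary integral, linear and continuous in \<open>V\<close> under bounded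
  limits. For \<open>V\<close> of the form h(v)*g(w) it is h(v) times the integral of
  \<open>Z v * T g\<close>, measurable by Fubini, and a monotone class argument over rectangles does
  the rest.\<close>

lemma pairing_m:
 assumes Z: "bdm (R >< M) (%(v, w). Z v w)" and V: "bdm (R >< M) (%(v, w). V v w)"
 shows "(%v. (LINT w|M. Z v w * T (V v) w)) : bm R"
proof -
 have Zb: "bdm M (Z v)" if "v : space R" for v
 using Z that by(auto simp: bdm_def sp_pair intro: measurable_Pair2')
 have adj: "EX Z'. igb M Z' & (ALL V. bdm M V --> (LINT w|M. Z v w * T V w) = (LINT w|M. Z' w * V w))"
 if "v : space R" for v using T_adj[OF Zb[OF that]] .
 \<comment> \<open>The choice need not depend measurably on \<open>v\<close>; measurability is shown
   for its pairings only.\<close>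
 define Q where "Q v = (SOME Z'. igb M Z' & (ALL V. bdm M V --> (LINT w|M. Z v w * T V w) = (LINT w|M. Z' w * V w)))" for v
 have Q: "igb M (Q v)" "bdm M V ==> (LINT w|M. Z v w * T V w) = (LINT w|M. Q v w * V w)"
 if "v : space R" for v V using someI_ex[OF adj[OF that]] unfolding Q_def[symmetric] by auto
 have Qi: "igb M (%w. Q v w * V w)" if vR: "v : space R" and Vb: "bdm M V" for v V
 proof -
 note [measurable] = bdm_m[OF Vb] bm_int[OF Q(1)[OF vR]]
 obtain c where c: "c >= 0" "!!w. w : space M ==> |V w| <= c" using bdm_bound[OF Vb] by blast
 show ?thesis by(rule Bintble_bound[where f = "%w. c*|Q v w|"])
 (use c Q(1)[OF vR] in "auto simp: abs_mult mult.commute intro!: AE_I2 mrm")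
 qed
 have sec: "bdm M (%w. f (v, w))" if "bdm (R >< M) f" "v : space R" for f :: "'a*'w => real" and v
 using that by(auto simp: bdm_def sp_pair)
 define P where "P f <-> (%v. (LINT w|M. Q v w * f (v, w))) : bm R" for f :: "'a*'w => real"
 have Plin: "P (%x. f x+c*g x)" if "P f" "P g" "bdm (R >< M) f" "bdm (R >< M) g" for f g c
 proof -
 have "(LINT w|M. Q v w * (f (v, w)+c*g (v, w))) = (LINT w|M. Q v w * f (v, w))+c*(LINT w|M. Q v w * g (v, w))"
 if "v : space R" for v
 using Qi[OF that sec[OF `bdm (R \<Otimes>\<^sub>M M) f` that]] Qi[OF that sec[OF `bdm (R \<Otimes>\<^sub>M M) g` that]]
 by(simp add: distrib_left mult.left_commute)
 thus ?thesis unfolding P_def using that(1,2)[unfolded P_def]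
 by(subst measurable_cong[where g = "%v. (LINT w|M. Q v w * f (v, w))+c*(LINT w|M. Q v w * g (v, w))"]) auto
 qed
 have Plim: "P f" if "!!n. P (g n)" "!!n x. x : space (R >< M) ==> |g n x| <= c"
 "!!n. g n : bm (R >< M)" "!!x. x : space (R >< M) ==> (%n. g n x) ----> f x"
 "bdm (R >< M) f" for f and g :: "nat => 'a*'w => real" and c unfolding P_def
 proof(rule borel_measurable_LIMSEQ_real)
 show "(%v. (LINT w|M. Q v w * g n (v, w))) : bm R" for n using that(1) by(simp add: P_def)
 fix v assume v: "v : space R"
 note m[measurable] = bm_int[OF Q(1)[OF v]]
 have [measurable]: "(%w. g n (v, w)) : bm M" for n using that(3)[of n] v by measurable
 have [measurable]: "(%w. f (v, w)) : bm M" using sec[OF that(5) v] by(simp add: bdm_def)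
 show "(%n. (LINT w|M. Q v w * g n (v, w))) ----> (LINT w|M. Q v w * f (v, w))"
 proof(rule dom_conv[where w = "%w. c*|Q v w|"])
 show "igb M (%w. c*|Q v w| )" using Q(1)[OF v] by auto
 show "AE w in M. (%n. Q v w * g n (v, w)) ----> Q v w * f (v, w)"
 using that(4) v by(intro AE_I2 tendsto_intros) (auto simp: sp_pair)
 show "AE w in M. norm (Q v w * g n (v, w)) <= c*|Q v w|" for n
 using mlm[OF that(2)[of "(v, _)" n] abs_ge_zero[of "Q v _"]] v
 by(intro AE_I2) (auto simp: sp_pair abs_mult mcomm[of c])
 qed measurable
 qed
 have Pind: "P f" if b: "bdm M g" and f: "!!v w. v : space R ==> w : space M ==> f (v, w) = h v * g w" and h: "h : bm R" for f g h
 proof -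
 note [measurable] = h
 have "(LINT w|M. Q v w * f (v, w)) = h v * (LINT w|M. Z v w * T g w)" if v: "v : space R" for v
 using Bint_cong[OF refl, of M "%w. Q v w * f (v, w)" "%w. h v * (Q v w * g w)"] Q(2)[OF v b] f[OF v] by(simp add: mult.left_commute)
 moreover have "(%v. h v * (LINT w|M. Z v w * T g w)) : bm R"
 using bdm_m[OF Z] sqi_m[OF T_sqi[OF F1.sqi_bdm[OF b]]] by measurable
 ultimately show ?thesis unfolding P_def by(subst measurable_cong) auto
 qed
 have "P (%(v, w). V v w)"
 proof(rule bdm_induct_generator[OF V sets_pair_measure[folded sp_pair] Int_stable_pair_measure_generator
 pair_measure_closed[folded sp_pair]])
 fix A assume "A : {a \<times> b |a b. a : sets R & b : sets M}"
 then obtain a b where A: "A = a \<times> b" "a : sets R" "b : sets M" by auto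
 show "P (ind A)"
 proof(rule Pind)
 show "bdm M (ind b :: _ => real)" using A by(intro bdmI[where c = 1]) (auto simp: ind_def)
 show "(ind a :: _ => real) : bm R" using A by simp
 qed (simp add: A indicator_times)
 next
 show "P (%_. 1)" using Pind[of "%_. 1" "%_. 1" "%_. 1"] by auto
 next
 fix u v :: "'a*'w => real" assume "P u" "!!x. x : space (R >< M) ==> u x = v x"
 moreover from this(2) have "(LINT w|M. Q y w * u (y, w)) = (LINT w|M. Q y w * v (y, w))" if "y : space R" for y
 using that by(intro Bint_cong) (auto simp: sp_pair)
 ultimately show "P v" unfolding P_def by(subst (asm) measurable_cong) auto
 qed (blast intro: Plin Plim bdm_m)+
 moreover have "(LINT w|M. Q v w * V v w) = (LINT w|M. Z v w * T (V v) w)" if "v : space R" for v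
 using Q(2)[OF that sec[OF V that]] by simp
 ultimately show ?thesis unfolding P_def by(subst measurable_cong) auto
qed

end

section \<open>Ito integrals of bounded integrands and their pairings\<close>

lemma fin_time: "finite_measure (time s (t::real))"
 by(rule finite_measureI) (simp add: emeasure_restrict_space emeasure_lborel_Icc_eq)

lemma bdm_compose_fst_snd:
 assumes "bdm M X" "A : sets R" shows "bdm (R >< M) (%(v, w). X w * ind A v)"
proof -
 note [measurable] = bdm_m[OF assms(1)] assms(2)
 obtain c where c: "c >= 0" "!!w. w : space M ==> |X w| <= c" using bdm_bound[OF assms(1)] by blast
 show ?thesis by(rule bdmI[where c = c]) (use c in "auto simp: sp_pair ind_def")
qed

lemma bdm_section:
 assumes "bdm (R >< M) (%(v, w). H v w)" "v : space R" shows "bdm M (H v)"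
proof -
 obtain c where c: "!!x. x : space (R >< M) ==> \<bar>case x of (v, w) => H v w\<bar> <= c"
 using bdm_bound[OF assms(1)] by blast
 have "H v : bm M" using m_comp[OF measurable_Pair1'[OF assms(2)] bdm_m[OF assms(1)]] by simp
 thus ?thesis by(rule bdmI[where c = c]) (use c[of "(v, _)"] assms(2) in "auto simp: sp_pair")
qed

lemma (in bmf) sv_pair:
 assumes "sproc M F s t n ta xi" shows "bdm (time s t' >< M) (%(v, w). sval n ta xi v w)"
proof -
 \<comment> \<open>Cutting the step down to \<open>{s..t'}\<close> makes it a set of the restricted
   time space and changes nothing there.\<close>
 have "bdm (time s t' >< M) (%(v, w). xi k w * ind ({ta k<..ta (Suc k)} Int {s..t'}) v)" if "k < n" for k
 using sp_bdm(2)[OF assms that] by(intro bdm_compose_fst_snd) (auto simp: sets_restrict_space)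
 hence "bdm (time s t' >< M) (%x. SUM k<n. (%(v, w). xi k w * ind ({ta k<..ta (Suc k)} Int {s..t'}) v) x)"
 by(intro bdm_sum) auto
 moreover have "(SUM k<n. (%(v, w). xi k w * ind ({ta k<..ta (Suc k)} Int {s..t'}) v) x) = (case x of (v, w) => sval n ta xi v w)"
 if xs: "x : space (time s t' >< M)" for x
 proof -
 obtain v w where x: "x = (v, w)" and v: "v : {s..t'}" using xs by(auto simp: sp_pair sp_restr)
 have "ind (A Int {s..t'}) v = (ind A v :: real)" for A using v by(simp add: ind_def)
 thus ?thesis unfolding x by(simp only: prod.case simple_value_def)
 qed
 ultimately show ?thesis by(auto simp: bdm_def cong: measurable_cong)
qed

text \<open>Fubini rewrites the nonnegative integrals of the definition as Bochner integrals with
  time outside. \<open>X\<close> is square integrable because it differs from some simple integral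
  by a variable of finite second moment.\<close>

lemma (in bmf) ito_approx:
 assumes ito: "ito_int M F (B i) s t' H X" and i: "i : I" and Hb: "bdm (time s t' >< M) (%(v, w). H v w)"
 obtains n ta xi where "!!m. sproc M F s t' (n m) (ta m) (xi m)"
 "L2lim M (%m. sint (B i) (n m) (ta m) (xi m)) X"
 "(%m. (LINT v|(time s t'). (LINT w|M. (sval (n m) (ta m) (xi m) v w-H v w)^2))) ----> 0"
 "!!m. igb (time s t') (%v. (LINT w|M. (sval (n m) (ta m) (xi m) v w-H v w)^2))"
proof -
 let ?R = "time s t'"
 interpret R: finite_measure ?R by(rule fin_time)
 interpret RM: pair_sigma_finite ?R M ..
 interpret RMf: finite_measure "?R >< M" by(rule fin_pair) (unfold_locales)
 from ito obtain n ta xi where sp: "!!m. sproc M F s t' (n m) (ta m) (xi m)"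
 and d: "(%m. \<integral>\<^sup>+w. (\<integral>\<^sup>+u\<in>{s..t'}. ennreal ((H u w-sval (n m) (ta m) (xi m) u w)^2) \<partial>lborel) \<partial>M) ----> 0"
 and e: "(%m. \<integral>\<^sup>+w. ennreal ((X w-sint (B i) (n m) (ta m) (xi m) w)^2) \<partial>M) ----> 0"
 and Xm[measurable]: "X : bm M" unfolding has_ito_integral_def by blast
 define g where "g m v w = (sval (n m) (ta m) (xi m) v w-H v w)^2" for m v w
 have gb: "bdm (?R >< M) (%(v, w). g m v w)" for m
 using bdm_mult[OF bdm_diff[OF sv_pair[OF sp] Hb] bdm_diff[OF sv_pair[OF sp] Hb]]
 unfolding g_def by(simp add: split_beta' p2es)
 note gm = bdm_m[OF gb] and gi = RMf.bdm_i[OF gb]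
 have dm: "(LINT v|?R. (LINT w|M. g m v w)) = enn2real (NN M (%w. (\<integral>\<^sup>+u\<in>{s..t'}. ennreal ((H u w-sval (n m) (ta m) (xi m) u w)^2) \<partial>lborel)))" for m
 proof -
 have "(LINT v|?R. (LINT w|M. g m v w)) = (LINT x|(?R >< M). (case x of (v, w) => g m v w))"
 by(rule RM.integral_fst[OF gi])
 also have "... = enn2real (NN (?R >< M) (%x. ennreal (case x of (v, w) => g m v w)))"
 by(rule integral_eq_nn_integral) (use gm in "auto simp: g_def")
 also have "(NN (?R >< M) (%x. ennreal (case x of (v, w) => g m v w))) = (NN M (%w. \<integral>\<^sup>+v. ennreal (g m v w) \<partial>?R))"
 using RM.nn_integral_snd[of "%x. ennreal (case x of (v, w) => g m v w)"] gm by simp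
 also have "... = (NN M (%w. (\<integral>\<^sup>+u\<in>{s..t'}. ennreal ((H u w-sval (n m) (ta m) (xi m) u w)^2) \<partial>lborel)))"
 unfolding g_def by(intro nn_cong) (simp add: nn_integral_restrict_space power2_commute)
 finally show ?thesis .
 qed
 define S where "S m = sint (B i) (n m) (ta m) (xi m)" for m
 note Ss = si_sqi[OF sp i, folded S_def] and e = e[folded S_def]
 have XS: "sqi M (%w. X w-S m w)" if "(NN M (%w. ennreal ((X w-S m w)^2))) < \<infinity>" for m
 using that sqi_m[OF Ss] Xm unfolding sqi_def by(auto intro!: integrableI_nonneg)
 obtain m0 where "(NN M (%w. ennreal ((X w-S m0 w)^2))) < \<infinity>"
 using eventually_happens[OF order_tendstoD(2)[OF e, of \<infinity>]] by auto
 hence Xs: "sqi M X" using sqi_add[OF XS[of m0] Ss[of m0]] by simp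
 have "(LINT w|M. (S m w-X w)^2) = enn2real (NN M (%w. ennreal ((X w-S m w)^2)))" for m
 using sqi_m[OF Ss] by(subst integral_eq_nn_integral) (auto simp: power2_commute)
 hence "L2lim M S X" using enn2real_tendsto_0[OF e] Xs Ss by(simp add: L2lim_def)
 moreover have "(%m. (LINT v|?R. (LINT w|M. g m v w))) ----> 0" unfolding dm by(rule enn2real_tendsto_0[OF d])
 ultimately show ?thesis using that[of n ta xi] sp RM.integrable_fst[OF gi] unfolding S_def[abs_def] g_def by blast
qed

lemma (in bmf) bdm_L2_bound:
 assumes h: "bdm M h" "ALL w:space M. |h w| <= a" shows "sqrt (LINT w|M. (h w)^2) <= a" "0 <= a"
proof -
 obtain w where "w : space M" using not_empty by blast
 thus a: "0 <= a" using h(2) by fastforce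
 have "(LINT w|M. (h w)^2) <= (LINT w|M. a^2)"
 using sqi_square[OF sqi_bdm[OF h(1)]] pow_mono[OF bspec[OF h(2)] abs_ge_zero, of _ 2] by(intro int_mono) auto
 thus "sqrt (LINT w|M. (h w)^2) <= a" using a real_le_lsqrt by(simp add: prob_space)
qed

context ito_pairing
begin

lemma T_cs:
 assumes "sqi M f" "sqi M g"
 shows "|LINT w|M. f w * T g w| <= sqrt (LINT w|M. (f w)^2) * sqrt (LINT w|M. (g w)^2)"
 by(rule otrans[OF cs_abs[OF assms(1) T_sqi[OF assms(2)]]]) (use T_contr[OF assms(2)] in "intro mlm, auto")

lemma pairing_bdm:
 assumes Z: "bdm (R >< M) (%(v, w). Z v w)" and V: "bdm (R >< M) (%(v, w). V v w)"
 shows "bdm R (%v. (LINT w|M. Z v w * T (V v) w))"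
proof -
 obtain k l where k: "!!v. v : space R ==> ALL w:space M. |Z v w| <= k"
 and l: "!!v. v : space R ==> ALL w:space M. |V v w| <= l"
 using bdm_bound[OF Z] bdm_bound[OF V] by(fastforce simp: sp_pair)
 show ?thesis
 proof(rule bdmI[OF pairing_m[OF Z V], where c = "k*l"])
 fix v assume v: "v : space R"
 note Zv = bdm_section[OF Z v] and Vv = bdm_section[OF V v]
 show "|LINT w|M. Z v w * T (V v) w| <= k*l" by(rule otrans[OF T_cs[OF F1.sqi_bdm[OF Zv] F1.sqi_bdm[OF Vv]]
 mult_mono[OF F1.bdm_L2_bound(1)[OF Zv k[OF v]] F1.bdm_L2_bound(1)[OF Vv l[OF v]]]])
 (use F1.bdm_L2_bound(2)[OF Zv k[OF v]] in auto)
 qed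
qed

text \<open>Bilinearity bounds the error of the pairing at time v by products of the L2 distances
  \<open>p\<close> and \<open>p'\<close> between the simple and the given integrands. These tend to
  zero in L2 over time, so both sides of \<open>simple_pair\<close> pass to the limit.\<close>

lemma ito_pair:
 assumes X: "ito_int M F1 (B i) s t' H X" and X': "ito_int M F2 (B j) s t' H' X'"
 and I: "i : I" "j : I" and t': "t' <= t"
 and H: "bdm (time s t' >< M) (%(v, w). H v w)" and H': "bdm (time s t' >< M) (%(v, w). H' v w)"
 shows "(LINT w|M. X w * T X' w)
 = (if i = j then r*(LINT v|(time s t'). (LINT w|M. H v w * T (H' v) w)) else 0)"
proof -
 define R where "R = time s t'"
 interpret R: finite_measure R unfolding R_def by(rule fin_time)
 note Hb = H[folded R_def] H'[folded R_def]
 obtain n ta xi where 1: "!!m. sproc M F1 s t' (n m) (ta m) (xi m)"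
 "L2lim M (%m. sint (B i) (n m) (ta m) (xi m)) X"
 "(%m. (LINT v|R. (LINT w|M. (sval (n m) (ta m) (xi m) v w-H v w)^2))) ----> 0"
 "!!m. igb R (%v. (LINT w|M. (sval (n m) (ta m) (xi m) v w-H v w)^2))"
 using F1.ito_approx[OF X I(1) H] unfolding R_def by blast
 obtain n' ta' xi' where 2: "!!m. sproc M F2 s t' (n' m) (ta' m) (xi' m)"
 "L2lim M (%m. sint (B j) (n' m) (ta' m) (xi' m)) X'"
 "(%m. (LINT v|R. (LINT w|M. (sval (n' m) (ta' m) (xi' m) v w-H' v w)^2))) ----> 0"
 "!!m. igb R (%v. (LINT w|M. (sval (n' m) (ta' m) (xi' m) v w-H' v w)^2))"
 using F2.ito_approx[OF X' I(2) H'] unfolding R_def by blast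
 obtain c c' where c: "!!v. v : space R ==> ALL w:space M. |H v w| <= c"
 and c': "!!v. v : space R ==> ALL w:space M. |H' v w| <= c'"
 using bdm_bound[OF Hb(1)] bdm_bound[OF Hb(2)] by(fastforce simp: sp_pair)
 define sv where "sv m v = sval (n m) (ta m) (xi m) v" for m v
 define sv' where "sv' m v = sval (n' m) (ta' m) (xi' m) v" for m v
 have sm: "bdm (R >< M) (%(v, w). sv m v w)" "bdm (R >< M) (%(v, w). sv' m v w)" for m
 unfolding sv_def sv'_def R_def by(rule F1.sv_pair[OF 1(1)]) (rule F2.sv_pair[OF 2(1)])
 define p where "p m v = sqrt (LINT w|M. (sv m v w-H v w)^2)" for m v
 define p' where "p' m v = sqrt (LINT w|M. (sv' m v w-H' v w)^2)" for m v
 have sq: "sqi R f" if "igb R (%v. (f v)^2)" "!!v. 0 <= f v" for f :: "real => real"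
 using m_comp[OF bm_int[OF that(1)] borel_measurable_sqrt] that by(simp add: sqi_def)
 have pL: "L2lim R p (%_. 0)" "L2lim R p' (%_. 0)"
 using 1(3,4) 2(3,4) by(auto simp: L2lim_def sv_def sv'_def p_def p'_def intro!: sq)
 define b where "b v = (LINT w|M. H v w * T (H' v) w)" for v
 define bn where "bn m v = (LINT w|M. sv m v w * T (sv' m v) w)" for m v
 have diff: "|bn m v-b v| <= p m v * p' m v+p m v * c'+c*p' m v" if v: "v : space R" for m v
 proof -
 define x y where "x w = sv m v w-H v w" and "y w = sv' m v w-H' v w" for w
 note bv = bdm_section[OF sm(1) v, of m] bdm_section[OF sm(2) v, of m] bdm_section[OF Hb(1) v] bdm_section[OF Hb(2) v]
 note q = bv[THEN F1.sqi_bdm]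
 have xy: "sqi M x" "sqi M y" using q unfolding x_def[abs_def] y_def[abs_def] by(auto intro: sqi_diff)
 note [measurable] = xy[THEN sqi_m] q[THEN sqi_m] T_sqi[OF xy(2), THEN sqi_m]
 T_sqi[OF q(2), THEN sqi_m] T_sqi[OF q(4), THEN sqi_m]
 have "bn m v = (LINT w|M. x w * T y w+x w * T (H' v) w+H v w * T y w+H v w * T (H' v) w)" unfolding bn_def
 proof(rule int_cong_AE)
 show "AE w in M. sv m v w * T (sv' m v) w = x w * T y w+x w * T (H' v) w+H v w * T y w+H v w * T (H' v) w"
 using T_diff[OF q(2,4)] unfolding y_def[abs_def, symmetric]
 proof eventually_elim
 case (elim w)
 hence "T (sv' m v) w = T y w+T (H' v) w" by simp
 thus ?case by(simp add: x_def algs)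
 qed
 qed measurable
 also have "... = (LINT w|M. x w * T y w)+(LINT w|M. x w * T (H' v) w)+(LINT w|M. H v w * T y w)+b v"
 unfolding b_def using T_integrable[OF xy] T_integrable[OF xy(1) q(4)] T_integrable[OF q(3) xy(2)]
 T_integrable[OF q(3,4)] by simp
 finally have "|bn m v-b v| <= |LINT w|M. x w * T y w|+|LINT w|M. x w * T (H' v) w|+|LINT w|M. H v w * T y w|"
 by linarith
 also have "... <= p m v * p' m v+p m v * c'+c*p' m v"
 proof(intro add_mono)
 show "|LINT w|M. x w * T y w| <= p m v * p' m v" using T_cs[OF xy] by(simp add: p_def p'_def x_def y_def)
 show "|LINT w|M. x w * T (H' v) w| <= p m v * c'"
 using otrans[OF T_cs[OF xy(1) q(4)] mlm[OF F1.bdm_L2_bound(1)[OF bv(4) c'[OF v]]]] by(simp add: p_def x_def)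
 show "|LINT w|M. H v w * T y w| <= c*p' m v"
 using otrans[OF T_cs[OF q(3) xy(2)] mrm[OF F1.bdm_L2_bound(1)[OF bv(3) c[OF v]]]] by(simp add: p'_def y_def)
 qed
 finally show ?thesis .
 qed
 have bi: "igb R b" "igb R (bn m)" for m
 unfolding b_def[abs_def] bn_def[abs_def] by(rule R.bdm_i[OF pairing_bdm[OF Hb]] R.bdm_i[OF pairing_bdm[OF sm]])+
 have conv: "(%m. (LINT v|R. bn m v)) ----> (LINT v|R. b v)"
 proof(rule LIM_zero_cancel, rule Lim_null_comparison[OF always_eventually], rule allI)
 note k = L2lim_const[OF R.sqi_bdm[OF bdm_const]]
 note sqi = pL[unfolded L2lim_def, THEN conjunct1, rule_format] R.sqi_bdm[OF bdm_const]
 note ii = sqi_mi[OF sqi(1,2)] sqi_mi[OF sqi(1,3)] sqi_mi[OF sqi(3,2)]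
 show "(%m. (LINT v|R. p m v * p' m v)+(LINT v|R. p m v * c')+(LINT v|R. c*p' m v)) ----> 0"
 using tendsto_add[OF tendsto_add[OF L2lim_mult[OF pL] L2lim_mult[OF pL(1) k]] L2lim_mult[OF k pL(2)]] by simp
 fix m
 have "norm ((LINT v|R. bn m v)-(LINT v|R. b v)) <= (LINT v|R. norm (bn m v-b v))"
 using bi integral_norm_bound[of R "%v. bn m v-b v"] by simp
 also have "... <= (LINT v|R. p m v * p' m v+p m v * c'+c*p' m v)"
 using bi diff ii by(intro int_mono Bintble_add) auto
 finally show "norm ((LINT v|R. bn m v)-(LINT v|R. b v)) <= (LINT v|R. p m v * p' m v)+(LINT v|R. p m v * c')+(LINT v|R. c*p' m v)"
 using ii by simp
 qed
 have "(%m. (LINT w|M. sint (B i) (n m) (ta m) (xi m) w * T (sint (B j) (n' m) (ta' m) (xi' m)) w))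
 ----> (if i = j then r*(LINT v|R. b v) else 0)"
 unfolding simple_pair[OF 1(1) 2(1) t' I] R_def[symmetric] sv_def[symmetric] sv'_def[symmetric] bn_def[symmetric]
 using tendsto_mult_left[OF conv, of r] by(cases "i = j") auto
 from LIMSEQ_unique[OF L2lim_mult[OF 1(2) T_L2lim[OF 2(2)]] this] show ?thesis unfolding R_def b_def .
qed

end

lemma bdm_pair_integral:
 fixes H :: "'b => 'a => real"
 assumes "finite_measure R" "finite_measure M" and H: "bdm (R >< M) (%(v, w). H v w)"
 shows "igb R (%v. (LINT w|M. H v w))" "bdm M (%w. (LINT v|R. H v w))"
 "!!w. w : space M ==> igb R (%v. H v w)"
proof -
 interpret R: finite_measure R by fact
 interpret M: finite_measure M by fact
 interpret RM: pair_sigma_finite R M ..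
 interpret RMf: finite_measure "R >< M" by(rule fin_pair) (unfold_locales)
 note Hm[measurable] = bdm_m[OF H]
 have i: "igb (R >< M) (%(v, w). H v w)" by(rule RMf.bdm_i[OF H])
 show "igb R (%v. (LINT w|M. H v w))" by(rule RM.integrable_fst[OF i])
 obtain c where c: "c >= 0" "!!x. x : space (R >< M) ==> \<bar>case x of (v, w) => H v w\<bar> <= c"
 using bdm_bound[OF H] by blast
 have Hv: "(%v. H v w) : bm R" if ww: "w : space M" for w using m_comp[OF measurable_Pair2'[OF ww] Hm] by simp
 show int: "igb R (%v. H v w)" if ww: "w : space M" for w
 by(rule R.integrable_const_bound[where B = c]) (use c(2)[of "(_, w)"] ww Hv[OF ww] in "auto simp: sp_pair")
 show "bdm M (%w. (LINT v|R. H v w))"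
 proof(rule bdmI[where c = "c * measure R (space R)"])
 show "(%w. (LINT v|R. H v w)) : bm M" using measurable_pair_swap[OF Hm] by measurable
 fix w assume ww: "w : space M"
 have "|(LINT v|R. H v w)| <= (LINT v|R. |H v w| )" by(rule integral_abs_bound)
 also have "... <= (LINT v|R. c)"
 using int[OF ww] c(2)[of "(_, w)"] ww by(intro int_mono) (auto simp: sp_pair)
 finally show "|(LINT v|R. H v w)| <= c * measure R (space R)" by(simp add: mcomm)
 qed
qed

lemma integral_time_swap:
 fixes c :: "'b => 'a => real"
 assumes R: "finite_measure R" and M: "finite_measure M" and Z: "igb M Z"
 and c: "bdm (R >< M) (%(v, w). c v w)"
 shows "(LINT w|M. Z w * (LINT v|R. c v w)) = (LINT v|R. (LINT w|M. Z w * c v w))"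
proof -
 interpret R: finite_measure R by fact
 interpret M: finite_measure M by fact
 interpret RM: pair_sigma_finite R M ..
 note [measurable] = bdm_m[OF c] bm_int[OF Z]
 obtain C where C: "C >= 0" "!!x. x : space (R >< M) ==> \<bar>case x of (v, w) => c v w\<bar> <= C"
 using bdm_bound[OF c] by blast
 have "igb (R >< M) (%(v, w). Z w * c v w)"
 proof(rule Bintble_bound[where f = "%(v, w). C*Z w"])
 show "igb (R >< M) (%(v, w). C*Z w)" using Z by(intro RM.Fubini_integrable) auto
 show "AE x in R >< M. norm (case x of (v, w) => Z w * c v w) <= norm (case x of (v, w) => C*Z w)"
 using mlm[OF C(2) abs_ge_zero, of _ "Z (snd _)"] C(1)
 by(intro AE_I2) (fastforce simp: split_beta abs_mult mcomm)
 qed measurable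
 from RM.Fubini_integral[OF this] show ?thesis by simp
qed

lemma bdm_restrict_time:
 assumes "bdm (time s (t::real) >< M) f" "u <= t" shows "bdm (time s u >< M) f"
proof -
 have id: "(%x. x) : time s u >< M ~> time s t >< M"
 proof -
 have f: "fst : time s u >< M ~> time s t"
 using assms(2) by(intro measurable_restrict_space2 measurable_fst'')
 (auto simp: sp_pair sp_restr intro!: m_comp[OF measurable_fst] m_restr1)
 have "(%x. (fst x, snd x)) : time s u >< M ~> time s t >< M" by(intro measurable_Pair f measurable_snd)
 thus ?thesis by simp
 qed
 obtain c where c: "!!x. x : space (time s t >< M) ==> |f x| <= c" using bdm_bound[OF assms(1)] by blast
 show ?thesis by(rule bdmI[where c = c]) (use m_comp[OF id bdm_m[OF assms(1)]] c m_space[OF id] in auto)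
qed

text \<open>With the identity for \<open>T\<close>, the twisted isometry and the martingale lemmas
  become the usual ones for a single filtration.\<close>

lemma (in bmf) id_pairing: "ito_pairing M F F s I B t (%X. X) 1"
proof(intro ito_pairing.intro ito_pairing_axioms.intro)
 show "EX Z'. igb M Z' & (ALL V. bdm M V --> (LINT w|M. Z w * V w) = (LINT w|M. Z' w * V w))"
 if "bdm M Z" for Z using bdm_i[OF that] by blast
 show "EX V'. bdm (F u) V' & (AE w in M. V w = V' w)" if "bdm (F u) V" for V u using that by auto
qed (unfold_locales, auto)

section \<open>Stopping simple processes at an earlier time\<close>

definition tnodes :: "real => (nat => real) => nat => real" where
 "tnodes u ta k = min (ta k) u"

text \<open>Steps that start at \<open>u\<close> or later get the value 0: their nodes collapse to
  \<open>u\<close>, where \<open>xi k\<close> need not be measurable.\<close>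

definition tvals :: "real => (nat => real) => (nat => 'w => real) => nat => 'w => real" where
 "tvals u ta xi k = (if ta k < u then xi k else (%_. 0))"

lemma sp_trunc:
 assumes "sproc M F s t n ta xi" "s <= u" "u <= t" shows "sproc M F s u n (tnodes u ta) (tvals u ta xi)"
 unfolding sproc_def
proof(intro conjI allI impI)
 fix k assume k: "k < n"
 thus "tnodes u ta k <= tnodes u ta (Suc k)" using assms by(auto simp: sproc_def tnodes_def)
 show "tvals u ta xi k : bm (F (tnodes u ta k))"
 using assms k by(auto simp: sproc_def tnodes_def tvals_def min_def)
 show "EX c. ALL w:space M. |tvals u ta xi k w| <= c" using assms k by(auto simp: sproc_def tvals_def)
qed (use assms in "auto simp: sproc_def tnodes_def")

lemma simple_value_truncated:
 assumes "v <= u" shows "sval n (tnodes u ta) (tvals u ta xi) v w = sval n ta xi v w"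
 unfolding simple_value_def
 by(rule sum.cong) (use assms in \<open>auto simp: tnodes_def tvals_def ind_def\<close>)

context ito_pairing
begin

definition be where "be Z V = (LINT w|M. Z w * T V w)"

lemma be_add_right: "sqi M Z ==> sqi M V ==> sqi M V' ==> be Z (%w. V w+V' w) = be Z V+be Z V'"
proof -
 assume s: "sqi M Z" "sqi M V" "sqi M V'"
 note [measurable] = sqi_m[OF s(1)] sqi_m[OF T_sqi[OF s(2)]] sqi_m[OF T_sqi[OF s(3)]]
 sqi_m[OF T_sqi[OF sqi_add[OF s(2,3)]]]
 have "be Z (%w. V w+V' w) = (LINT w|M. Z w * T V w+Z w * T V' w)" unfolding be_def
 by(rule int_cong_AE) (use T_add[OF s(2,3)] in "auto elim!: ev_mono simp: distrib_left")
 thus ?thesis using T_integrable[OF s(1,2)] T_integrable[OF s(1,3)] by(simp add: be_def)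
qed

lemma be_cmult_right: "sqi M Z ==> sqi M V ==> be Z (%w. c*V w) = c*be Z V"
proof -
 assume s: "sqi M Z" "sqi M V"
 note [measurable] = sqi_m[OF s(1)] sqi_m[OF T_sqi[OF s(2)]]
 sqi_m[OF T_sqi[OF sqi_cmult[OF s(2)]]]
 have "be Z (%w. c*V w) = (LINT w|M. c*(Z w * T V w))" unfolding be_def
 by(rule int_cong_AE) (use T_cmult[OF s(2), of c] in "auto elim!: ev_mono simp: mult_ac")
 thus ?thesis by(simp add: be_def)
qed

lemma be_add_left: "sqi M Z ==> sqi M Z' ==> sqi M V ==> be (%w. Z w+Z' w) V = be Z V+be Z' V"
 using T_integrable[of Z V] T_integrable[of Z' V] by(simp add: be_def distrib_right)

lemma be_cmult_left: "be (%w. c*Z w) V = c*be Z V" by(simp add: be_def massoc)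

lemma be_cong_right:
 assumes "sqi M Z" "sqi M V" "sqi M V'" "AE w in M. V w = V' w" shows "be Z V = be Z V'"
proof -
 note [measurable] = sqi_m[OF assms(1)] sqi_m[OF T_sqi[OF assms(2)]] sqi_m[OF T_sqi[OF assms(3)]]
 have "AE w in M. Z w * T V w = Z w * T V' w" using T_AE_cong[OF assms(2-4)] by eventually_elim simp
 thus ?thesis unfolding be_def by(intro int_cong_AE) auto
qed

lemma be_cong_left:
 assumes "sqi M Z" "sqi M Z'" "sqi M V" "AE w in M. Z w = Z' w" shows "be Z V = be Z' V" unfolding be_def
 by(rule int_cong_AE) (use assms sqi_m[OF T_sqi] in "auto elim!: ev_mono simp: sqi_m")

lemma be_sum_right:
 assumes "finite J" "sqi M Z" "!!k. k : J ==> sqi M (V k)"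
 shows "be Z (%w. SUM k:J. V k w) = (SUM k:J. be Z (V k))" using assms(1,3)
proof(induction J)
 case empty
 thus ?case using be_cmult_right[of Z "%_. 0" 0] assms(2) by simp
next
 case (insert k J)
 thus ?case using be_add_right[OF assms(2), of "V k" "%w. SUM k:J. V k w"] sqi_sum[of J M V] by simp
qed

lemma be_sum_left:
 assumes "!!k. k : J ==> sqi M (Z k)" "sqi M V" shows "be (%w. SUM k:J. Z k w) V = (SUM k:J. be (Z k) V)"
 unfolding be_def sum_distrib_right by(rule Bint_sum) (use assms T_integrable in auto)

lemma be_const_right: "sqi M Z ==> be Z (%_. c) = c*(LINT w|M. Z w)"
proof -
 assume Z: "sqi M Z"
 have one: "sqi M (%_. 1)" by(simp add: F1.sqi_bdm)
 have "be Z (%_. c) = c*be Z (%_. 1)" using be_cmult_right[OF Z one, of c] by simp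
 also have "be Z (%_. 1) = (LINT w|M. Z w)" unfolding be_def by(rule int_cong_AE)
 (use Z sqi_m[OF T_sqi[OF one]] T_one in "auto elim!: ev_mono simp: sqi_m")
 finally show ?thesis .
qed

lemma be_time_r:
 assumes R: "finite_measure R" and Z: "bdm M Z" and c: "bdm (R >< M) (%(v, w). c v w)"
 shows "be Z (%w. (LINT v|R. c v w)) = (LINT v|R. be Z (c v))"
proof -
 obtain Z' where Z': "igb M Z'" "!!V. bdm M V ==> be Z V = (LINT w|M. Z' w * V w)"
 using T_adj[OF Z] unfolding be_def by blast
 have "be Z (%w. (LINT v|R. c v w)) = (LINT w|M. Z' w * (LINT v|R. c v w))"
 by(rule Z'(2)[OF bdm_pair_integral(2)[OF R F1.finite_measure_axioms c]])
 also have "... = (LINT v|R. (LINT w|M. Z' w * c v w))" by(rule integral_time_swap[OF R F1.finite_measure_axioms Z'(1) c])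
 also have "... = (LINT v|R. be Z (c v))" by(rule Bint_cong[OF refl]) (simp add: Z'(2) bdm_section[OF c])
 finally show ?thesis .
qed

lemma be_time_l:
 assumes R: "finite_measure R" and V: "bdm M V" and a: "bdm (R >< M) (%(v, w). a v w)"
 shows "be (%w. (LINT v|R. a v w)) V = (LINT v|R. be (a v) V)"
 using integral_time_swap[OF R F1.finite_measure_axioms F1.sqi_i[OF T_sqi[OF F1.sqi_bdm[OF V]]] a]
 by(simp add: be_def mcomm)

lemma be_L2lim:
 assumes "L2lim M X X'" "L2lim M Y Y'" shows "(%m. be (X m) (Y m)) ----> be X' Y'"
 unfolding be_def by(rule L2lim_mult[OF assms(1) T_L2lim[OF assms(2)]])

text \<open>\<open>T\<close> turns a step after \<open>u\<close> into \<open>r\<close> times an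
  adapted variable times the same increment, and such a product is orthogonal to \<open>Z\<close>. A
  step that contains \<open>u\<close> is split there.\<close>

lemma simple_truncated_pair:
 assumes S: "sproc M F2 s t' n ta xi" and t': "t' <= t" and i: "i : I"
 and u: "s <= u" "u <= t'" and Z: "bdm (F1 u) Z" shows "be Z (sint (B i) n ta xi)
 = be Z (sint (B i) n (tnodes u ta) (tvals u ta xi))"
proof -
 note S' = sp_trunc[OF S u]
 define ta' xi' where "ta' = tnodes u ta" and "xi' = tvals u ta xi"
 note tm = sp_times[OF S]
 have Zs: "sqi M Z" using F1.bdm_F[OF u(1) Z] by(rule F1.sqi_bdm)
 have sum: "be Z (sint (B i) n sg et) = (SUM k<n. be Z (%w. et k w * (B i (sg (Suc k)) w-B i (sg k) w)))"
 if "sproc M F2 s y n sg et" for sg et y unfolding simple_integral_def[abs_def]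
 by(rule be_sum_right) (use Zs F2.st_sqi[OF that _ i] in auto)
 have term0: "be Z (%w. et w * (B i b w-B i a w)) = 0"
 if a: "u <= a" "a <= b" "b <= t" and et: "bdm (F2 a) et" for et a b
 proof -
 have sa: "s <= a" using a u by auto
 obtain V where V: "bdm (F1 a) V" "AE w in M. T et w = V w" using T_adapt[OF sa otrans[OF a(2,3)] et] by blast
 have ets: "sqi M et" using F2.bdm_F[OF sa et] by(rule F1.sqi_bdm)
 have s2: "sqi M (%w. et w * (B i b w-B i a w))"
 using i sa a by(intro sqi_bdm_mult F2.bdm_F[OF sa et] F1.B_incr_sqi) auto
 note [measurable] = sqi_m[OF Zs] sqi_m[OF T_sqi[OF ets]] bdm_m[OF F1.bdm_F[OF sa V(1)]]
 sqi_m[OF T_sqi[OF s2]] sqi_m[OF F1.B_incr_sqi[OF i sa otrans[OF sa a(2)]]]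
 have "be Z (%w. et w * (B i b w-B i a w)) = (LINT w|M. r*((Z w * V w)*(B i b w-B i a w)))" unfolding be_def
 proof(rule int_cong_AE)
 show "AE w in M. Z w * T (%w. et w * (B i b w-B i a w)) w = r*(Z w * V w * (B i b w-B i a w))"
 using V(2) T_incr[OF i sa a(2,3) et] by eventually_elim simp
 qed measurable
 also have "... = r*(LINT w|M. (Z w * V w)*(B i b w-B i a w))" by simp
 also have "(LINT w|M. (Z w * V w)*(B i b w-B i a w)) = 0"
 by(rule F1.B_mart[OF i sa a(2)]) (intro bdm_mult V(1) F1.bdm_F_mono[OF u(1) a(1) Z])
 finally show ?thesis by simp
 qed
 have trm: "be Z (%w. xi k w * (B i (ta (Suc k)) w-B i (ta k) w)) = be Z (%w. xi' k w * (B i (ta' (Suc k)) w-B i (ta' k) w))"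
 if k: "k < n" for k
 proof -
 have tk: "s <= ta k" "ta k <= ta (Suc k)" "ta (Suc k) <= t"
 using S k tm(2)[of "Suc k"] tm(1)[of k] t' by(auto simp: sproc_def)
 note xk = F2.sp_bdm[OF S k]
 show ?thesis
 proof(cases "ta k < u")
 case False
 have "xi' k = (%_. 0)" using False by(simp add: xi'_def tvals_def)
 moreover have "be Z (%_. 0) = 0" using be_cmult_right[OF Zs, of "%_. 0" 0] by simp
 ultimately show ?thesis using term0[of "ta k" "ta (Suc k)" "xi k"] False tk xk(1) by simp
 next
 case True
 hence x': "xi' k = xi k" "ta' k = ta k" by(auto simp: xi'_def ta'_def tvals_def tnodes_def)
 show ?thesis
 proof(cases "ta (Suc k) <= u")
 case True
 thus ?thesis using x' by(simp add: ta'_def tnodes_def)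
 next
 case False
 hence t2: "ta' (Suc k) = u" by(simp add: ta'_def tnodes_def)
 have xu: "bdm (F2 u) (xi k)" using `ta k < u` tk xk(1) by(intro F2.bdm_F_mono[of "ta k" u]) auto
 have "be Z (%w. xi k w * (B i (ta (Suc k)) w-B i (ta k) w))
 = be Z (%w. xi k w * (B i u w-B i (ta k) w)+xi k w * (B i (ta (Suc k)) w-B i u w))" by(simp add: algs)
 also have "... = be Z (%w. xi k w * (B i u w-B i (ta k) w))+be Z (%w. xi k w * (B i (ta (Suc k)) w-B i u w))"
 using tk u i xk(2) by(intro be_add_right Zs sqi_bdm_mult F1.B_incr_sqi) auto
 also have "be Z (%w. xi k w * (B i (ta (Suc k)) w-B i u w)) = 0" using False tk by(intro term0 xu) auto
 finally show ?thesis by(simp add: x' t2)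
 qed
 qed
 qed
 show ?thesis using trm unfolding sum[OF S] sum[OF S'] ta'_def xi'_def by(intro sum.cong) auto
qed

lemma simple_integral_degenerate:
 assumes S: "sproc M F s s n ta xi" shows "sint (B i) n ta xi = (%_. 0)"
proof -
 have "ta k = s" if "k <= n" for k using sp_times[OF S, of k] that by auto
 thus ?thesis by(auto simp: simple_integral_def fun_eq_iff)
qed

lemma ito_int_simple:
 assumes sp: "sproc M F2 s u n sg et" and i: "i : I"
 shows "ito_int M F2 (B i) s u (sval n sg et) (sint (B i) n sg et)" unfolding has_ito_integral_def
proof(intro conjI exI[of _ "%_. n"] exI[of _ "%_. sg"] exI[of _ "%_. et"] allI sp)
 have "sets (time s u >< M) = sets (restrict_space borel {s..u} >< M)"
 by(intro sets_pair_measure_cong sets_restrict_space_cong) auto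
 thus "(%(v, w). sval n sg et v w) : bm (restrict_space borel {s..u} >< M)"
 using bdm_m[OF F2.sv_pair[OF sp, of u]] m_cong_sets[OF _ refl] by blast
qed (use sqi_m[OF F2.si_sqi[OF sp i]] in auto)

text \<open>\<open>X\<close> and \<open>Xu\<close> are not two values of one process: the equation
  supplies an integral for each end point separately. The isometry shows that the simple integrals
  approximating \<open>X\<close>, stopped at \<open>u\<close>, converge to \<open>Xu\<close>; before
  the limit the pairings agree by \<open>simple_truncated_pair\<close>.\<close>

lemma ito_mart:
 assumes X: "ito_int M F2 (B i) s t' H X" and Xu: "ito_int M F2 (B i) s u H Xu"
 and i: "i : I" and t': "t' <= t" and u: "s <= u" "u <= t'" and Z: "bdm (F1 u) Z"
 and Hb: "bdm (time s t' >< M) (%(v, w). H v w)" shows "be Z X = be Z Xu"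
proof -
 define R where "R = time s u"
 have fR: "finite_measure R" unfolding R_def by(rule fin_time)
 have Zs: "sqi M Z" using F1.bdm_F[OF u(1) Z] by(rule F1.sqi_bdm)
 interpret id: ito_pairing M F2 F2 s I B t' "%X. X" 1 by(rule F2.id_pairing)
 obtain n ta xi where 1: "!!m. sproc M F2 s t' (n m) (ta m) (xi m)"
 "L2lim M (%m. sint (B i) (n m) (ta m) (xi m)) X"
 "(%m. (LINT v|(time s t'). (LINT w|M. (sval (n m) (ta m) (xi m) v w-H v w)^2))) ----> 0"
 "!!m. igb (time s t') (%v. (LINT w|M. (sval (n m) (ta m) (xi m) v w-H v w)^2))"
 using F2.ito_approx[OF X i Hb] by blast
 define sg et where "sg m = tnodes u (ta m)" and "et m = tvals u (ta m) (xi m)" for m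
 note 3 = sp_trunc[OF 1(1) u, folded sg_def et_def]
 define S where "S m = sint (B i) (n m) (sg m) (et m)" for m
 define g where "g m = sval (n m) (sg m) (et m)" for m
 have Hu: "bdm (time s u >< M) (%(v, w). H v w)" by(rule bdm_restrict_time[OF Hb u(2)])
 have gu: "bdm (time s u >< M) (%(v, w). g m v w)" for m unfolding g_def by(rule F2.sv_pair[OF 3])
 have Ss: "sqi M (S m)" for m unfolding S_def by(rule F2.si_sqi[OF 3 i])
 have Xs: "sqi M Xu" using F2.ito_approx[OF Xu i Hu] unfolding L2lim_def by metis
 note SI = ito_int_simple[OF 3 i, folded S_def g_def]
 note pair = id.ito_pair[OF _ _ i i u(2), simplified]
 define d where "d m v = (LINT w|M. (sval (n m) (ta m) (xi m) v w-H v w)^2)" for m v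
 have d0: "d m v >= 0" for m v by(simp add: d_def)
 have dR': "set_integrable lborel {s..t'} (d m)" for m
 using 1(4)[of m] unfolding d_def[symmetric] by(simp add: integrable_restrict_space set_integrable_def)
 have dR: "set_integrable lborel {s..u} (d m)" for m by(rule set_integrable_subset[OF dR']) (use u in auto)
 \<comment> \<open>After expansion of the square each term is an isometry over
   \<open>[s, u]\<close>, where the stopped process still agrees with the original one; enlarging
   the interval to \<open>[s, t']\<close> gives the bound.\<close>
 have e: "(LINT w|M. (S m w-Xu w)^2) <= (LINT v|(time s t'). d m v)" for m
 proof -
 have prod: "igb R (%v. (LINT w|M. f v w * h v w))"
 if f: "bdm (time s u >< M) (%(v, w). f v w)" and h: "bdm (time s u >< M) (%(v, w). h v w)" for f h
 unfolding R_def by(rule bdm_pair_integral(1)[OF fR[unfolded R_def] F1.finite_measure_axioms])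
 (use bdm_mult[OF f h] in "simp add: split_beta'")
 have sq: "(LINT w|M. (f w-h w)^2) = (LINT w|M. f w * f w)-2*(LINT w|M. f w * h w)+(LINT w|M. h w * h w)"
 if f: "sqi M f" and h: "sqi M h" for f h
 proof -
 have "(LINT w|M. (f w-h w)^2) = (LINT w|M. f w * f w-2*(f w * h w)+h w * h w)"
 by(intro Bint_cong) (auto simp: p2es algs)
 thus ?thesis using sqi_mi[OF f f] sqi_mi[OF f h] sqi_mi[OF h h] by simp
 qed
 have "(LINT w|M. (S m w-Xu w)^2) = (LINT v|R. (LINT w|M. g m v w * g m v w))-2*(LINT v|R. (LINT w|M. g m v w * H v w))
 + (LINT v|R. (LINT w|M. H v w * H v w))" unfolding sq[OF Ss Xs] R_def
 by(simp only: pair[OF SI SI gu gu] pair[OF SI Xu gu Hu] pair[OF Xu Xu Hu Hu])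
 also have "... = (LINT v|R. (LINT w|M. g m v w * g m v w)-2*(LINT w|M. g m v w * H v w)+(LINT w|M. H v w * H v w))"
 using prod[OF gu gu, of m m] prod[OF gu Hu, of m] prod[OF Hu Hu] by simp
 also have "... = (LINT v|R. d m v)"
 proof(rule Bint_cong[OF refl])
 fix v assume "v : space R"
 hence v: "v : space (time s u)" "v <= u" by(auto simp: R_def sp_restr)
 have "g m v = sval (n m) (ta m) (xi m) v"
 unfolding g_def sg_def et_def by(rule ext, rule simple_value_truncated[OF v(2)])
 thus "(LINT w|M. g m v w * g m v w)-2*(LINT w|M. g m v w * H v w)+(LINT w|M. H v w * H v w) = d m v"
 using sq[OF F1.sqi_bdm[OF bdm_section[OF gu v(1)]] F1.sqi_bdm[OF bdm_section[OF Hu v(1)]], of m] by(simp add: d_def)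
 qed
 also have "... = (LINT v|lborel. ind {s..u} v .* d m v)" unfolding R_def by(rule int_restr) simp
 also have "... <= (LINT v|lborel. ind {s..t'} v .* d m v)"
 using dR' dR d0 u by(intro int_mono) (auto simp: set_integrable_def ind_def)
 also have "... = (LINT v|(time s t'). d m v)" by(rule int_restr[symmetric]) simp
 finally show ?thesis .
 qed
 have "(%m. (LINT w|M. (S m w-Xu w)^2)) ----> 0"
 by(rule tendsto_sandwich[OF _ _ t_const 1(3)[folded d_def]]) (use e in auto)
 hence "L2lim M S Xu" using Ss Xs by(simp add: L2lim_def)
 from be_L2lim[OF L2lim_const[OF Zs] this] be_L2lim[OF L2lim_const[OF Zs] 1(2)] show ?thesis
 unfolding simple_truncated_pair[OF 1(1) t' i u Z] S_def sg_def et_def by(rule LIMSEQ_unique[symmetric])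
qed

text \<open>Stopping at \<open>u = s\<close> leaves simple processes on a degenerate interval, whose
  integrals vanish.\<close>

lemma ito_mean:
 assumes X: "ito_int M F2 (B i) s t' H X" and i: "i : I" and t': "s <= t'" "t' <= t" and Z: "bdm (F1 s) Z"
 and H: "bdm (time s t' >< M) (%(v, w). H v w)" shows "be Z X = 0"
proof -
 have Zs: "sqi M Z" using F1.bdm_F[OF order_refl Z] by(rule F1.sqi_bdm)
 obtain n ta xi where 1: "!!m. sproc M F2 s t' (n m) (ta m) (xi m)"
 "L2lim M (%m. sint (B i) (n m) (ta m) (xi m)) X" by(rule F2.ito_approx[OF X i H], rule that)
 have "be Z (sint (B i) (n m) (ta m) (xi m)) = 0" for m
 unfolding simple_truncated_pair[OF 1(1) t'(2) i order_refl t'(1) Z]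
 simple_integral_degenerate[OF sp_trunc[OF 1(1) order_refl t'(1)]]
 using be_cmult_right[OF Zs, of "%_. 0" 0] by simp
 with be_L2lim[OF L2lim_const[OF Zs] 1(2)] show ?thesis by(simp add: LIMSEQ_const_iff)
qed

end

section \<open>Semimartingale decompositions and the product formula\<close>

definition (in bmf) semimart ::
 "real => (real => 'w => real) => real => (real => 'w => real) => (nat => real => 'w => real) => bool" where
 "semimart t X x a b \<longleftrightarrow>
 bdm (time s t >< M) (%(v, w). X v w) &
 bdm (time s t >< M) (%(v, w). a v w) &
 (ALL i:I. bdm (time s t >< M) (%(v, w). b i v w)) &
 (ALL u. s <= u & u <= t --> bdm (F u) (X u) & bdm (F u) (a u) &
 (EX J. (ALL i:I. ito_int M F (B i) s u (b i) (J i)) &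
 (AE w in M. X u w = x+(SUM i:I. J i w)+1/2*(LINT v|(time s u). a v w))))"

text \<open>The integrals are chosen at every time at once. The family \<open>J u i\<close> need not
  be a process in \<open>u\<close>; consistency between times enters through \<open>ito_mart\<close>
  alone.\<close>

lemma (in bmf) semimart_decomposition:
 assumes X: "semimart t X x a b"
 obtains J where "!!u i. s <= u ==> u <= t ==> i : I ==> ito_int M F (B i) s u (b i) (J u i)"
 "!!u i. s <= u ==> u <= t ==> i : I ==> sqi M (J u i)"
 "!!u. s <= u ==> u <= t ==> AE w in M. X u w-x-1/2*(LINT v|(time s u). a v w) = (SUM i:I. J u i w)"
proof -
 have "ALL u:{s..t}. EX J. (ALL i:I. ito_int M F (B i) s u (b i) (J i)) &
 (AE w in M. X u w = x+(SUM i:I. J i w)+1/2*(LINT v|(time s u). a v w))" using X by(simp add: semimart_def)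
 from bchoice[OF this] obtain J where "ALL u:{s..t}. (ALL i:I. ito_int M F (B i) s u (b i) (J u i)) &
 (AE w in M. X u w = x+(SUM i:I. J u i w)+1/2*(LINT v|(time s u). a v w))" ..
 note J = bspec[OF this, OF atLeastAtMost_iff[THEN iffD2], OF conjI]
 show ?thesis
 proof(rule that[of J])
 fix u i assume u: "s <= u" "u <= t" and i: "i : I"
 show Ji: "ito_int M F (B i) s u (b i) (J u i)" by(rule bspec[OF conjunct1[OF J[OF u]] i])
 have "bdm (time s t >< M) (%(v, w). b i v w)" using X i by(simp add: semimart_def)
 from bdm_restrict_time[OF this u(2)] show "sqi M (J u i)" by(rule ito_approx[OF Ji i]) (simp add: L2lim_def)
 next
 fix u assume u: "s <= u" "u <= t"
 show "AE w in M. X u w-x-1/2*(LINT v|(time s u). a v w) = (SUM i:I. J u i w)"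
 using conjunct2[OF J[OF u]] by eventually_elim simp
 qed
qed

context ito_pairing
begin

lemma mart_right:
 assumes fI: "finite I" and Y: "F2.semimart t Y y c d" and NN: "ALL u:{s..t}. sqi M (N u)"
 and N: "!!u w. N u w = Y u w-y-1/2*(LINT v|(time s u). c v w)" and u: "s <= u" "u <= t"
 shows "bdm (F1 u) Z ==> be Z (N t) = be Z (N u)" "bdm (F1 s) Z ==> be Z (N t) = 0"
proof -
 obtain J where J: "!!u i. s <= u ==> u <= t ==> i : I ==> ito_int M F2 (B i) s u (d i) (J u i)"
 "!!u i. s <= u ==> u <= t ==> i : I ==> sqi M (J u i)"
 "!!u. s <= u ==> u <= t ==> AE w in M. N u w = (SUM i:I. J u i w)"
 by(rule F2.semimart_decomposition[OF Y, folded N], rule that)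
 have d: "bdm (time s t >< M) (%(v, w). d i v w)" if "i : I" for i using Y that by(simp add: F2.semimart_def)
 note tt = otrans[OF u] order_refl
 note Nb = bspec[OF NN, OF atLeastAtMost_iff[THEN iffD2], OF conjI]
 have sum: "be Z (N v) = (SUM i:I. be Z (J v i))" if Z: "sqi M Z" and v: "s <= v" "v <= t" for v Z
 using be_cong_right[OF Z Nb[OF v] sqi_sum[OF J(2)[OF v]] J(3)[OF v]] be_sum_right[OF fI Z J(2)[OF v]] by simp
 show "be Z (N t) = be Z (N u)" if Z: "bdm (F1 u) Z"
 proof -
 have Zs: "sqi M Z" using F1.bdm_F[OF u(1) Z] by(rule F1.sqi_bdm)
 show ?thesis unfolding sum[OF Zs tt] sum[OF Zs u]
 by(intro sum.cong refl ito_mart[OF J(1)[OF tt] J(1)[OF u] _ order_refl u Z d])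
 qed
 show "be Z (N t) = 0" if Z: "bdm (F1 s) Z"
 proof -
 have Zs: "sqi M Z" using F1.bdm_F[OF order_refl Z] by(rule F1.sqi_bdm)
 show ?thesis unfolding sum[OF Zs tt] by(intro sum.neutral ballI ito_mean[OF J(1)[OF tt] _ tt Z d])
 qed
qed

text \<open>Integration by parts without paths or discretisation. With \<open>A\<close> and
  \<open>C\<close> the accumulated drifts, X = x+N+A/2 and Y = y+N'+C/2. The martingale property
  moves \<open>N\<close> and \<open>N'\<close> back to the time of the drift with which they are
  paired, Fubini on a triangle handles drift against drift, and the remaining integrals of
  \<open>be (A v) (c v)\<close> cancel.\<close>

lemma product_formula:
 assumes fI: "finite I" and st: "s <= t" and X: "F1.semimart t X x a b" and Y: "F2.semimart t Y y c d"
 shows "be (X t) (Y t) = x * y+(LINT v|(time s t). (1 / 2 * be (a v) (Y v)+1 / 2 * be (X v) (c v)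
 + r * (SUM i:I. be (b i v) (d i v))))"
proof -
 define R where "R u = time s u" for u
 have fR: "finite_measure (R u)" for u unfolding R_def by(rule fin_time)
 interpret Rt: finite_measure "R t" by(rule fR)
 interpret RR: pair_sigma_finite "R t" "R t" ..
 interpret RRf: finite_measure "R t >< R t" by(rule fin_pair) (unfold_locales)
 have spR: "space (R u) = {s..u}" for u by(simp add: R_def sp_restr)
 interpret id1: ito_pairing M F1 F1 s I B t "%X. X" 1 by(rule F1.id_pairing)
 note tt = st order_refl
 have Xb: "bdm (R t >< M) (%(v, w). X v w)" and ab: "bdm (R t >< M) (%(v, w). a v w)"
 and bb: "!!i. i : I ==> bdm (R t >< M) (%(v, w). b i v w)" and aF: "!!u. s <= u ==> u <= t ==> bdm (F1 u) (a u)"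
 using X unfolding F1.semimart_def R_def by blast+
 have Yb: "bdm (R t >< M) (%(v, w). Y v w)" and cb: "bdm (R t >< M) (%(v, w). c v w)"
 and db: "!!i. i : I ==> bdm (R t >< M) (%(v, w). d i v w)" and cF: "!!u. s <= u ==> u <= t ==> bdm (F2 u) (c u)"
 using Y unfolding F2.semimart_def R_def by blast+
 define A where "A u w = (LINT v|(R u). a v w)" for u w
 define C where "C u w = (LINT v|(R u). c v w)" for u w
 define N where "N u w = X u w-x-1/2*A u w" for u w
 define N' where "N' u w = Y u w-y-1/2*C u w" for u w
 note ND = N_def[unfolded A_def R_def] and ND' = N'_def[unfolded C_def R_def]
 note restrict = bdm_restrict_time[of s t, folded R_def]
 have Ab: "bdm M (A u)" and Cb: "bdm M (C u)" if "u <= t" for u unfolding A_def[abs_def] C_def[abs_def]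
 by(rule bdm_pair_integral(2)[OF fR F1.finite_measure_axioms restrict[OF ab that]])
 (rule bdm_pair_integral(2)[OF fR F1.finite_measure_axioms restrict[OF cb that]])
 have vb: "bdm M (X v)" "bdm M (Y v)" "bdm M (a v)" "bdm M (c v)" if "s <= v" "v <= t" for v
 using bdm_section[OF Xb] bdm_section[OF Yb] bdm_section[OF ab] bdm_section[OF cb] that by(auto simp: spR)
 have Nb: "bdm M (N u)" "bdm M (N' u)" if "s <= u" "u <= t" for u
 unfolding N_def[abs_def] N'_def[abs_def] by(intro bdm_diff vb that bdm_cmult bdm_const Ab Cb)+
 note sq = F1.sqi_bdm
 have Ns: "ALL u:{s..t}. sqi M (N u)" "ALL u:{s..t}. sqi M (N' u)" using sq[OF Nb(1)] sq[OF Nb(2)] by auto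
 have one: "bdm F (%_. 1)" for F :: "'w measure" by simp
 note martY = mart_right(1)[OF fI Y Ns(2) ND'] and meanY = mart_right(2)[OF fI Y Ns(2) ND' tt one]
 have TX: "be (N u) V = (LINT w|M. Z w * N u w)"
 if "s <= v" "s <= u" "u <= t" and Z: "bdm (F1 v) Z" "AE w in M. T V w = Z w" and V: "sqi M V" for u v V Z
 unfolding be_def
 proof(rule int_cong_AE)
 show "AE w in M. N u w * T V w = Z w * N u w" using Z(2) by eventually_elim simp
 qed (use bdm_m[OF Nb(1)[OF that(2,3)]] sqi_m[OF T_sqi[OF V]] bdm_m[OF F1.bdm_F[OF that(1) Z(1)]] in measurable)
 \<comment> \<open>The martingale property of the first factor is used through \<open>T\<close>:
   \<open>T V\<close> has a version adapted to the first filtration, so the identity pairing applies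
   to it.\<close>
 have martX: "be (N t) V = be (N u) V" if u: "s <= u" "u <= t" and V: "bdm (F2 u) V" for u V
 proof -
 obtain Z where Z: "bdm (F1 u) Z" "AE w in M. T V w = Z w" using T_adapt[OF u V] by blast
 note VM = sq[OF F2.bdm_F[OF u(1) V]]
 show ?thesis unfolding TX[OF u(1) tt Z VM] TX[OF u(1) u Z VM]
 using id1.mart_right(1)[OF fI X Ns(1) ND u Z(1)] by(simp add: id1.be_def)
 qed
 have NN: "be (N t) (N' t) = r*(SUM i:I. (LINT v|(R t). be (b i v) (d i v)))"
 proof -
 obtain J where J: "!!u i. s <= u ==> u <= t ==> i : I ==> ito_int M F1 (B i) s u (b i) (J u i)"
 "!!u i. s <= u ==> u <= t ==> i : I ==> sqi M (J u i)" "!!u. s <= u ==> u <= t ==> AE w in M. N u w = (SUM i:I. J u i w)"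
 by(rule F1.semimart_decomposition[OF X, folded ND], rule that)
 obtain J' where J': "!!u i. s <= u ==> u <= t ==> i : I ==> ito_int M F2 (B i) s u (d i) (J' u i)"
 "!!u i. s <= u ==> u <= t ==> i : I ==> sqi M (J' u i)" "!!u. s <= u ==> u <= t ==> AE w in M. N' u w = (SUM i:I. J' u i w)"
 by(rule F2.semimart_decomposition[OF Y, folded ND'], rule that)
 have "be (N t) (N' t) = be (%w. SUM i:I. J t i w) (N' t)" by(intro be_cong_left sq Nb tt sqi_sum J)
 also have "... = be (%w. SUM i:I. J t i w) (%w. SUM i:I. J' t i w)" by(intro be_cong_right sq Nb tt sqi_sum J J')
 also have "... = (SUM i:I. SUM j:I. be (J t i) (J' t j))"
 by(subst be_sum_left) (auto intro!: sum.cong be_sum_right fI J(2) J'(2) st sqi_sum)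
 also have "... = (SUM i:I. SUM j:I. if i = j then r*(LINT v|(R t). be (b i v) (d j v)) else 0)"
 unfolding R_def be_def
 by(intro sum.cong refl ito_pair[OF J(1)[OF tt] J'(1)[OF tt] _ _ order_refl bb[unfolded R_def] db[unfolded R_def]])
 also have "... = r*(SUM i:I. (LINT v|(R t). be (b i v) (d i v)))" using fI by(simp add: sum.delta sdl)
 finally show ?thesis .
 qed
 \<comment> \<open>Drift at time v against drift at time u, on the triangle v <= u.\<close>
 define q where "q v u = (if v <= u then be (a v) (c u) else 0)" for v u
 have qb: "bdm (R t >< R t) (%(v, u). q v u)"
 proof -
 have lift: "bdm ((R t >< R t) >< M) (%(z, w). f (p z) w)"
 if f: "bdm (R t >< M) (%(v, w). f v w)" and [measurable]: "p : R t >< R t ~> R t" for f and p :: "real*real => real"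
 proof -
 have m: "(%(z, w). (p z, w)) : (R t >< R t) >< M ~> R t >< M" by measurable
 obtain k where k: "!!x. x : space (R t >< M) ==> \<bar>case x of (v, w) => f v w\<bar> <= k" using bdm_bound[OF f] by blast
 show ?thesis using m_comp[OF m bdm_m[OF f]] k[OF m_space[OF m]]
 by(intro bdmI[where c = k]) (auto simp: split_beta')
 qed
 have [measurable]: "(%x. x) : bm (R t)" unfolding R_def by(intro m_restr1) simp
 have "bdm (R t >< R t) (%x. if fst x <= snd x then 1 else 0)" by(rule bdmI[where c = 1]) auto
 from bdm_mult[OF this pairing_bdm[OF lift[OF ab measurable_fst] lift[OF cb measurable_snd]]]
 have "bdm (R t >< R t) (%x. (if fst x <= snd x then 1 else 0)*be (a (fst x)) (c (snd x)))" by(simp add: be_def)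
 thus ?thesis by(rule back_subst[of "bdm _"]) (auto simp: q_def fun_eq_iff)
 qed
 note qi = RRf.bdm_i[OF qb]
 have restr: "(LINT v|(R u). f v) = (LINT v|(R t). (if v <= u then f v else 0))" if "u <= t" for u and f :: "real => real"
 proof -
 have "(LINT v|(R u). f v) = (LINT v|lborel. ind {s..u} v .* f v)" unfolding R_def by(rule int_restr) simp
 also have "... = (LINT v|lborel. ind {s..t} v .* (if v <= u then f v else 0))"
 using that by(intro Bint_cong) (auto simp: ind_def)
 also have "... = (LINT v|(R t). (if v <= u then f v else 0))" unfolding R_def by(rule int_restr[symmetric]) simp
 finally show ?thesis .
 qed
 have Ac: "be (A u) (c u) = (LINT v|(R t). q v u)" if u: "s <= u" "u <= t" for u
 using be_time_l[OF fR vb(4)[OF u] restrict[OF ab u(2)]] restr[OF u(2), of "%v. be (a v) (c u)"]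
 by(simp add: A_def[abs_def] q_def)
 have bint: "igb (R t) (%v. be (f v) (g v))"
 if "bdm (R t >< M) (%(v, w). f v w)" "bdm (R t >< M) (%(v, w). g v w)" for f g
 unfolding be_def by(rule Rt.bdm_i[OF pairing_bdm[OF that]])
 have cst: "bdm (R t >< M) (%(v, w). f w)" if "bdm M f" for f
 using m_comp[OF measurable_snd bdm_m[OF that], of "R t"] that by(fastforce simp: bdm_def split_beta' sp_pair)
 have aC: "be (a v) (C t)-be (a v) (C v) = (LINT u|(R t). q v u)" if v: "s <= v" "v <= t" for v
 proof -
 let ?f = "%u. be (a v) (c u)"
 have fm: "?f : bm (R t)" using bm_int[OF bint[OF cst[OF vb(3)[OF v]] cb]] .
 have fi: "igb (R t) ?f" using bint[OF cst[OF vb(3)[OF v]] cb] .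
 have [measurable]: "(%x. x) : bm (R t)" unfolding R_def by(intro m_restr1) simp
 have gi: "igb (R t) (%u. if u <= v then ?f u else 0)" by(rule Bintble_bound[OF fi]) (use fm in auto)
 have "be (a v) (C t)-be (a v) (C v) = (LINT u|(R t). ?f u-(if u <= v then ?f u else 0))"
 using be_time_r[OF fR vb(3)[OF v] cb] be_time_r[OF fR vb(3)[OF v] restrict[OF cb v(2)]]
 restr[OF v(2), of ?f] fi gi by(simp add: C_def[abs_def])
 also have "... = (LINT u|(R t). q v u)"
 proof(rule int_cong_AE)
 \<comment> \<open>The two integrands differ at most at \<open>u = v\<close>, since \<open>q\<close>
   includes the diagonal.\<close>
 have "AE u in R t. u ~= v"
 unfolding R_def using AE_lborel_singleton[of v] by(subst AE_restrict_space_iff) auto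
 thus "AE u in R t. ?f u-(if u <= v then ?f u else 0) = q v u" by eventually_elim (auto simp: q_def)
 show "(%u. q v u) : bm (R t)" using bdm_m[OF bdm_section[OF qb]] v by(simp add: spR)
 qed (use fm in measurable)
 finally show ?thesis .
 qed
 have Aci: "igb (R t) (%u. be (A u) (c u))"
 by(rule Bintble_cong[THEN iffD1, OF refl _ RR.integrable_snd[OF qi]]) (auto simp: Ac spR)
 have di: "igb (R t) (%v. be (a v) (C t)-be (a v) (C v))"
 by(rule Bintble_cong[THEN iffD1, OF refl _ RR.integrable_fst[OF qi]]) (auto simp: aC spR)
 have "(LINT v|(R t). be (a v) (C t)-be (a v) (C v)) = (LINT v|(R t). (LINT u|(R t). q v u))"
 by(intro Bint_cong) (auto simp: aC spR)
 also have "... = (LINT u|(R t). (LINT v|(R t). q v u))" by(rule RR.Fubini_integral[OF qi, symmetric])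
 also have "... = (LINT v|(R t). be (A v) (c v))" by(intro Bint_cong) (auto simp: Ac spR)
 finally have tri: "(LINT v|(R t). be (a v) (C t)-be (a v) (C v)) = (LINT v|(R t). be (A v) (c v))" .
 have decY: "be Z (Y u) = be Z (N' u)+y*(LINT w|M. Z w)+1/2*be Z (C u)" if u: "s <= u" "u <= t" and Z: "bdm M Z" for Z u
 proof -
 have "be Z (Y u) = be Z (%w. (N' u w+y)+1/2*C u w)" by(simp add: N'_def)
 also have "... = be Z (%w. N' u w+y)+be Z (%w. 1/2*C u w)"
 by(rule be_add_right) (intro sq Z bdm_add Nb u bdm_const bdm_cmult Cb)+
 also have "be Z (%w. N' u w+y) = be Z (N' u)+be Z (%_. y)" by(rule be_add_right) (intro sq Z Nb u bdm_const)+
 finally show ?thesis by(simp only: be_const_right[OF sq[OF Z]] be_cmult_right[OF sq[OF Z] sq[OF Cb[OF u(2)]]])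
 qed
 have decX: "be (X u) V = be (N u) V+x*be (%_. 1) V+1/2*be (A u) V" if u: "s <= u" "u <= t" and V: "bdm M V" for V u
 proof -
 have "be (X u) V = be (%w. (N u w+x*1)+1/2*A u w) V" by(simp add: N_def)
 also have "... = be (%w. N u w+x*1) V+be (%w. 1/2*A u w) V"
 by(rule be_add_left) (intro sq V bdm_add Nb u bdm_const bdm_cmult Ab)+
 also have "be (%w. N u w+x*1) V = be (N u) V+be (%_. x*1) V" by(rule be_add_left) (intro sq V Nb u bdm_const)+
 finally show ?thesis by(simp only: be_cmult_left)
 qed
 have bi: "igb (R t) (%v. be (a v) (Y v))" "igb (R t) (%v. be (X v) (c v))"
 "igb (R t) (%v. be (%_. 1) (c v))" "!!i. i : I ==> igb (R t) (%v. be (b i v) (d i v))"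
 by(intro bint ab Yb Xb cb cst bdm_const bb db; assumption)+
 have e5: "be (N t) (C t) = (LINT v|(R t). be (X v) (c v))-x*(LINT v|(R t). be (%_. 1) (c v))-1/2*(LINT v|(R t). be (A v) (c v))"
 proof -
 have "be (N t) (C t) = (LINT v|(R t). be (N t) (c v))"
 unfolding C_def[abs_def] by(rule be_time_r[OF fR Nb(1)[OF tt] cb])
 also have "... = (LINT v|(R t). be (X v) (c v)-x*be (%_. 1) (c v)-1/2*be (A v) (c v))"
 by(intro Bint_cong) (use martX cF decX vb(4) in "auto simp: spR")
 finally show ?thesis using bi Aci by simp
 qed
 have e6: "be (A t) (Y t) = (LINT v|(R t). be (a v) (Y v))+1/2*(LINT v|(R t). be (A v) (c v))"
 proof -
 have "be (A t) (Y t) = (LINT v|(R t). be (a v) (Y t))"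
 unfolding A_def[abs_def] by(rule be_time_l[OF fR vb(2)[OF tt] ab])
 also have "... = (LINT v|(R t). be (a v) (Y v)+1/2*(be (a v) (C t)-be (a v) (C v)))"
 proof(rule Bint_cong[OF refl])
 fix v assume "v : space (R t)"
 hence v: "s <= v" "v <= t" by(auto simp: spR)
 show "be (a v) (Y t) = be (a v) (Y v)+1/2*(be (a v) (C t)-be (a v) (C v))"
 using decY[OF tt vb(3)[OF v]] decY[OF v vb(3)[OF v]] martY[OF v aF[OF v]] by(simp add: right_diff_distrib)
 qed
 also have "... = (LINT v|(R t). be (a v) (Y v))+1/2*(LINT v|(R t). be (a v) (C t)-be (a v) (C v))"
 using Bint_add[OF bi(1) i_mult_r[OF di, of "1/2"]] by simp
 finally show ?thesis by(simp add: tri)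
 qed
 have e4: "be (%_. 1) (C t) = (LINT v|(R t). be (%_. 1) (c v))"
 unfolding C_def[abs_def] by(rule be_time_r[OF fR one cb])
 have "(LINT v|(R t). (1/2*be (a v) (Y v)+1/2*be (X v) (c v)+r*(SUM i:I. be (b i v) (d i v))))
 = 1/2*(LINT v|(R t). be (a v) (Y v))+1/2*(LINT v|(R t). be (X v) (c v))+r*(SUM i:I. (LINT v|(R t). be (b i v) (d i v)))"
 using bi by(simp add: Bint_sum)
 moreover have "(LINT w|M. N t w) = 0"
 using id1.mart_right(2)[OF fI X Ns(1) ND tt one] by(simp add: id1.be_def)
 ultimately show ?thesis
 unfolding R_def[symmetric] using decX[OF tt vb(2)[OF tt]] decY[OF tt Nb(1)[OF tt]] decY[OF tt one] meanY e4 e5 e6 NN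
 by(simp add: F1.prob_space algs)
qed

end

section \<open>Independent white noises in a filtration\<close>

lemma (in prob_space) normal_moments:
 assumes X: "distributed M lborel X (%x. ennreal (normal_density 0 sg x))" and sg: "sg > 0"
 shows "X : bm M" "igb M (%w. X w ^ k)"
 "(LINT w|M. X w) = 0" "(LINT w|M. (X w)^2) = sg^2" "(LINT w|M. (X w) ^ 4) = 3 * sg ^ 4"
proof -
 show Xm: "X : bm M" using distributed_measurable[OF X] by simp
 have pos: "!!x. 0 <= normal_density 0 sg x" by simp
 show "igb M (%w. X w ^ k)"
 using distributed_integrable[OF X, of "%x. x ^ k"] integrable_normal_moment[OF sg, of 0 k] by simp
 have m: "(LINT w|M. X w ^ k) = (LINT x|lborel. normal_density 0 sg x*x ^ k)" for k
 by(rule distributed_integral[OF X, symmetric]) auto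
 show "(LINT w|M. X w) = 0" using m[of 1] integral_normal_moment_odd[OF sg, of 0 0] by simp
 show "(LINT w|M. (X w)^2) = sg^2" using m[of 2] integral_normal_moment_even[OF sg, of 0 1] by simp
 have "fact 4 = (24::real)" by(simp add: fact_numeral)
 thus "(LINT w|M. (X w) ^ 4) = 3 * sg ^ 4" using m[of 4] integral_normal_moment_even[OF sg, of 0 2] sg
 by(simp add: fs p2es power4_eq_xxxx)
qed

text \<open>Each noise is a Brownian motion in the filtration and the noises are mutually
  independent. Joint independence of several increments from the past does not come with these
  axioms; \<open>cross_cov\<close> and \<open>levy_increment\<close> recover it.\<close>

locale noise_filtration = prob_space M for M :: "'w measure" +
 fixes F :: "real => 'w measure" and s :: real and N :: nat and W :: "nat => real => real => 'w => real"
 assumes noises: "independent_white_noises N M W"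
 and bm: "!!i. i : {1..N} ==> brownian_motion_in M F s (W i s)" and sub: "!!u. s <= u ==> subalgebra M (F u)"
 and mono: "!!u v. s <= u ==> u <= v ==> sets (F u) <= sets (F v)"
begin

lemma noise: "i : {1..N} ==> white_noise M (W i)" using noises by(simp add: independent_white_noises_def)

lemma W_meas: "i : {1..N} ==> u <= v ==> W i u v : bm M" using noise[of i] unfolding white_noise_def by blast

lemma W_add: "i : {1..N} ==> u <= v ==> v <= ww ==> AE w in M. W i u ww w = W i u v w+W i v ww w"
 using noise[of i] unfolding white_noise_def by blast

lemma W_zero: "i : {1..N} ==> AE w in M. W i u u w = 0" using noise[of i] unfolding white_noise_def by blast

lemma W_normal: "i : {1..N} ==> u < v ==> distributed M lborel (W i u v) (%x. ennreal (normal_density 0 (sqrt (v-u)) x))"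
 using noise[of i] unfolding white_noise_def by blast

lemma incr_normal: "i : {1..N} ==> s <= u ==> u < v ==>
 distributed M lborel (%w. W i s v w-W i s u w) (%x. ennreal (normal_density 0 (sqrt (v-u)) x))"
 using bm[of i] unfolding bmi_def by blast

lemma W_sqi:
 assumes "i : {1..N}" "u <= v" shows "sqi M (W i u v)"
proof(cases "u = v")
 case True
 show ?thesis unfolding True
 by(rule sqi_cong_AE[OF sqi_zero[of M] _ W_meas[OF assms(1) order_refl]]) (use W_zero[OF assms(1)] in auto)
next
 case False
 hence "u < v" using assms by simp
 thus ?thesis using normal_moments(1)[OF W_normal[OF assms(1)]] normal_moments(2)[OF W_normal[OF assms(1)], of u v 2]
 by(auto simp: sqi_def)
qed

lemma incr_indep:
 assumes i: "i : {1..N}" and u: "s <= u" "u < v" and Z: "Z : bm (F u)"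
 shows "indep_var borel Z borel (%w. W i s v w-W i s u w)"
proof -
 have ind: "indep_set (sets (F u)) (sets (vimage_algebra (space M) (%w. W i s v w-W i s u w) borel))"
 using bm[OF i] u unfolding bmi_def by blast
 have sp: "space (F u) = space M" using sub[OF u(1)] by(simp add: suba_def)
 have sub1: "sigma_sets (space M) {Z -` A Int space M |A. A : sets borel} <= sets (F u)"
 unfolding sp[symmetric] using Z by(intro sets.sigma_sets_subset) (auto intro: m_sets)
 have m: "Z : bm M" by(rule m_subalg[OF sub[OF u(1)] Z])
 have m2: "(%w. W i s v w-W i s u w) : bm M" using W_meas[OF i, of s v] W_meas[OF i, of s u] u by simp
 show ?thesis unfolding indep_var_eq
 proof(intro conjI m m2)
 show "indep_set (sigma_sets (space M) {Z -` A Int space M |A. A : sets borel})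
 (sigma_sets (space M) {(%w. W i s v w-W i s u w) -` A Int space M |A. A : sets borel})"
 using ind sub1 unfolding indep_sets2_eq sets_vimage_algebra by blast
 qed
qed

lemma incr_indep_integral:
 assumes i: "i : {1..N}" and u: "s <= u" "u < v" and Z: "bdm (F u) Z"
 and g: "g : bm borel" and gi: "igb M (%w. g (W i s v w-W i s u w))"
 shows "(LINT w|M. Z w * g (W i s v w-W i s u w)) = (LINT w|M. Z w)*(LINT w|M. g (W i s v w-W i s u w))"
proof -
 have "indep_var borel ((%x. x) \<circ> Z) borel (g \<circ> (%w. W i s v w-W i s u w))"
 by(rule indep_var_compose[OF incr_indep[OF i u bdm_m[OF Z]]]) (use g in auto)
 moreover have "igb M Z" by(rule bdm_i[OF bdm_subalg[OF sub[OF u(1)] Z]])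
 ultimately show ?thesis using indep_var_lebesgue_integral[of Z "%w. g (W i s v w-W i s u w)"] gi
 by(simp add: comp_def)
qed

sublocale bm_martingales M F s "{1..N}" "%i. W i s"
proof
 fix i u v Z assume i: "i : {1..N}" and u: "s <= u" "u <= v" and Z: "bdm (F u) Z"
 show "(LINT w|M. Z w * (W i s v w-W i s u w)) = 0"
 proof(cases "u = v")
 case False
 hence uv: "u < v" using u by simp
 note mo = normal_moments[OF incr_normal[OF i u(1) uv]]
 show ?thesis using incr_indep_integral[OF i u(1) uv Z, of "%x. x"] mo(2)[of 1] mo(3) uv by simp
 qed simp
next
 show "W i s u : bm (F u)" if "i : {1..N}" "s <= u" for i u
 using bm[OF that(1)] that(2) unfolding bmi_def by blast
qed (use sub mono W_sqi in auto)

lemma W_incr_AE: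
 assumes "i : {1..N}" "s <= u" "u <= v" shows "AE w in M. W i s v w-W i s u w = W i u v w"
 using W_add[OF assms(1,2,3)] by eventually_elim simp

lemma incr_var:
 assumes "i : {1..N}" "s <= u" "u <= v" shows "(LINT w|M. (W i s v w-W i s u w)^2) = v-u"
proof(cases "u = v")
 case False
 hence uv: "u < v" using assms by simp
 show ?thesis using normal_moments(4)[OF incr_normal[OF assms(1,2) uv]] uv by simp
qed simp

text \<open>Independence of the two noises says nothing about their increments given
  \<open>F u\<close>. Cut \<open>[u, v]\<close> into n steps. Products over different steps have
  mean zero by the martingale property. The sum \<open>Q\<close> of products over equal steps
  approximates the bracket, and by independence of the noises its second moment is (v-u)^2/n, so
  Cauchy-Schwarz gives zero in the limit.\<close>

lemma cross_cov:
 assumes ij: "i : {1..N}" "j : {1..N}" "i ~= j" and u: "s <= u" "u <= v" and Z: "bdm (F u) Z"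
 shows "(LINT w|M. Z w * ((W i s v w-W i s u w)*(W j s v w-W j s u w))) = 0"
proof -
 define E where "E = (LINT w|M. Z w * ((W i s v w-W i s u w)*(W j s v w-W j s u w)))"
 define z where "z = (LINT w|M. (Z w)^2)"
 have ZM: "bdm M Z" by(rule bdm_F[OF u(1) Z])
 have bound: "E^2 <= z*((v-u)^2/real n)" if n: "n > 0" for n
 proof -
 define h where "h = (v-u)/real n"
 define ta where "ta k = u+real k*h" for k
 have h: "h >= 0" "real n*h = v-u" using u n by(auto simp: h_def)
 have ta: "s <= ta k" "u <= ta k" "ta k <= ta (Suc k)" "ta (Suc k)-ta k = h" for k
 using h u by(auto simp: ta_def algs intro: otrans add_increasing2)
 have tam: "ta k <= ta l" if "k <= l" for k l using that h by(simp add: ta_def mrm)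
 have tae: "ta 0 = u" "ta n = v" using h by(auto simp: ta_def)
 define de where "de i k w = W i s (ta (Suc k)) w-W i s (ta k) w" for i k w
 have des: "sqi M (de i k)" if "i : {1..N}" for i k unfolding de_def using that ta by(intro B_incr_sqi) auto
 have deF: "de i k : bm (F (ta l))" if "i : {1..N}" "k < l" for i k l
 unfolding de_def using that ta tam[of "Suc k" l] tam[of k l] by(intro borel_measurable_diff B_meas_F) auto
 have sumd: "W i s v w-W i s u w = (SUM k<n. de i k w)" for i w
 using sum_lessThan_telescope[of "%k. W i s (ta k) w" n] by(simp add: de_def tae)
 have ZF: "bdm (F (ta l)) Z" for l by(rule bdm_F_mono[OF u(1) ta(2) Z])
 have zero1: "(LINT w|M. (Z w * de i' k w)*de j' l w) = 0" if "i' : {1..N}" "j' : {1..N}" "k < l" for i' j' k l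
 proof -
 note [measurable] = bdm_m[OF ZF[of l]] deF[OF that(1,3)]
 show ?thesis unfolding de_def[of j' l]
 by(rule B_mart_sqi[OF that(2) ta(1) ta(3) sqi_bdm_mult[OF ZM des[OF that(1)]]]) measurable
 qed
 have zero2: "(LINT w|M. de i' k w * de i' l w) = 0" if "i' : {1..N}" "k < l" for i' k l
 unfolding de_def[of i' l] by(rule B_mart_sqi[OF that(1) ta(1) ta(3) des[OF that(1)] deF[OF that]])
 have cov: "(LINT w|M. de i' k w * de i' l w) = (if k = l then h else 0)" if i': "i' : {1..N}" for i' k l
 proof -
 have "(LINT w|M. de i' k w * de i' k w) = h"
 using incr_var[OF i' ta(1) ta(3), of k] ta(4)[of k] by(simp add: de_def p2es)
 moreover have "(LINT w|M. de i' k w * de i' l w) = 0" if "k ~= l"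
 using zero2[OF i', of k l] zero2[OF i', of l k] that by(cases "k < l") (auto simp: mcomm)
 ultimately show ?thesis by auto
 qed
 define Q where "Q w = (SUM k<n. de i k w * de j k w)" for w
 \<comment> \<open>Grouping the four increments by noise instead of by step gives independent
   factors.\<close>
 have prod4: "(LINT w|M. (de i k w * de i l w)*(de j k w * de j l w)) = (if k = l then h*h else 0)"
 "igb M (%w. (de i k w * de i l w)*(de j k w * de j l w))" for k l
 proof -
 let ?J = "{(u::real, v). u <= v}"
 define g where "g ww = (ww (s, ta (Suc k))-ww (s, ta k))*(ww (s, ta (Suc l))-ww (s, ta l))" for ww :: "real*real => real"
 have gm: "g : bm (\<Pi>\<^sub>M uv\<in>?J. borel)" unfolding g_def using ta(1)
 by(intro bm_times borel_measurable_diff measurable_component_singleton) auto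
 have "indep_vars (%_. \<Pi>\<^sub>M uv\<in>?J. borel) (%i w. restrict (%(u, v). W i u v w) ?J) {1..N}"
 using noises by(simp add: independent_white_noises_def)
 hence "indep_vars (%_. borel) (%i w. g (restrict (%(u, v). W i u v w) ?J)) {1..N}"
 by(rule indep_vars_compose2) (rule gm)
 also have "(%i w. g (restrict (%(u, v). W i u v w) ?J)) = (%i w. de i k w * de i l w)"
 using ta(1) by(simp add: g_def de_def fun_eq_iff)
 finally have iv: "indep_vars (%_. borel) (%i w. de i k w * de i l w) {i, j}"
 by(rule indep_vars_subset) (use ij in auto)
 have int: "igb M (%w. de i' k w * de i' l w)" if "i' : {i, j}" for i' using that ij by(intro sqi_mi des) auto
 show "(LINT w|M. (de i k w * de i l w)*(de j k w * de j l w)) = (if k = l then h*h else 0)"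
 using indep_vars_lebesgue_integral[OF _ iv int] ij cov[OF ij(1), of k l] cov[OF ij(2), of k l] by(simp split: if_splits)
 show "igb M (%w. (de i k w * de i l w)*(de j k w * de j l w))"
 using indep_vars_integrable[OF _ iv int] ij by simp
 qed
 have Qsq: "(Q w)^2 = (SUM k<n. SUM l<n. (de i k w * de i l w)*(de j k w * de j l w))" for w
 unfolding Q_def p2es sum_product by(intro sum.cong) (auto simp: mult_ac)
 have Qm: "Q : bm M" unfolding Q_def[abs_def] using sqi_m[OF des[OF ij(1)]] sqi_m[OF des[OF ij(2)]]
 by(intro bm_sum bm_times) auto
 have Qs: "sqi M Q" unfolding sqi_def Qsq using Qm prod4(2) by(auto intro!: Bintble_sum)
 have Qe: "(LINT w|M. (Q w)^2) = real n*(h*h)" unfolding Qsq by(subst integral_sum2) (auto simp: prod4)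
 have "E = (LINT w|M. (SUM k<n. SUM l<n. (Z w * de i k w)*de j l w))" unfolding E_def sumd
 by(subst sum_product) (simp only: sdl massoc)
 also have "... = (SUM k<n. SUM l<n. (LINT w|M. (Z w * de i k w)*de j l w))"
 by(rule integral_sum2) (intro sqi_mi sqi_bdm_mult ZM des ij)
 also have "... = (SUM k<n. SUM l<n. if k = l then (LINT w|M. (Z w * de i k w)*de j k w) else 0)"
 proof(intro sum.cong refl)
 fix k l
 show "(LINT w|M. (Z w * de i k w)*de j l w) = (if k = l then (LINT w|M. (Z w * de i k w)*de j k w) else 0)"
 proof(cases k l rule: linorder_cases)
 case less thus ?thesis using zero1[OF ij(1,2)] by simp
 next
 case greater
 have "(LINT w|M. (Z w * de i k w)*de j l w) = (LINT w|M. (Z w * de j l w)*de i k w)"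
 by(intro Bint_cong) (auto simp: mult_ac)
 thus ?thesis using zero1[OF ij(2,1) greater] greater by simp
 qed simp
 qed
 also have "... = (SUM k<n. (LINT w|M. (Z w * de i k w)*de j k w))" by(simp add: sum.delta)
 also have "... = (LINT w|M. (SUM k<n. (Z w * de i k w)*de j k w))"
 by(rule Bint_sum[symmetric]) (intro sqi_mi sqi_bdm_mult ZM des ij)
 also have "... = (LINT w|M. Z w * Q w)" by(simp add: Q_def sdl massoc)
 finally have "E^2 <= z*(real n*(h*h))" using cs_sqi[OF sqi_bdm[OF ZM] Qs] by(simp add: z_def Qe)
 also have "real n*(h*h) = (v-u)^2/real n" using n by(simp add: h_def p2es fs)
 finally show ?thesis .
 qed
 have "(%n. z*((v-u)^2/real n)) ----> z*0" by(intro t_mult t_const lim_const_over_n)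
 hence "E^2 <= z*0" by(rule LIMSEQ_le_const) (use bound in "auto intro!: exI[of _ 1]")
 thus ?thesis by(simp add: E_def)
qed

sublocale bmf M F s "{1..N}" "%i. W i s"
proof
 fix i j u v Z assume ij: "i : {1..N}" "j : {1..N}" and u: "s <= u" "u <= v" and Z: "bdm (F u) Z"
 show "(LINT w|M. Z w * ((W i s v w-W i s u w)*(W j s v w-W j s u w)))
 = (if i = j then (v-u)*(LINT w|M. Z w) else 0)"
 proof(cases "i = j & u < v")
 case True
 hence uv: "u < v" and "i = j" by auto
 note mo = normal_moments[OF incr_normal[OF ij(1) u(1) uv]]
 have "(LINT w|M. Z w * (W i s v w-W i s u w)^2) = (LINT w|M. Z w)*(v-u)"
 using incr_indep_integral[OF ij(1) u(1) uv Z, of "%x. x^2"] mo(2)[of 2] mo(4) uv by simp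
 thus ?thesis using `i = j` by(simp add: p2es mcomm)
 next
 case False
 thus ?thesis using cross_cov[OF ij _ u Z] u by(cases "i = j") auto
 qed
qed

end

section \<open>Characteristic functions of random families\<close>

lemma cis_measurable[measurable]: "cis : bm borel" by(intro bm_cont continuous_intros)

text \<open>Normalised weights are probability densities, to which Levy's uniqueness theorem
  applies. If the common mass \<open>m\<close> is zero, both sides vanish.\<close>

lemma weighted_char_unique_1:
 assumes M1: "finite_measure M1" and M2: "finite_measure M2"
 and X[measurable]: "X : bm M1" and Y[measurable]: "Y : bm M2"
 and w1: "bdm M1 w1" "!!w. w1 w >= 0" and w2: "bdm M2 w2" "!!w. w2 w >= 0"
 and eq: "!!th. (LINT w|M1. w1 w .* cis (th * X w)) = (LINT w|M2. w2 w .* cis (th * Y w))"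
 and A: "A : sets borel" shows "(LINT w|M1. w1 w * ind A (X w)) = (LINT w|M2. w2 w * ind A (Y w))"
proof -
 interpret M1: finite_measure M1 by fact
 interpret M2: finite_measure M2 by fact
 note [measurable] = bdm_m[OF w1(1)] bdm_m[OF w2(1)] A
 have i1: "igb M1 w1" and i2: "igb M2 w2" using M1.bdm_i[OF w1(1)] M2.bdm_i[OF w2(1)] .
 have m_eq: "(LINT w|M1. w1 w) = (LINT w|M2. w2 w)" using eq[of 0] by(auto simp: scaleR_conv_of_real)
 define m where "m = (LINT w|M1. w1 w)"
 have m0: "m >= 0" unfolding m_def using w1(2) by simp
 show ?thesis
 proof(cases "m = 0")
 case True
 have "AE w in M1. w1 w = 0" "AE w in M2. w2 w = 0"
 using True m_eq int_0_AE[OF i1] int_0_AE[OF i2] w1(2) w2(2) unfolding m_def by auto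
 hence "AE w in M1. w1 w * ind A (X w) = 0" "AE w in M2. w2 w * ind A (Y w) = 0" by(auto elim!: ev_mono)
 thus ?thesis by(simp add: integral_eq_zero_AE)
 next
 case False
 hence mp: "m > 0" using m0 by simp
 define D1 where "D1 = density M1 (%w. ennreal (w1 w /m))"
 define D2 where "D2 = density M2 (%w. ennreal (w2 w /m))"
 have p1: "prob_space D1" unfolding D1_def
 proof(rule prob_spaceI)
 have "emeasure (density M1 (%w. ennreal (w1 w /m))) (space M1) = (NN M1 (%w. ennreal (w1 w /m)))"
 by(subst emeasure_density) (auto intro!: nn_cong)
 also have "... = ennreal (LINT w|M1. w1 w /m)" using i1 w1(2) mp by(intro nn_eq) auto
 also have "(LINT w|M1. w1 w /m) = 1" using mp by(simp add: m_def)
 finally show "emeasure (density M1 (%w. ennreal (w1 w /m))) (space (density M1 (%w. ennreal (w1 w /m)))) = 1" by simp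
 qed
 have p2: "prob_space D2" unfolding D2_def
 proof(rule prob_spaceI)
 have "emeasure (density M2 (%w. ennreal (w2 w /m))) (space M2) = (NN M2 (%w. ennreal (w2 w /m)))"
 by(subst emeasure_density) (auto intro!: nn_cong)
 also have "... = ennreal (LINT w|M2. w2 w /m)" using i2 w2(2) mp by(intro nn_eq) auto
 also have "(LINT w|M2. w2 w /m) = 1" using mp m_eq by(simp add: m_def)
 finally show "emeasure (density M2 (%w. ennreal (w2 w /m))) (space (density M2 (%w. ennreal (w2 w /m)))) = 1" by simp
 qed
 have c1: "char (distr D1 borel X) th = (1 /m) .* (LINT w|M1. w1 w .* cis (th * X w))" for th
 unfolding char_def D1_def using w1(2) mp
 by(simp add: integral_distr integral_density cis_conv_exp flip: integral_scaleR_right)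
 have c2: "char (distr D2 borel Y) th = (1 /m) .* (LINT w|M2. w2 w .* cis (th * Y w))" for th
 unfolding char_def D2_def using w2(2) mp
 by(simp add: integral_distr integral_density cis_conv_exp flip: integral_scaleR_right)
 have "distr D1 borel X = distr D2 borel Y"
 proof(rule Levy_uniqueness)
 show "real_distribution (distr D1 borel X)" by(rule prob_space.real_distribution_distr[OF p1]) (simp add: D1_def)
 show "real_distribution (distr D2 borel Y)" by(rule prob_space.real_distribution_distr[OF p2]) (simp add: D2_def)
 show "char (distr D1 borel X) = char (distr D2 borel Y)" using c1 c2 eq by(simp add: fun_eq_iff)
 qed
 hence "(LINT x|(distr D1 borel X). ind A x) = (LINT x|(distr D2 borel Y). (ind A x :: real))" by simp
 moreover have "(LINT x|(distr D1 borel X). ind A x) = (1 /m)*(LINT w|M1. w1 w * ind A (X w))"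
 proof -
 have "(LINT x|(distr D1 borel X). ind A x) = (LINT w|D1. (ind A (X w) :: real))"
 by(rule integral_distr) (auto simp: D1_def)
 also have "... = (LINT w|M1. (w1 w /m) .* ind A (X w))" unfolding D1_def
 by(rule integral_density) (use w1(2) mp in auto)
 finally show ?thesis by simp
 qed
 moreover have "(LINT x|(distr D2 borel Y). ind A x) = (1 /m)*(LINT w|M2. w2 w * ind A (Y w))"
 proof -
 have "(LINT x|(distr D2 borel Y). ind A x) = (LINT w|D2. (ind A (Y w) :: real))"
 by(rule integral_distr) (auto simp: D2_def)
 also have "... = (LINT w|M2. (w2 w /m) .* ind A (Y w))" unfolding D2_def
 by(rule integral_density) (use w2(2) mp in auto)
 finally show ?thesis by simp
 qed
 ultimately show ?thesis using mp by simp
 qed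
qed

lemma bdm_prod_indicator:
 assumes "!!j. j : J ==> X j : bm M" "!!j. j : J ==> A j : sets borel"
 shows "bdm M (%w. PROD j:J. ind (A j) (X j w))"
proof(rule bdmI[where c = 1])
 show "(%w. PROD j:J. ind (A j) (X j w) :: real) : bm M"
 proof(rule borel_measurable_prod)
 fix j assume "j : J"
 note [measurable] = assms[OF this]
 show "(%w. ind (A j) (X j w) :: real) : bm M" by measurable
 qed
 show "|PROD j:J. ind (A j) (X j w)| <= (1::real)" for w
 unfolding abs_prod by(intro prod_le_1) (auto simp: ind_def)
qed

lemma (in finite_measure) integrable_bdm_cis:
 assumes "bdm M ww" "f : bm M" shows "igb M (%w. ww w .* cis (f w))"
proof -
 note [measurable] = bdm_m[OF assms(1)] assms(2)
 obtain c where c: "!!w. w : space M ==> |ww w| <= c" using bdm_bound[OF assms(1)] by blast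
 show ?thesis by(rule integrable_const_bound[where B = c]) (use c in auto)
qed

lemma integral_lin3:
 fixes f g h :: "'a => complex"
 assumes "igb M f" "igb M g" "igb M h"
 shows "(LINT x|M. f x+(c*g x+d*h x)) = (LINT x|M. f x)+(c*(LINT x|M. g x)+d*(LINT x|M. h x))"
 using assms by simp

lemma integral_Re_Im:
 fixes f g :: "'a => real"
 assumes "igb M f" "igb M g"
 shows "(LINT x|M. cor (f x)+\<i> * cor (g x)) = cor (LINT x|M. f x)+\<i> * cor (LINT x|M. g x)"
 using assms by simp

text \<open>One coordinate at a time is turned from an exponential into an indicator. The
  one-dimensional lemma wants nonnegative weights, so the other coordinates enter through the factor
  \<open>1+cos (T1 w+ph)\<close>; the phases 0 and -pi/2 then recover the real and the imaginary
  part of their exponential.\<close>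

lemma weighted_char_unique_finite:
 assumes M1: "finite_measure M1" and M2: "finite_measure M2" and J: "finite J"
 and X: "!!j. j : J ==> X j : bm M1" and Y: "!!j. j : J ==> Y j : bm M2"
 and w1: "bdm M1 w1" "!!w. w1 w >= 0" and w2: "bdm M2 w2" "!!w. w2 w >= 0"
 and eq: "!!th. (LINT w|M1. w1 w .* cis (SUM j:J. th j*X j w)) = (LINT w|M2. w2 w .* cis (SUM j:J. th j*Y j w))"
 and A: "!!j. j : J ==> A j : sets borel"
 shows "(LINT w|M1. w1 w * (PROD j:J. ind (A j) (X j w))) = (LINT w|M2. w2 w * (PROD j:J. ind (A j) (Y j w)))"
proof -
 interpret M1: finite_measure M1 by fact
 interpret M2: finite_measure M2 by fact
 define g1 where "g1 K w = w1 w * (PROD j:K. ind (A j) (X j w))" for K w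
 define g2 where "g2 K w = w2 w * (PROD j:K. ind (A j) (Y j w))" for K w
 have gb: "bdm M1 (g1 K)" "bdm M2 (g2 K)" if "K <= J" for K
 unfolding g1_def[abs_def] g2_def[abs_def] using that X Y A by(auto intro!: bdm_mult w1 w2 bdm_prod_indicator)
 have g0: "g1 K w >= 0" "g2 K w' >= 0" for K w w'
 unfolding g1_def g2_def using w1(2) w2(2) by(auto intro!: mult_nn prod_nonneg)
 have S: "ALL th. (LINT w|M1. g1 K w .* cis (SUM j:J-K. th j*X j w)) = (LINT w|M2. g2 K w .* cis (SUM j:J-K. th j*Y j w))"
 if "finite K" "K <= J" for K using that
 proof(induction K)
 case empty
 thus ?case using eq by(simp add: g1_def g2_def)
 next
 case (insert k K)
 hence kJ: "k : J" "k \<notin> K" "K <= J" by auto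
 have JK: "J-K = insert k (J-insert k K)" using kJ by blast
 define L where "L = J-insert k K"
 have L: "finite L" "k \<notin> L" "J-K = insert k L" using J unfolding JK L_def by simp_all
 have IH: "(LINT w|M1. g1 K w .* cis (th k*X k w+(SUM j:L. th j*X j w))) = (LINT w|M2. g2 K w .* cis (th k*Y k w+(SUM j:L. th j*Y j w)))" for th
 proof -
 have "(LINT w|M1. g1 K w .* cis (SUM j:J-K. th j*X j w)) = (LINT w|M2. g2 K w .* cis (SUM j:J-K. th j*Y j w))"
 using insert.IH[OF kJ(3)] by blast
 thus ?thesis unfolding L(3) sum.insert[OF L(1,2)] .
 qed
 show ?case
 proof
 fix th
 define T1 where "T1 w = (SUM j:L. th j*X j w)" for w
 define T2 where "T2 w = (SUM j:L. th j*Y j w)" for w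
 have [measurable]: "X k : bm M1" "Y k : bm M2" "A k : sets borel" using kJ X Y A by auto
 have Tm[measurable]: "T1 : bm M1" "T2 : bm M2"
 unfolding T1_def[abs_def] T2_def[abs_def] L_def using X Y by(auto intro!: bm_sum bm_times)
 have IHa: "(LINT w|M1. g1 K w .* cis (a*X k w+b*T1 w)) = (LINT w|M2. g2 K w .* cis (a*Y k w+b*T2 w))" for a b
 proof -
 have "(SUM j:L. (if j = k then a else b*th j)*Z j) = b*(SUM j:L. th j*Z j)" for Z
 unfolding sdl using L(2) by(intro sum.cong refl) auto
 thus ?thesis using IH[of "%j. if j = k then a else b*th j"] by(simp only: T1_def T2_def if_True refl)
 qed
 have bc: "bdm M1 (%w. g1 K w * (1+cos (T1 w+ph)))" "bdm M2 (%w. g2 K w * (1+cos (T2 w+ph)))" for ph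
 proof -
 have "bdm M1 (%w. 1+cos (T1 w+ph))" "bdm M2 (%w. 1+cos (T2 w+ph))"
 by(intro bdm_add bdm_const bdmI[where c = 1]; simp)+
 thus "bdm M1 (%w. g1 K w * (1+cos (T1 w+ph)))" "bdm M2 (%w. g2 K w * (1+cos (T2 w+ph)))"
 using gb[OF kJ(3)] by(auto intro: bdm_mult)
 qed
 have pos: "1+cos x >= 0" for x :: real using cos_ge_minus_one[of x] by linarith
 have expand: "(g*(1+cos (T+ph))) .* cis (a*x) = g .* cis (a*x+0*T)
 + ((cis ph /2)*(g .* cis (a*x+1*T))+(cis (-ph)/2)*(g .* cis (a*x+(-1)*T)))" for g T ph a x :: real
 by(simp add: complex_eq_iff cos_add sin_add cos_diff sin_diff fs)
 have w_eq: "(LINT w|M1. (g1 K w * (1+cos (T1 w+ph))) .* cis (a*X k w))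
 = (LINT w|M2. (g2 K w * (1+cos (T2 w+ph))) .* cis (a*Y k w))" for a ph
 proof -
 have i1: "igb M1 (%w. g1 K w .* cis (a*X k w+b*T1 w))" for b
 by(rule M1.integrable_bdm_cis[OF gb(1)[OF kJ(3)]]) measurable
 have i2: "igb M2 (%w. g2 K w .* cis (a*Y k w+b*T2 w))" for b
 by(rule M2.integrable_bdm_cis[OF gb(2)[OF kJ(3)]]) measurable
 have "(LINT w|M1. (g1 K w * (1+cos (T1 w+ph))) .* cis (a*X k w)) =
 (LINT w|M1. g1 K w .* cis (a*X k w+0*T1 w)) +
 ((cis ph /2)*(LINT w|M1. g1 K w .* cis (a*X k w+1*T1 w))
 + (cis (-ph)/2)*(LINT w|M1. g1 K w .* cis (a*X k w+(-1)*T1 w)))"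
 unfolding expand by(rule integral_lin3[OF i1 i1 i1])
 also have "... = (LINT w|M2. g2 K w .* cis (a*Y k w+0*T2 w)) +
 ((cis ph /2)*(LINT w|M2. g2 K w .* cis (a*Y k w+1*T2 w))
 + (cis (-ph)/2)*(LINT w|M2. g2 K w .* cis (a*Y k w+(-1)*T2 w)))" unfolding IHa ..
 also have "... = (LINT w|M2. (g2 K w * (1+cos (T2 w+ph))) .* cis (a*Y k w))"
 unfolding expand by(rule integral_lin3[OF i2 i2 i2, symmetric])
 finally show ?thesis .
 qed
 have ind_eq: "(LINT w|M1. (g1 K w * (1+cos (T1 w+ph)))*ind (A k) (X k w))
 = (LINT w|M2. (g2 K w * (1+cos (T2 w+ph)))*ind (A k) (Y k w))" for ph
 by(rule weighted_char_unique_1[OF M1 M2 _ _ bc(1) _ bc(2) _ w_eq]) (auto intro!: mult_nn g0 pos)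
 have ind_eq0: "(LINT w|M1. g1 K w * ind (A k) (X k w)) = (LINT w|M2. g2 K w * ind (A k) (Y k w))"
 by(rule weighted_char_unique_1[OF M1 M2 _ _ gb(1)[OF kJ(3)] g0(1) gb(2)[OF kJ(3)] g0(2)]) (use IHa[of _ 0] in auto)
 have ib: "bdm M1 (%w. g1 K w * ind (A k) (X k w))" "bdm M2 (%w. g2 K w * ind (A k) (Y k w))"
 by(intro bdm_mult gb kJ bdmI[where c = 1]; simp add: ind_def)+
 have cosb: "igb M1 (%w. g1 K w * ind (A k) (X k w)*cos (T1 w+ph))"
 "igb M2 (%w. g2 K w * ind (A k) (Y k w)*cos (T2 w+ph))" for ph
 by(intro M1.bdm_i M2.bdm_i bdm_mult ib bdmI[where c = 1]; simp)+
 have cos_eq: "(LINT w|M1. g1 K w * ind (A k) (X k w)*cos (T1 w+ph))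
 = (LINT w|M2. g2 K w * ind (A k) (Y k w)*cos (T2 w+ph))" for ph
 using ind_eq[of ph] ind_eq0 cosb[of ph] M1.bdm_i[OF ib(1)] M2.bdm_i[OF ib(2)] by(auto simp: algs)
 have ins: "g1 (insert k K) w = g1 K w * ind (A k) (X k w)" "g2 (insert k K) w' = g2 K w'*ind (A k) (Y k w')" for w w'
 using insert.hyps kJ by(simp_all add: g1_def g2_def mult_ac)
 have split: "(g .* cis T) = of_real (g*cos (T+0))+\<i> * of_real (g*cos (T+(-pi/2)))" for g T :: real
 by(simp add: complex_eq_iff cos_diff cos_add)
 show "(LINT w|M1. g1 (insert k K) w .* cis (SUM j:J-insert k K. th j*X j w)) =
 (LINT w|M2. g2 (insert k K) w .* cis (SUM j:J-insert k K. th j*Y j w))"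
 unfolding L_def[symmetric] T1_def[symmetric] T2_def[symmetric] ins split
 unfolding integral_Re_Im[OF cosb(1) cosb(1)] integral_Re_Im[OF cosb(2) cosb(2)] cos_eq ..
 qed
 qed
 have "(LINT w|M1. g1 J w .* cis 0) = (LINT w|M2. g2 J w .* cis 0)" using S[OF J order_refl] by simp
 hence "cor (LINT w|M1. g1 J w) = cor (LINT w|M2. g2 J w)" by(simp add: scaleR_conv_of_real)
 thus ?thesis by(simp add: g1_def g2_def)
qed

lemma distr_PiM_eqI_char:
 fixes X :: "'i => 'a => real" and Y :: "'i => 'b => real"
 assumes M1: "finite_measure M1" and M2: "finite_measure M2"
 and X: "!!j. j : J ==> X j : bm M1" and Y: "!!j. j : J ==> Y j : bm M2"
 and w1: "bdm M1 w1" "!!w. w1 w >= 0" and w2: "bdm M2 w2" "!!w. w2 w >= 0"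
 and eq: "!!K th. finite K ==> K <= J ==>
 (LINT w|M1. w1 w .* cis (SUM j:K. th j*X j w)) = (LINT w|M2. w2 w .* cis (SUM j:K. th j*Y j w))"
 shows "distr (density M1 w1) (\<Pi>\<^sub>M j\<in>J. borel) (%w. \<lambda>j\<in>J. X j w) = distr (density M2 w2) (\<Pi>\<^sub>M j\<in>J. borel) (%w. \<lambda>j\<in>J. Y j w)"
proof(rule measure_eqI_PiM_infinite)
 interpret M1: finite_measure M1 by fact
 interpret M2: finite_measure M2 by fact
 note [measurable] = bdm_m[OF w1(1)] bdm_m[OF w2(1)]
 have Xm: "(%w. \<lambda>j\<in>J. X j w) : M1 ~> (\<Pi>\<^sub>M j\<in>J. borel)" using X by(intro measurable_restrict) auto
 have Ym: "(%w. \<lambda>j\<in>J. Y j w) : M2 ~> (\<Pi>\<^sub>M j\<in>J. borel)" using Y by(intro measurable_restrict) auto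
 have i1: "igb M1 w1" and i2: "igb M2 w2" using M1.bdm_i[OF w1(1)] M2.bdm_i[OF w2(1)] .
 show "finite_measure (distr (density M1 w1) (\<Pi>\<^sub>M j\<in>J. borel) (%w. \<lambda>j\<in>J. X j w))"
 proof(rule finite_measure.finite_measure_distr)
 show "finite_measure (density M1 (%w. ennreal (w1 w)))"
 proof(rule finite_measureI)
 have "emeasure (density M1 (%w. ennreal (w1 w))) (space M1) = (NN M1 (%w. ennreal (w1 w)))"
 by(subst emeasure_density) (auto intro!: nn_cong)
 also have "... = ennreal (LINT w|M1. w1 w)" using i1 w1(2) by(intro nn_eq) auto
 finally show "emeasure (density M1 (%w. ennreal (w1 w))) (space (density M1 (%w. ennreal (w1 w)))) ~= \<infinity>" by simp
 qed
 show "(%w. \<lambda>j\<in>J. X j w) : density M1 (%w. ennreal (w1 w)) ~> (\<Pi>\<^sub>M j\<in>J. borel)" using Xm by simp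
 qed
 fix A :: "'i => real set" and K assume K: "finite K" "K <= J" and A: "!!i. i : K ==> A i : sets borel"
 let ?E = "prod_emb J (%_. borel) K (Pi\<^sub>E K A)"
 have E: "?E : sets (\<Pi>\<^sub>M j\<in>J. borel)" using K A by(intro sets_PiM_I) auto
 have indE: "ind ?E (\<lambda>j\<in>J. z j) = (PROD j:K. ind (A j) (z j) :: real)" for z :: "'i => real"
 using K K(1) by(auto simp: prod_emb_def PiE_iff restrict_def space_PiM subset_iff extensional_def ind_def)
 have e1: "emeasure (distr (density M1 w1) (\<Pi>\<^sub>M j\<in>J. borel) (%w. \<lambda>j\<in>J. X j w)) ?E
 = ennreal (LINT w|M1. w1 w * (PROD j:K. ind (A j) (X j w)))"
 proof -
 have b: "bdm M1 (%w. w1 w * (PROD j:K. ind (A j) (X j w)))"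
 using K X A by(intro bdm_mult w1 bdm_prod_indicator) auto
 have "emeasure (distr (density M1 w1) (\<Pi>\<^sub>M j\<in>J. borel) (%w. \<lambda>j\<in>J. X j w)) ?E
 = (NN M1 (%w. ennreal (w1 w)*ind ((%w. \<lambda>j\<in>J. X j w) -` ?E Int space M1) w))"
 using Xm E by(subst emeasure_distr) (auto simp: emeasure_density m_sets)
 also have "... = (NN M1 (%w. ennreal (w1 w * (PROD j:K. ind (A j) (X j w)))))"
 proof(rule nn_cong)
 fix w assume "w : space M1"
 hence "ind ((%w. \<lambda>j\<in>J. X j w) -` ?E Int space M1) w = ennreal (ind ?E (\<lambda>j\<in>J. X j w))"
 by(auto simp: ind_def)
 thus "ennreal (w1 w)*ind ((%w. \<lambda>j\<in>J. X j w) -` ?E Int space M1) w = ennreal (w1 w * (PROD j:K. ind (A j) (X j w)))"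
 using w1(2)[of w] by(simp only: indE ennreal_mult'[symmetric])
 qed
 also have "... = ennreal (LINT w|M1. w1 w * (PROD j:K. ind (A j) (X j w)))"
 by(rule nn_eq[OF M1.bdm_i[OF b]]) (auto intro!: AE_I2 mult_nn w1 prod_nonneg)
 finally show ?thesis .
 qed
 have e2: "emeasure (distr (density M2 w2) (\<Pi>\<^sub>M j\<in>J. borel) (%w. \<lambda>j\<in>J. Y j w)) ?E
 = ennreal (LINT w|M2. w2 w * (PROD j:K. ind (A j) (Y j w)))"
 proof -
 have b: "bdm M2 (%w. w2 w * (PROD j:K. ind (A j) (Y j w)))"
 using K Y A by(intro bdm_mult w2 bdm_prod_indicator) auto
 have "emeasure (distr (density M2 w2) (\<Pi>\<^sub>M j\<in>J. borel) (%w. \<lambda>j\<in>J. Y j w)) ?E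
 = (NN M2 (%w. ennreal (w2 w)*ind ((%w. \<lambda>j\<in>J. Y j w) -` ?E Int space M2) w))"
 using Ym E by(subst emeasure_distr) (auto simp: emeasure_density m_sets)
 also have "... = (NN M2 (%w. ennreal (w2 w * (PROD j:K. ind (A j) (Y j w)))))"
 proof(rule nn_cong)
 fix w assume "w : space M2"
 hence "ind ((%w. \<lambda>j\<in>J. Y j w) -` ?E Int space M2) w = ennreal (ind ?E (\<lambda>j\<in>J. Y j w))"
 by(auto simp: ind_def)
 thus "ennreal (w2 w)*ind ((%w. \<lambda>j\<in>J. Y j w) -` ?E Int space M2) w = ennreal (w2 w * (PROD j:K. ind (A j) (Y j w)))"
 using w2(2)[of w] by(simp only: indE ennreal_mult'[symmetric])
 qed
 also have "... = ennreal (LINT w|M2. w2 w * (PROD j:K. ind (A j) (Y j w)))"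
 by(rule nn_eq[OF M2.bdm_i[OF b]]) (auto intro!: AE_I2 mult_nn w2 prod_nonneg)
 finally show ?thesis .
 qed
 show "emeasure (distr (density M1 w1) (\<Pi>\<^sub>M j\<in>J. borel) (%w. \<lambda>j\<in>J. X j w)) ?E
 = emeasure (distr (density M2 w2) (\<Pi>\<^sub>M j\<in>J. borel) (%w. \<lambda>j\<in>J. Y j w)) ?E"
 unfolding e1 e2
 using weighted_char_unique_finite[OF M1 M2 K(1) _ _ w1 w2 eq[OF K] A] X Y K by(simp add: subset_iff)
qed auto

section \<open>Levy's characterization\<close>

definition cbdm :: "'a measure => ('a => complex) => bool" where
 "cbdm M Z <-> Z : bm M & (EX c. ALL w:space M. norm (Z w) <= c)"

lemma cbdm_Re_Im:
 assumes "cbdm M Z" shows "bdm M (%w. Re (Z w))" "bdm M (%w. Im (Z w))"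
proof -
 obtain c where c: "!!w. w : space M ==> norm (Z w) <= c" using assms by(auto simp: cbdm_def)
 have [measurable]: "Z : bm M" using assms by(simp add: cbdm_def)
 show "bdm M (%w. Re (Z w))" by(rule bdmI[where c = c]) (use c abs_Re_le_cmod otrans in "auto, blast")
 show "bdm M (%w. Im (Z w))" by(rule bdmI[where c = c]) (use c abs_Im_le_cmod otrans in "auto, blast")
qed

lemma cbdm_mult_cis:
 assumes "cbdm M Z" "f : bm M" shows "cbdm M (%w. Z w * cis (f w))"
 using assms unfolding cbdm_def by(auto simp: norm_mult)

lemma cbdm_of_real: "bdm M Z ==> cbdm M (%w. cor (Z w))" by(auto simp: cbdm_def bdm_def)

lemma cbdm_subalg:
 assumes "subalgebra M F" "cbdm F Z" shows "cbdm M Z"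
proof -
 have "Z : bm M" "space F = space M" using assms m_subalg[OF assms(1)] by(auto simp: cbdm_def suba_def)
 thus ?thesis using assms(2) by(simp add: cbdm_def)
qed

lemma (in finite_measure) cbdm_integrable:
 assumes "cbdm M Z" shows "igb M Z" using assms by(auto simp: cbdm_def intro: integrable_const_bound)

lemma int_cmr:
 assumes "igb M (%w. Re (Z w)*X w)" "igb M (%w. Im (Z w)*X w)" shows "igb M (%w. Z w * cor (X w))"
 "(LINT w|M. Z w * cor (X w)) = Complex (LINT w|M. Re (Z w)*X w) (LINT w|M. Im (Z w)*X w)"
proof -
 have e: "Z w * cor (X w) = cor (Re (Z w)*X w)+\<i> * cor (Im (Z w)*X w)" for w by(simp add: complex_eq_iff)
 show "igb M (%w. Z w * cor (X w))" unfolding e using assms by(simp del: of_real_mult)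
 show "(LINT w|M. Z w * cor (X w)) = Complex (LINT w|M. Re (Z w)*X w) (LINT w|M. Im (Z w)*X w)"
 unfolding e using assms by(simp add: complex_eq_iff del: of_real_mult)
qed

text \<open>Increments of order h^(3/2) over n equal steps add up to order n^(-1/2). This takes the
  place of solving a differential equation for \<open>f\<close>.\<close>

lemma superlinear_constant:
 fixes f :: "real => 'a::real_normed_vector"
 assumes ab: "a <= b" and K: "!!x h. a <= x ==> h >= 0 ==> x+h <= b ==> norm (f (x+h)-f x) <= K*(h * sqrt h)"
 shows "f b = f a"
proof -
 define L where "L = b-a"
 have L: "L >= 0" using ab by(simp add: L_def)
 have bound: "norm (f b-f a) <= K*L * sqrt (L/real n)" if n: "n > 0" for n
 proof -
 define h where "h = L/real n"
 have h: "h >= 0" "real n*h = L" using L n by(auto simp: h_def)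
 have le: "a+real k*h+h <= b" if "k < n" for k
 proof -
 have "real (Suc k)*h <= real n*h" using that h(1) by(intro mrm) auto
 thus ?thesis using h(2) by(simp add: L_def algs)
 qed
 have "f b-f a = (SUM k<n. f (a+real (Suc k)*h)-f (a+real k*h))"
 using sum_lessThan_telescope[of "%k. f (a+real k*h)" n] h(2) by(simp add: L_def)
 also have "norm ... <= (SUM k<n. norm (f (a+real (Suc k)*h)-f (a+real k*h)))" by(rule norm_sum)
 also have "... <= (SUM k<n. K*(h * sqrt h))"
 proof(rule sum_mono)
 fix k assume "k : {..<n}"
 thus "norm (f (a+real (Suc k)*h)-f (a+real k*h)) <= K*(h * sqrt h)"
 using K[of "a+real k*h" h] le[of k] h(1) by(simp add: algs)
 qed
 also have "... = K*(real n*h) * sqrt h" by simp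
 finally show ?thesis by(simp add: h(2)) (simp add: h_def)
 qed
 have "(%n. K*L * sqrt (L/real n)) ----> K*L * sqrt 0" by(intro tendsto_intros lim_const_over_n)
 hence "norm (f b-f a) <= K*L * sqrt 0"
 by(rule LIMSEQ_le_const) (use bound in \<open>auto intro!: exI[of _ 1]\<close>)
 thus ?thesis by simp
qed

section \<open>Conditional characteristic functions of noise increments\<close>

context noise_filtration
begin

definition linc :: "(nat => real) => real => real => 'w => real" where
 "linc th u v w = (SUM i:{1..N}. th i*(W i s v w-W i s u w))"

definition sqn :: "(nat => real) => real" where
 "sqn th = (SUM i:{1..N}. (th i)^2)"

lemma sqn_nonneg: "sqn th >= 0" by(simp add: sqn_def sum_nonneg)

lemma linc_sqi: "s <= u ==> s <= v ==> sqi M (linc th u v)"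
 unfolding linc_def[abs_def] by(intro sqi_sum sqi_cmult B_incr_sqi)

lemma linc_F: "s <= u ==> u <= v ==> linc th u v : bm (F v)" unfolding linc_def[abs_def]
 by(intro bm_sum bm_times bm_const borel_measurable_diff B_meas B_meas_F) auto

lemma linc_mean:
 assumes "s <= u" "u <= v" "bdm (F u) Z" shows "(LINT w|M. Z w * linc th u v w) = 0"
proof -
 have ZM: "bdm M Z" by(rule bdm_F[OF assms(1,3)])
 have "(LINT w|M. Z w * linc th u v w) = (LINT w|M. (SUM i:{1..N}. th i*(Z w * (W i s v w-W i s u w))))"
 unfolding linc_def sdl by(simp add: mult.left_commute)
 also have "... = (SUM i:{1..N}. th i*(LINT w|M. Z w * (W i s v w-W i s u w)))" using assms by(subst Bint_sum)
 (auto intro!: i_mult_r sqi_mi sqi_bdm[OF ZM] B_incr_sqi)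
 also have "... = 0" using B_mart[OF _ assms] by simp
 finally show ?thesis .
qed

lemma linc_sq:
 assumes "s <= u" "u <= v" "bdm (F u) Z" shows "igb M (%w. Z w * (linc th u v w)^2)"
 "(LINT w|M. Z w * (linc th u v w)^2) = sqn th * (v-u)*(LINT w|M. Z w)"
proof -
 have ZM: "bdm M Z" by(rule bdm_F[OF assms(1,3)])
 have uv: "s <= v" using assms by simp
 show "igb M (%w. Z w * (linc th u v w)^2)"
 using sqi_mi[OF sqi_bdm_mult[OF ZM linc_sqi[OF assms(1) uv]] linc_sqi[OF assms(1) uv], of th th]
 by(simp add: p2es massoc)
 define D where "D i w = W i s v w-W i s u w" for i w
 have "(LINT w|M. Z w * (linc th u v w)^2) = (LINT w|M. (SUM i:{1..N}. SUM j:{1..N}. th i*th j*(Z w * (D i w * D j w))))"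
 unfolding linc_def p2es D_def[symmetric] by(subst sum_product) (simp only: sdl mult_ac)
 also have "... = (SUM i:{1..N}. SUM j:{1..N}. (LINT w|M. th i*th j*(Z w * (D i w * D j w))))"
 proof(rule integral_sum2)
 fix i j assume ij: "i : {1..N}" "j : {1..N}"
 have "igb M (%w. (Z w * D i w)*D j w)"
 unfolding D_def using ij assms(1) uv by(intro sqi_mi sqi_bdm_mult ZM B_incr_sqi)
 thus "igb M (%w. th i*th j*(Z w * (D i w * D j w)))" by(intro i_mult_r) (simp add: massoc)
 qed
 also have "... = (SUM i:{1..N}. SUM j:{1..N}. if i = j then th i*th j*((v-u)*(LINT w|M. Z w)) else 0)"
 using B_cov[OF _ _ assms] unfolding D_def by(intro sum.cong refl) auto
 also have "... = (SUM i:{1..N}. (th i)^2*((v-u)*(LINT w|M. Z w)))"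
 by(intro sum.cong refl) (simp add: sum.delta p2es)
 also have "... = sqn th * (v-u)*(LINT w|M. Z w)" by(simp add: sqn_def sum_distrib_right massoc)
 finally show "(LINT w|M. Z w * (linc th u v w)^2) = sqn th * (v-u)*(LINT w|M. Z w)" .
qed

text \<open>Interpolation between the second and the fourth moment: |y|^3 <= q*y^2+y^4/q. The choice
  \<open>q = sqrt h\<close> makes both terms of order h^(3/2) and produces the two summands of the
  constant.\<close>

lemma linc_cube:
 assumes "s <= u" "h >= 0" shows "igb M (%w. |linc th u (u+h) w| ^ 3)"
 "(LINT w|M. |linc th u (u+h) w| ^ 3) <= (sqn th+3*(sqn th)^2*(real N)^2)*(h * sqrt h)"
proof -
 define D where "D i w = W i s (u+h) w-W i s u w" for i w
 define x where "x = linc th u (u+h)"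
 have xm[measurable]: "x : bm M" using assms linc_sqi[of u "u+h" th] by(simp add: x_def sqi_def)
 have D4: "igb M (%w. D i w ^ 4)" "(LINT w|M. D i w ^ 4) = 3*h^2" if "i : {1..N}" for i
 proof -
 have "igb M (%w. D i w ^ 4) & (LINT w|M. D i w ^ 4) = 3*h^2"
 proof(cases "h = 0")
 case False
 hence "u < u+h" using assms by simp
 note mo = normal_moments[OF incr_normal[OF that assms(1) this]]
 have "sqrt h ^ 4 = h^2" using assms(2) by(simp add: power4_eq_xxxx p2es)
 thus ?thesis using mo(2)[of 4] mo(5) False assms(2) by(simp add: D_def)
 qed (simp add: D_def)
 thus "igb M (%w. D i w ^ 4)" "(LINT w|M. D i w ^ 4) = 3*h^2" by auto
 qed
 have x4: "x w ^ 4 <= (sqn th)^2*real N*(SUM i:{1..N}. D i w ^ 4)" for w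
 proof -
 have "(x w)^2 <= sqn th * (SUM i:{1..N}. (D i w)^2)"
 unfolding x_def linc_def D_def[symmetric] sqn_def by(rule Cauchy_Schwarz_ineq_sum)
 hence "((x w)^2)^2 <= (sqn th * (SUM i:{1..N}. (D i w)^2))^2" by(intro pow_mono) auto
 moreover have "(SUM i:{1..N}. 1*(D i w)^2)^2 <= (SUM i:{1..N}. 1\<^sup>2)*(SUM i:{1..N}. ((D i w)^2)^2)"
 by(rule Cauchy_Schwarz_ineq_sum)
 hence "(sqn th)^2*(SUM i:{1..N}. (D i w)^2)^2 <= (sqn th)^2*(real N*(SUM i:{1..N}. D i w ^ 4))"
 by(intro mlm) auto
 ultimately show ?thesis by(simp add: pmd massoc)
 qed
 have S4: "igb M (%w. (sqn th)^2*real N*(SUM i:{1..N}. D i w ^ 4))" using D4(1) by(intro i_mult_r Bintble_sum)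
 have S4e: "(LINT w|M. (sqn th)^2*real N*(SUM i:{1..N}. D i w ^ 4)) = (sqn th)^2*real N*(real N*(3*h^2))"
 using D4 by(simp add: Bint_sum)
 have x4i: "igb M (%w. x w ^ 4)"
 by(rule Bintble_bound[OF S4]) (use x4 in "auto intro!: AE_I2 otrans[OF _ abs_ge_self]")
 have x2: "igb M (%w. (x w)^2)" "(LINT w|M. (x w)^2) = sqn th * h"
 using linc_sq[of u "u+h" "%_. 1" th] assms by(simp_all add: x_def prob_space)
 show "igb M (%w. |linc th u (u+h) w| ^ 3)"
 proof -
 have "|y| ^ 3 <= y^2+y ^ 4" for y :: real
 proof -
 have "0 <= y^2*( |y|-1)^2+y^2*|y|" by simp
 thus ?thesis by(cases "y >= 0") (auto simp: p2es power3_eq_cube power4_eq_xxxx algs)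
 qed
 thus ?thesis unfolding x_def[symmetric] by(intro Bintble_bound[OF Bintble_add[OF x2(1) x4i]])
 (auto intro!: AE_I2 otrans[OF _ abs_ge_self])
 qed
 hence x3i: "igb M (%w. |x w| ^ 3)" by(simp add: x_def)
 show "(LINT w|M. |linc th u (u+h) w| ^ 3) <= (sqn th+3*(sqn th)^2*(real N)^2)*(h * sqrt h)"
 proof(cases "h = 0")
 case True
 thus ?thesis by(simp add: linc_def)
 next
 case False
 hence hp: "h > 0" using assms by simp
 define q where "q = sqrt h"
 have q: "q > 0" "h = q^2" using hp by(auto simp: q_def)
 have young: "|y| ^ 3 <= q*y^2+y ^ 4/q" for y :: real
 proof -
 have "0 <= (q-|y| )^2*|y|^2" by simp
 also have "... = q^2*y^2-2*q*|y| ^ 3+y ^ 4"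
 by(cases "y >= 0") (auto simp: p2es power3_eq_cube power4_eq_xxxx algs)
 finally have "2*q*|y| ^ 3 <= q^2*y^2+y ^ 4" by simp
 moreover have "q*|y| ^ 3 >= 0" using q by simp
 ultimately have "q*|y| ^ 3 <= q^2*y^2+y ^ 4" by linarith
 thus ?thesis using q(1) by(simp add: fs p2es)
 qed
 have "(LINT w|M. |x w| ^ 3) <= (LINT w|M. q*(x w)^2+x w ^ 4/q)"
 using x2 x4i x3i young by(intro int_mono) auto
 also have "... = q*(sqn th * h)+(LINT w|M. x w ^ 4)/q" using x2 x4i by simp
 also have "... <= q*(sqn th * h)+((sqn th)^2*real N*(real N*(3*h^2)))/q"
 proof -
 have "(LINT w|M. x w ^ 4) <= (sqn th)^2*real N*(real N*(3*h^2))"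
 unfolding S4e[symmetric] using x4 by(intro int_mono x4i S4)
 thus ?thesis using q(1) by(simp add: divide_right_mono)
 qed
 also have "... = (sqn th+3*(sqn th)^2*(real N)^2)*(h*q)" using q(1) by(simp add: q(2) p2es fs)
 finally show ?thesis by(simp add: x_def q_def)
 qed
qed

text \<open>Levy's characterisation, conditional on \<open>F a\<close>. The factor
  \<open>exp (sqn th * (v-a)/2)\<close> compensates the second order term of the exponential, and
  the remainder is of order h^(3/2), so \<open>superlinear_constant\<close> applies to
  \<open>P\<close>. The third moment bound takes the place of path continuity.\<close>

lemma levy_increment:
 fixes Z :: "'w => complex"
 assumes ab: "s <= a" "a <= b" and Z: "cbdm (F a) Z"
 shows "(LINT w|M. Z w * cis (linc th a b w)) = exp (- (sqn th * (b-a)/2))*(LINT w|M. Z w)"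
proof -
 define Q where "Q v = (LINT w|M. Z w * cis (linc th a v w))" for v
 define P where "P v = exp (sqn th * (v-a)/2)*Q v" for v
 obtain c0 where c0: "!!w. w : space (F a) ==> norm (Z w) <= c0" using Z by(auto simp: cbdm_def)
 define c where "c = max 0 c0"
 have c: "c >= 0" "!!w. w : space M ==> norm (Z w) <= c"
 using c0 F_space[OF ab(1)] by(auto simp: c_def le_max_iff_disj)
 define C3 where "C3 = sqn th+3*(sqn th)^2*(real N)^2"
 have Zv: "cbdm (F v) (%w. Z w * cis (linc th a v w))" if "a <= v" for v
 proof(rule cbdm_mult_cis[OF _ linc_F[OF ab(1) that]])
 have "s <= v" using that ab by simp
 have sub: "subalgebra (F v) (F a)"
 using F_mono[OF ab(1) that] F_space[OF ab(1)] F_space[OF `s \<le> v`] by(simp add: suba_def)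
 show "cbdm (F v) Z" by(rule cbdm_subalg[OF sub Z])
 qed
 have QM: "cbdm M (%w. Z w * cis (linc th a v w))" if "a <= v" for v
 using cbdm_subalg[OF F_sub Zv[OF that]] that ab by simp
 have Qn: "norm (Q v) <= c" if v: "a <= v" for v
 proof -
 have "norm (Q v) <= (LINT w|M. norm (Z w * cis (linc th a v w)))" unfolding Q_def by(rule integral_norm_bound)
 also have "... <= (LINT w|M. c)"
 using integrable_norm[OF cbdm_integrable[OF QM[OF v]]] c by(intro int_mono) (auto simp: norm_mult)
 finally show ?thesis by(simp add: prob_space)
 qed
 \<comment> \<open>Second order Taylor expansion: the linear term has mean zero, the quadratic one
   contributes \<open>sqn th * h/2\<close>, and the cubic moment bounds the remainder.\<close>
 have step: "norm (Q (v+h)-(1-cor (sqn th * h/2))*Q v) <= c*C3*(h * sqrt h)"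
 if v: "a <= v" and h: "h >= 0" for v h
 proof -
 have sv: "s <= v" "v <= v+h" using ab v h by auto
 define Z' where "Z' w = Z w * cis (linc th a v w)" for w
 define x where "x = linc th v (v+h)"
 have Z': "cbdm (F v) Z'" unfolding Z'_def[abs_def] by(rule Zv[OF v])
 have Z'M: "cbdm M Z'" unfolding Z'_def[abs_def] by(rule QM[OF v])
 have [measurable]: "Z' : bm M" using Z'M by(simp add: cbdm_def)
 have xs: "sqi M x" unfolding x_def using sv by(intro linc_sqi) auto
 note [measurable] = sqi_m[OF xs]
 have Z'n: "norm (Z' w) <= c" if "w : space M" for w using c(2)[OF that] by(simp add: Z'_def norm_mult)
 note RI = cbdm_Re_Im[OF Z'] and RIM = cbdm_Re_Im[OF Z'M]
 note x1 = int_cmr[where Z = Z' and X = x, OF sqi_mi[OF sqi_bdm[OF RIM(1)] xs] sqi_mi[OF sqi_bdm[OF RIM(2)] xs]]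
 note x2 = int_cmr[where Z = Z' and X = "%w. (x w)^2",
 OF linc_sq(1)[OF sv RI(1), of th, folded x_def] linc_sq(1)[OF sv RI(2), of th, folded x_def]]
 have e1: "(LINT w|M. Z' w * cor (x w)) = 0"
 unfolding x1(2) using linc_mean[OF sv RI(1), of th] linc_mean[OF sv RI(2), of th] by(simp add: x_def complex_eq_iff)
 have Q_RI: "Q v = Complex (LINT w|M. Re (Z' w)) (LINT w|M. Im (Z' w))"
 using cbdm_integrable[OF Z'M] by(simp add: Q_def Z'_def[symmetric] complex_eq_iff integral_Re integral_Im)
 have e2: "(LINT w|M. Z' w * cor ((x w)^2)) = cor (sqn th * h)*Q v"
 unfolding x2(2) Q_RI using linc_sq(2)[OF sv RI(1), of th] linc_sq(2)[OF sv RI(2), of th]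
 by(simp add: x_def complex_eq_iff)
 have Qvh: "Q (v+h) = (LINT w|M. Z' w * cis (x w))"
 proof -
 have "linc th a v w+x w = linc th a (v+h) w" for w
 unfolding x_def linc_def sum.distrib[symmetric] by(intro sum.cong) (auto simp: algs)
 thus ?thesis unfolding Q_def Z'_def by(simp add: massoc cis_mult)
 qed
 have Qv0: "(LINT w|M. Z' w) = Q v" by(simp add: Q_def Z'_def)
 have ci: "igb M (%w. Z' w * cis (x w))" by(rule cbdm_integrable[OF cbdm_mult_cis[OF Z'M]]) simp
 define R where "R w = Z' w * (cis (x w)-(1+\<i> * x w-(x w)\<^sup>2/2))" for w
 have R: "R w = Z' w * cis (x w)-(Z' w+\<i> * (Z' w * cor (x w))-(1/2)*(Z' w * cor ((x w)^2)))" for w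
 by(simp add: R_def algs)
 have Ri: "igb M R" unfolding R
 using ci x1(1) x2(1) cbdm_integrable[OF Z'M] by(intro Bintble_diff Bintble_add i_mult_r)
 have "Q (v+h)-(1-cor (sqn th * h/2))*Q v = (LINT w|M. R w)"
 proof -
 have "(LINT w|M. R w) = Q (v+h)-(Q v+\<i> * (LINT w|M. Z' w * cor (x w))
 - (1/2)*(LINT w|M. Z' w * cor ((x w)^2)))" unfolding R using ci x1(1) x2(1) cbdm_integrable[OF Z'M]
 by(subst Bint_diff, simp, (intro Bintble_diff Bintble_add i_mult_r; simp),
 subst Bint_diff, (intro Bintble_add i_mult_r; simp), (intro i_mult_r; simp),
 subst Bint_add, simp, (intro i_mult_r; simp)) (simp add: Qvh[symmetric] Qv0)
 thus ?thesis unfolding e1 e2 by(simp add: algs)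
 qed
 also have "norm ... <= (LINT w|M. norm (R w))" by(rule integral_norm_bound)
 also have "... <= (LINT w|M. c*|x w| ^ 3)"
 proof(rule int_mono)
 show "igb M (%w. norm (R w))" using Ri by simp
 show "igb M (%w. c*|x w| ^ 3)" using linc_cube(1)[OF sv(1) h, of th] by(simp add: x_def)
 fix w assume w: "w : space M"
 have "norm (cis y-(1+\<i> * y-y^2/2)) <= |y| ^ 3" for y :: real
 proof -
 have "(SUM k<=2. (\<i> * cor y) ^ k/fact k) = 1+\<i> * y-y^2/2"
 by(simp add: numeral_2_eq_2 p2es) (simp add: algs)
 hence "norm (cis y-(1+\<i> * y-y^2/2)) <= |y| ^ 3/6"
 using iexp_approx1[of y 2] by(simp add: cis_conv_exp fact_numeral)
 also have "... <= |y| ^ 3" by simp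
 finally show ?thesis .
 qed
 thus "norm (R w) <= c*|x w| ^ 3" unfolding R_def norm_mult using Z'n[OF w] c(1) by(intro mult_mono) auto
 qed
 also have "... = c*(LINT w|M. |x w| ^ 3)" by simp
 also have "... <= c*(C3*(h * sqrt h))"
 unfolding C3_def x_def using linc_cube(2)[OF sv(1) h, of th] c(1) by(intro mlm) auto
 finally show ?thesis by(simp add: massoc)
 qed
 define L where "L = b-a"
 define S where "S = sqn th"
 have S0: "S >= 0" by(simp add: S_def sqn_nonneg)
 \<comment> \<open>The first summand is the Taylor remainder, the second the error of
   \<open>1-y\<close> against \<open>exp (-y)\<close>; the factor in front bounds the compensating
   exponential on the interval.\<close>
 define K where "K = exp (S*L/2)*(c*C3+c*(S/2)^2 * sqrt L)"
 have "P b = P a"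
 proof(rule superlinear_constant[OF ab(2), where K = K])
 fix v h assume v: "a <= v" and h: "h >= 0" and vb: "v+h <= b"
 define y where "y = S*h/2"
 have y0: "y >= 0" using S0 h by(simp add: y_def)
 have hL: "h <= L" using v vb by(simp add: L_def)
 have expy: "|exp (-y)-(1-y)| <= y^2"
 proof -
 have l: "1-y <= exp (-y)" using exp_ge1[of "-y"] by simp
 have "exp (-y) <= 1/(1+y)" using exp_ge1[of y] y0 by(simp add: exp_minus fs)
 also have "... <= 1-y+y^2" using y0 by(auto simp: p2es algs fs)
 finally show ?thesis using l by simp
 qed
 have h2: "y^2 <= (S/2)^2 * sqrt L*(h * sqrt h)"
 proof -
 have "y^2 = (S/2)^2*(h*(sqrt h * sqrt h))" using h by(simp add: y_def p2es)
 also have "... <= (S/2)^2*(h*(sqrt L * sqrt h))" using h hL by(intro mlm mrm) auto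
 finally show ?thesis by(simp add: mult_ac)
 qed
 have "P (v+h)-P v = exp (S*(v+h-a)/2)*(Q (v+h)-exp (-y)*Q v)"
 proof -
 have "exp (S*(v-a)/2) = exp (S*(v+h-a)/2)*exp (-y)" by(simp add: y_def exp_add[symmetric] fs)
 thus ?thesis by(simp add: P_def S_def[symmetric] algs flip: of_real_mult)
 qed
 also have "norm ... = exp (S*(v+h-a)/2)*norm (Q (v+h)-exp (-y)*Q v)" by(simp add: norm_mult)
 also have "... <= exp (S*L/2)*(c*C3*(h * sqrt h)+c*((S/2)^2 * sqrt L*(h * sqrt h)))"
 proof(intro mult_mono)
 show "exp (S*(v+h-a)/2) <= exp (S*L/2)" using S0 vb by(simp add: L_def mlm)
 have "Q (v+h)-exp (-y)*Q v = (Q (v+h)-(1-cor (sqn th * h/2))*Q v)-cor (exp (-y)-(1-y))*Q v"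
 by(simp add: y_def S_def algs)
 also have "norm ... <= norm (Q (v+h)-(1-cor (sqn th * h/2))*Q v)+norm (cor (exp (-y)-(1-y))*Q v)"
 by(rule norm_triangle_ineq4)
 also have "... <= c*C3*(h * sqrt h)+c*((S/2)^2 * sqrt L*(h * sqrt h))"
 proof(rule add_mono[OF step[OF v h]])
 have "norm (cor (exp (-y)-(1-y))*Q v) = |exp (-y)-(1-y)| * norm (Q v)" by(simp only: norm_mult norm_of_real)
 also have "... <= ((S/2)^2 * sqrt L*(h * sqrt h))*c" using expy h2 Qn[OF v] by(intro mult_mono) auto
 finally show "norm (cor (exp (-y)-(1-y))*Q v) <= c*((S/2)^2 * sqrt L*(h * sqrt h))" by(simp add: mcomm)
 qed
 finally show "norm (Q (v+h)-cor (exp (-y))*Q v) <= c*C3*(h * sqrt h)+c*((S/2)^2 * sqrt L*(h * sqrt h))" .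
 qed auto
 also have "... = K*(h * sqrt h)" by(simp add: K_def algs)
 finally show "norm (P (v+h)-P v) <= K*(h * sqrt h)" .
 qed
 moreover have "Q a = (LINT w|M. Z w)" by(simp add: Q_def linc_def)
 ultimately have "cor (exp (sqn th * (b-a)/2))*Q b = (LINT w|M. Z w)" by(simp add: P_def)
 hence "cor (exp (- (sqn th * (b-a)/2))*exp (sqn th * (b-a)/2))*Q b = exp (- (sqn th * (b-a)/2))*(LINT w|M. Z w)"
 by(simp only: of_real_mult massoc)
 moreover have "exp (- (sqn th * (b-a)/2))*exp (sqn th * (b-a)/2) = 1" by(simp add: exp_minus)
 ultimately show ?thesis unfolding Q_def by simp
qed

end

section \<open>The noise algebra and immersion\<close>

definition nset :: "nat => real => real => (nat*real*real) set" where
 "nset N a b = {(i, u, v). i : {1..N} & a <= u & u <= v & v <= b}"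

definition nz :: "(nat => real => real => 'w => real) => nat*real*real => 'w => real" where
 "nz W j w = (case j of (i, u, v) => W i u v w)"

definition nspc :: "nat => real => real => (nat*real*real => real) measure" where
 "nspc N a b = (\<Pi>\<^sub>M j\<in>nset N a b. borel)"

definition nmap :: "nat => (nat => real => real => 'w => real) => real => real => 'w => (nat*real*real => real)" where
 "nmap N W a b w = (\<lambda>j\<in>nset N a b. nz W j w)"

text \<open>The noise sigma-field before completion, as a preimage of a product sigma-field: its
  measurable functions are functionals of the noise at every point, which the completed
  \<open>noise_algebra\<close> would give only up to null sets.\<close>

definition nalg :: "'w measure => nat => (nat => real => real => 'w => real) => real => real => 'w measure" where
 "nalg M N W a b = vimage_algebra (space M) (nmap N W a b) (nspc N a b)"

abbreviation (input) "CE M N W a b \<equiv> real_cond_exp M (nalg M N W a b)"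

lemma nmap_m:
 assumes "!!i u v. i : {1..N} ==> a <= u ==> u <= v ==> v <= b ==> W i u v : bm G"
 shows "nmap N W a b : G ~> nspc N a b" unfolding nmap_def[abs_def] nspc_def
 using assms by(intro measurable_restrict) (auto simp: nset_def nz_def split: prod.split)

lemma space_nalg[simp]: "space (nalg M N W a b) = space M" by(simp add: nalg_def)

lemma nmap_space: "nmap N W a b : space M \<rightarrow> space (nspc N a b)"
 by(auto simp: nmap_def nspc_def space_PiM)

lemma sets_nalg: "sets (nalg M N W a b) = {nmap N W a b -` C Int space M | C. C : sets (nspc N a b)}"
 unfolding nalg_def by(rule sets_vimage_algebra2[OF nmap_space])

lemma nmap_nalg: "nmap N W a b : nalg M N W a b ~> nspc N a b"
 unfolding nalg_def by(rule measurable_vimage_algebra1[OF nmap_space])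

lemma nalg_subset:
 assumes "space G = space M"
 and "!!i u v. i : {1..N} ==> a <= u ==> u <= v ==> v <= b ==> W i u v : bm G"
 shows "sets (nalg M N W a b) <= sets G"
 using m_sets[OF nmap_m[OF assms(2)]] unfolding sets_nalg assms(1)[symmetric] by auto

lemma W_nalg:
 assumes "i : {1..N}" "a <= u" "u <= v" "v <= b" shows "W i u v : bm (nalg M N W a b)"
proof -
 have j: "(i, u, v) : nset N a b" using assms by(simp add: nset_def)
 have "(%w. nmap N W a b w (i, u, v)) : bm (nalg M N W a b)"
 by(rule m_comp[OF nmap_nalg]) (use j in "simp add: nspc_def")
 thus ?thesis using j by(simp add: nmap_def nz_def)
qed

lemma nalg_mono:
 assumes "a' <= a" "b <= b'" shows "sets (nalg M N W a b) <= sets (nalg M N W a' b')"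
 by(rule nalg_subset) (use assms in \<open>auto intro!: W_nalg\<close>)

section \<open>Gaussian linear functionals of the noise\<close>

context noise_filtration
begin

lemma grid_char:
 fixes Z :: "'w => complex"
 assumes ta: "s <= ta 0" "!!k. ta k <= ta (Suc k)" and Z: "cbdm (F (ta 0)) Z"
 shows "(LINT w|M. Z w * cis (SUM k<n. linc (th k) (ta k) (ta (Suc k)) w))
 = exp (- ((SUM k<n. sqn (th k)*(ta (Suc k)-ta k))/2))*(LINT w|M. Z w)"
proof(induction n)
 case 0
 thus ?case by simp
next
 case (Suc n)
 have tam: "ta k <= ta l" if "k <= l" for k l using that by(rule lift_Suc_mono_le[of ta, OF ta(2)])
 have tas: "s <= ta k" for k using tam[of 0 k] ta(1) by simp
 define Z' where "Z' w = Z w * cis (SUM k<n. linc (th k) (ta k) (ta (Suc k)) w)" for w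
 have "cbdm (F (ta n)) Z'" unfolding Z'_def[abs_def]
 proof(rule cbdm_mult_cis)
 have "subalgebra (F (ta n)) (F (ta 0))"
 using F_mono[OF ta(1) tam[of 0 n]] F_space[OF ta(1)] F_space[OF tas] by(simp add: suba_def)
 thus "cbdm (F (ta n)) Z" using Z by(rule cbdm_subalg)
 show "(%w. SUM k<n. linc (th k) (ta k) (ta (Suc k)) w) : bm (F (ta n))"
 proof(rule bm_sum)
 fix k assume "k : {..<n}"
 hence "ta (Suc k) <= ta n" by(intro tam) auto
 thus "linc (th k) (ta k) (ta (Suc k)) : bm (F (ta n))" by(rule F_subset[OF tas _ linc_F[OF tas ta(2)]])
 qed
 qed
 from levy_increment[OF tas ta(2) this, of "th n"]
 have "(LINT w|M. Z' w * cis (linc (th n) (ta n) (ta (Suc n)) w)) = exp (- (sqn (th n)*(ta (Suc n)-ta n)/2))*(LINT w|M. Z' w)" .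
 moreover have "Z' w * cis (linc (th n) (ta n) (ta (Suc n)) w) = Z w * cis (SUM k<Suc n. linc (th k) (ta k) (ta (Suc k)) w)" for w
 by(simp add: Z'_def cis_mult massoc)
 moreover have "cor (exp (- (sqn (th n)*(ta (Suc n)-ta n)/2)))*cor (exp (- ((SUM k<n. sqn (th k)*(ta (Suc k)-ta k))/2)))
 = cor (exp (- ((SUM k<Suc n. sqn (th k)*(ta (Suc k)-ta k))/2)))"
 by(simp add: exp_add[symmetric] fs flip: of_real_mult)
 ultimately show ?case using Suc.IH[folded Z'_def] by(simp only: massoc[symmetric])
qed

text \<open>The end points of all intervals are sorted into one grid, on which the combination is
  almost surely a sum over consecutive steps, and \<open>grid_char\<close> peels these off one by
  one. Scaling by \<open>x\<close> multiplies the variance by x^2, so one \<open>V\<close> serves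
  all \<open>x\<close> and all \<open>Z\<close>.\<close>

lemma linear_functional_char:
 fixes \<iota> :: "'k => nat" and al ga c :: "'k => real"
 assumes K: "finite K" and a: "s <= a"
 and j: "!!j. j : K ==> \<iota> j : {1..N}" "!!j. j : K ==> a <= al j" "!!j. j : K ==> al j <= ga j"
 obtains V :: real where "!!x (Z :: 'w => complex). cbdm (F a) Z ==>
 (LINT w|M. Z w * cis (x*(SUM j:K. c j*W (\<iota> j) (al j) (ga j) w))) = cor (exp (- (x^2*V/2)))*(LINT w|M. Z w)"
proof -
 define D where "D = insert a (al ` K Un ga ` K)"
 define l where "l = sorted_list_of_set D"
 have D: "finite D" "a : D" using K by(auto simp: D_def)
 have l: "set l = D" "sorted_wrt (<) l" using D by(auto simp: l_def strict_sorted_list_of_set)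
 have len: "length l > 0" using l(1) D(2) by(cases l) auto
 define n where "n = length l-1"
 \<comment> \<open>Beyond the last node the grid stays constant, which keeps it monotone over all
   indices.\<close>
 define ta where "ta k = l ! (min k n)" for k
 have taless: "ta k < ta k'" if "k < k'" "k' <= n" for k k'
 using that len sorted_wrt_nth_less[OF l(2), of k k'] by(simp add: ta_def n_def)
 have tamono: "ta k <= ta (Suc k)" for k
 proof(cases "Suc k <= n")
 case True thus ?thesis using taless[of k "Suc k"] by simp
 next
 case False
 hence "min k n = n" "min (Suc k) n = n" by auto
 thus ?thesis by(simp add: ta_def)
 qed
 have ex: "EX m<=n. ta m = d" if d: "d : D" for d
 proof -
 have "d : set l" using d l(1) by simp
 then obtain m where "m < length l" "l ! m = d" by(auto simp: in_set_conv_nth)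
 thus ?thesis by(intro exI[of _ m]) (auto simp: ta_def n_def)
 qed
 have ta0: "ta 0 = a"
 proof -
 have "a <= d" if "d : D" for d using that j(2,3) by(auto simp: D_def intro: otrans)
 hence "a <= ta 0" using l(1) len by(auto simp: ta_def)
 moreover obtain m where "m <= n" "ta m = a" using ex[OF D(2)] by auto
 hence "ta 0 <= a" using taless[of 0 m] by(cases "m = 0") auto
 ultimately show ?thesis by simp
 qed
 have tas: "s <= ta k" for k using lift_Suc_mono_le[of ta 0 k, OF tamono] ta0 a by simp
 define de where "de i k w = W i s (ta (Suc k)) w-W i s (ta k) w" for i k w
 have tele: "W i s v w-W i s u w = (SUM k<n. if u <= ta k & ta k < v then de i k w else 0)"
 if uv: "u : D" "v : D" "u <= v" for i u v w
 proof -
 obtain m where m: "m <= n" "ta m = u" using ex[OF uv(1)] by auto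
 obtain m' where m': "m' <= n" "ta m' = v" using ex[OF uv(2)] by auto
 have mm: "m <= m'" using taless[of m' m] m m' uv(3) by(cases "m' < m") auto
 have iff: "(u <= ta k & ta k < v) <-> (m <= k & k < m')" if "k < n" for k
 using taless[of k m] taless[of m k] taless[of k m'] taless[of m' k] m m' that
 by(smt (verit) linorder_le_less_linear nat_less_le order_less_imp_le)
 have "(SUM k<n. if u <= ta k & ta k < v then de i k w else 0) = (SUM k:{..<n}. if m <= k & k < m' then de i k w else 0)"
 by(intro sum.cong) (use iff in auto)
 also have "... = (SUM k:{m..<m'}. de i k w)" by(rule sum.mono_neutral_cong_right) (use m' in auto)
 also have "... = W i s (ta m') w-W i s (ta m) w"
 unfolding de_def using sum_Suc_diff'[OF mm, of "%k. W i s (ta k) w"] by simp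
 finally show ?thesis using m m' by simp
 qed
 define th where "th k i = (SUM j:K. if \<iota> j = i & al j <= ta k & ta k < ga j then c j else 0)" for k i
 define V where "V = (SUM k<n. sqn (th k)*(ta (Suc k)-ta k))"
 have L: "AE w in M. (SUM j:K. c j*W (\<iota> j) (al j) (ga j) w) = (SUM k<n. linc (th k) (ta k) (ta (Suc k)) w)"
 proof -
 have "AE w in M. ALL j:K. W (\<iota> j) (al j) (ga j) w = W (\<iota> j) s (ga j) w-W (\<iota> j) s (al j) w"
 proof(intro AE_finite_allI[OF K])
 fix j' assume j': "j' : K"
 show "AE w in M. W (\<iota> j') (al j') (ga j') w = W (\<iota> j') s (ga j') w-W (\<iota> j') s (al j') w"
 using W_incr_AE[OF j(1)[OF j'] otrans[OF a j(2)[OF j']] j(3)[OF j']] by eventually_elim simp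
 qed
 thus ?thesis
 proof eventually_elim
 case (elim w)
 have "(SUM j:K. c j*W (\<iota> j) (al j) (ga j) w) = (SUM j:K. c j*(SUM k<n. if al j <= ta k & ta k < ga j then de (\<iota> j) k w else 0))"
 proof(intro sum.cong refl)
 fix j' assume j': "j' : K"
 have "W (\<iota> j') (al j') (ga j') w = (SUM k<n. if al j' <= ta k & ta k < ga j' then de (\<iota> j') k w else 0)"
 using elim j' tele[of "al j'" "ga j'" "\<iota> j'" w] j(3)[OF j'] by(simp add: D_def)
 thus "c j'*W (\<iota> j') (al j') (ga j') w = c j'*(SUM k<n. if al j' <= ta k & ta k < ga j' then de (\<iota> j') k w else 0)" by simp
 qed
 also have "... = (SUM j:K. SUM k<n. SUM i:{1..N}. (if \<iota> j = i & al j <= ta k & ta k < ga j then c j else 0)*de i k w)"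
 proof(intro sum.cong refl)
 fix j' assume j': "j' : K"
 have "(SUM i:{1..N}. (if \<iota> j' = i & al j' <= ta k & ta k < ga j' then c j' else 0)*de i k w)
 = c j'*(if al j' <= ta k & ta k < ga j' then de (\<iota> j') k w else 0)" for k
 proof -
 have "(SUM i:{1..N}. (if \<iota> j' = i & al j' <= ta k & ta k < ga j' then c j' else 0)*de i k w)
 = (SUM i:{1..N}. if i = \<iota> j' then c j'*(if al j' <= ta k & ta k < ga j' then de i k w else 0) else 0)"
 by(intro sum.cong) auto
 also have "... = c j'*(if al j' <= ta k & ta k < ga j' then de (\<iota> j') k w else 0)"
 using j(1)[OF j'] by(subst sum.delta) auto
 finally show ?thesis .
 qed
 thus "c j'*(SUM k<n. if al j' <= ta k & ta k < ga j' then de (\<iota> j') k w else 0)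
 = (SUM k<n. SUM i:{1..N}. (if \<iota> j' = i & al j' <= ta k & ta k < ga j' then c j' else 0)*de i k w)"
 by(simp only: sdl)
 qed
 also have "... = (SUM k<n. SUM j:K. SUM i:{1..N}. (if \<iota> j = i & al j <= ta k & ta k < ga j then c j else 0)*de i k w)"
 by(rule sum.swap)
 also have "... = (SUM k<n. SUM i:{1..N}. SUM j:K. (if \<iota> j = i & al j <= ta k & ta k < ga j then c j else 0)*de i k w)"
 by(intro sum.cong refl sum.swap)
 also have "... = (SUM k<n. linc (th k) (ta k) (ta (Suc k)) w)"
 by(simp add: linc_def th_def de_def sum_distrib_right)
 finally show ?case .
 qed
 qed
 show ?thesis
 proof(rule that[of V])
 fix x :: real and Z :: "'w => complex" assume Z: "cbdm (F a) Z"
 have ZM: "cbdm M Z" by(rule cbdm_subalg[OF F_sub[OF a] Z])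
 note [measurable] = ZM[unfolded cbdm_def, THEN conjunct1]
 have [measurable]: "(%w. SUM j:K. c j*W (\<iota> j) (al j) (ga j) w) : bm M"
 using j by(intro bm_sum bm_times bm_const W_meas) auto
 have [measurable]: "(%w. SUM k<n. linc (%i. x*th k i) (ta k) (ta (Suc k)) w) : bm M"
 by(intro bm_sum sqi_m[OF linc_sqi[OF tas tas]])
 have "(LINT w|M. Z w * cis (x*(SUM j:K. c j*W (\<iota> j) (al j) (ga j) w)))
 = (LINT w|M. Z w * cis (SUM k<n. linc (%i. x*th k i) (ta k) (ta (Suc k)) w))"
 proof(rule int_cong_AE)
 have "linc (%i. x*th k i) (ta k) (ta (Suc k)) w = x*linc (th k) (ta k) (ta (Suc k)) w" for k w
 by(simp add: linc_def sdl massoc)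
 thus "AE w in M. Z w * cis (x*(SUM j:K. c j*W (\<iota> j) (al j) (ga j) w)) =
 Z w * cis (SUM k<n. linc (%i. x*th k i) (ta k) (ta (Suc k)) w)"
 using L by(auto simp: sdl[symmetric] elim!: ev_mono)
 qed measurable
 also have "... = exp (- ((SUM k<n. sqn (%i. x*th k i)*(ta (Suc k)-ta k))/2))*(LINT w|M. Z w)"
 by(rule grid_char) (use ta0 a tamono Z in auto)
 also have "(SUM k<n. sqn (%i. x*th k i)*(ta (Suc k)-ta k)) = x^2*V"
 proof -
 have "sqn (%i. x*th k i) = x^2 * sqn (th k)" for k by(simp add: sqn_def pmd sdl)
 thus ?thesis by(simp add: V_def sdl massoc)
 qed
 finally show "(LINT w|M. Z w * cis (x*(SUM j:K. c j*W (\<iota> j) (al j) (ga j) w))) = cor (exp (- (x^2*V/2)))*(LINT w|M. Z w)" .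
 qed
qed

lemma nalg_sub: "subalgebra M (nalg M N W a b)"
 unfolding suba_def using nalg_subset[of M M N a b W] W_meas by auto

end

text \<open>\<open>W i u v\<close> agrees with \<open>W i s v - W i s u\<close> only almost surely,
  and the filtration is not completed, so its measurability does not follow from that of the
  Brownian motions started at \<open>s\<close>.\<close>

locale driven = noise_filtration M F s N W
 for M :: "'w measure" and F :: "real => 'w measure" and s :: real and N :: nat
 and W :: "nat => real => real => 'w => real" +
 assumes W_F: "!!i u v ww. i : {1..N} ==> s <= u ==> u <= v ==> v <= ww ==> W i u v : bm (F ww)"
begin

lemma nalg_F: "s <= u ==> subalgebra (F u) (nalg M N W s u)"
 unfolding suba_def using nalg_subset[of "F u" M N s u W] W_F F_space by auto

lemma finite_subalg: "finite_measure_subalgebra M (nalg M N W a b)" by unfold_locales (rule nalg_sub)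

text \<open>The noise after \<open>u\<close> is independent of \<open>F u\<close>, so it adds
  nothing to what the earlier noise says about \<open>V\<close>. In detail, V-V0 is orthogonal to
  the exponential of every linear functional of the noise on \<open>[s, t]\<close>: the part after
  \<open>u\<close> factors out by \<open>linear_functional_char\<close>, the part before is
  measurable for the noise up to \<open>u\<close>. A common version bounded everywhere is what the
  adaptedness axiom of \<open>ito_pairing\<close> asks for.\<close>

lemma immersion_bounded:
 assumes u: "s <= u" "u <= t" and V: "bdm (F u) V"
 obtains V0 where "bdm (nalg M N W s u) V0" "AE w in M. (CE M N W s t) V w = V0 w"
 "AE w in M. (CE M N W s u) V w = V0 w"
proof -
 interpret Cu: finite_measure_subalgebra M "nalg M N W s u" by(rule finite_subalg)
 interpret Ct: finite_measure_subalgebra M "nalg M N W s t" by(rule finite_subalg)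
 have VM: "bdm M V" by(rule bdm_F[OF u(1) V])
 note Vi = bdm_i[OF VM]
 obtain c where c: "c >= 0" "ALL w:space M. |V w| <= c" using bdm_bound[OF VM] by blast
 have cV: "AE w in M. V w <= c" "AE w in M. -c <= V w" using c(2) by(auto intro!: AE_I2 simp: abs_le_iff minus_le_iff)
 \<comment> \<open>Clipping changes the conditional expectation on a null set only and makes the
   bound hold everywhere.\<close>
 define V0 where "V0 w = max (-c) (min c ((CE M N W s u) V w))" for w
 have V0b: "bdm (nalg M N W s u) V0" unfolding V0_def[abs_def] by(rule bdmI[where c = c]) (use c(1) in auto)
 have e1: "AE w in M. (CE M N W s u) V w = V0 w"
 using Cu.real_cond_exp_le_c[OF Vi cV(1)] Cu.real_cond_exp_ge_c[OF Vi cV(2)]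
 by eventually_elim (simp add: V0_def)
 have V0M: "bdm M V0" by(rule bdm_subalg[OF nalg_sub V0b])
 define D where "D w = V w-V0 w" for w
 have DF: "bdm (F u) D" unfolding D_def[abs_def] by(intro bdm_diff V bdm_subalg[OF nalg_F[OF u(1)] V0b])
 have DM: "bdm M D" by(rule bdm_F[OF u(1) DF])
 have orth: "(LINT w|M. D w * g w) = 0" if g: "bdm (nalg M N W s u) g" for g
 proof -
 have gM: "bdm M g" by(rule bdm_subalg[OF nalg_sub g])
 note [measurable] = bdm_m[OF gM] bdm_m[OF VM] bdm_m[OF V0M]
 have gV: "igb M (%w. g w * V w)" by(intro bdm_i bdm_mult gM VM)
 have "(LINT w|M. g w * V w) = (LINT w|M. g w * (CE M N W s u) V w)"
 by(rule Cu.real_cond_exp_intg(2)[OF gV bdm_m[OF g], symmetric]) measurable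
 also have "... = (LINT w|M. g w * V0 w)" using e1 by(intro int_cong_AE) auto
 finally have "(LINT w|M. g w * V w) = (LINT w|M. g w * V0 w)" .
 thus ?thesis using Bint_diff[OF gV bdm_i[OF bdm_mult[OF gM V0M]]] by(auto simp: D_def algs)
 qed
 obtain d where d: "d >= 0" "!!w. w : space M ==> |D w| <= d" using bdm_bound[OF DM] by blast
 \<comment> \<open>The uniqueness lemma compares nonnegative weights, so \<open>D\<close> is shifted
   by its bound and the result compared with the constant weight \<open>d\<close>.\<close>
 define G where "G w = max 0 (D w+d)" for w
 have G: "bdm M G" "G w >= 0" "w : space M ==> G w = D w+d" for w
 proof -
 note [measurable] = bdm_m[OF DM]
 show "bdm M G" unfolding G_def[abs_def] by(rule bdmI[where c = "2*d"]) (use d in "auto simp: abs_le_iff")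
 qed (use d(2)[of w] in "auto simp: G_def abs_le_iff")
 have W_at: "nz W j : bm M" if "j : nset N s t" for j
 using that W_meas by(auto simp: nset_def nz_def[abs_def] split: prod.splits)
 let ?L = "%K th w. SUM j:K. th j*nz W j w"
 have Lm: "?L K th : bm M" if "K <= nset N s t" for K th
 using that W_at by(intro bm_sum bm_times bm_const) auto
 have char0: "(LINT w|M. D w .* cis (?L K th w)) = 0" if K: "finite K" "K <= nset N s t" for K th
 proof -
 define \<iota> where "\<iota> j = fst j" for j :: "nat*real*real"
 define al where "al j = fst (snd j)" for j :: "nat*real*real"
 define ga where "ga j = snd (snd j)" for j :: "nat*real*real"
 have jK: "\<iota> j : {1..N}" "s <= al j" "al j <= ga j" if "j : K" for j
 using K(2) that by(auto simp: nset_def \<iota>_def al_def ga_def)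
 have at: "nz W j w = W (\<iota> j) (al j) (ga j) w" for j w by(simp add: nz_def \<iota>_def al_def ga_def split: prod.split)
 define L1 where "L1 w = (SUM j:K. th j*W (\<iota> j) (min (al j) u) (min (ga j) u) w)" for w
 define L2 where "L2 w = (SUM j:K. th j*W (\<iota> j) (max (al j) u) (max (ga j) u) w)" for w
 \<comment> \<open>Every increment is split at \<open>u\<close>; for an interval on one side of
   \<open>u\<close>, the other part is the increment over a point, almost surely zero.\<close>
 have L: "AE w in M. ?L K th w = L1 w+1*L2 w"
 proof -
 have "AE w in M. ALL j:K. W (\<iota> j) (al j) (ga j) w = W (\<iota> j) (min (al j) u) (min (ga j) u) w+W (\<iota> j) (max (al j) u) (max (ga j) u) w"
 proof(intro AE_finite_allI[OF K(1)])
 fix j assume j: "j : K"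
 consider "ga j <= u" | "u <= al j" | "al j <= u" "u <= ga j" using jK(3)[OF j] by linarith
 thus "AE w in M. W (\<iota> j) (al j) (ga j) w = W (\<iota> j) (min (al j) u) (min (ga j) u) w+W (\<iota> j) (max (al j) u) (max (ga j) u) w"
 using W_zero[OF jK(1)[OF j], of u] W_add[OF jK(1)[OF j], of "al j" u "ga j"] jK(3)[OF j]
 by cases (simp_all add: min_absorb1 min_absorb2 max_absorb1 max_absorb2)
 qed
 thus ?thesis by eventually_elim (simp add: at L1_def L2_def sum.distrib[symmetric] distrib_left)
 qed
 have L1m: "L1 : bm (nalg M N W s u)" unfolding L1_def[abs_def] using jK u
 by(intro bm_sum bm_times bm_const W_nalg) (auto simp: min.coboundedI1 min.mono)
 define Z where "Z w = cor (D w)*cis (L1 w)" for w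
 have Z: "cbdm (F u) Z" unfolding Z_def[abs_def]
 by(rule cbdm_mult_cis[OF cbdm_of_real[OF DF] m_subalg[OF nalg_F[OF u(1)] L1m]])
 have Z0: "(LINT w|M. Z w) = 0"
 proof -
 have cb: "bdm (nalg M N W s u) (%w. cos (L1 w))" "bdm (nalg M N W s u) (%w. sin (L1 w))"
 by(rule bdmI[where c = 1], rule m_comp[OF L1m], simp, simp)+
 have "(LINT w|M. Z w) = (LINT w|M. cor (D w * cos (L1 w))+\<i> * cor (D w * sin (L1 w)))"
 by(intro Bint_cong) (auto simp: Z_def complex_eq_iff)
 also have "... = cor (LINT w|M. D w * cos (L1 w))+\<i> * cor (LINT w|M. D w * sin (L1 w))"
 by(intro integral_Re_Im bdm_i bdm_mult DM bdm_subalg[OF nalg_sub cb(1)] bdm_subalg[OF nalg_sub cb(2)])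
 finally show ?thesis by(simp add: orth[OF cb(1)] orth[OF cb(2)])
 qed
 have jmax: "max (al j) u <= max (ga j) u" if "j : K" for j using jK(3)[OF that] by(intro max.mono order_refl)
 obtain V' :: real where V': "!!x (Z :: 'w => complex). cbdm (F u) Z ==>
 (LINT w|M. Z w * cis (x*(SUM j:K. th j*W (\<iota> j) (max (al j) u) (max (ga j) u) w))) = cor (exp (- (x^2*V'/2)))*(LINT w|M. Z w)"
 by(rule linear_functional_char[OF K(1) u(1), where \<iota> = \<iota> and al = "%j. max (al j) u" and ga = "%j. max (ga j) u" and c = th])
 (erule jK jmax | rule max.cobounded2 | blast)+
 have L2m: "L2 : bm M" unfolding L2_def[abs_def] by(intro bm_sum bm_times bm_const W_meas jK jmax)
 have "(LINT w|M. D w .* cis (?L K th w)) = (LINT w|M. Z w * cis (1*L2 w))"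
 proof(rule int_cong_AE)
 note [measurable] = bdm_m[OF DM] L2m m_subalg[OF nalg_sub L1m] Lm[OF K(2), of th]
 show "(%w. Z w * cis (1*L2 w)) : bm M" unfolding Z_def by measurable
 show "(%w. D w .* cis (?L K th w)) : bm M" by measurable
 show "AE w in M. D w .* cis (?L K th w) = Z w * cis (1*L2 w)"
 using L by eventually_elim (simp add: Z_def scaleR_conv_of_real massoc cis_mult)
 qed
 also have "... = 0" unfolding L2_def V'[OF Z] Z0 by simp
 finally show ?thesis .
 qed
 have deq: "distr (density M G) (nspc N s t) (nmap N W s t) = distr (density M (%_. d)) (nspc N s t) (nmap N W s t)"
 unfolding nspc_def nmap_def[abs_def]
 proof(rule distr_PiM_eqI_char[OF _ _ W_at W_at G(1,2) bdm_const d(1)])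
 fix K th assume K: "finite K" "K <= nset N s t"
 have "(LINT w|M. G w .* cis (?L K th w)) = (LINT w|M. D w .* cis (?L K th w)+d .* cis (?L K th w))"
 by(intro Bint_cong) (auto simp: G(3) scaleR_left_distrib)
 also have "... = (LINT w|M. D w .* cis (?L K th w))+(LINT w|M. d .* cis (?L K th w))"
 by(intro Bint_add integrable_bdm_cis DM bdm_const Lm K)
 finally show "(LINT w|M. G w .* cis (?L K th w)) = (LINT w|M. d .* cis (?L K th w))" by(simp only: char0[OF K] add_0)
 qed unfold_locales
 have nm: "nmap N W s t : M ~> nspc N s t" by(rule nmap_m) (rule W_meas)
 have set0: "(\<integral>w\<in>A. V w \<partial>M) = (\<integral>w\<in>A. V0 w \<partial>M)" if A: "A : sets (nalg M N W s t)" for A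
 proof -
 obtain C where C: "C : sets (nspc N s t)" "A = nmap N W s t -` C Int space M" using A unfolding sets_nalg by auto
 have AM: "A : sets M" using A nalg_sub by(auto simp: suba_def)
 have Ib: "bdm M (ind A :: _ => real)" using AM by(intro bdmI[where c = 1]) (auto simp: ind_def)
 have em: "(LINT w|M. G w * ind A w) = measure (distr (density M G) (nspc N s t) (nmap N W s t)) C"
 if G: "bdm M G" "!!w. G w >= 0" for G
 proof -
 have "emeasure (distr (density M G) (nspc N s t) (nmap N W s t)) C = (NN M (%w. ennreal (G w)*ind A w))"
 using nm C AM bdm_m[OF G(1)] by(simp add: emeasure_distr emeasure_density)
 also have "... = (NN M (%w. ennreal (G w * ind A w)))" by(intro nn_cong) (auto simp: ind_def)
 also have "... = ennreal (LINT w|M. G w * ind A w)"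
 by(rule nn_eq[OF bdm_i[OF bdm_mult[OF G(1) Ib]]]) (use G(2) in auto)
 finally show ?thesis using G(2) by(simp add: measure_def Bint_nonneg)
 qed
 have "(LINT w|M. D w * ind A w)+(LINT w|M. d * ind A w) = (LINT w|M. D w * ind A w+d * ind A w)"
 by(rule Bint_add[symmetric]) (intro bdm_i bdm_mult DM bdm_const Ib)+
 also have "... = (LINT w|M. G w * ind A w)" by(intro Bint_cong) (auto simp: G(3) distrib_right)
 also have "... = (LINT w|M. d * ind A w)" unfolding em[OF G(1,2)] em[OF bdm_const d(1)] deq ..
 finally have "(LINT w|M. D w * ind A w) = 0" by simp
 moreover have "(LINT w|M. D w * ind A w) = (LINT w|M. V w * ind A w)-(LINT w|M. V0 w * ind A w)"
 unfolding D_def left_diff_distrib by(intro Bint_diff bdm_i bdm_mult VM V0M Ib)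
 ultimately show ?thesis unfolding set_int_def by(simp add: mcomm)
 qed
 have V0t: "V0 : bm (nalg M N W s t)" by(rule m_subalg[OF _ bdm_m[OF V0b]])
 (use nalg_mono[OF order_refl u(2), of M N W s] in "auto simp: suba_def")
 show ?thesis by(rule that[OF V0b Ct.real_cond_exp_charact[OF set0 Vi bdm_i[OF V0M] V0t] e1])
qed

end

section \<open>Functions on the star graph\<close>

locale star =
 fixes N :: nat and e :: "nat => real => 'g::{metric_space, second_countable_topology}" and p :: "nat => real"
 assumes N2: "N >= 2" and star: "star_graph N e"
 and p01: "!!i. i : {1..N} ==> 0 < p i" "!!i. i : {1..N} ==> p i < 1" and psum: "(SUM i:{1..N}. p i) = 1"
begin

definition rad :: "'g => real" where "rad x = dist x (origin e)"

text \<open>At the origin, which lies on every ray, the value is arbitrary; this is why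
  \<open>sfun\<close> has a separate value there.\<close>

definition idx :: "'g => nat" where "idx x = (THE i. i : {1..N} & x : ray e i)"

definition sfun :: "real => (nat => real => real) => 'g => real" where
 "sfun c b x = (if x = origin e then c else b (idx x) (rad x))"

lemma e0: "i : {1..N} ==> e i 0 = origin e" using star by(simp add: star_graph_def)

lemma e_dist: "i : {1..N} ==> u >= 0 ==> v >= 0 ==> dist (e i u) (e i v) = |u-v|"
 using star by(simp add: star_graph_def)

lemma rays_inter: "i : {1..N} ==> j : {1..N} ==> i ~= j ==> ray e i Int ray e j = {origin e}"
 using star unfolding star_graph_def by blast

lemma dist_rays: "i : {1..N} ==> j : {1..N} ==> i ~= j ==> x : ray e i ==> y : ray e j ==> dist x y = rad x+rad y"
 using star unfolding star_graph_def rad_def by blast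

lemma rad_e[simp]: "i : {1..N} ==> r >= 0 ==> rad (e i r) = r"
 using e_dist[of i r 0] e0[of i] by(simp add: rad_def)

lemma rad_nonneg[simp]: "rad x >= 0" by(simp add: rad_def)

lemma rad_origin[simp]: "rad (origin e) = 0" by(simp add: rad_def)

lemma rad_pos: "x ~= origin e ==> rad x > 0" by(simp add: rad_def)

lemma e_ray: "r >= 0 ==> e i r : ray e i" by(auto simp: ray_def)

lemma e_neq: "i : {1..N} ==> r > 0 ==> e i r ~= origin e"
 using rad_e[of i r] rad_origin by(auto simp del: rad_e)

lemma idx_unique:
 assumes "x ~= origin e" "i : {1..N}" "x : ray e i" shows "idx x = i"
 unfolding idx_def using assms rays_inter by(intro the_equality) blast+

lemma idx_e[simp]: "i : {1..N} ==> r > 0 ==> idx (e i r) = i" by(rule idx_unique) (auto simp: e_neq e_ray)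

lemma ray_idx:
 assumes "x ~= origin e" shows "idx x : {1..N}" "x : ray e (idx x)" "x = e (idx x) (rad x)"
proof -
 have "x : (UN i:{1..N}. ray e i)" using star by(simp add: star_graph_def)
 then obtain i r where i: "i : {1..N}" "r >= 0" "x = e i r" by(auto simp: ray_def)
 moreover have "r > 0" using i e0[of i] assms by(cases "r = 0") auto
 ultimately show "idx x : {1..N}" "x : ray e (idx x)" "x = e (idx x) (rad x)" using e_ray[of r i] by auto
qed

lemma mem_ray: "i : {1..N} ==> x : ray e i <-> x = origin e \<or> idx x = i"
 using ray_idx(2)[of x] idx_unique[of x i] e_ray[of 0 i] e0[of i] by auto

lemma sfun_e:
 assumes "i : {1..N}" "r >= 0" "b i 0 = c" shows "sfun c b (e i r) = b i r"
 using assms e0[of i] by(cases "r = 0") (auto simp: sfun_def e_neq)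

lemma closed_ray: assumes i: "i : {1..N}" shows "closed (ray e i)" unfolding closed_def open_dist
proof safe
 fix x assume x: "x \<notin> ray e i"
 hence o: "x ~= origin e" using mem_ray[OF i] by auto
 have d: "idx x ~= i" using x o mem_ray[OF i] by auto
 show "EX ep>0. ALL y. dist y x < ep --> y : - ray e i"
 proof(intro exI[of _ "rad x"] conjI allI impI rad_pos[OF o])
 fix y assume y: "dist y x < rad x"
 show "y : - ray e i"
 proof
 assume "y : ray e i"
 hence "dist y x = rad y+rad x" using dist_rays[OF i ray_idx(1)[OF o] d[symmetric] _ ray_idx(2)[OF o]] by simp
 thus False using y rad_nonneg[of y] by linarith
 qed
 qed
qed

lemma ray_sets[measurable]: "i : {1..N} ==> ray e i : sets borel" using closed_ray by auto

lemma rad_continuous: "continuous_on S rad" unfolding rad_def[abs_def] by(intro continuous_intros)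

lemma rad_measurable[measurable]: "rad : bm borel" by(rule bm_cont[OF rad_continuous])

lemma sfun_cont:
 assumes "!!i. i : {1..N} ==> continuous_on {0..} (b i)" "!!i. i : {1..N} ==> b i 0 = c"
 shows "continuous_on UNIV (sfun c b)"
proof -
 have "continuous_on (UN i:{1..N}. ray e i) (sfun c b)"
 proof(rule continuous_on_closed_Union)
 show "continuous_on (ray e i) (sfun c b)" if i: "i : {1..N}" for i
 proof(rule continuous_on_eq)
 show "continuous_on (ray e i) (%x. b i (rad x))"
 by(rule continuous_on_compose2[OF assms(1)[OF i] rad_continuous]) auto
 show "b i (rad x) = sfun c b x" if "x : ray e i" for x
 using that i assms(2)[OF i] by(auto simp: sfun_def mem_ray)
 qed
 qed (auto simp: closed_ray)
 thus ?thesis using star by(simp add: star_graph_def)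
qed

lemma sfun_alt:
 "sfun c b x = (if x = origin e then c else SUM i:{1..N}. ind (ray e i) x*b i (rad x))"
proof(cases "x = origin e")
 case False
 have "(SUM i:{1..N}. ind (ray e i) x*b i (rad x)) = (SUM i:{1..N}. if i = idx x then b (idx x) (rad x) else 0)"
 using False by(intro sum.cong) (auto simp: mem_ray ind_def)
 thus ?thesis using False ray_idx(1)[OF False] by(simp add: sfun_def)
qed (simp add: sfun_def)

lemma sfun_m[measurable]:
 assumes "!!i. i : {1..N} ==> b i : bm borel" shows "sfun c b : bm borel"
proof -
 have "(%x. SUM i:{1..N}. ind (ray e i) x*b i (rad x)) : bm borel"
 by(intro bm_sum bm_times borel_measurable_indicator ray_sets
 m_comp[OF rad_measurable assms])
 thus ?thesis unfolding sfun_alt[abs_def] by measurable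
qed

lemma sfun_bdm:
 assumes "!!i. i : {1..N} ==> b i : bm borel"
 and "!!i r. i : {1..N} ==> r >= 0 ==> |b i r| <= K" shows "bdm borel (sfun c b)"
 using assms ray_idx(1) by(intro bdmI[where c = "max |c| K"] sfun_m) (auto simp: sfun_def le_max_iff_disj)

section \<open>Bounded test functions on the star\<close>

definition stest :: "('g => real) => ('g => real) => ('g => real) => bool" where
 "stest f f1 f2 <-> f : test_functions N e p & sder N e p 1 f = f1 & sder N e p 2 f = f2 &
 bdm borel f & bdm borel f1 & bdm borel f2"

lemma sder_no:
 "x ~= origin e ==> sder N e p k f x = (deriv ^^ k) (%r. f (e (idx x) r)) (rad x)"
 unfolding star_deriv_def idx_def rad_def by(rule if_not_P)

text \<open>Profiles smooth on the whole line have their values at 0 as one-sided limits. The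
  conditions at the origin become \<open>q0\<close>, continuity of the glued function, and
  \<open>p0\<close>, vanishing of its weighted first derivative.\<close>

lemma stest_profile:
 fixes q q1 q2 :: "nat => real => real"
 assumes d1: "!!i r. i : {1..N} ==> (q i has_real_derivative q1 i r) (at r)"
 and d2: "!!i r. i : {1..N} ==> (q1 i has_real_derivative q2 i r) (at r)"
 and c2: "!!i. i : {1..N} ==> continuous_on UNIV (q2 i)"
 and b: "!!i r. i : {1..N} ==> r >= 0 ==> |q i r| <= K" "!!i r. i : {1..N} ==> r >= 0 ==> |q1 i r| <= K"
 "!!i r. i : {1..N} ==> r >= 0 ==> |q2 i r| <= K"
 and q0: "!!i. i : {1..N} ==> q i 0 = c" and p0: "(SUM i:{1..N}. p i*q1 i 0) = 0"
 shows "stest (sfun c q) (sfun 0 q1) (sfun (SUM i:{1..N}. p i*q2 i 0) q2)"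
proof -
 have c0: "continuous_on UNIV (q i)" and c1: "continuous_on UNIV (q1 i)" if "i : {1..N}" for i
 using d1[OF that] d2[OF that] by(auto intro!: continuous_at_imp_continuous_on DERIV_isCont)
 define g where "g i r = sfun c q (e i r)" for i r
 have g: "g i r = q i r" if "i : {1..N}" "r >= 0" for i r
 unfolding g_def by(rule sfun_e[where b = q]) (use that q0 in auto)
 have g1: "(g i has_real_derivative q1 i r) (at r)" if i: "i : {1..N}" and "r > 0" for i r
 by(rule has_field_derivative_transform_within_open[OF d1[OF i], of "{0<..}"]) (use that g in auto)
 have dg: "deriv (g i) r = q1 i r" if "i : {1..N}" "r > 0" for i r by(rule DERIV_imp_deriv[OF g1[OF that]])
 have g2: "(deriv (g i) has_real_derivative q2 i r) (at r)" if i: "i : {1..N}" and "r > 0" for i r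
 proof(rule has_field_derivative_transform_within_open[OF d2[OF i], of "{0<..}"])
 show "q1 i x = deriv (g i) x" if "x : {0<..}" for x using dg[OF i, of x] that by simp
 qed (use that in auto)
 have ddg: "deriv (deriv (g i)) r = q2 i r" if "i : {1..N}" "r > 0" for i r
 by(rule DERIV_imp_deriv[OF g2[OF that]])
 have ev: "\<forall>\<^sub>F r in at_right 0. (0::real) < r" by(simp add: eventually_at_right_less)
 have l1: "(deriv (g i) ~~> q1 i 0) (at_right 0)" if i: "i : {1..N}" for i
 proof(rule Lim_transform_eventually)
 show "(q1 i ~~> q1 i 0) (at_right 0)"
 using c1[OF i] by(auto simp: continuous_on_def intro: tendsto_within_subset)
 show "\<forall>\<^sub>F r in at_right 0. q1 i r = deriv (g i) r" using ev by eventually_elim (simp add: dg[OF i])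
 qed
 have l2: "(deriv (deriv (g i)) ~~> q2 i 0) (at_right 0)" if i: "i : {1..N}" for i
 proof(rule Lim_transform_eventually)
 show "(q2 i ~~> q2 i 0) (at_right 0)"
 using c2[OF i] by(auto simp: continuous_on_def intro: tendsto_within_subset)
 show "\<forall>\<^sub>F r in at_right 0. q2 i r = deriv (deriv (g i)) r" using ev by eventually_elim (simp add: ddg[OF i])
 qed
 have sd1: "sder N e p 1 (sfun c q) x = sfun 0 q1 x" for x
 proof(cases "x = origin e")
 case True
 have "(SUM i:{1..N}. p i*Lim (at_right 0) ((deriv ^^ 1) (g i))) = (SUM i:{1..N}. p i*q1 i 0)"
 using l1 by(intro sum.cong refl arg_cong2[where f = times]) (simp add: tendsto_Lim)
 thus ?thesis using True p0 by(simp add: star_deriv_def sfun_def g_def[abs_def])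
 next
 case False
 thus ?thesis using dg[OF ray_idx(1)[OF False] rad_pos[OF False]]
 using False by(simp add: sder_no g_def[abs_def]) (simp add: sfun_def)
 qed
 have sd2: "sder N e p 2 (sfun c q) x = sfun (SUM i:{1..N}. p i*q2 i 0) q2 x" for x
 proof(cases "x = origin e")
 case True
 have "(SUM i:{1..N}. p i*Lim (at_right 0) ((deriv ^^ 2) (g i))) = (SUM i:{1..N}. p i*q2 i 0)"
 using l2 by(intro sum.cong refl arg_cong2[where f = times]) (simp add: tendsto_Lim numeral_2_eq_2)
 thus ?thesis using True by(simp add: star_deriv_def sfun_def g_def[abs_def])
 next
 case False
 thus ?thesis using ddg[OF ray_idx(1)[OF False] rad_pos[OF False]]
 using False by(simp add: sder_no g_def[abs_def] numeral_2_eq_2) (simp add: sfun_def)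
 qed
 have cf: "continuous_on UNIV (sfun c q)" by(rule sfun_cont) (use c0 q0 in "auto intro: continuous_on_subset")
 have "sfun c q : C2b N e" unfolding C2b_def Let_def
 proof(intro CollectI conjI ballI cf)
 fix i assume i: "i : {1..N}"
 have G: "(%r. sfun c q (e i r)) = g i" by(simp add: g_def[abs_def])
 show "ALL r>0. (%r. sfun c q (e i r)) differentiable at r"
 unfolding G using g1[OF i] by(auto simp: real_differentiable_def)
 show "ALL r>0. deriv (%r. sfun c q (e i r)) differentiable at r"
 unfolding G using g2[OF i] by(auto simp: real_differentiable_def)
 show "continuous_on {0<..} (deriv (deriv (%r. sfun c q (e i r))))"
 unfolding G by(rule continuous_on_eq[OF continuous_on_subset[OF c2[OF i]]]) (auto simp: ddg[OF i])
 show "bounded (deriv (%r. sfun c q (e i r)) ` {0<..})"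
 unfolding G using b(2)[OF i] by(auto simp: bounded_iff dg[OF i] intro!: exI[of _ K])
 show "bounded (deriv (deriv (%r. sfun c q (e i r))) ` {0<..})"
 unfolding G using b(3)[OF i] by(auto simp: bounded_iff ddg[OF i] intro!: exI[of _ K])
 show "EX l. (deriv (%r. sfun c q (e i r)) ~~> l) (at_right 0)" unfolding G using l1[OF i] by blast
 show "EX l. (deriv (deriv (%r. sfun c q (e i r))) ~~> l) (at_right 0)" unfolding G using l2[OF i] by blast
 qed
 hence "sfun c q : test_functions N e p" using sd1[of "origin e"] by(simp add: test_functions_def sfun_def)
 moreover have m: "q i : bm borel" "q1 i : bm borel" "q2 i : bm borel" if "i : {1..N}" for i
 using c0[OF that] c1[OF that] c2[OF that] by(auto intro: bm_cont)
 ultimately show ?thesis unfolding stest_def using sd1 sd2 b m by(auto intro!: sfun_bdm[where K = K])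
qed

text \<open>Dividing by the weight of the ray cancels the factor \<open>p i\<close> in the
  derivative at the origin.\<close>

definition S :: "'g => real" where "S x = sfun 0 (%i r. r/p i) x"

text \<open>The squared slope of \<open>S\<close>. At the origin it is the sum of
  \<open>p i * (1/p i)^2\<close>, following the convention for second derivatives there, so that one
  formula for the second derivative of a cosine holds on the whole star.\<close>

definition sg :: "'g => real" where "sg x = sfun (SUM i:{1..N}. 1/p i) (%i r. 1/(p i)^2) x"

definition cosS :: "real => 'g => real" where "cosS xi x = cos (xi * S x)"

definition sinS :: "(nat => real) => real => 'g => real" where "sinS w xi x = w (idx x) * sin (xi * S x)"

text \<open>The plain radius is used here, so that no slope \<open>sg\<close> enters the equation of
  this function.\<close>

definition gaussS :: "real => 'g => real" where "gaussS l x = exp (- (l*(rad x)^2))"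

lemma S_origin[simp]: "S (origin e) = 0" by(simp add: S_def sfun_def)

lemma S_no: "x ~= origin e ==> S x = rad x/p (idx x)" by(simp add: S_def sfun_def)

lemma S_ge_rad: "S x >= rad x"
proof(cases "x = origin e")
 case False
 thus ?thesis using p01[OF ray_idx(1)[OF False]] rad_nonneg[of x]
 by(simp add: S_no pos_le_divide_eq mult_left_le)
qed simp

lemma S_nonneg[simp]: "S x >= 0" using S_ge_rad[of x] rad_nonneg[of x] by linarith

lemma S_pos: "x ~= origin e ==> S x > 0" using S_ge_rad[of x] rad_pos[of x] by linarith

lemma S_measurable[measurable]: "S : bm borel" unfolding S_def[abs_def] by measurable

lemma sg_origin: "sg (origin e) = (SUM i:{1..N}. 1/p i)" by(simp add: sg_def sfun_def)

lemma sg_no: "x ~= origin e ==> sg x = 1/(p (idx x))^2" by(simp add: sg_def sfun_def)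

lemma inverse_p_ge_1: "i : {1..N} ==> 1 <= 1/(p i)^2" "i : {1..N} ==> 1 <= 1/p i"
 using p01[of i] by(auto simp: power_le_one)

lemma sg_ge_1: "sg x >= 1"
proof(cases "x = origin e")
 case True
 have one: "(1::nat) : {1..N}" using N2 by simp
 have "1/p 1 <= (SUM i:{1..N}. 1/p i)" using p01(1) by(intro member_le_sum one) (auto simp: less_imp_le)
 thus ?thesis using True inverse_p_ge_1(2)[OF one] by(simp add: sg_origin)
qed (use inverse_p_ge_1(1)[OF ray_idx(1)] sg_no in auto)

lemma sg_bdm: "bdm borel sg"
proof -
 have "1/(p i)^2 <= (SUM i:{1..N}. 1/(p i)^2)" if "i : {1..N}" for i using that by(intro member_le_sum) auto
 thus ?thesis unfolding sg_def[abs_def] by(intro sfun_bdm[where K = "SUM i:{1..N}. 1/(p i)^2"]) auto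
qed

lemma sg_measurable[measurable]: "sg : bm borel" by(rule bdm_m[OF sg_bdm])

definition cosS1 :: "real => 'g => real" where "cosS1 xi = sfun 0 (%i r. - (xi /p i) * sin (xi /p i*r))"

definition sinS1 :: "(nat => real) => real => 'g => real" where
 "sinS1 w xi = sfun 0 (%i r. w i*(xi /p i)*cos (xi /p i*r))"

lemma stest_scaled:
 fixes h h1 h2 :: "real => real" and a k :: "nat => real"
 assumes d: "!!x. (h has_real_derivative h1 x) (at x)" "!!x. (h1 has_real_derivative h2 x) (at x)"
 and c: "continuous_on UNIV h2" and b: "!!x. |h x| <= B" "!!x. |h1 x| <= B" "!!x. |h2 x| <= B"
 and q0: "!!i. i : {1..N} ==> a i*h 0 = c" and p0: "(SUM i:{1..N}. p i*(a i * k i*h1 0)) = 0"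
 shows "stest (sfun c (%i r. a i*h (k i*r))) (sfun 0 (%i r. a i * k i*h1 (k i*r)))
 (sfun (SUM i:{1..N}. p i*(a i*(k i)^2*h2 0)) (%i r. a i*(k i)^2*h2 (k i*r)))"
proof -
 define K where "K = (SUM i:{1..N}. ( |a i|+|a i * k i|+|a i*(k i)^2| )*B)"
 have B: "B >= 0" using b(1)[of 0] by linarith
 have K: "|y*z| <= K"
 if i: "i : {1..N}" and y: "|y| <= |a i|+|a i * k i|+|a i*(k i)^2|" and z: "|z| <= B" for i y z
 proof -
 have "|y*z| <= ( |a i|+|a i * k i|+|a i*(k i)^2| )*B"
 unfolding abs_mult[of y z] by(rule mult_mono[OF y z]) auto
 also have "... <= K" unfolding K_def using i B by(intro member_le_sum) auto
 finally show ?thesis .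
 qed
 note [derivative_intros] = DERIV_chain2[OF d(1)] DERIV_chain2[OF d(2)]
 have "stest (sfun c (%i r. a i*h (k i*r))) (sfun 0 (%i r. a i * k i*h1 (k i*r)))
 (sfun (SUM i:{1..N}. p i*(a i*(k i)^2*h2 (k i*0))) (%i r. a i*(k i)^2*h2 (k i*r)))"
 proof(rule stest_profile[where K = K])
 show "((%r. a i*h (k i*r)) has_real_derivative a i * k i*h1 (k i*r)) (at r)" for i r
 by(auto intro!: derivative_eq_intros)
 show "((%r. a i * k i*h1 (k i*r)) has_real_derivative a i*(k i)^2*h2 (k i*r)) (at r)" for i r
 by(auto intro!: derivative_eq_intros simp: p2es)
 show "continuous_on UNIV (%r. a i*(k i)^2*h2 (k i*r))" for i
 by(intro continuous_intros continuous_on_compose2[OF c]) auto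
 show "|a i*h (k i*r)| <= K" if "i : {1..N}" for i r by(rule K[OF that _ b(1)]) auto
 show "|a i * k i*h1 (k i*r)| <= K" if "i : {1..N}" for i r by(rule K[OF that _ b(2)]) auto
 show "|a i*(k i)^2*h2 (k i*r)| <= K" if "i : {1..N}" for i r by(rule K[OF that _ b(3)]) auto
 qed (use q0 p0 in auto)
 thus ?thesis by simp
qed

lemma stest_cong:
 assumes "stest f f1 f2" "!!x. f x = g x" "!!x. f1 x = g1 x" "!!x. f2 x = g2 x" shows "stest g g1 g2"
proof -
 have "f = g" "f1 = g1" "f2 = g2" using assms(2-) by auto
 thus ?thesis using assms(1) by simp
qed

lemma cosS_test: "stest (cosS xi) (cosS1 xi) (%x. - (xi^2 * sg x*cosS xi x))"
proof(rule stest_cong)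
 show "stest (sfun 1 (%i r. 1*cos (xi /p i*r))) (sfun 0 (%i r. 1*(xi /p i)*- sin (xi /p i*r)))
 (sfun (SUM i:{1..N}. p i*(1*(xi /p i)^2*- cos 0)) (%i r. 1*(xi /p i)^2*- cos (xi /p i*r)))"
 by(rule stest_scaled[where B = 1]) (auto intro!: derivative_eq_intros continuous_intros)
 show "sfun 1 (%i r. 1*cos (xi /p i*r)) x = cosS xi x" for x
 by(cases "x = origin e") (simp_all add: cosS_def S_no sfun_def)
 show "sfun 0 (%i r. 1*(xi /p i)*- sin (xi /p i*r)) x = cosS1 xi x" for x by(simp add: cosS1_def sfun_def)
 show "sfun (SUM i:{1..N}. p i*(1*(xi /p i)^2*- cos 0)) (%i r. 1*(xi /p i)^2*- cos (xi /p i*r)) x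
 = - (xi^2 * sg x*cosS xi x)" for x
 proof(cases "x = origin e")
 case True
 have "(SUM i:{1..N}. p i*(1*(xi /p i)^2*- cos 0)) = - (xi^2*(SUM i:{1..N}. 1/p i))"
 unfolding sdl sum_negf[symmetric] by(rule sum.cong) (use p01 in "auto simp: power_divide p2es")
 thus ?thesis using True by(simp add: cosS_def sg_origin sfun_def)
 next
 case False
 thus ?thesis by(simp add: cosS_def S_no sg_no sfun_def power_divide)
 qed
qed

text \<open>The slope at 0 along ray i is \<open>w i * (xi /p i)\<close>, so the weighted sum of
  slopes is \<open>xi\<close> times the sum of the weights. The second derivative vanishes at the
  origin because sin 0 = 0.\<close>

lemma sinS_test:
 assumes w: "(SUM i:{1..N}. w i) = 0"
 shows "stest (sinS w xi) (sinS1 w xi) (%x. - (xi^2 * sg x * sinS w xi x))"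
proof(rule stest_cong)
 have p0: "(SUM i:{1..N}. p i*(w i*(xi /p i)*cos 0)) = 0"
 proof -
 have "(SUM i:{1..N}. p i*(w i*(xi /p i)*cos 0)) = (SUM i:{1..N}. xi * w i)"
 proof(rule sum.cong)
 show "p i*(w i*(xi /p i)*cos 0) = xi * w i" if "i : {1..N}" for i using p01(1)[OF that] by simp
 qed simp
 thus ?thesis using w by(simp add: sdl[symmetric])
 qed
 show "stest (sfun 0 (%i r. w i * sin (xi /p i*r))) (sfun 0 (%i r. w i*(xi /p i)*cos (xi /p i*r)))
 (sfun (SUM i:{1..N}. p i*(w i*(xi /p i)^2*- sin 0)) (%i r. w i*(xi /p i)^2*- sin (xi /p i*r)))"
 by(rule stest_scaled[where B = 1]) (use p0 in "auto intro!: derivative_eq_intros continuous_intros")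
 show "sfun 0 (%i r. w i * sin (xi /p i*r)) x = sinS w xi x" for x
 by(cases "x = origin e") (simp_all add: sinS_def S_no sfun_def)
 show "sfun 0 (%i r. w i*(xi /p i)*cos (xi /p i*r)) x = sinS1 w xi x" for x by(simp add: sinS1_def sfun_def)
 show "sfun (SUM i:{1..N}. p i*(w i*(xi /p i)^2*- sin 0)) (%i r. w i*(xi /p i)^2*- sin (xi /p i*r)) x
 = - (xi^2 * sg x * sinS w xi x)" for x
 by(cases "x = origin e") (simp_all add: sinS_def S_no sg_no sfun_def power_divide)
qed

definition gaussS1 :: "real => 'g => real" where "gaussS1 l x = - (2*l*rad x*gaussS l x)"

lemma gaussS_test:
 assumes l: "l >= 0" shows "stest (gaussS l) (gaussS1 l) (%x. (4*l^2*(rad x)^2-2*l)*gaussS l x)"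
proof(rule stest_cong)
 have b: "x^2*exp (- x\<^sup>2) <= 1" for x :: real
 proof -
 have "x^2 <= exp (x^2)" using exp_ge1[of "x^2"] by linarith
 thus ?thesis by(simp add: exp_minus fs)
 qed
 have b2: "|x*exp (- x\<^sup>2)| <= 1" for x :: real
 proof -
 have "|x| <= 1+x^2" using power2_diff[of "|x|" 1] zero_le_power2[of "|x|-1"] zero_le_power2[of x] by(simp add: p2es[of "|x|"]; linarith)
 also have "... <= exp (x^2)" by(rule exp_ge1)
 finally show ?thesis by(simp add: abs_mult exp_minus fs)
 qed
 have b3: "|(4*x^2-2)*exp (- x\<^sup>2)| <= 6" for x :: real
 proof -
 have "|(4*x^2-2)*exp (- x\<^sup>2)| <= 4*(x^2*exp (- x\<^sup>2))+2*exp (- x\<^sup>2)"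
 by(simp add: left_diff_distrib abs_le_iff)
 also have "... <= 4*1+2*1" by(intro add_mono mlm b) auto
 finally show ?thesis by simp
 qed
 show "stest (sfun 1 (%i r. 1*exp (- (sqrt l*r)\<^sup>2))) (sfun 0 (%i r. 1 * sqrt l*(- 2*(sqrt l*r)*exp (- (sqrt l*r)\<^sup>2))))
 (sfun (SUM i:{1..N}. p i*(1*(sqrt l)^2*((4*0\<^sup>2-2)*exp (- 0\<^sup>2)))) (%i r. 1*(sqrt l)^2*((4*(sqrt l*r)^2-2)*exp (- (sqrt l*r)\<^sup>2))))"
 proof(rule stest_scaled[where B = 6])
 show "((%x. exp (- x\<^sup>2)) has_real_derivative-2*x*exp (- x\<^sup>2)) (at x)" for x :: real
 by(auto intro!: derivative_eq_intros)
 show "((%x. - 2*x*exp (- x\<^sup>2)) has_real_derivative (4*x^2-2)*exp (- x\<^sup>2)) (at x)" for x :: real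
 by(auto intro!: derivative_eq_intros simp: algs p2es)
 show "continuous_on UNIV (%x::real. (4*x^2-2)*exp (- x\<^sup>2))" by(intro continuous_intros)
 show "|- 2*x*exp (- x\<^sup>2)| <= 6" for x :: real using b2[of x] by(simp add: abs_mult)
 show "|exp (- x\<^sup>2)| <= 6" for x :: real
 proof -
 have "exp (- x\<^sup>2) <= 1" by simp
 thus ?thesis unfolding abs_exp_cancel by(rule otrans) simp
 qed
 qed (use b3 in auto)
 have sl: "(sqrt l*r)^2 = l*r^2" for r using l by(simp add: pmd)
 show "sfun 1 (%i r. 1*exp (- (sqrt l*r)\<^sup>2)) x = gaussS l x" for x
 by(cases "x = origin e") (simp_all add: gaussS_def sfun_def sl)
 show "sfun 0 (%i r. 1 * sqrt l*(- 2*(sqrt l*r)*exp (- (sqrt l*r)\<^sup>2))) x = gaussS1 l x" for x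
 using l by(cases "x = origin e") (simp_all add: gaussS_def gaussS1_def sfun_def sl)
 show "sfun (SUM i:{1..N}. p i*(1*(sqrt l)^2*((4*0\<^sup>2-2)*exp (- 0\<^sup>2)))) (%i r. 1*(sqrt l)^2*((4*(sqrt l*r)^2-2)*exp (- (sqrt l*r)\<^sup>2))) x
 = (4*l^2*(rad x)^2-2*l)*gaussS l x" for x
 proof(cases "x = origin e")
 case True
 have "(SUM i:{1..N}. p i*(1*(sqrt l)^2*((4*0\<^sup>2-2)*exp (- 0\<^sup>2)))) = (SUM i:{1..N}. p i)*(- (2*l))"
 unfolding sum_distrib_right using l by(intro sum.cong) auto
 hence "(SUM i:{1..N}. p i*(1*(sqrt l)^2*((4*0\<^sup>2-2)*exp (- 0\<^sup>2)))) = - (2*l)"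
 unfolding psum by simp
 thus ?thesis unfolding sfun_def using True by(simp only: if_True) (simp add: gaussS_def)
 next
 case False
 thus ?thesis using l by(simp add: gaussS_def sfun_def sl p2es[of l] algs)
 qed
qed

end

section \<open>Gaussian mixtures of cosines\<close>

abbreviation (input) "stdn \<equiv> std_normal_distribution"

interpretation stdn: prob_space stdn using real_dist_normal_dist by(simp add: real_distribution_def)

text \<open>A smoothed absolute value: even, convex, with second derivative \<open>gau\<close> and
  asymptotic slope \<open>gslope\<close>. Division by xi^2 cancels the factor that the second
  derivative of a cosine produces.\<close>

definition gmix :: "real => real" where "gmix w = (LINT xi|stdn. (1-cos (xi * w))/xi^2)"

text \<open>Half of a Gaussian integral, sqrt(pi/2).\<close>

definition gslope :: real where "gslope = (LBINT y:{0..}. gau y)"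

lemma stdn_AE_nonzero: "AE xi in stdn. xi ~= 0"
proof -
 have "AE xi in lborel. xi ~= (0::real)" by(rule AE_lborel_singleton)
 thus ?thesis by(subst AE_density) (auto elim: ev_mono)
qed

lemma cos_stdn: "(LINT xi|stdn. cos (xi * z)) = gau z"
proof -
 have i: "igb stdn (%x. iexp (z*x))" by(rule stdn.integrable_iexp) auto
 have "(LINT xi|stdn. cos (xi * z)) = (LINT xi|stdn. Re (iexp (z*xi)))"
 by(intro Bint_cong) (auto simp: Re_exp mcomm)
 also have "... = Re (char stdn z)" unfolding char_def by(rule integral_Re[OF i])
 also have "... = gau z" unfolding char_std_normal_distribution by(simp add: Re_exp flip: exp_of_real)
 finally show ?thesis .
qed

lemma one_minus_cos_le: "1-cos (x::real) <= x^2/2"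
proof -
 have "1-cos x = 2*(sin (x/2))^2" using cos_double_sin[of "x/2"] by simp
 also have "... <= 2*(x/2)^2" using abs_sin_x_le_abs_x[of "x/2"] unfolding abs_le_square_iff by simp
 finally show ?thesis by(simp add: power_divide)
qed

lemma cosq_le: "0 <= (1-cos (xi * w))/xi^2" "(1-cos (xi * w))/xi^2 <= w^2/(2::real)"
proof -
 show "(1-cos (xi * w))/xi^2 <= w^2/2"
 using one_minus_cos_le[of "xi * w"] by(cases "xi = 0") (simp_all add: divide_le_eq pmd mcomm)
qed simp

lemma gmix_nonneg: "gmix w >= 0" unfolding gmix_def by(rule Bint_nonneg) (rule cosq_le)

lemma gmix_even: "gmix |w| = gmix w" unfolding gmix_def by(cases "w >= 0") simp_all

lemma gmix_0[simp]: "gmix 0 = 0" by(simp add: gmix_def)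

lemma gmix_measurable[measurable]: "gmix : bm borel" unfolding gmix_def[abs_def] by measurable

lemma cos_mixture:
 assumes nu: "finite_measure nu" and w: "bdm nu w" and z[measurable]: "z : bm nu"
 shows "(LINT xi|stdn. (LINT x|nu. w x*cos (xi * z x))) = (LINT x|nu. w x*gau (z x))"
 and "igb stdn (%xi. (LINT x|nu. w x*cos (xi * z x)))"
proof -
 interpret nu: finite_measure nu by fact
 interpret P: pair_sigma_finite stdn nu ..
 interpret Pf: finite_measure "stdn >< nu" by(rule fin_pair) unfold_locales
 obtain K where K: "K >= 0" "!!x. x : space nu ==> |w x| <= K" using bdm_bound[OF w] by blast
 note [measurable] = bdm_m[OF w]
 have "bdm (stdn >< nu) (%(xi, x). w x*cos (xi * z x))"
 proof(rule bdmI[where c = "K*1"])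
 fix y assume "y : space (stdn >< nu)"
 hence "snd y : space nu" by(auto simp: sp_pair)
 thus "\<bar>case y of (xi, x) => w x*cos (xi * z x)\<bar> <= K*1"
 using K unfolding case_prod_beta abs_mult by(intro mult_mono) auto
 qed measurable
 hence i: "igb (stdn >< nu) (%(xi, x). w x*cos (xi * z x))" by(rule Pf.bdm_i)
 show "(LINT xi|stdn. (LINT x|nu. w x*cos (xi * z x))) = (LINT x|nu. w x*gau (z x))"
 using P.Fubini_integral[OF i] by(simp add: cos_stdn)
 show "igb stdn (%xi. (LINT x|nu. w x*cos (xi * z x)))" using P.integrable_fst[OF i] by simp
qed

lemma gmix_mixture:
 assumes nu: "finite_measure nu" and w: "bdm nu w" and z: "z : bm nu" "igb nu (%x. (z x)^2)"
 shows "(LINT xi|stdn. (LINT x|nu. w x*((1-cos (xi * z x))/xi^2))) = (LINT x|nu. w x*gmix (z x))"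
 and "igb nu (%x. w x*gmix (z x))"
 and "igb stdn (%xi. (LINT x|nu. w x*((1-cos (xi * z x))/xi^2)))"
proof -
 interpret nu: finite_measure nu by fact
 interpret P: pair_sigma_finite stdn nu ..
 obtain K where K: "K >= 0" "!!x. x : space nu ==> |w x| <= K" using bdm_bound[OF w] by blast
 note [measurable] = bdm_m[OF w] z(1)
 have i: "igb (stdn >< nu) (%(xi, x). w x*((1-cos (xi * z x))/xi^2))"
 proof(rule Bintble_bound)
 have "igb (stdn >< nu) (%(xi, x). (1::real)*(K*(z x)^2/2))"
 by(rule P.Fubini_integrable) (use z in "auto simp: case_prod_beta")
 thus "igb (stdn >< nu) (%y. K*(z (snd y))^2/2)" by(simp add: cpb)
 show "AE y in stdn >< nu. norm (case y of (xi, x) => w x*((1-cos (xi * z x))/xi^2)) <= norm (K*(z (snd y))^2/2)"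
 proof(rule AE_I2)
 fix y assume "y : space (stdn >< nu)"
 hence "snd y : space nu" by(auto simp: sp_pair)
 hence "|w (snd y)| * ((1-cos (fst y*z (snd y)))/(fst y)^2) <= K*((z (snd y))^2/2)"
 using K by(intro mult_mono cosq_le) auto
 thus "norm (case y of (xi, x) => w x*((1-cos (xi * z x))/xi^2)) <= norm (K*(z (snd y))^2/2)"
 using K(1) cosq_le(1)[of "fst y" "z (snd y)"] by(simp add: case_prod_beta abs_mult)
 qed
 qed measurable
 show "(LINT xi|stdn. (LINT x|nu. w x*((1-cos (xi * z x))/xi^2))) = (LINT x|nu. w x*gmix (z x))"
 proof -
 have "(LINT xi|stdn. (LINT x|nu. w x*((1-cos (xi * z x))/xi^2))) = (LINT x|nu. (LINT xi|stdn. w x*((1-cos (xi * z x))/xi^2)))"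
 using P.Fubini_integral[OF i] by(simp only: prod.case)
 also have "... = (LINT x|nu. w x*gmix (z x))" unfolding gmix_def by(simp only: int_mr0)
 finally show ?thesis .
 qed
 show "igb stdn (%xi. (LINT x|nu. w x*((1-cos (xi * z x))/xi^2)))"
 using P.integrable_fst[OF i] by(simp only: prod.case)
 show "igb nu (%x. w x*gmix (z x))"
 using P.integrable_snd[OF i] unfolding gmix_def by(simp only: prod.case int_mr0)
qed

lemma gauss_integrable: "igb lborel (%y::real. gau y)" "igb lborel (%y::real. |y| * gau y)"
proof -
 have e: "gau y = sqrt (2*pi) * std_normal_density y" for y by(simp add: std_normal_density_def)
 show "igb lborel (%y::real. gau y)" unfolding e using integrable_std_normal_moment_abs[of 0] by simp
 show "igb lborel (%y::real. |y| * gau y)"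
 unfolding e using i_mult_r[OF integrable_std_normal_moment_abs[of 1], of "sqrt (2*pi)"] by(simp add: mult_ac)
qed

text \<open>For nonzero \<open>xi\<close>, \<open>(1-cos (xi * w))/xi^2\<close> is the integral of
  \<open>(w-y)*cos (xi * y)\<close> over \<open>[0, w]\<close>; averaging over the Gaussian
  frequency turns the cosine into \<open>gau y\<close>.\<close>

lemma gmix_formula:
 assumes w: "w >= 0" shows "gmix w = (LBINT y:{0..w}. (w-y)*gau y)"
proof -
 have fm: "finite_measure (time 0 w)" by(rule fin_time)
 have ri: "(LINT y|(time 0 w). h y) = (LBINT y:{0..w}. h y)" for h :: "real => real"
 by(simp add: int_restr set_int_def)
 have b: "bdm (time 0 w) (%y. w-y)" by(rule bdmI[where c = w]) (auto simp: sp_restr intro!: m_restr1)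
 have id: "(%y. y) : bm (time 0 w)" by(intro m_restr1) simp
 have ftc: "(LBINT y:{0..w}. (w-y)*cos (xi * y)) = (1-cos (xi * w))/xi^2" if "xi ~= 0" for xi
 proof -
 define G where "G y = (w-y) * sin (xi * y)/xi-cos (xi * y)/xi^2" for y
 have "(LBINT y:{0..w}. (w-y)*cos (xi * y)) = G w-G 0" unfolding set_int_def
 proof(subst integral_FTC_Icc_real[where F = G, symmetric])
 show "(LINT y|lborel. ind {0..w} y .* ((w-y)*cos (xi * y))) = (LINT y|lborel. (w-y)*cos (xi * y)*ind {0..w} y)"
 by(simp add: mcomm)
 show "(G has_real_derivative (w-y)*cos (xi * y)) (at y)" for y
 unfolding G_def using that by(auto intro!: derivative_eq_intros simp: p2es fs)
 show "isCont (%y. (w-y)*cos (xi * y)) y" for y by(intro continuous_intros)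
 qed (use w in auto)
 thus ?thesis by(simp add: G_def diff_divide_distrib)
 qed
 have "gmix w = (LINT xi|stdn. (LINT y|(time 0 w). (w-y)*cos (xi * y)))" unfolding gmix_def
 proof(rule int_cong_AE)
 show "(%xi. (LINT y|(time 0 w). (w-y)*cos (xi * y))) : bm stdn"
 by(rule bm_int[OF cos_mixture(2)[OF fm b id]])
 show "AE xi in stdn. (1-cos (xi * w))/xi^2 = (LINT y|(time 0 w). (w-y)*cos (xi * y))"
 using stdn_AE_nonzero by eventually_elim (simp add: ri ftc)
 qed measurable
 also have "... = (LINT y|(time 0 w). (w-y)*gau y)" by(rule cos_mixture(1)[OF fm b id])
 finally show ?thesis unfolding ri .
qed

lemma gslope_pos: "gslope > 0"
proof -
 have "0 < (LBINT y:{0..1::real}. gau (1::real))" by(simp add: set_int_def)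
 also have "... <= gslope" unfolding gslope_def set_int_def
 proof(rule int_mono)
 show "igb lborel (%y::real. ind {0..} y .* gau y)" by(intro integrable_mult_indicator gauss_integrable) auto
 fix y :: real
 have "gau (1::real) <= gau y" if "0 <= y" "y <= 1" using pow_mono[OF that(2,1), of 2] by simp
 thus "ind {0..1} y .* gau 1 <= ind {0..} y .* gau y" by(auto simp: ind_def)
 qed simp
 finally show ?thesis .
qed

text \<open>For w >= 0 the deficit gslope*w-gmix(w) is the integral of min(w,y)*gau(y) over y >= 0,
  hence nonnegative and at most a first absolute moment.\<close>

lemma gmix_linear: "EX C>=0. ALL w. gmix w <= gslope*|w| & gslope*|w|-C <= gmix w"
proof -
 define C where "C = (LINT y|lborel. |y::real| * gau y)"
 have main: "gmix w <= gslope*w & gslope*w-C <= gmix w" if w: "w >= 0" for w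
 proof -
 have i1: "igb lborel (%y::real. w*(ind {0..} y .* gau y))"
 by(intro i_mult_r integrable_mult_indicator gauss_integrable) auto
 have i2: "igb lborel (%y::real. ind {0..w} y .* ((w-y)*gau y))"
 proof(rule Bintble_bound[OF i1])
 show "AE y in lborel. norm (ind {0..w} y .* ((w-y)*gau y)) <= norm (w*(ind {0..} y .* gau y))"
 using w by(intro AE_I2) (auto simp: ind_def abs_mult intro!: mrm)
 qed measurable
 have e1: "gslope*w = (LINT y|lborel. w*(ind {0..} y .* gau y))" by(simp add: gslope_def set_int_def mcomm)
 have e2: "gmix w = (LINT y|lborel. ind {0..w} y .* ((w-y)*gau y))"
 using gmix_formula[OF w] by(simp add: set_int_def)
 have e3: "gslope*w-gmix w = (LINT y|lborel. w*(ind {0..} y .* gau y)-ind {0..w} y .* ((w-y)*gau y))"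
 unfolding e1 e2 by(rule Bint_diff[OF i1 i2, symmetric])
 have "gmix w <= gslope*w" unfolding e1 e2
 by(rule int_mono[OF i2 i1]) (use w in "auto simp: ind_def intro!: mrm")
 moreover have "gslope*w-gmix w <= C" unfolding e3 C_def
 proof(rule int_mono[OF Bintble_diff[OF i1 i2] gauss_integrable(2)])
 fix y :: real
 consider "y < 0" | "0 <= y" "y <= w" | "0 <= y" "w < y" by linarith
 thus "w*(ind {0..} y .* gau y)-ind {0..w} y .* ((w-y)*gau y) <= |y| * gau y"
 using w by cases (auto simp: ind_def left_diff_distrib mult_nonpos_nonneg intro!: mrm)
 qed
 ultimately show ?thesis by linarith
 qed
 have "C >= 0" unfolding C_def by(rule Bint_nonneg) simp
 moreover have "gmix w <= gslope*|w| & gslope*|w|-C <= gmix w" for w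
 using main[of "|w|"] by(simp add: gmix_even)
 ultimately show ?thesis by blast
qed

lemma gmix_scale_limit: "(%n. ep n) ----> 0 ==> (!!n. ep n > 0) ==> (%n. ep n*gmix (w/ep n)) ----> gslope*|w|"
proof -
 assume e: "ep ----> 0" "!!n. ep n > 0"
 obtain C where C: "!!w. gmix w <= gslope*|w|" "!!w. gslope*|w|-C <= gmix w" using gmix_linear by blast
 show "(%n. ep n*gmix (w/ep n)) ----> gslope*|w|"
 proof(rule tendsto_sandwich)
 have en: "ep n*(gslope*|w/ep n| ) = gslope*|w|" for n using e(2)[of n] by simp
 show "\<forall>\<^sub>F n in sequentially. ep n*gmix (w/ep n) <= gslope*|w|"
 using mlm[OF C(1) less_imp_le[OF e(2)]] en by(intro always_eventually allI) (metis (no_types))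
 have "gslope*|w|-ep n*C <= ep n*gmix (w/ep n)" for n
 using mlm[OF C(2)[of "w/ep n"] less_imp_le[OF e(2)[of n]]] en[of n] by(simp add: right_diff_distrib)
 thus "\<forall>\<^sub>F n in sequentially. gslope*|w|-ep n*C <= ep n*gmix (w/ep n)" by simp
 show "(%n. gslope*|w|-ep n*C) ----> gslope*|w|"
 using tendsto_diff[OF t_const t_mult[OF e(1) t_const], of "gslope*|w|" C] by simp
 qed simp
qed

section \<open>Two-point measures\<close>

text \<open>The coordinates of interest are unbounded while the test functions at hand are bounded,
  so second moments are extracted from cosines: 2*(1-cos(t*z))/t^2 tends to z^2 as t tends to 0, the
  identity bounds its integral by \<open>C\<close>, and Fatou's lemma concludes.\<close>

lemma sqi_of_cos:
 fixes z :: "'a => real" and Th :: "'b => real"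
 assumes mu: "prob_space mu" and Lm: "finite_measure Lm" and z[measurable]: "z : bm mu"
 and Th: "bdm Lm Th" and y[measurable]: "y : bm Lm"
 and id: "!!xi. (LINT x|mu. cos (xi * z x)) = cos (xi * z0)-1/2*xi^2*(LINT x|Lm. Th x*cos (xi * y x))"
 shows "igb mu (%x. (z x)^2)"
proof -
 interpret mu: prob_space mu by fact
 interpret Lm: finite_measure Lm by fact
 obtain K where K: "K >= 0" "!!x. x : space Lm ==> |Th x| <= K" using bdm_bound[OF Th] by blast
 note [measurable] = bdm_m[OF Th]
 define t where "t n = 1/(real n+1)" for n
 define h where "h n x = 2*((1-cos (t n*z x))/(t n)^2)" for n x
 have t: "t n > 0" for n by(simp add: t_def)
 define C where "C = z0^2+K * measure Lm (space Lm)"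
 have bound: "(LINT x|mu. h n x) <= C" for n
 proof -
 have ic: "igb mu (%x. cos (t n*z x))" by(intro mu.bdm_i bdmI[where c = 1]) auto
 have b: "bdm Lm (%x. Th x*cos (t n*y x))" by(intro bdm_mult Th bdmI[where c = 1]) auto
 have "(LINT x|Lm. Th x*cos (t n*y x)) <= (LINT x|Lm. K)"
 proof(rule int_mono)
 fix x assume "x : space Lm"
 have "Th x*cos (t n*y x) <= |Th x| * |cos (t n*y x)|" unfolding abs_mult[symmetric] by(rule abs_ge_self)
 also have "... <= K*1" using K(2)[OF `x \<in> space Lm`] K(1) by(intro mult_mono) auto
 finally show "Th x*cos (t n*y x) <= K" by simp
 qed (auto intro: Lm.bdm_i b)
 hence le: "(LINT x|Lm. Th x*cos (t n*y x)) <= K * measure Lm (space Lm)" by(simp add: mcomm)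
 have "(LINT x|mu. h n x) = 2/(t n)^2*(1-(LINT x|mu. cos (t n*z x)))"
 unfolding h_def using ic by(simp add: mu.prob_space)
 also have "... = 2*((1-cos (t n*z0))/(t n)^2)+(LINT x|Lm. Th x*cos (t n*y x))"
 unfolding id using t[of n] by(simp add: fs)
 also have "... <= C" unfolding C_def using cosq_le(2)[of "t n" z0] le by linarith
 finally show ?thesis .
 qed
 have lim: "(%n. h n x) ----> (z x)\<^sup>2" for x
 proof -
 have "((%h. sin (z x/2*h)) has_real_derivative z x/2) (at 0)" by(auto intro!: derivative_eq_intros)
 hence "((%h. sin (z x/2*h)/h) ~~> z x/2) (at 0)" by(simp add: DERIV_def)
 moreover have "filterlim t (at 0) sequentially"
 unfolding filterlim_at using LIMSEQ_inverse_real_of_nat t by(auto simp: t_def[abs_def] inverse_eq_divide add.commute)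
 ultimately have "(%n. sin (z x/2*t n)/t n) ----> z x/2" by(rule filterlim_compose)
 hence "(%n. (sin (z x/2*t n)/t n)^2*4) ----> (z x/2)\<^sup>2*4" by(rule t_mult[OF tendsto_power t_const])
 hence "(%n. (sin (t n*z x/2)/t n)^2*4) ----> (z x/2)\<^sup>2*4" by(simp add: mcomm)
 moreover have "(sin (t n*z x/2)/(t n))^2*4 = h n x" for n
 using cos_double_sin[of "t n*z x/2"] by(simp add: h_def power_divide)
 ultimately show ?thesis by(simp add: power_divide)
 qed
 have hn: "h n x >= 0" for n x by(simp add: h_def)
 have hm[measurable]: "h n : bm mu" for n unfolding h_def[abs_def] by measurable
 have hi: "igb mu (h n)" for n
 proof(rule mu.bdm_i, rule bdmI[where c = "2*(2/(t n)^2)"])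
 show "|h n x| <= 2*(2/(t n)^2)" for x
 proof -
 have "2-2*cos (t n*z x) <= 4" using cos_ge_minus_one[of "t n*z x"] by linarith
 hence "(2-2*cos (t n*z x))/(t n)^2 <= 4/(t n)^2" by(intro divide_right_mono) auto
 thus ?thesis by(simp add: h_def)
 qed
 qed measurable
 have "(NN mu (%x. ennreal ((z x)^2))) = (NN mu (%x. liminf (%n. ennreal (h n x))))"
 by(intro nn_cong) (metis lim_imp_Liminf lim tendsto_ennrealI trivial_limit_sequentially)
 also have "... <= liminf (%n. \<integral>\<^sup>+x. ennreal (h n x) \<partial>mu)" by(rule nn_integral_liminf) measurable
 also have "... <= liminf (%n. ennreal C)"
 by(intro Liminf_mono always_eventually allI) (simp add: nn_eq[OF hi] hn bound ennreal_leI)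
 also have "... < \<infinity>" by(simp add: Liminf_const)
 finally show ?thesis by(intro integrableI_nonneg) auto
qed

text \<open>The identity at frequency \<open>xi /ep\<close>, divided by xi^2, is averaged over a
  Gaussian \<open>xi\<close>. Cosines become Gaussians, and the result is a Tanaka formula smoothed
  at scale \<open>ep\<close>. Two terms are carried because \<open>two_point_separation\<close>
  treats the difference and the sum of two coordinates at once.\<close>

lemma gmix_identity:
 fixes z1 z2 w1 w2 :: "'a => real" and y1 y2 Th1 Th2 :: "'b => real"
 assumes mu: "finite_measure mu" and Lm: "finite_measure Lm"
 and w: "bdm mu w1" "bdm mu w2" and z: "z1 : bm mu" "z2 : bm mu"
 "igb mu (%x. (z1 x)^2)" "igb mu (%x. (z2 x)^2)"
 and Th: "bdm Lm Th1" "bdm Lm Th2" and y: "y1 : bm Lm" "y2 : bm Lm"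
 and id: "!!xi. (LINT x|mu. (w1 x*(1-cos (xi * z1 x))+w2 x*(1-cos (xi * z2 x))))
 = (1-cos (xi * z0))+1/2*xi^2*(LINT x|Lm. (Th1 x*cos (xi * y1 x)+Th2 x*cos (xi * y2 x)))" and ep: "ep > 0"
 shows "(LINT x|mu. (w1 x*gmix (z1 x/ep)+w2 x*gmix (z2 x/ep))) = gmix (z0/ep) +
 1/(2*ep^2)*(LINT x|Lm. (Th1 x*gau (y1 x/ep)+Th2 x*gau (y2 x/ep)))"
proof -
 interpret mu: finite_measure mu by fact
 interpret Lm: finite_measure Lm by fact
 have zm: "(%x. z1 x/ep) : bm mu" "(%x. z2 x/ep) : bm mu"
 "(%x. y1 x/ep) : bm Lm" "(%x. y2 x/ep) : bm Lm" using z(1,2) y by(auto intro: borel_measurable_divide)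
 have zi: "igb mu (%x. (z1 x/ep)^2)" "igb mu (%x. (z2 x/ep)^2)" using z(3,4) by(simp_all add: power_divide)
 note g1 = gmix_mixture[OF mu w(1) zm(1) zi(1)] and g2 = gmix_mixture[OF mu w(2) zm(2) zi(2)]
 note c1 = cos_mixture[OF Lm Th(1) zm(3)] and c2 = cos_mixture[OF Lm Th(2) zm(4)]
 have i0: "igb stdn (%xi. (1-cos (xi * (z0/ep)))/xi^2)"
 by(rule stdn.bdm_i, rule bdmI[where c = "(z0/ep)^2/2"]) (use cosq_le[of _ "z0/ep"] in auto)
 have "(LINT x|mu. (w1 x*gmix (z1 x/ep)+w2 x*gmix (z2 x/ep)))
 = (LINT xi|stdn. ((LINT x|mu. w1 x*((1-cos (xi * (z1 x/ep)))/xi^2))+(LINT x|mu. w2 x*((1-cos (xi * (z2 x/ep)))/xi^2))))"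
 unfolding Bint_add[OF g1(2) g2(2)] Bint_add[OF g1(3) g2(3)] g1(1) g2(1) ..
 also have "... = (LINT xi|stdn. ((1-cos (xi * (z0/ep)))/xi^2+1/(2*ep^2)*((LINT x|Lm. Th1 x*cos (xi * (y1 x/ep)))+(LINT x|Lm. Th2 x*cos (xi * (y2 x/ep))))))"
 proof(rule int_cong_AE)
 show "(%xi. (LINT x|mu. w1 x*((1-cos (xi * (z1 x/ep)))/xi^2))+(LINT x|mu. w2 x*((1-cos (xi * (z2 x/ep)))/xi^2))) : bm stdn"
 by(rule borel_measurable_add[OF bm_int[OF g1(3)] bm_int[OF g2(3)]])
 show "(%xi. (1-cos (xi * (z0/ep)))/xi^2+1/(2*ep^2)*((LINT x|Lm. Th1 x*cos (xi * (y1 x/ep)))+(LINT x|Lm. Th2 x*cos (xi * (y2 x/ep))))) : bm stdn"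
 by(intro borel_measurable_add bm_times bm_const bm_int[OF i0]
 bm_int[OF c1(2)] bm_int[OF c2(2)])
 show "AE xi in stdn. (LINT x|mu. w1 x*((1-cos (xi * (z1 x/ep)))/xi^2))+(LINT x|mu. w2 x*((1-cos (xi * (z2 x/ep)))/xi^2))
 = (1-cos (xi * (z0/ep)))/xi^2+1/(2*ep^2)*((LINT x|Lm. Th1 x*cos (xi * (y1 x/ep)))+(LINT x|Lm. Th2 x*cos (xi * (y2 x/ep))))"
 using stdn_AE_nonzero
 proof eventually_elim
 case (elim xi)
 have bc: "bdm mu (%x. 1-cos (xi * (z1 x/ep)))" "bdm mu (%x. 1-cos (xi * (z2 x/ep)))"
 "bdm Lm (%x. cos (xi * (y1 x/ep)))" "bdm Lm (%x. cos (xi * (y2 x/ep)))"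
 using zm by(auto intro!: bdmI[where c = 1] bdm_diff bdm_const borel_measurable_cos bm_times simp del: times_divide_eq_right)
 have q: "(LINT x|mu. w x*(g x/xi^2)) = (LINT x|mu. w x*g x)/xi^2" for w g :: "'a => real"
 by(simp only: times_divide_eq_right integral_divide_zero)
 have e: "xi * (a/ep) = xi /ep * a" for a by simp
 have "(LINT x|mu. w1 x*((1-cos (xi * (z1 x/ep)))/xi^2))+(LINT x|mu. w2 x*((1-cos (xi * (z2 x/ep)))/xi^2))
 = (LINT x|mu. (w1 x*(1-cos (xi * (z1 x/ep)))+w2 x*(1-cos (xi * (z2 x/ep)))))/xi^2"
 unfolding q Bint_add[OF mu.bdm_i[OF bdm_mult[OF w(1) bc(1)]] mu.bdm_i[OF bdm_mult[OF w(2) bc(2)]]]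
 by(rule add_divide_distrib[symmetric])
 also have "... = ((1-cos (xi * (z0/ep)))+1/2*(xi /ep)^2*(LINT x|Lm. (Th1 x*cos (xi * (y1 x/ep))+Th2 x*cos (xi * (y2 x/ep)))))/xi^2"
 unfolding e id ..
 also have "(LINT x|Lm. (Th1 x*cos (xi * (y1 x/ep))+Th2 x*cos (xi * (y2 x/ep))))
 = (LINT x|Lm. Th1 x*cos (xi * (y1 x/ep)))+(LINT x|Lm. Th2 x*cos (xi * (y2 x/ep)))"
 by(intro Bint_add Lm.bdm_i bdm_mult Th bc)
 finally show ?case using elim ep by(simp add: add_divide_distrib power_divide)
 qed
 qed
 also have "... = gmix (z0/ep)+1/(2*ep^2)*((LINT x|Lm. Th1 x*gau (y1 x/ep))+(LINT x|Lm. Th2 x*gau (y2 x/ep)))"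
 unfolding Bint_add[OF i0 i_mult_r[OF Bintble_add[OF c1(2) c2(2)]]]
 int_mr0 Bint_add[OF c1(2) c2(2)] c1(1) c2(1) gmix_def ..
 also have "(LINT x|Lm. Th1 x*gau (y1 x/ep))+(LINT x|Lm. Th2 x*gau (y2 x/ep))
 = (LINT x|Lm. (Th1 x*gau (y1 x/ep)+Th2 x*gau (y2 x/ep)))"
 using zm by(intro Bint_add[symmetric] Lm.bdm_i bdm_mult Th bdmI[where c = 1]) auto
 finally show ?thesis .
qed

section \<open>Two-point measures and their equation\<close>

context star
begin

text \<open>\<open>mu\<close> is meant as the law of a pair of points at a final time and
  \<open>Lm\<close> as its occupation measure until then. The integrand is the generator of two
  motions whose driving noises have correlation \<open>rh\<close> on a common ray and none on
  different rays.\<close>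

definition tpt :: "real => 'g => 'g => ('g*'g) measure => ('g*'g) measure => bool" where
 "tpt rh x y mu Lm <-> prob_space mu & sets mu = sets (borel >< borel) &
 finite_measure Lm & sets Lm = sets (borel >< borel) &
 (ALL f f1 f2 g g1 g2. stest f f1 f2 --> stest g g1 g2 -->
 (LINT z|mu. f (fst z)*g (snd z)) = f x*g y +
 (LINT z|Lm. (1/2*(f2 (fst z)*g (snd z))+1/2*(f (fst z)*g2 (snd z)) +
 rh * (SUM i:{1..N}. (ind (ray e i) (fst z)*f1 (fst z))*(ind (ray e i) (snd z)*g1 (snd z))))))"

definition sray :: "'g => 'g => bool" where
 "sray x y <-> x ~= origin e & y ~= origin e & idx x = idx y"

text \<open>Meant for first derivatives of test functions: at the origin these are zero by the
  gluing condition, so a pair with a point there contributes nothing.\<close>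

lemma ray_sum:
 assumes "f (origin e) = (0::real)" "g (origin e) = 0"
 shows "(SUM i:{1..N}. (ind (ray e i) x*f x)*(ind (ray e i) y*g y)) = (if sray x y then f x*g y else 0)"
proof(cases "x = origin e \<or> y = origin e")
 case False
 have "(SUM i:{1..N}. (ind (ray e i) x*f x)*(ind (ray e i) y*g y))
 = (SUM i:{1..N}. if i = idx x then (if idx x = idx y then f x*g y else 0) else 0)"
 using False by(intro sum.cong) (auto simp: mem_ray ind_def)
 thus ?thesis using False ray_idx(1)[of x] by(simp add: sray_def)
qed (use assms in "auto simp: sray_def")

lemma sray_m[measurable]: "Measurable.pred (borel >< borel) (%z. sray (fst z) (snd z))"
proof -
 have "sray x y <-> x ~= origin e & y ~= origin e & (EX i:{1..N}. x : ray e i & y : ray e i)" for x y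
 using ray_idx(1)[of x] by(auto simp: sray_def mem_ray)
 thus ?thesis by simp measurable
qed

lemma sray_sg: "sray x y ==> sg x = sg y" by(simp add: sray_def sg_no)

lemma cosS1_not_origin: "x ~= origin e ==> cosS1 xi x = - (xi /p (idx x)) * sin (xi * S x)"
 by(simp add: cosS1_def sfun_def S_no)

lemma sinS1_not_origin: "x ~= origin e ==> sinS1 w xi x = w (idx x)*(xi /p (idx x))*cos (xi * S x)"
 by(simp add: sinS1_def sfun_def S_no)

lemma deriv_origin[simp]: "cosS1 xi (origin e) = 0" "sinS1 w xi (origin e) = 0" "gaussS1 l (origin e) = 0"
 by(simp_all add: cosS1_def sinS1_def gaussS1_def sfun_def)

lemma same_cos: "sray x y ==> cosS1 xi x*cosS1 et y = xi * et * sg x*(sin (xi * S x) * sin (et * S y))"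
 by(simp add: cosS1_not_origin sray_def sg_no p2es)

lemma same_sin: "sray x y ==> sinS1 w xi x * sinS1 w et y = (w (idx x))^2*(xi * et * sg x*(cos (xi * S x)*cos (et * S y)))"
 by(simp add: sinS1_not_origin sray_def sg_no p2es)

lemma cosS_measurable[measurable]: "cosS xi : bm borel" unfolding cosS_def[abs_def] by measurable

lemma sinS_alt: "sinS w xi = sfun 0 (%i r. w i * sin (xi /p i*r))"
 by(rule ext) (simp add: sinS_def sfun_def S_no)

lemma sinS_measurable[measurable]: "sinS w xi : bm borel" unfolding sinS_alt by measurable

lemma cosS1_measurable[measurable]: "cosS1 xi : bm borel" unfolding cosS1_def by measurable
lemma sinS1_measurable[measurable]: "sinS1 w xi : bm borel" unfolding sinS1_def by measurable

lemma tpt_cos: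
 assumes tp: "tpt rh x y mu Lm"
 shows "(LINT z|mu. cos (xi * S (fst z))) = cos (xi * S x)-1/2*xi^2*(LINT z|Lm. sg (fst z)*cos (xi * S (fst z)))"
 and "(LINT z|mu. cos (xi * S (snd z))) = cos (xi * S y)-1/2*xi^2*(LINT z|Lm. sg (snd z)*cos (xi * S (snd z)))"
proof -
 have c0: "cosS 0 x = 1" "cosS1 0 x = 0" for x by(simp_all add: cosS_def cosS1_def sfun_def)
 note tp' = tp[unfolded tpt_def, THEN conjunct2, THEN conjunct2, THEN conjunct2, THEN conjunct2, rule_format]
 have "(LINT z|mu. cosS xi (fst z)*cosS 0 (snd z)) = cosS xi x*cosS 0 y+(LINT z|Lm. - 1/2*xi^2*(sg (fst z)*cos (xi * S (fst z))))"
 unfolding tp'[OF cosS_test[of xi] cosS_test[of 0]] by(simp add: c0 cosS_def massoc)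
 thus "(LINT z|mu. cos (xi * S (fst z))) = cos (xi * S x)-1/2*xi^2*(LINT z|Lm. sg (fst z)*cos (xi * S (fst z)))"
 unfolding int_mr0 by(simp add: c0 cosS_def)
 have "(LINT z|mu. cosS 0 (fst z)*cosS xi (snd z)) = cosS 0 x*cosS xi y+(LINT z|Lm. - 1/2*xi^2*(sg (snd z)*cos (xi * S (snd z))))"
 unfolding tp'[OF cosS_test[of 0] cosS_test[of xi]] by(simp add: c0 cosS_def massoc)
 thus "(LINT z|mu. cos (xi * S (snd z))) = cos (xi * S y)-1/2*xi^2*(LINT z|Lm. sg (snd z)*cos (xi * S (snd z)))"
 unfolding int_mr0 by(simp add: c0 cosS_def)
qed

lemma tpt_m:
 assumes tp: "tpt rh x y mu Lm" and f: "f : borel >< borel ~> K" shows "f : mu ~> K" "f : Lm ~> K"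
 using tp f m_cong_sets[of mu "borel >< borel" K K] m_cong_sets[of Lm "borel >< borel" K K]
 unfolding tpt_def by auto

lemma tpt_b:
 assumes tp: "tpt rh x y mu Lm" and f: "bdm (borel >< borel) f" shows "bdm mu f" "bdm Lm f"
proof -
 obtain c where c: "!!u. |f u| <= c" using f by(auto simp: bdm_def sp_pair)
 show "bdm mu f" "bdm Lm f" by(rule bdmI[where c = c], rule tpt_m[OF tp bdm_m[OF f]], rule c)+
qed

lemma bdm_fs:
 assumes "bdm borel (f :: 'g => real)"
 shows "bdm (borel >< borel) (%z. f (fst (z :: 'g*'g)))" "bdm (borel >< borel) (%z. f (snd (z :: 'g*'g)))"
proof -
 obtain c where c: "!!u. |f u| <= c" using assms by(auto simp: bdm_def)
 note [measurable] = bdm_m[OF assms]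
 show "bdm (borel >< borel) (%z. f (fst (z :: 'g*'g)))" "bdm (borel >< borel) (%z. f (snd (z :: 'g*'g)))"
 by(rule bdmI[where c = c]; use c in simp)+
qed

lemma two_point_square_integrable:
 assumes tp: "tpt rh x y mu Lm" shows "igb mu (%z. (S (fst z))^2)" "igb mu (%z. (S (snd z))^2)"
proof -
 have P: "prob_space mu" "finite_measure Lm" using tp by(auto simp: tpt_def)
 have bf: "bdm (borel >< borel) (%z. sg (fst (z :: 'g*'g)))" "bdm (borel >< borel) (%z. sg (snd (z :: 'g*'g)))"
 by(rule bdm_fs[OF sg_bdm])+
 show "igb mu (%z. (S (fst z))^2)" by(rule sqi_of_cos[OF P tpt_m(1)[OF tp] tpt_b(2)[OF tp bf(1)]
 tpt_m(2)[OF tp] tpt_cos(1)[OF tp]]) measurable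
 show "igb mu (%z. (S (snd z))^2)" by(rule sqi_of_cos[OF P tpt_m(1)[OF tp] tpt_b(2)[OF tp bf(2)]
 tpt_m(2)[OF tp] tpt_cos(2)[OF tp]]) measurable
qed

lemma tpt_dom:
 assumes tp: "tpt rh x y mu Lm" and z: "z : bm (borel >< borel)" and le: "!!u. |z u| <= S (fst u)+S (snd u)"
 shows "igb mu (%u. (z u)^2)" "igb mu z"
proof -
 interpret prob_space mu using tp by(simp add: tpt_def)
 have zm: "z : bm mu" by(rule tpt_m(1)[OF tp z])
 show i: "igb mu (%u. (z u)^2)"
 proof(rule Bintble_bound)
 show "igb mu (%u. 2*(S (fst u))^2+2*(S (snd u))^2)" using two_point_square_integrable[OF tp] by simp
 show "AE u in mu. norm ((z u)^2) <= norm (2*(S (fst u))^2+2*(S (snd u))^2)"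
 proof(rule AE_I2)
 fix u
 have "(z u)^2 <= (S (fst u)+S (snd u))^2" using pow_mono[OF le[of u], of 2] by simp
 also have "... <= 2*(S (fst u))^2+2*(S (snd u))^2"
 using zero_le_power2[of "S (fst u)-S (snd u)"] by(simp add: power2_sum power2_diff)
 finally show "norm ((z u)^2) <= norm (2*(S (fst u))^2+2*(S (snd u))^2)" by simp
 qed
 qed (use zm in measurable)
 show "igb mu z" using sqi_i[of z] i zm by(simp add: sqi_def)
qed

end

section \<open>Two rays\<close>

context star
begin

text \<open>The signed coordinate that unfolds two rays into a line. Its sine is \<open>sinS\<close>
  with weights 1 and -1, whose sum is zero when there are two rays.\<close>

definition Y :: "'g => real" where "Y x = (if idx x = 1 then S x else-S x)"

definition opposite :: "'g => 'g => bool" where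
 "opposite x y <-> x ~= origin e & y ~= origin e & idx x ~= idx y"

lemma abs_Y[simp]: "|Y x| = S x" by(simp add: Y_def)

lemma Y_alt: "Y = sfun 0 (%i r. if i = 1 then r/p i else-(r/p i))"
 by(rule ext) (simp add: Y_def sfun_def S_no)

lemma Y_measurable[measurable]: "Y : bm borel" unfolding Y_alt by measurable

lemma opposite_m[measurable]: "Measurable.pred (borel >< borel) (%z. opposite (fst z) (snd z))"
proof -
 have "opposite x y <-> x ~= origin e & y ~= origin e & ~ sray x y" for x y
 by(auto simp: sray_def opposite_def)
 thus ?thesis by simp measurable
qed

text \<open>The bracket density of al*Y(first)+be*Y(second) for fully correlated noises. On a common
  ray it vanishes for the difference of the coordinates, \<open>al = 1\<close> and
  \<open>be = -1\<close>.\<close>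

definition Th :: "real => real => 'g*'g => real" where
 "Th al be z = al^2 * sg (fst z)+be^2 * sg (snd z)+2 * al * be * (if sray (fst z) (snd z) then sg (fst z) else 0)"

lemma Th_bdm: "bdm (borel >< borel) (Th al be)"
proof -
 obtain K where K: "K >= 0" "!!x. |sg x| <= K" using bdm_bound[OF sg_bdm] by auto
 have "bdm (borel >< borel) (%z. if sray (fst z) (snd z) then sg (fst z) else 0)"
 by(rule bdmI[where c = K]) (use K in auto)
 thus ?thesis unfolding Th_def[abs_def] by(intro bdm_add bdm_cmult bdm_fs sg_bdm)
qed

text \<open>The addition theorem splits the cosine into a product of cosines minus a product of
  sines. For two rays every factor is a test function, so the two-point equation applies to each
  product.\<close>

lemma lin_Y_identity:
 assumes N: "N = 2" and tp: "tpt 1 x y mu Lm"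
 shows "(LINT z|mu. cos (xi * (al * Y (fst z)+be * Y (snd z)))) = cos (xi * (al * Y x+be * Y y))
 - 1/2*xi^2*(LINT z|Lm. Th al be z*cos (xi * (al * Y (fst z)+be * Y (snd z))))"
proof -
 interpret mu: prob_space mu using tp by(simp add: tpt_def)
 interpret Lm: finite_measure Lm using tp by(simp add: tpt_def)
 define w :: "nat => real" where "w i = (if i = 1 then 1 else -1)" for i
 have w0: "(SUM i:{1..N}. w i) = 0" unfolding N by(simp add: w_def numeral_2_eq_2)
 have w2: "(w i)^2 = 1" for i by(simp add: w_def)
 have cY: "cos (et * Y x) = cosS et x" and sY: "sin (et * Y x) = sinS w et x" for et x
 by(simp_all add: Y_def cosS_def sinS_def w_def)
 have cl: "cos (xi * (al * Y x+be * Y y)) = cosS (xi * al) x*cosS (xi * be) y-sinS w (xi * al) x * sinS w (xi * be) y" for x y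
 unfolding cY[symmetric] sY[symmetric] cos_add[symmetric] by(simp add: algs)
 note tp' = tp[unfolded tpt_def, THEN conjunct2, THEN conjunct2, THEN conjunct2, THEN conjunct2, rule_format]
 have bc: "bdm borel (cosS et)" "bdm borel (sinS w et)" "bdm borel (cosS1 et)" "bdm borel (sinS1 w et)" for et
 using cosS_test[of et] sinS_test[OF w0, of et] by(auto simp: stest_def)
 have ind: "bdm borel (ind (ray e i) :: 'g => real)" if "i : {1..N}" for i
 using that by(intro bdmI[where c = 1]) (auto simp: ind_def)
 have gen: "bdm (borel >< borel) (%z. 1/2*(- (et^2 * sg (fst z)*f (fst z))*g (snd z))+1/2*(f (fst z)*- (ze^2 * sg (snd z)*g (snd z))) +
 1*(SUM i:{1..N}. (ind (ray e i) (fst z)*f1 (fst z))*(ind (ray e i) (snd z)*g1 (snd z))))"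
 if b: "bdm borel f" "bdm borel g" "bdm borel f1" "bdm borel g1" for f g f1 g1 :: "'g => real" and et ze
 proof -
 have m: "bdm borel (%x. - (et^2 * sg x*f x))" "bdm borel (%x. - (ze^2 * sg x*g x))"
 using bdm_cmult[OF bdm_mult[OF bdm_cmult[OF sg_bdm] b(1)], of "-1"] bdm_cmult[OF bdm_mult[OF bdm_cmult[OF sg_bdm] b(2)], of "-1"] by simp_all
 show ?thesis by(intro bdm_add bdm_cmult bdm_sum bdm_mult[OF bdm_fs(1) bdm_fs(2)]
 bdm_fs(1)[OF m(1)] bdm_fs(2)[OF m(2)]
 bdm_mult[OF bdm_fs(1)[OF bdm_mult[OF ind]] bdm_fs(2)[OF bdm_mult[OF ind]]] b m)
 qed
 let ?A = "%z. 1/2*(- ((xi * al)^2 * sg (fst z)*cosS (xi * al) (fst z))*cosS (xi * be) (snd z))+1/2*(cosS (xi * al) (fst z)*- ((xi * be)^2 * sg (snd z)*cosS (xi * be) (snd z))) +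
 1*(SUM i:{1..N}. (ind (ray e i) (fst z)*cosS1 (xi * al) (fst z))*(ind (ray e i) (snd z)*cosS1 (xi * be) (snd z)))"
 let ?B = "%z. 1/2*(- ((xi * al)^2 * sg (fst z) * sinS w (xi * al) (fst z)) * sinS w (xi * be) (snd z))+1/2*(sinS w (xi * al) (fst z)*- ((xi * be)^2 * sg (snd z) * sinS w (xi * be) (snd z))) +
 1*(SUM i:{1..N}. (ind (ray e i) (fst z) * sinS1 w (xi * al) (fst z))*(ind (ray e i) (snd z) * sinS1 w (xi * be) (snd z)))"
 have rc: "(SUM i:{1..N}. (ind (ray e i) a*cosS1 et a)*(ind (ray e i) b*cosS1 ze b)) = (if sray a b then cosS1 et a*cosS1 ze b else 0)"
 and rs: "(SUM i:{1..N}. (ind (ray e i) a * sinS1 w et a)*(ind (ray e i) b * sinS1 w ze b)) = (if sray a b then sinS1 w et a * sinS1 w ze b else 0)" for a b et ze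
 by(rule ray_sum; simp)+
 have AB: "?A z-?B z = - 1/2*xi^2*(Th al be z*cos (xi * (al * Y (fst z)+be * Y (snd z))))" for z
 proof(cases "sray (fst z) (snd z)")
 case True
 hence i: "idx (fst z) = idx (snd z)" by(simp add: sray_def)
 have "sinS w (xi * al) (fst z) * sinS w (xi * be) (snd z) = (w (idx (fst z)))^2*(sin (xi * al * S (fst z)) * sin (xi * be * S (snd z)))"
 using i by(simp add: sinS_def p2es)
 hence ss: "sin (xi * al * S (fst z)) * sin (xi * be * S (snd z)) = sinS w (xi * al) (fst z) * sinS w (xi * be) (snd z)" by(simp add: w2)
 have cc: "cos (xi * al * S (fst z))*cos (xi * be * S (snd z)) = cosS (xi * al) (fst z)*cosS (xi * be) (snd z)"
 by(simp add: cosS_def)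
 show ?thesis unfolding rc rs cl Th_def
 using True by(simp add: same_cos same_sin w2 ss cc sray_sg[OF True]) (simp add: fs p2es)
 next
 case False
 show ?thesis unfolding rc rs cl Th_def using False by(simp add: fs p2es)
 qed
 have "(LINT z|mu. cos (xi * (al * Y (fst z)+be * Y (snd z))))
 = (LINT z|mu. cosS (xi * al) (fst z)*cosS (xi * be) (snd z))-(LINT z|mu. sinS w (xi * al) (fst z) * sinS w (xi * be) (snd z))"
 unfolding cl by(intro Bint_diff mu.bdm_i tpt_b(1)[OF tp] bdm_mult bdm_fs bc)
 also have "... = (cosS (xi * al) x*cosS (xi * be) y-sinS w (xi * al) x * sinS w (xi * be) y)+((LINT z|Lm. ?A z)-(LINT z|Lm. ?B z))"
 unfolding tp'[OF cosS_test cosS_test] tp'[OF sinS_test[OF w0] sinS_test[OF w0]] by simp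
 also have "(LINT z|Lm. ?A z)-(LINT z|Lm. ?B z) = (LINT z|Lm. ?A z-?B z)"
 by(rule Bint_diff[symmetric]; rule Lm.bdm_i, rule tpt_b(2)[OF tp], rule gen) (rule bc)+
 finally show ?thesis unfolding AB cl[symmetric] int_mr0 by simp
qed

lemma lin_Y_gmix:
 assumes N: "N = 2" and tp: "tpt 1 x y mu Lm" and ab: "|al| <= 1" "|be| <= 1" and ep: "ep > 0"
 shows "(LINT z|mu. gmix ((al * Y (fst z)+be * Y (snd z))/ep)) = gmix ((al * Y x+be * Y y)/ep)
 + 1/(2*ep^2)*(LINT z|Lm. Th al be z*gau ((al * Y (fst z)+be * Y (snd z))/ep))"
 and "igb mu (%z. al * Y (fst z)+be * Y (snd z))"
 and "igb mu (%z. gmix ((al * Y (fst z)+be * Y (snd z))/ep))"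
proof -
 interpret mu: prob_space mu using tp by(simp add: tpt_def)
 have fin: "finite_measure mu" "finite_measure Lm" using tp by(auto simp: tpt_def) unfold_locales
 let ?z = "%z. al * Y (fst z)+be * Y (snd z)"
 have zm: "?z : bm (borel >< borel)" by measurable
 note zm' = tpt_m[OF tp zm]
 have le: "|?z u| <= S (fst u)+S (snd u)" for u
 proof -
 have "|?z u| <= |al| * S (fst u)+|be| * S (snd u)" by(rule otrans[OF abs_triangle_ineq]) (simp add: abs_mult)
 also have "... <= S (fst u)+S (snd u)" using ab by(intro add_mono) (auto intro: mult_left_le_one_le)
 finally show ?thesis .
 qed
 note zi = tpt_dom[OF tp zm le]
 show "igb mu ?z" by(rule zi)
 have "(LINT u|mu. (1*gmix (?z u/ep)+0*gmix (?z u/ep))) = gmix ((al * Y x+be * Y y)/ep)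
 + 1/(2*ep^2)*(LINT z|Lm. (Th al be z*gau (?z z/ep)+0*gau (?z z/ep)))"
 proof(rule gmix_identity[OF fin bdm_const bdm_const zm'(1) zm'(1) zi(1) zi(1) tpt_b(2)[OF tp Th_bdm] bdm_const zm'(2) zm'(2) _ ep])
 fix xi
 have "igb mu (%u. cos (xi * ?z u))" using zm'(1) by(intro mu.bdm_i bdmI[where c = 1]) auto
 thus "(LINT u|mu. (1*(1-cos (xi * ?z u))+0*(1-cos (xi * ?z u))))
 = 1-cos (xi * (al * Y x+be * Y y))+1/2*xi^2*(LINT u|Lm. (Th al be u*cos (xi * ?z u)+0*cos (xi * ?z u)))"
 using lin_Y_identity[OF N tp, of xi al be] by(simp add: mu.prob_space)
 qed
 thus "(LINT u|mu. gmix (?z u/ep)) = gmix ((al * Y x+be * Y y)/ep)+1/(2*ep^2)*(LINT u|Lm. Th al be u*gau (?z u/ep))"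
 by simp
 have "igb mu (%u. (?z u/ep)^2)" using zi(1) by(simp add: power_divide)
 from gmix_mixture(2)[OF fin(1) bdm_const borel_measurable_divide[OF zm'(1) bm_const] this, of 1]
 show "igb mu (%z. gmix (?z z/ep))" by simp
qed

lemma Th_nonneg: "al >= 0 ==> be >= 0 ==> Th al be z >= 0"
 using sg_ge_1[of "fst z"] sg_ge_1[of "snd z"] by(simp add: Th_def)

text \<open>A local time bound: in the smoothed Tanaka formula the occupation term, divided by
  2*ep^2, is at most the mean of \<open>gmix\<close>, which is O(1/ep) by linear growth. The
  constant is uniform in the coefficients, as the average in \<open>opposite_occupation\<close>
  requires.\<close>

lemma lin_Y_small:
 assumes N: "N = 2" and tp: "tpt 1 x y mu Lm"
 shows "EX C>=0. ALL al:{0..1}. ALL be:{0..1}. ALL ep>0. (LINT z|Lm. Th al be z*gau ((al * Y (fst z)+be * Y (snd z))/ep)) <= C*ep"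
proof -
 interpret mu: prob_space mu using tp by(simp add: tpt_def)
 have si: "igb mu (%u. S (fst u)+S (snd u))"
 by(rule tpt_dom(2)[OF tp]) (auto intro!: abs_of_nonneg add_nonneg_nonneg)
 define C where "C = 2*gslope*(LINT u|mu. S (fst u)+S (snd u))"
 have "C >= 0" unfolding C_def using gslope_pos by(intro mult_nn Bint_nonneg) auto
 moreover have "(LINT z|Lm. Th al be z*gau ((al * Y (fst z)+be * Y (snd z))/ep)) <= C*ep"
 if ab: "al : {0..1}" "be : {0..1}" and ep: "ep > 0" for al be ep
 proof -
 have ab': "|al| <= 1" "|be| <= 1" using ab by auto
 let ?I = "(LINT z|Lm. Th al be z*gau ((al * Y (fst z)+be * Y (snd z))/ep))"
 obtain C1 where C1: "!!w. gmix w <= gslope*|w|" using gmix_linear by blast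
 have "1/(2*ep^2)*?I <= (LINT z|mu. gmix ((al * Y (fst z)+be * Y (snd z))/ep))"
 unfolding lin_Y_gmix(1)[OF N tp ab' ep] using gmix_nonneg by simp
 also have "... <= (LINT u|mu. gslope/ep * (S (fst u)+S (snd u)))"
 proof(rule int_mono[OF lin_Y_gmix(3)[OF N tp ab' ep] i_mult_r[OF si]])
 fix u
 have "|al * Y (fst u)+be * Y (snd u)| <= |al| * S (fst u)+|be| * S (snd u)"
 by(rule otrans[OF abs_triangle_ineq]) (simp add: abs_mult)
 also have "... <= S (fst u)+S (snd u)" using ab' by(intro add_mono) (auto intro: mult_left_le_one_le)
 finally have "gslope*|(al * Y (fst u)+be * Y (snd u))/ep| <= gslope/ep * (S (fst u)+S (snd u))"
 using ep gslope_pos by(simp add: abs_divide divide_right_mono)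
 thus "gmix ((al * Y (fst u)+be * Y (snd u))/ep) <= gslope/ep * (S (fst u)+S (snd u))"
 using C1[of "(al * Y (fst u)+be * Y (snd u))/ep"] by linarith
 qed
 also have "... = C/(2*ep)" unfolding C_def int_mr0 by simp
 finally show ?thesis using ep by(simp add: fs p2es)
 qed
 ultimately show ?thesis by blast
qed

end

text \<open>Following Le Gall, the occupation of the region where the two points lie on different rays is
 controlled by averaging the smoothed local times of all convex combinations of the two coordinates.\<close>

lemma interval_gauss_lower:
 fixes a d ep :: real
 assumes d: "d ~= 0" and ep: "ep > 0" and u: "0 <= - a/d" "- a/d <= 1"
 shows "ennreal (exp (- 1/2) * min 1 (ep /|d| )) <= (\<integral>\<^sup>+v\<in>{0..1}. ennreal (gau ((a+v * d)/ep)) \<partial>lborel)"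
proof -
 define u0 where "u0 = - a/d"
 define h where "h = ep /|d|"
 have h: "h > 0" using d ep by(simp add: h_def)
 define l where "l = max 0 (u0-h)"
 define r where "r = min 1 (u0+h)"
 have u01: "0 <= u0" "u0 <= 1" using u by(auto simp: u0_def)
 \<comment> \<open>The centre \<open>u0\<close> lies in \<open>[0, 1]\<close>, so the part of its
   \<open>h\<close>-neighbourhood inside has length at least \<open>min 1 h\<close>.\<close>
 have lr: "l <= r" "min 1 h <= r-l" "0 <= l" "r <= 1"
 using h u01 unfolding l_def r_def by(auto simp: min_def max_def)
 have "ennreal (exp (- 1/2) * min 1 h) <= ennreal (exp (- 1/2))*ennreal (r-l)"
 using lr h by(subst ennreal_mult[symmetric]) (auto intro!: ennreal_leI)
 also have "... = (NN lborel (%v. ennreal (exp (- 1/2))*ind {l..r} v))"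
 using lr by(simp add: nn_integral_cmult_indicator)
 also have "... <= (\<integral>\<^sup>+v\<in>{0..1}. ennreal (gau ((a+v * d)/ep)) \<partial>lborel)"
 proof(rule nn_integral_mono)
 fix v :: real
 show "ennreal (exp (- 1/2))*ind {l..r} v <= ennreal (gau ((a+v * d)/ep))*ind {0..1} v"
 proof(cases "v : {l..r}")
 case True
 hence v: "|v-u0| <= h" "v : {0..1}" using lr unfolding l_def r_def by auto
 have "(v-u0)*d = a+v * d" using d by(simp add: u0_def distrib_right)
 hence "(a+v * d)/ep = (v-u0)*d/ep" by simp
 hence "|(a+v * d)/ep| = |v-u0| * |d| /ep" using ep by(simp add: abs_mult)
 also have "... <= 1" using v(1) d ep by(simp add: h_def pos_le_divide_eq)
 finally have "((a+v * d)/ep)^2 <= 1" by(simp add: abs_square_le_1)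
 thus ?thesis using True v(2) by(auto intro!: ennreal_leI)
 qed simp
 qed
 finally show ?thesis by(simp add: h_def)
qed

context star
begin

text \<open>On opposite rays the signed coordinates have opposite signs, so some convex combination
  of them is zero; the last two inequalities place its coefficient in \<open>[0, 1]\<close>.\<close>

lemma opposite_Y:
 assumes N: "N = 2" and o: "opposite x y"
 shows "|Y x-Y y| = S x+S y" "Y x-Y y ~= 0" "0 <= - Y y/(Y x-Y y)" "- Y y/(Y x-Y y) <= 1"
proof -
 have S: "S x > 0" "S y > 0" using o S_pos by(auto simp: opposite_def)
 have oo: "x ~= origin e" "y ~= origin e" "idx x ~= idx y" using o by(auto simp: opposite_def)
 have "idx x <= 2" "idx y <= 2" "idx x >= 1" "idx y >= 1" using ray_idx(1)[OF oo(1)] ray_idx(1)[OF oo(2)] N by auto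
 hence "idx x = 1 & idx y = 2 \<or> idx x = 2 & idx y = 1" using oo(3) by linarith
 hence "Y x = S x & Y y = - S y \<or> Y x = - S x & Y y = S y" by(auto simp: Y_def)
 thus "|Y x-Y y| = S x+S y" "Y x-Y y ~= 0" "0 <= - Y y/(Y x-Y y)" "- Y y/(Y x-Y y) <= 1"
 using S by(auto simp: divide_simps)
qed

text \<open>The combination with coefficient v is within \<open>ep\<close> of zero for a share of v
  of order min(1, ep/|D|), where \<open>D\<close> is the difference of the coordinates. Averaging
  the O(ep) bound of \<open>lin_Y_small\<close> over v therefore bounds the occupation integral of
  min(1, ep/|D|) by O(ep); division by \<open>ep\<close> and Fatou's lemma give integrability of
  1/|D|.\<close>

lemma opposite_occupation:
 assumes N: "N = 2" and tp: "tpt 1 x y mu Lm"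
 shows "igb Lm (%z. ind {z. opposite (fst z) (snd z)} z/|Y (fst z)-Y (snd z)| )"
proof -
 interpret Lm: finite_measure Lm using tp by(simp add: tpt_def)
 interpret R: finite_measure "time 0 (1::real)" by(rule fin_time)
 interpret P: pair_sigma_finite "time 0 (1::real)" Lm ..
 define op where "op = {z. opposite (fst z) (snd z)}"
 define D where "D z = Y (fst z)-Y (snd z)" for z
 have opm0: "op : sets (borel >< borel)" using opposite_m unfolding op_def pred_def by(simp add: sp_pair)
 have setsL: "sets Lm = sets (borel >< borel)" using tp by(simp add: tpt_def)
 have opm[measurable]: "op : sets Lm" using opm0 setsL by simp
 have Ym[measurable]: "(%z. Y (fst z)) : bm Lm" "(%z. Y (snd z)) : bm Lm"
 by(rule tpt_m(2)[OF tp]; measurable)+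
 have Dm[measurable]: "D : bm Lm" unfolding D_def[abs_def] by measurable
 obtain C where C: "C >= 0" "!!al be ep. al : {0..1} ==> be : {0..1} ==> ep > 0 ==>
 (LINT z|Lm. Th al be z*gau ((al * Y (fst z)+be * Y (snd z))/ep)) <= C*ep" using lin_Y_small[OF N tp] by blast
 define E where "E ep v z = gau ((Y (snd z)+v * D z)/ep)" for ep v z
 have lin: "v * Y (fst z)+(1-v)*Y (snd z) = Y (snd z)+v * D z" for v z by(simp add: D_def algs)
 have step: "(\<integral>\<^sup>+z\<in>op. ennreal (E ep v z) \<partial>Lm) <= ennreal (2*C*ep)" if v: "v : {0..1}" and ep: "ep > 0" for v ep
 proof -
 have v': "1-v : {0..1}" using v by auto
 have Eb: "bdm Lm (%z. Th v (1-v) z*E ep v z)"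
 by(intro bdm_mult tpt_b(2)[OF tp Th_bdm] bdmI[where c = 1]) (auto simp: E_def[abs_def])
 have nn: "Th v (1-v) z*E ep v z >= 0" for z using v by(intro mult_nn Th_nonneg) (auto simp: E_def)
 \<comment> \<open>With \<open>sg >= 1\<close> this bounds the bracket density of opposite points
   below by 1/2, for every coefficient.\<close>
 have half: "1 <= 2*(v^2+(1-v)^2)" using zero_le_power2[of "2 * v-1"] by(simp add: p2es algs)
 have "(\<integral>\<^sup>+z\<in>op. ennreal (E ep v z) \<partial>Lm) <= (NN Lm (%z. ennreal (2*(Th v (1-v) z*E ep v z))))"
 proof(rule nn_integral_mono)
 fix z
 show "ennreal (E ep v z)*ind op z <= ennreal (2*(Th v (1-v) z*E ep v z))"
 proof(cases "z : op")
 case True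
 hence "~ sray (fst z) (snd z)" by(auto simp: op_def opposite_def sray_def)
 hence "Th v (1-v) z = v^2 * sg (fst z)+(1-v)^2 * sg (snd z)" by(simp add: Th_def)
 also have "... >= v\<^sup>2*1+(1-v)^2*1" using sg_ge_1 by(intro add_mono mlm) auto
 finally have "2*(v^2+(1-v)^2) <= 2*Th v (1-v) z" by simp
 note otrans[OF half this]
 hence "1*E ep v z <= 2*Th v (1-v) z*E ep v z" by(intro mrm) (auto simp: E_def)
 thus ?thesis using True by(auto intro!: ennreal_leI)
 qed simp
 qed
 also have "... = ennreal (LINT z|Lm. 2*(Th v (1-v) z*E ep v z))"
 by(rule nn_eq[OF i_mult_r[OF Lm.bdm_i[OF Eb]]]) (use nn in auto)
 also have "... <= ennreal (2*C*ep)"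
 using C(2)[OF v v' ep] unfolding lin E_def[symmetric] by(auto intro!: ennreal_leI)
 finally show ?thesis .
 qed
 define c where "c = exp (- 1/2 :: real)"
 have cpos: "c > 0" by(simp add: c_def)
 have Em: "(%(v, z). ennreal (E ep v z)*ind op z) : bm (time 0 1 >< Lm)" for ep
 proof -
 have [measurable]: "(%z::real. z) : bm (time 0 1)" by(intro m_restr1) simp
 show ?thesis unfolding E_def by measurable
 qed
 have occ: "(\<integral>\<^sup>+z\<in>op. ennreal (c * min 1 (ep /|D z| )) \<partial>Lm) <= ennreal (2*C*ep)" if ep: "ep > 0" for ep
 proof -
 have "(\<integral>\<^sup>+z\<in>op. ennreal (c * min 1 (ep /|D z| )) \<partial>Lm) <= (NN Lm (%z. (NN (time 0 1) (%v. ennreal (E ep v z)*ind op z))))"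
 proof(rule nn_integral_mono)
 fix z assume "z : space Lm"
 show "ennreal (c * min 1 (ep /|D z| ))*ind op z <= (NN (time 0 1) (%v. ennreal (E ep v z)*ind op z))"
 proof(cases "z : op")
 case True
 hence o: "opposite (fst z) (snd z)" by(simp add: op_def)
 have "ennreal (c * min 1 (ep /|D z| )) <= (\<integral>\<^sup>+v\<in>{0..1}. ennreal (E ep v z) \<partial>lborel)"
 unfolding c_def E_def by(rule interval_gauss_lower) (use opposite_Y[OF N o] ep in "auto simp: D_def")
 also have "... = (NN (time 0 1) (%v. ennreal (E ep v z)))"
 by(rule nn_integral_restrict_space[symmetric]) simp
 finally show ?thesis using True by simp
 qed simp
 qed
 also have "... = (NN (time 0 1) (%v. (NN Lm (%z. ennreal (E ep v z)*ind op z))))"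
 using P.Fubini'[OF Em[of ep]] by simp
 also have "... <= (NN (time 0 (1::real)) (%v. ennreal (2*C*ep)))"
 by(rule nn_integral_mono) (use step[OF _ ep] in "auto simp: sp_restr")
 also have "... = ennreal (2*C*ep)" by(simp add: emeasure_restrict_space sp_restr)
 finally show ?thesis .
 qed
 define h where "h n z = (real n+1) * min 1 (1/(real n+1)/|D z| )*ind op z" for n z
 have hm[measurable]: "h n : bm Lm" for n unfolding h_def[abs_def] by measurable
 have hb: "(NN Lm (%z. ennreal (h n z))) <= ennreal (2*C/c)" for n
 proof -
 define t where "t = (real n+1)/c"
 have t: "t >= 0" using cpos by(simp add: t_def)
 have "(NN Lm (%z. ennreal (h n z))) = (NN Lm (%z. ennreal t*(ennreal (c * min 1 (1/(real n+1)/|D z| ))*ind op z)))"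
 using t cpos by(intro nn_cong) (auto simp: h_def t_def ind_def ennreal_mult[symmetric])
 also have "... = ennreal t*(\<integral>\<^sup>+z\<in>op. ennreal (c * min 1 (1/(real n+1)/|D z| )) \<partial>Lm)"
 by(rule nn_integral_cmult) measurable
 also have "... <= ennreal t*ennreal (2*C*(1/(real n+1)))" by(intro mlm occ) auto
 also have "... = ennreal (2*C/c)" using t C(1) cpos by(subst ennreal_mult[symmetric]) (auto simp: t_def)
 finally show ?thesis .
 qed
 have lim: "(%n. h n z) ----> ind op z/|D z|" for z
 proof(cases "z : op")
 case True
 hence D: "|D z| > 0" using opposite_Y(2)[OF N] by(auto simp: op_def D_def)
 have "\<forall>\<^sub>F n in sequentially. h n z = 1/|D z|"
 using eventually_ge_at_top[of "nat \<lceil>1/|D z|\<rceil>"]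
 proof eventually_elim
 case (elim n)
 hence "1/|D z| <= real n" by linarith
 hence "1 <= (real n+1)*|D z|" using D by(simp add: fs)
 hence "1/(real n+1)/|D z| <= 1" using D by(simp add: fs)
 hence "min 1 (1/(real n+1)/|D z| ) = 1/(real n+1)/|D z|" by(rule min_absorb2)
 thus ?case using True by(simp add: h_def)
 qed
 thus ?thesis using True by(simp add: tendsto_eventually)
 qed (simp add: h_def)
 have "(NN Lm (%z. ennreal (ind op z/|D z| ))) = (NN Lm (%z. liminf (%n. ennreal (h n z))))"
 by(intro nn_cong) (metis lim_imp_Liminf lim tendsto_ennrealI trivial_limit_sequentially)
 also have "... <= liminf (%n. \<integral>\<^sup>+z. ennreal (h n z) \<partial>Lm)" by(rule nn_integral_liminf) measurable
 also have "... <= liminf (%n. ennreal (2*C/c))" by(intro Liminf_mono always_eventually allI hb)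
 also have "... < \<infinity>" by(simp add: Liminf_const)
 finally show ?thesis unfolding op_def[symmetric] D_def[symmetric] by(intro integrableI_nonneg) auto
qed

text \<open>With coefficients 1 and 0 the combination vanishes where the first point is the origin;
  there the Gaussian is 1 and the bracket density at least 1. By \<open>lin_Y_small\<close> such
  pairs have measure at most C*ep for every \<open>ep\<close>. The second point is treated
  alike.\<close>

lemma origin_occupation:
 assumes N: "N = 2" and tp: "tpt 1 x y mu Lm" shows "AE z in Lm. fst z ~= origin e & snd z ~= origin e"
proof -
 interpret Lm: finite_measure Lm using tp by(simp add: tpt_def)
 have setsL: "sets Lm = sets (borel >< borel)" using tp by(simp add: tpt_def)
 have spL: "space Lm = UNIV" using sets_sp[OF setsL] by(simp add: sp_pair)
 obtain C where C: "C >= 0" "!!al be ep. al : {0..1} ==> be : {0..1} ==> ep > 0 ==>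
 (LINT z|Lm. Th al be z*gau ((al * Y (fst z)+be * Y (snd z))/ep)) <= C*ep" using lin_Y_small[OF N tp] by blast
 have null: "AE z in Lm. ~ Q z" if Q: "{z. Q z} : sets Lm" and ab: "al : {0..1}" "be : {0..1}"
 and le: "!!z. Q z ==> al * Y (fst z)+be * Y (snd z) = 0 & Th al be z >= 1" for Q al be
 proof -
 have "measure Lm {z. Q z} <= C*ep" if ep: "ep > 0" for ep
 proof -
 have zm: "(%z. al * Y (fst z)+be * Y (snd z)) : bm Lm" by(rule tpt_m(2)[OF tp]) measurable
 have b: "bdm Lm (%z. Th al be z*gau ((al * Y (fst z)+be * Y (snd z))/ep))"
 using zm by(intro bdm_mult tpt_b(2)[OF tp Th_bdm] bdmI[where c = 1]) auto
 have "measure Lm {z. Q z} = (LINT z|Lm. ind {z. Q z} z)" using Q by simp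
 also have "... <= (LINT z|Lm. Th al be z*gau ((al * Y (fst z)+be * Y (snd z))/ep))"
 proof(rule int_mono)
 show "igb Lm (ind {z. Q z} :: _ => real)" using Q by(simp add: Lm.emeasure_finite less_top[symmetric])
 show "ind {z. Q z} z <= Th al be z*gau ((al * Y (fst z)+be * Y (snd z))/ep)" for z
 using le[of z] Th_nonneg[of al be z] ab by(auto simp: ind_def)
 qed (rule Lm.bdm_i[OF b])
 also have "... <= C*ep" by(rule C(2)[OF ab ep])
 finally show ?thesis .
 qed
 hence le: "measure Lm {z. Q z} <= C*(de /(C+1))" if "de > 0" for de using that C(1) by(simp del: times_divide_eq_right)
 have "measure Lm {z. Q z} <= 0"
 proof(rule field_le_epsilon)
 fix de :: real assume de: "de > 0"
 have "C*(de /(C+1)) <= de" using de C(1) by(simp add: fs)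
 thus "measure Lm {z. Q z} <= 0+de" using le[OF de] by linarith
 qed
 hence "measure Lm {z. Q z} = 0" by(simp add: antisym)
 hence "{z. Q z} : null_sets Lm" using Q by(simp add: null_sets_def Lm.emeasure_eq_measure)
 thus ?thesis by(rule AE_I') (auto simp: spL)
 qed
 have "{z. fst z = origin e} : sets Lm" "{z. snd z = origin e} : sets Lm"
 proof -
 have "{z : space (borel >< borel). fst z = origin e} : sets (borel >< borel)"
 "{z : space (borel >< borel). snd z = origin e} : sets (borel >< borel)" by measurable
 thus "{z. fst z = origin e} : sets Lm" "{z. snd z = origin e} : sets Lm" by(simp_all add: setsL sp_pair)
 qed
 note sets = this
 have Y0: "Y (origin e) = 0" by(simp add: Y_def)
 have "AE z in Lm. fst z ~= origin e" by(rule null[OF sets(1), of 1 0]) (use sg_ge_1 Y0 in "auto simp: Th_def")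
 moreover have "AE z in Lm. snd z ~= origin e" by(rule null[OF sets(2), of 0 1]) (use sg_ge_1 Y0 in "auto simp: Th_def")
 ultimately show ?thesis by eventually_elim simp
qed

text \<open>Smoothed Tanaka formula for the difference \<open>D\<close>, which starts at 0. On a
  common ray its bracket density is zero and pairs at the origin are negligible, so only opposite
  pairs remain. There the Gaussian kernel tends to zero and stays below a multiple of 1/|D|, so that
  dominated convergence gives E|D| = 0.\<close>

theorem two_point_diagonal:
 assumes N: "N = 2" and tp: "tpt 1 x x mu Lm" shows "AE z in mu. fst z = snd z"
proof -
 interpret mu: prob_space mu using tp by(simp add: tpt_def)
 interpret Lm: finite_measure Lm using tp by(simp add: tpt_def)
 define D where "D z = Y (fst z)-Y (snd z)" for z
 define op where "op = {z. opposite (fst z) (snd z)}"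
 have ab: "|1::real| <= 1" "|-1::real| <= 1" by auto
 have lin: "1*Y (fst z) + -1*Y (snd z) = D z" for z by(simp add: D_def)
 have Dm0: "D : bm (borel >< borel)" unfolding D_def[abs_def] by measurable
 note Dm[measurable] = tpt_m[OF tp Dm0]
 have opm0: "op : sets (borel >< borel)" using opposite_m unfolding op_def pred_def by(simp add: sp_pair)
 have opm[measurable]: "op : sets Lm" using opm0 tp by(simp add: tpt_def)
 have Di: "igb mu D" using lin_Y_gmix(2)[OF N tp ab, of 1] unfolding lin by(simp add: eta_contract_eq)
 note Thb = tpt_b(2)[OF tp Th_bdm, of 1 "-1"]
 obtain K where K: "K >= 0" "!!z. z : space Lm ==> |Th 1 (-1) z| <= K" using bdm_bound[OF Thb] by blast
 note [measurable] = bdm_m[OF Thb]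
 define q where "q n z = ind op z*Th 1 (-1) z*((real n+1)*gau (D z*(real n+1)))" for n z
 obtain C where C: "C >= 0" "!!w. gslope*|w|-C <= gmix w" using gmix_linear by blast
 have main: "gslope*(LINT z|mu. |D z| ) <= C*(1/(real n+1))+1/2*(LINT z|Lm. q n z)" for n
 proof -
 define ep where "ep = 1/(real n+1)"
 have ep: "ep > 0" by(simp add: ep_def)
 have inv: "D z/ep = D z*(real n+1)" for z by(simp add: ep_def)
 have gi: "igb mu (%z. gmix (D z/ep))" using lin_Y_gmix(3)[OF N tp ab ep] unfolding lin .
 have "(LINT z|mu. gslope/ep * |D z|-C) <= (LINT z|mu. gmix (D z/ep))"
 proof(rule int_mono[OF _ gi])
 show "igb mu (%z. gslope/ep * |D z|-C)" using Di by simp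
 show "gslope/ep * |D z|-C <= gmix (D z/ep)" for z using C(2)[of "D z/ep"] ep by(simp add: abs_divide)
 qed
 also have "... = 1/(2*ep^2)*(LINT z|Lm. Th 1 (-1) z*gau (D z/ep))"
 using lin_Y_gmix(1)[OF N tp ab ep] unfolding lin by simp
 also have "(LINT z|Lm. Th 1 (-1) z*gau (D z/ep)) = (LINT z|Lm. ep * q n z)"
 proof(rule int_cong_AE)
 show "AE z in Lm. Th 1 (-1) z*gau (D z/ep) = ep * q n z" using origin_occupation[OF N tp]
 proof eventually_elim
 case (elim z)
 show ?case
 proof(cases "z : op")
 case True
 thus ?thesis by(simp add: q_def inv) (simp add: ep_def)
 next
 case False
 hence "sray (fst z) (snd z)" using elim by(auto simp: op_def opposite_def sray_def)
 hence "Th 1 (-1) z = 0" by(simp add: Th_def sray_sg)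
 thus ?thesis using False by(simp add: q_def)
 qed
 qed
 show "(%z. ep * q n z) : bm Lm" unfolding q_def[abs_def] by measurable
 qed measurable
 finally have "gslope/ep * (LINT z|mu. |D z| )-C <= 1/(2*ep)*(LINT z|Lm. q n z)"
 using Di ep by(simp add: mu.prob_space p2es)
 hence "ep * (gslope/ep * (LINT z|mu. |D z| )-C) <= ep * (1/(2*ep)*(LINT z|Lm. q n z))"
 using ep by(intro mlm) auto
 thus ?thesis using ep by(simp add: right_diff_distrib) (simp add: ep_def)
 qed
 have qlim: "(%n. (LINT z|Lm. q n z)) ----> (LINT z|Lm. 0)"
 proof(rule dom_conv[where w = "%z. K*(ind op z/|D z| )"])
 show "igb Lm (%z. K*(ind op z/|D z| ))"
 using opposite_occupation[OF N tp] unfolding op_def D_def by(rule i_mult_r)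
 show "q n : bm Lm" for n unfolding q_def[abs_def] by measurable
 have key: "t*gau (d*t) <= 2/(d^2*t)" if "d ~= 0" "t > 0" for d t :: real
 proof -
 have "(d*t)^2/2 <= exp ((d*t)^2/2)" using exp_ge1[of "(d*t)^2/2"] by linarith
 hence "gau (d*t) <= 2/(d*t)^2" using that by(simp add: exp_minus fs)
 hence "t*gau (d*t) <= t*(2/(d*t)^2)" using that by(intro mlm) auto
 also have "... = 2/(d^2*t)" using that by(simp add: p2es)
 finally show ?thesis .
 qed
 show "AE z in Lm. (%n. q n z) ----> 0"
 proof(rule AE_I2)
 fix z
 show "(%n. q n z) ----> 0"
 proof(cases "z : op")
 case True
 hence D: "D z ~= 0" using opposite_Y(2)[OF N] by(auto simp: op_def D_def)
 have "(%n. (real n+1)*gau (D z*(real n+1))) ----> 0"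
 proof(rule tendsto_sandwich[OF _ _ t_const])
 show "\<forall>\<^sub>F n in sequentially. (real n+1)*gau (D z*(real n+1)) <= 2/((D z)^2*(real n+1))"
 by(intro always_eventually allI key D) simp
 have "(%n. 2/(D z)^2*inverse (real (Suc n))) ----> 2/(D z)^2*0"
 by(intro t_mult t_const LIMSEQ_inverse_real_of_nat)
 thus "(%n. 2/((D z)^2*(real n+1))) ----> 0" by(simp add: fs)
 qed simp
 from t_mult[OF t_const[of "ind op z*Th 1 (-1) z"] this] show ?thesis by(simp add: q_def)
 qed (simp add: q_def)
 qed
 show "AE z in Lm. norm (q n z) <= K*(ind op z/|D z| )" for n
 proof(rule AE_I2)
 fix z assume z: "z : space Lm"
 show "norm (q n z) <= K*(ind op z/|D z| )"
 proof(cases "z : op")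
 case True
 hence D: "|D z| > 0" using opposite_Y(2)[OF N] by(auto simp: op_def D_def)
 \<comment> \<open>The bound \<open>w*gau w <= 1\<close> is what yields the dominating function
   1/|D|.\<close>
 define w where "w = |D z| * (real n+1)"
 have "w <= 1+w^2/2" using zero_le_power2[of "w-1"] by(simp add: power2_diff)
 also have "... <= exp (w^2/2)" by(rule exp_ge1)
 finally have "w*gau w <= 1" by(simp add: exp_minus fs)
 moreover have "w^2 = (D z*(real n+1))^2" by(simp add: w_def pmd)
 ultimately have "|D z| * ((real n+1)*gau (D z*(real n+1))) <= 1" by(simp add: w_def massoc)
 hence "(real n+1)*gau (D z*(real n+1)) <= 1/|D z|" using D by(simp add: pos_le_divide_eq mcomm)
 hence "|Th 1 (-1) z| * ((real n+1)*gau (D z*(real n+1))) <= K*(1/|D z| )"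
 using K(1) K(2)[OF z] by(intro mult_mono) auto
 thus ?thesis using True by(simp add: q_def abs_mult)
 qed (simp add: q_def)
 qed
 qed measurable
 have clim: "(%n. C*(1/(real n+1))) ----> C*0"
 proof(rule t_mult[OF t_const])
 have "1/(real n+1) = inverse (real (Suc n))" for n by(simp add: inverse_eq_divide add.commute)
 thus "(%n. 1/(real n+1)) ----> 0" using LIMSEQ_inverse_real_of_nat by simp
 qed
 have "(%n. C*(1/(real n+1))+1/2*(LINT z|Lm. q n z)) ----> C*0+1/2*(LINT z|Lm. 0)"
 by(rule tendsto_add[OF clim t_mult[OF t_const qlim]])
 hence "gslope*(LINT z|mu. |D z| ) <= C*0+1/2*(LINT z|Lm. 0)" by(rule LIMSEQ_le_const) (use main in blast)
 hence "(LINT z|mu. |D z| ) <= 0" using gslope_pos by(simp add: mult_le_0_iff)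
 hence "(LINT z|mu. |D z| ) = 0" by(intro antisym Bint_nonneg) auto
 hence "AE z in mu. |D z| = 0" using int_0_AE[of mu "%z. |D z|"] Di by simp
 thus ?thesis
 proof eventually_elim
 case (elim z)
 hence eq: "Y (fst z) = Y (snd z)" by(simp add: D_def)
 hence "S (fst z) = S (snd z)" using abs_Y by metis
 moreover have "fst z = origin e <-> snd z = origin e"
 using `S (fst z) = S (snd z)` S_pos[of "fst z"] S_pos[of "snd z"] S_origin by force
 moreover have "idx (fst z) = idx (snd z)" if o: "fst z ~= origin e" "snd z ~= origin e"
 using opposite_Y(2)[OF N, of "fst z" "snd z"] eq o by(auto simp: opposite_def)
 ultimately show ?case using ray_idx(3)[of "fst z"] ray_idx(3)[of "snd z"] p01(1)[OF ray_idx(1)[of "fst z"]]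
 by(cases "fst z = origin e") (auto simp: S_no)
 qed
qed

end

section \<open>Occupation near the origin\<close>

text \<open>\<open>h\<close> lies strictly between both rates and 1. \<open>A\<close> is large
  enough to start the induction and to absorb the inhomogeneous term at each step.\<close>

lemma geometric_recurrence_tendsto_0:
 fixes w :: "nat => real"
 assumes c: "0 <= c" "c < 1" and d: "0 <= d" "d < 1" and B: "B >= 0" and w: "!!n. w n >= 0"
 and rec: "!!n. w (Suc n) <= c*w n+B*d ^ n" shows "w ----> 0"
proof -
 obtain h where h: "max c d < h" "h < 1" using dense[of "max c d" 1] c d by auto
 define A where "A = max (w 0) (B/(h-c))"
 have "B/(h-c) <= A" by(simp add: A_def)
 hence A: "B <= A*(h-c)" using h by(simp add: pos_divide_le_eq)
 have bound: "w n <= A*h ^ n" for n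
 proof(induction n)
 case 0 thus ?case by(simp add: A_def)
 next
 case (Suc n)
 have "w (Suc n) <= c*(A*h ^ n)+B*h ^ n"
 using rec[of n] mlm[OF Suc.IH c(1)] mlm[OF pow_mono[of d h n] B] h d by auto
 also have "... = (c*A+B)*h ^ n" by(simp add: algs)
 also have "... <= (A*h)*h ^ n" using A h c by(intro mrm) (auto simp: algs)
 finally show ?case by simp
 qed
 have "(%n. A*h ^ n) ----> A*0" using h c by(intro t_mult t_const LIMSEQ_power_zero) auto
 hence "(%n. A*h ^ n) ----> 0" by simp
 thus ?thesis by(rule tendsto_sandwich[OF _ _ t_const, rotated 2]) (auto simp: w bound)
qed

context star
begin

text \<open>The graph distance in the coordinate \<open>S\<close>; when one point is the origin, the
  second branch gives the coordinate of the other.\<close>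

definition rdist :: "'g*'g => real" where
 "rdist z = (if sray (fst z) (snd z) then |S (fst z)-S (snd z)| else S (fst z)+S (snd z))"

text \<open>The centred indicator of ray k. Summing to zero over the rays makes
  \<open>sinS (wk k)\<close> a test function; as k varies, the weights represent the projection
  orthogonal to constants, which tells equal rays from different ones.\<close>

definition wk :: "nat => nat => real" where "wk k i = (if i = k then 1 else 0)-1/real N"

lemma wk_sum: "k : {1..N} ==> (SUM i:{1..N}. wk k i) = 0" using N2 by(simp add: wk_def sum_subtractf)

lemma wk_prod_sum:
 assumes "i : {1..N}" "j : {1..N}" shows "(SUM k:{1..N}. wk k i*wk k j) = (if i = j then 1 else 0)-1/real N"
proof -
 have "wk k i*wk k j = (if k = i then (if i = j then 1 else 0) else 0)-(if k = i then 1/real N else 0)-(if k = j then 1/real N else 0)+1/(real N*real N)" for k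
 by(auto simp: wk_def algs)
 thus ?thesis using assms N2 by(simp add: sum.distrib sum_subtractf)
qed

text \<open>Occupation near the origin: the equation for \<open>exp (- l R\<^sup>2)\<close>, with \<open>R\<close> the distance of the pair to the
 origin, compares the Laplace transform of the occupation measure at two scales by convexity.\<close>

lemma gaussS_prod: "gaussS l x*gaussS l y = exp (- (l*((rad x)^2+(rad y)^2)))"
 by(simp add: gaussS_def exp_add[symmetric] algs)

lemma gaussS_bdm: "l >= 0 ==> bdm (borel >< borel) (%z. gaussS l (fst z)*gaussS l (snd z))"
 using gaussS_test[of l] unfolding stest_def by(intro bdm_mult bdm_fs) auto

lemma occupation_scales:
 assumes rh: "0 <= rh" and tp: "tpt rh (origin e) (origin e) mu Lm" and lm: "0 < m" "m < l"
 shows "(LINT z|Lm. gaussS l (fst z)*gaussS l (snd z)) <= 1/(2*l) +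
 (1+rh)*(l/(l-m))*((LINT z|Lm. gaussS m (fst z)*gaussS m (snd z))-(LINT z|Lm. gaussS l (fst z)*gaussS l (snd z)))"
proof -
 interpret mu: prob_space mu using tp by(simp add: tpt_def)
 interpret Lm: finite_measure Lm using tp by(simp add: tpt_def)
 define E where "E l z = gaussS l (fst z)*gaussS l (snd z)" for l and z :: "'g*'g"
 define R where "R z = (rad (fst z))^2+(rad (snd z))^2" for z :: "'g*'g"
 have E: "E l z = exp (- (l * R z))" for l z by(simp add: E_def R_def gaussS_prod)
 have l0: "l >= 0" "l > 0" using lm by auto
 have Eb: "bdm Lm (E k)" if "k >= 0" for k unfolding E_def[abs_def] by(rule tpt_b(2)[OF tp gaussS_bdm[OF that]])
 have Ei: "igb Lm (E l)" "igb Lm (E m)" using lm by(auto intro!: Lm.bdm_i Eb)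
 note tp' = tp[unfolded tpt_def, THEN conjunct2, THEN conjunct2, THEN conjunct2, THEN conjunct2, rule_format]
 let ?A = "%z. 1/2*((4*l^2*(rad (fst z))^2-2*l)*gaussS l (fst z)*gaussS l (snd z))+1/2*(gaussS l (fst z)*((4*l^2*(rad (snd z))^2-2*l)*gaussS l (snd z))) +
 rh * (SUM i:{1..N}. (ind (ray e i) (fst z)*gaussS1 l (fst z))*(ind (ray e i) (snd z)*gaussS1 l (snd z)))"
 define q where "q = (1+rh)*(l/(l-m))"
 \<comment> \<open>The cross term is bounded by 2ab <= a^2+b^2, leaving a multiple of
   \<open>l * R z*E l z\<close>, which is then replaced by a difference of two scales.\<close>
 have Abd: "?A z <= 2*l*q*(E m z-E l z)-2*l*E l z" for z
 proof -
 have "(SUM i:{1..N}. (ind (ray e i) (fst z)*gaussS1 l (fst z))*(ind (ray e i) (snd z)*gaussS1 l (snd z)))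
 = (if sray (fst z) (snd z) then gaussS1 l (fst z)*gaussS1 l (snd z) else 0)" by(rule ray_sum) auto
 also have "... <= 2*l^2 * R z*E l z"
 proof -
 have "gaussS1 l (fst z)*gaussS1 l (snd z) = 2*l^2*(2*rad (fst z)*rad (snd z))*E l z"
 by(simp add: gaussS1_def E_def p2es)
 also have "... <= 2*l^2 * R z*E l z" using zero_le_power2[of "rad (fst z)-rad (snd z)"]
 by(intro mrm mlm) (auto simp: E R_def power2_diff)
 finally show ?thesis by(auto simp: E R_def)
 qed
 finally have "?A z <= 1/2*((4*l^2*(rad (fst z))^2-2*l)*gaussS l (fst z)*gaussS l (snd z))+1/2*(gaussS l (fst z)*((4*l^2*(rad (snd z))^2-2*l)*gaussS l (snd z)))+rh * (2*l^2 * R z*E l z)"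
 using rh by(intro add_mono mlm order_refl) auto
 also have "... = 2*l*(1+rh)*(l * R z*E l z)-2*l*E l z" by(simp add: E_def R_def fs p2es)
 also have "l * R z*E l z <= l/(l-m)*(E m z-E l z)"
 proof -
 \<comment> \<open>The inequality 1+x <= exp x at x = (l-m)*R trades the factor \<open>R\<close> for
   the smaller scale parameter \<open>m\<close>.\<close>
 have "E m z = E l z*exp ((l-m) * R z)" by(simp add: E exp_add[symmetric] algs)
 moreover have "E l z*(1+(l-m) * R z) <= E l z*exp ((l-m) * R z)" by(intro mlm exp_ge1) (simp add: E)
 ultimately have "(l-m)*(R z*E l z) <= E m z-E l z" by(simp add: algs)
 hence "R z*E l z <= (E m z-E l z)/(l-m)" using lm by(simp add: pos_le_divide_eq mcomm)
 hence "l*(R z*E l z) <= l*((E m z-E l z)/(l-m))" using l0 by(intro mlm)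
 thus ?thesis by(simp add: massoc)
 qed
 hence "2*l*(1+rh)*(l * R z*E l z)-2*l*E l z <= 2*l*(1+rh)*(l/(l-m)*(E m z-E l z))-2*l*E l z"
 using rh l0 by(intro diff_right_mono mlm) auto
 finally show ?thesis by(simp add: q_def massoc)
 qed
 \<comment> \<open>Positivity is all that is kept of the final law; the 1 below comes from the start
   at the origin.\<close>
 have "0 <= (LINT z|mu. gaussS l (fst z)*gaussS l (snd z))" by(intro Bint_nonneg) (simp add: gaussS_def)
 also have "... = 1+(LINT z|Lm. ?A z)"
 unfolding tp'[OF gaussS_test[OF l0(1)] gaussS_test[OF l0(1)]] by(simp add: gaussS_def)
 also have "(LINT z|Lm. ?A z) <= (LINT z|Lm. 2*l*q*(E m z-E l z)-2*l*E l z)"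
 proof(rule int_mono[OF _ _ Abd])
 have gb: "bdm borel (gaussS l)" "bdm borel (gaussS1 l)" "bdm borel (%x. (4*l^2*(rad x)^2-2*l)*gaussS l x)"
 using gaussS_test[OF l0(1)] by(auto simp: stest_def)
 have ind: "bdm borel (ind (ray e i) :: 'g => real)" if "i : {1..N}" for i
 using that by(intro bdmI[where c = 1]) (auto simp: ind_def)
 show "igb Lm ?A" by(rule Lm.bdm_i, rule tpt_b(2)[OF tp],
 intro bdm_add bdm_cmult bdm_sum bdm_mult[OF bdm_fs(1)[OF gb(3)] bdm_fs(2)[OF gb(1)]]
 bdm_mult[OF bdm_fs(1)[OF gb(1)] bdm_fs(2)[OF gb(3)]]
 bdm_mult[OF bdm_fs(1)[OF bdm_mult[OF ind]] bdm_fs(2)[OF bdm_mult[OF ind]]] gb)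
 qed (use Ei in simp)
 also have "... = 2*l*q*((LINT z|Lm. E m z)-(LINT z|Lm. E l z))-2*l*(LINT z|Lm. E l z)" using Ei by simp
 finally have "2*l*(LINT z|Lm. E l z) <= 1+2*l*q*((LINT z|Lm. E m z)-(LINT z|Lm. E l z))" by simp
 hence "(LINT z|Lm. E l z) <= (1+2*l*q*((LINT z|Lm. E m z)-(LINT z|Lm. E l z)))/(2*l)"
 using l0 by(simp add: pos_le_divide_eq mcomm)
 thus ?thesis unfolding q_def[symmetric] E_def using l0 by(simp add: add_divide_distrib)
qed

text \<open>Along the scales k^(2n) the comparison is a linear recurrence for k^n times the Laplace
  transform, of rate q*k/(1+q). The rate is below 1 when q*(k-1) < 1; as k tends to 1 the left side
  tends to (1+rh)/2, so any correlation below 1 leaves room, and k = 1+(1-rh)/4 is an explicit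
  choice. The conclusion says that the transform at l is o(l^(-1/2)) along these scales, which
  matches the factor 1/ep in \<open>two_point_separation\<close>.\<close>

lemma occupation_decay:
 assumes rh: "0 <= rh" "rh < 1" and tp: "tpt rh (origin e) (origin e) mu Lm"
 obtains k where "k > 1" "(%n. k ^ n*(LINT z|Lm. gaussS (k ^ (2*n)) (fst z)*gaussS (k ^ (2*n)) (snd z))) ----> 0"
proof -
 define \<psi> where "\<psi> l = (LINT z|Lm. gaussS l (fst z)*gaussS l (snd z))" for l
 have \<psi>0: "\<psi> l >= 0" for l unfolding \<psi>_def by(intro Bint_nonneg) (simp add: gaussS_def)
 define et where "et = (1-rh)/4"
 define k where "k = 1+et"
 have et: "et > 0" "rh = 1-4*et" using rh unfolding et_def by(simp_all add: fs)
 have k: "k > 1" using et by(simp add: k_def)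
 have k2: "k^2 > 1" using k by(simp add: one_less_power)
 define q where "q = (1+rh)*(k^2/(k^2-1))"
 have q0: "q >= 0" unfolding q_def using rh k2 by(intro mult_nn divide_nonneg_nonneg) auto
 have "(1+rh) * k^2 < k+1"
 proof -
 have "(1+rh) * k^2 = 2-6*et^2-4*et ^ 3" by(simp add: et(2) k_def p2es power3_eq_cube algs)
 also have "... < 2+et" using et(1) zero_le_power2[of et] zero_less_power[OF et(1), of 3] by linarith
 finally show ?thesis by(simp add: k_def)
 qed
 moreover have "q*(k-1)*(k+1) = (1+rh) * k^2"
 proof -
 have "(k-1)*(k+1) = k^2-1" by(simp add: p2es algs)
 thus ?thesis using k2 by(simp add: q_def massoc)
 qed
 ultimately have "q*(k-1)*(k+1) < 1*(k+1)" by simp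
 hence qk: "q*(k-1) < 1" using k by(simp add: mult_less_cancel_right)
 define c where "c = q * k/(1+q)"
 have c: "0 <= c" "c < 1" using q0 k qk by(auto simp: c_def algs)
 define w where "w n = k ^ n*\<psi> (k ^ (2*n))" for n
 have "w ----> 0"
 proof(rule geometric_recurrence_tendsto_0[OF c, where d = "1 /k" and B = 1])
 show "w n >= 0" for n using \<psi>0 k by(simp add: w_def)
 fix n
 define m where "m = k ^ (2*n)"
 define l where "l = k ^ (2*Suc n)"
 have m: "m > 0" using k by(simp add: m_def)
 have l: "l = k^2 * m" by(simp add: l_def m_def p2es)
 have ml: "m < l" using m k2 by(simp add: l)
 have frac: "l/(l-m) = k^2/(k^2-1)"
 proof -
 have "l-m = (k^2-1) * m" by(simp add: l algs)
 thus ?thesis using m by(simp add: l)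
 qed
 have "\<psi> l <= 1/(2*l)+q*(\<psi> m-\<psi> l)"
 using occupation_scales[OF rh(1) tp m ml] unfolding \<psi>_def[symmetric] frac q_def .
 hence "(1+q)*\<psi> l <= 1/(2*l)+q*\<psi> m" by(simp add: algs)
 hence "\<psi> l <= (1/(2*l)+q*\<psi> m)/(1+q)" using q0 by(simp add: pos_le_divide_eq mcomm)
 hence "k ^ Suc n*\<psi> l <= k ^ Suc n*((1/(2*l)+q*\<psi> m)/(1+q))" using k by(intro mlm) auto
 also have "... = c*(k ^ n*\<psi> m)+k ^ Suc n/(2*l)/(1+q)"
 by(simp add: c_def add_divide_distrib distrib_left)
 also have "k ^ Suc n/(2*l)/(1+q) <= 1*(1 /k) ^ n"
 proof -
 have "l = k ^ Suc n*(k ^ n * k)" unfolding l_def by(simp add: power_add[symmetric] mult_2)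
 hence "k ^ Suc n/(2*l) = 1/(2*(k ^ n * k))" using k by simp
 also have "... <= 1 /k ^ n" using k by(intro divide_left_mono) auto
 finally have "k ^ Suc n/(2*l)/(1+q) <= 1 /k ^ n/1" by(rule frac_le[rotated]) (use q0 k in auto)
 thus ?thesis by(simp add: power_one_over)
 qed
 finally show "w (Suc n) <= c*w n+1*(1 /k) ^ n" by(simp add: w_def l_def m_def)
 qed (use k in auto)
 thus ?thesis using that[OF k] by(simp add: w_def[abs_def] \<psi>_def)
qed

text \<open>The two-point equation for 2/N*(1-cos*cos) minus twice the sum over k of the products of
  sines with weights \<open>wk k\<close>. On different rays this depends on the sum of the
  coordinates alone; on a common ray the difference has weight 1 and the sum weight -(1-2/N). After
  smoothing, the left side is therefore the mean of \<open>rdist\<close> minus (1-2/N) times the sum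
  of the coordinates.\<close>

lemma separation_identity:
 assumes tp: "tpt rh (origin e) (origin e) mu Lm"
 shows "(LINT z|mu. ((if sray (fst z) (snd z) then 1 else 0)*(1-cos (xi * (S (fst z)-S (snd z))))
 + (if sray (fst z) (snd z) then-(1-2/real N) else 2/real N)*(1-cos (xi * (S (fst z)+S (snd z))))))
 = 1/2*xi^2*(LINT z|Lm. ((if sray (fst z) (snd z) then 2*(1-rh) * sg (fst z) else 0)*cos (xi * (S (fst z)-S (snd z)))
 + (if sray (fst z) (snd z) then-(2*(1-2/real N)*(1+rh) * sg (fst z)) else 2/real N*(sg (fst z)+sg (snd z)))
 * cos (xi * (S (fst z)+S (snd z)))))"
proof -
 interpret mu: prob_space mu using tp by(simp add: tpt_def)
 interpret Lm: finite_measure Lm using tp by(simp add: tpt_def)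
 have N0: "real N > 0" using N2 by simp
 note tp' = tp[unfolded tpt_def, THEN conjunct2, THEN conjunct2, THEN conjunct2, THEN conjunct2, rule_format]
 define Ac where "Ac z = 1/2*(- (xi^2 * sg (fst z)*cosS xi (fst z))*cosS xi (snd z))+1/2*(cosS xi (fst z)*- (xi^2 * sg (snd z)*cosS xi (snd z))) +
 rh * (SUM i:{1..N}. (ind (ray e i) (fst z)*cosS1 xi (fst z))*(ind (ray e i) (snd z)*cosS1 xi (snd z)))" for z :: "'g*'g"
 define As where "As k z = 1/2*(- (xi^2 * sg (fst z) * sinS (wk k) xi (fst z)) * sinS (wk k) xi (snd z))+1/2*(sinS (wk k) xi (fst z)*- (xi^2 * sg (snd z) * sinS (wk k) xi (snd z))) +
 rh * (SUM i:{1..N}. (ind (ray e i) (fst z) * sinS1 (wk k) xi (fst z))*(ind (ray e i) (snd z) * sinS1 (wk k) xi (snd z)))" for k and z :: "'g*'g"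
 have bc: "bdm borel (cosS xi)" "bdm borel (cosS1 xi)" using cosS_test[of xi] by(auto simp: stest_def)
 have bs: "bdm borel (sinS (wk k) xi)" "bdm borel (sinS1 (wk k) xi)" if "k : {1..N}" for k
 using sinS_test[OF wk_sum[OF that], of xi] by(auto simp: stest_def)
 have ind: "bdm borel (ind (ray e i) :: 'g => real)" if "i : {1..N}" for i
 using that by(intro bdmI[where c = 1]) (auto simp: ind_def)
 have gen: "bdm (borel >< borel) (%z. 1/2*(- (xi^2 * sg (fst z)*f (fst z))*f (snd z))+1/2*(f (fst z)*- (xi^2 * sg (snd z)*f (snd z))) +
 rh * (SUM i:{1..N}. (ind (ray e i) (fst z)*f1 (fst z))*(ind (ray e i) (snd z)*f1 (snd z))))"
 if b: "bdm borel f" "bdm borel f1" for f f1 :: "'g => real"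
 proof -
 have m: "bdm borel (%x. - (xi^2 * sg x*f x))"
 using bdm_cmult[OF bdm_mult[OF bdm_cmult[OF sg_bdm] b(1)], of "-1"] by simp
 show ?thesis by(intro bdm_add bdm_cmult bdm_sum bdm_mult[OF bdm_fs(1)[OF m] bdm_fs(2)[OF b(1)]]
 bdm_mult[OF bdm_fs(1)[OF b(1)] bdm_fs(2)[OF m]]
 bdm_mult[OF bdm_fs(1)[OF bdm_mult[OF ind]] bdm_fs(2)[OF bdm_mult[OF ind]]] b)
 qed
 have Aci: "igb Lm Ac" unfolding Ac_def[abs_def] by(intro Lm.bdm_i tpt_b(2)[OF tp] gen bc)
 have Asi: "igb Lm (As k)" if "k : {1..N}" for k
 unfolding As_def[abs_def] by(intro Lm.bdm_i tpt_b(2)[OF tp] gen bs that)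
 have ci: "igb mu (%z. cosS xi (fst z)*cosS xi (snd z))" by(intro mu.bdm_i tpt_b(1)[OF tp] bdm_mult bdm_fs bc)
 have si: "igb mu (%z. sinS (wk k) xi (fst z) * sinS (wk k) xi (snd z))" if "k : {1..N}" for k
 by(intro mu.bdm_i tpt_b(1)[OF tp] bdm_mult bdm_fs bs that)
 define cc where "cc z = cos (xi * S (fst z))*cos (xi * S (snd z))" for z :: "'g*'g"
 define ss where "ss z = sin (xi * S (fst z)) * sin (xi * S (snd z))" for z :: "'g*'g"
 have Cm: "cos (xi * (S (fst z)-S (snd z))) = cc z+ss z" for z by(simp add: cc_def ss_def cos_diff right_diff_distrib)
 have Cp: "cos (xi * (S (fst z)+S (snd z))) = cc z-ss z" for z by(simp add: cc_def ss_def cos_add distrib_left)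
 have sum_s: "(SUM k:{1..N}. sinS (wk k) xi (fst z) * sinS (wk k) xi (snd z)) = ((if sray (fst z) (snd z) then 1 else 0)-1/real N) * ss z" for z
 proof(cases "fst z = origin e \<or> snd z = origin e")
 case False
 have "(SUM k:{1..N}. sinS (wk k) xi (fst z) * sinS (wk k) xi (snd z)) = (SUM k:{1..N}. wk k (idx (fst z))*wk k (idx (snd z))) * ss z"
 unfolding sum_distrib_right by(rule sum.cong) (simp_all add: sinS_def ss_def mult_ac)
 thus ?thesis using False wk_prod_sum[of "idx (fst z)" "idx (snd z)"] ray_idx(1) by(simp add: sray_def)
 qed (auto simp: sinS_def ss_def)
 have sum_s1: "(SUM k:{1..N}. sinS1 (wk k) xi (fst z) * sinS1 (wk k) xi (snd z)) = (1-1/real N)*(xi^2 * sg (fst z)*cc z)" if s: "sray (fst z) (snd z)" for z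
 proof -
 have i: "idx (fst z) : {1..N}" using s ray_idx(1) by(simp add: sray_def)
 have "(SUM k:{1..N}. sinS1 (wk k) xi (fst z) * sinS1 (wk k) xi (snd z)) = (SUM k:{1..N}. wk k (idx (fst z))*wk k (idx (fst z)))*(xi^2 * sg (fst z)*cc z)"
 unfolding sum_distrib_right by(rule sum.cong) (simp_all add: same_sin[OF s] cc_def p2es)
 thus ?thesis unfolding wk_prod_sum[OF i i] by simp
 qed
 have rc: "(SUM i:{1..N}. (ind (ray e i) a*cosS1 xi a)*(ind (ray e i) b*cosS1 xi b)) = (if sray a b then cosS1 xi a*cosS1 xi b else 0)"
 and rs: "(SUM i:{1..N}. (ind (ray e i) a * sinS1 w xi a)*(ind (ray e i) b * sinS1 w xi b)) = (if sray a b then sinS1 w xi a * sinS1 w xi b else 0)" for a b w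
 by(rule ray_sum; simp)+
 have Ac': "Ac z = - (1/2)*xi^2*(sg (fst z)+sg (snd z))*cc z+rh * (if sray (fst z) (snd z) then xi\<^sup>2 * sg (fst z) * ss z else 0)" for z
 unfolding Ac_def rc by(simp add: cosS_def cc_def ss_def same_cos p2es algs)
 have As': "(SUM k:{1..N}. As k z) = - (1/2)*xi^2*(sg (fst z)+sg (snd z))*(((if sray (fst z) (snd z) then 1 else 0)-1/real N) * ss z)
 + rh * (if sray (fst z) (snd z) then (1-1/real N)*(xi^2 * sg (fst z)*cc z) else 0)" for z
 proof -
 have "As k z = - (1/2)*xi^2*(sg (fst z)+sg (snd z))*(sinS (wk k) xi (fst z) * sinS (wk k) xi (snd z))
 + rh * (if sray (fst z) (snd z) then sinS1 (wk k) xi (fst z) * sinS1 (wk k) xi (snd z) else 0)" for k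
 unfolding As_def rs by(simp add: algs)
 hence "(SUM k:{1..N}. As k z) = - (1/2)*xi^2*(sg (fst z)+sg (snd z))*(SUM k:{1..N}. sinS (wk k) xi (fst z) * sinS (wk k) xi (snd z))
 + rh * (if sray (fst z) (snd z) then (SUM k:{1..N}. sinS1 (wk k) xi (fst z) * sinS1 (wk k) xi (snd z)) else 0)"
 by(cases "sray (fst z) (snd z)") (simp_all only: sum.distrib sdl if_True if_False mult_zero_right sum.neutral_const)
 thus ?thesis unfolding sum_s using sum_s1[of z] by simp
 qed
 have "(LINT z|mu. ((if sray (fst z) (snd z) then 1 else 0)*(1-cos (xi * (S (fst z)-S (snd z))))
 + (if sray (fst z) (snd z) then-(1-2/real N) else 2/real N)*(1-cos (xi * (S (fst z)+S (snd z))))))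
 = (LINT z|mu. 2/real N*(1-cosS xi (fst z)*cosS xi (snd z))-2*(SUM k:{1..N}. sinS (wk k) xi (fst z) * sinS (wk k) xi (snd z)))"
 unfolding sum_s Cm Cp by(intro Bint_cong) (auto simp: cosS_def cc_def[symmetric] algs diff_divide_distrib)
 also have "... = 2/real N*(1-(LINT z|mu. cosS xi (fst z)*cosS xi (snd z)))-2*(SUM k:{1..N}. (LINT z|mu. sinS (wk k) xi (fst z) * sinS (wk k) xi (snd z)))"
 using ci si by(subst Bint_diff) (auto simp: mu.prob_space)
 also have "(LINT z|mu. cosS xi (fst z)*cosS xi (snd z)) = 1+(LINT z|Lm. Ac z)"
 unfolding tp'[OF cosS_test[of xi] cosS_test[of xi]] Ac_def by(simp add: cosS_def)
 also have "(SUM k:{1..N}. (LINT z|mu. sinS (wk k) xi (fst z) * sinS (wk k) xi (snd z))) = (SUM k:{1..N}. (LINT z|Lm. As k z))"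
 proof(rule sum.cong[OF refl])
 fix k assume k: "k : {1..N}"
 show "(LINT z|mu. sinS (wk k) xi (fst z) * sinS (wk k) xi (snd z)) = (LINT z|Lm. As k z)"
 unfolding tp'[OF sinS_test[OF wk_sum[OF k], of xi] sinS_test[OF wk_sum[OF k], of xi]] As_def by(simp add: sinS_def)
 qed
 also have "2/real N*(1-(1+(LINT z|Lm. Ac z)))-2*(SUM k:{1..N}. (LINT z|Lm. As k z)) = (LINT z|Lm. - (2/real N)*Ac z-2*(SUM k:{1..N}. As k z))"
 using Aci Asi by(subst Bint_diff) auto
 also have "... = (LINT z|Lm. 1/2*xi^2*((if sray (fst z) (snd z) then 2*(1-rh) * sg (fst z) else 0)*cos (xi * (S (fst z)-S (snd z)))
 + (if sray (fst z) (snd z) then-(2*(1-2/real N)*(1+rh) * sg (fst z)) else 2/real N*(sg (fst z)+sg (snd z)))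
 * cos (xi * (S (fst z)+S (snd z)))))"
 proof(rule Bint_cong[OF refl])
 fix z
 show "- (2/real N)*Ac z-2*(SUM k:{1..N}. As k z) = 1/2*xi^2*((if sray (fst z) (snd z) then 2*(1-rh) * sg (fst z) else 0)*cos (xi * (S (fst z)-S (snd z)))
 + (if sray (fst z) (snd z) then-(2*(1-2/real N)*(1+rh) * sg (fst z)) else 2/real N*(sg (fst z)+sg (snd z)))
 * cos (xi * (S (fst z)+S (snd z))))"
 proof(cases "sray (fst z) (snd z)")
 case True
 show ?thesis unfolding Ac' As' Cm Cp using True sray_sg[OF True] N0 by(simp add: fs)
 next
 case False
 show ?thesis unfolding Ac' As' Cm Cp using False N0 by(simp add: fs)
 qed
 qed
 finally show ?thesis unfolding int_mr0 .
qed

text \<open>In the smoothed identity, multiplied by \<open>ep\<close>, the term of the difference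
  has the coefficient 2*(1-rh)*sg >= 0 and is dropped, so the size of 1-rh does not survive. The
  negative term concerns the sum of the coordinates, charges only pairs near the origin, and
  vanishes in the limit by \<open>occupation_decay\<close>.\<close>

theorem two_point_separation:
 assumes rh: "0 <= rh" "rh < 1" and tp: "tpt rh (origin e) (origin e) mu Lm"
 shows "(1-2/real N)*(LINT z|mu. S (fst z)+S (snd z)) <= (LINT z|mu. rdist z)"
proof -
 interpret mu: prob_space mu using tp by(simp add: tpt_def)
 interpret Lm: finite_measure Lm using tp by(simp add: tpt_def)
 have fin: "finite_measure mu" "finite_measure Lm" by unfold_locales
 define kap where "kap = 1-2/real N"
 have N0: "real N >= 2" using N2 by simp
 have kap: "0 <= kap" "kap <= 1" using N0 by(auto simp: kap_def)
 obtain K where K: "K >= 0" "!!x. |sg x| <= K" using bdm_bound[OF sg_bdm] by auto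
 have sgK: "sg x <= K" "0 <= sg x" for x using K(2)[of x] sg_ge_1[of x] by auto
 define z1 where "z1 z = S (fst z)-S (snd z)" for z :: "'g*'g"
 define z2 where "z2 z = S (fst z)+S (snd z)" for z :: "'g*'g"
 define w1 where "w1 z = (if sray (fst z) (snd z) then 1 else 0 :: real)" for z :: "'g*'g"
 define w2 where "w2 z = (if sray (fst z) (snd z) then-kap else 2/real N)" for z :: "'g*'g"
 define T1 where "T1 z = (if sray (fst z) (snd z) then 2*(1-rh) * sg (fst z) else 0)" for z :: "'g*'g"
 define T2 where "T2 z = (if sray (fst z) (snd z) then-(2 * kap * (1+rh) * sg (fst z)) else 2/real N*(sg (fst z)+sg (snd z)))" for z :: "'g*'g"
 have zm0: "z1 : bm (borel >< borel)" "z2 : bm (borel >< borel)"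
 unfolding z1_def[abs_def] z2_def[abs_def] by measurable
 note z1m = tpt_m[OF tp zm0(1)] and z2m = tpt_m[OF tp zm0(2)]
 have zle: "|z1 z| <= S (fst z)+S (snd z)" "|z2 z| <= S (fst z)+S (snd z)" for z
 using S_nonneg[of "fst z"] S_nonneg[of "snd z"] unfolding z1_def z2_def by linarith+
 note z1i = tpt_dom[OF tp zm0(1) zle(1)] and z2i = tpt_dom[OF tp zm0(2) zle(2)]
 have w1b: "|w1 z| <= 1" and w2b: "|w2 z| <= 1" for z using kap N0 by(auto simp: w1_def w2_def)
 have wb0: "bdm (borel >< borel) w1" "bdm (borel >< borel) w2"
 by(rule bdmI[OF _ w1b], unfold w1_def[abs_def], measurable) (rule bdmI[OF _ w2b], unfold w2_def[abs_def], measurable)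
 note wb = tpt_b(1)[OF tp wb0(1)] tpt_b(1)[OF tp wb0(2)]
 have sp: "bdm (borel >< borel) (%z. if sray (fst z) (snd z) then a else (b::real))" for a b
 by(rule bdmI[where c = "|a|+|b|"]) auto
 have Tb0: "bdm (borel >< borel) T1" "bdm (borel >< borel) T2"
 proof -
 have "T1 = (%z. (if sray (fst z) (snd z) then 2*(1-rh) else 0) * sg (fst z))" by(auto simp: T1_def)
 thus "bdm (borel >< borel) T1" using bdm_mult[OF sp bdm_fs(1)[OF sg_bdm]] by simp
 have "T2 = (%z. (if sray (fst z) (snd z) then-(2 * kap * (1+rh)) else 2/real N) * sg (fst z)+(if sray (fst z) (snd z) then 0 else 2/real N) * sg (snd z))"
 by(rule ext) (simp add: T2_def algs)
 thus "bdm (borel >< borel) T2"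
 using bdm_add[OF bdm_mult[OF sp bdm_fs(1)[OF sg_bdm]] bdm_mult[OF sp bdm_fs(2)[OF sg_bdm]]] by simp
 qed
 note Tb = tpt_b(2)[OF tp Tb0(1)] tpt_b(2)[OF tp Tb0(2)]
 obtain k where k: "k > 1" "(%n. k ^ n*(LINT z|Lm. gaussS (k ^ (2*n)) (fst z)*gaussS (k ^ (2*n)) (snd z))) ----> 0"
 using occupation_decay[OF rh tp] by blast
 define \<psi> where "\<psi> n = (LINT z|Lm. gaussS (k ^ (2*n)) (fst z)*gaussS (k ^ (2*n)) (snd z))" for n
 \<comment> \<open>The factor sqrt 2 makes the Gaussian at scale \<open>ep n\<close> comparable with
   \<open>gaussS (k ^ (2*n))\<close>, without a further constant.\<close>
 define ep where "ep n = 1/(sqrt 2 * k ^ n)" for n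
 have ep: "ep n > 0" for n using k by(simp add: ep_def)
 have ep2: "(x/ep n)^2/2 = x^2 * k ^ (2*n)" for x n by(simp add: ep_def pmd power_mult[symmetric] mcomm[of n])
 have ep0: "ep ----> 0"
 proof -
 have "(%n. 1 /sqrt 2*(1 /k) ^ n) ----> 1 /sqrt 2*0" using k by(intro t_mult t_const LIMSEQ_power_zero) auto
 thus ?thesis by(simp add: ep_def[abs_def] power_one_over)
 qed
 define L where "L n = (LINT z|mu. w1 z*gmix (z1 z/ep n)+w2 z*gmix (z2 z/ep n))" for n
 define K2 where "K2 = 2 * kap * (1+rh)*K"
 have lower: "- (sqrt 2/2*K2*(k ^ n*\<psi> n)) <= ep n*L n" for n
 proof -
 have "L n = gmix (0/ep n)+1/(2*(ep n)^2)*(LINT z|Lm. T1 z*gau (z1 z/ep n)+T2 z*gau (z2 z/ep n))"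
 unfolding L_def
 proof(rule gmix_identity[OF fin wb z1m(1) z2m(1) z1i(1) z2i(1) Tb z1m(2) z2m(2) _ ep])
 show "(LINT z|mu. w1 z*(1-cos (xi * z1 z))+w2 z*(1-cos (xi * z2 z)))
 = 1-cos (xi * 0)+1/2*xi^2*(LINT z|Lm. T1 z*cos (xi * z1 z)+T2 z*cos (xi * z2 z))" for xi
 using separation_identity[OF tp, of xi] unfolding w1_def w2_def T1_def T2_def z1_def z2_def kap_def by simp
 qed
 also have "... >= 1/(2*(ep n)^2)*(- (K2*\<psi> n))"
 proof -
 have "(LINT z|Lm. - K2*(gaussS (k ^ (2*n)) (fst z)*gaussS (k ^ (2*n)) (snd z)))
 <= (LINT z|Lm. T1 z*gau (z1 z/ep n)+T2 z*gau (z2 z/ep n))"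
 proof(rule int_mono)
 show "igb Lm (%z. - K2*(gaussS (k ^ (2*n)) (fst z)*gaussS (k ^ (2*n)) (snd z)))"
 using k by(intro Lm.bdm_i bdm_cmult tpt_b(2)[OF tp gaussS_bdm]) auto
 show "igb Lm (%z. T1 z*gau (z1 z/ep n)+T2 z*gau (z2 z/ep n))"
 using z1m(2) z2m(2) by(intro Lm.bdm_i bdm_add bdm_mult Tb bdmI[where c = 1]) auto
 fix z
 have "T1 z >= 0" using rh sgK(2) by(simp add: T1_def)
 have K2: "K2 >= 0" using kap rh K by(simp add: K2_def)
 have "T2 z >= - K2"
 proof(cases "sray (fst z) (snd z)")
 case True
 have "2 * kap * (1+rh) * sg (fst z) <= K2" unfolding K2_def using kap rh sgK by(intro mlm) auto
 thus ?thesis using True by(simp add: T2_def)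
 next
 case False
 have "T2 z >= 0" using False sgK(2) N0 by(simp add: T2_def)
 thus ?thesis using K2 by linarith
 qed
 have "(z2 z)^2 >= (rad (fst z))\<^sup>2+(rad (snd z))^2"
 proof -
 have "(rad (fst z))^2 <= (S (fst z))^2" "(rad (snd z))^2 <= (S (snd z))^2" by(intro pow_mono S_ge_rad rad_nonneg)+
 moreover have "S (fst z)*S (snd z) >= 0" by simp
 ultimately show ?thesis unfolding z2_def power2_sum by linarith
 qed
 hence "gau (z2 z/ep n) <= gaussS (k ^ (2*n)) (fst z)*gaussS (k ^ (2*n)) (snd z)"
 using k ep2[of "z2 z" n] unfolding gaussS_prod by(simp add: mcomm mlm)
 hence "K2*gau (z2 z/ep n) <= K2*(gaussS (k ^ (2*n)) (fst z)*gaussS (k ^ (2*n)) (snd z))"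
 by(rule mlm[OF _ K2])
 moreover have "- K2*gau (z2 z/ep n) <= T2 z*gau (z2 z/ep n)" using `T2 z \<ge> - K2` by(intro mrm) auto
 moreover have "0 <= T1 z*gau (z1 z/ep n)" using `T1 z \<ge> 0` by simp
 ultimately show "- K2*(gaussS (k ^ (2*n)) (fst z)*gaussS (k ^ (2*n)) (snd z)) <= T1 z*gau (z1 z/ep n)+T2 z*gau (z2 z/ep n)"
 by simp
 qed
 from mlm[OF this, of "1/(2*(ep n)^2)"]
 show ?thesis unfolding int_mr0 \<psi>_def[symmetric] by simp
 qed
 finally have a: "ep n*(1/(2*(ep n)^2)*(- (K2*\<psi> n))) <= ep n*L n" using ep[of n] by(intro mlm) auto
 have b: "ep n*(1/(2*(ep n)^2)*(- (K2*\<psi> n))) = - (1/(2*ep n)*(K2*\<psi> n))"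
 using ep[of n] by(simp add: p2es)
 have c: "1/(2*ep n) = sqrt 2/2 * k ^ n" by(simp add: ep_def)
 show ?thesis using a unfolding b c by(simp add: mult_ac)
 qed
 obtain C where C: "!!w. gmix w <= gslope*|w|" using gmix_linear by blast
 have gb: "|ep n*gmix (x/ep n)| <= gslope*|x|" for n x
 using mlm[OF C[of "x/ep n"] less_imp_le[OF ep[of n]]] ep[of n] gmix_nonneg[of "x/ep n"] by(simp add: abs_divide)
 have conv: "(%n. (LINT z|mu. w1 z*(ep n*gmix (z1 z/ep n))+w2 z*(ep n*gmix (z2 z/ep n))))
 ----> (LINT z|mu. w1 z*(gslope*|z1 z| )+w2 z*(gslope*|z2 z| ))"
 proof(rule dom_conv[where w = "%z. gslope*|z1 z|+gslope*|z2 z|"])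
 note [measurable] = z1m(1) z2m(1) bdm_m[OF wb(1)] bdm_m[OF wb(2)]
 show "(%z. w1 z*(gslope*|z1 z| )+w2 z*(gslope*|z2 z| )) : bm mu" by measurable
 show "(%z. w1 z*(ep n*gmix (z1 z/ep n))+w2 z*(ep n*gmix (z2 z/ep n))) : bm mu" for n by measurable
 show "igb mu (%z. gslope*|z1 z|+gslope*|z2 z| )" using z1i(2) z2i(2) by simp
 show "AE z in mu. (%n. w1 z*(ep n*gmix (z1 z/ep n))+w2 z*(ep n*gmix (z2 z/ep n))) ----> w1 z*(gslope*|z1 z| )+w2 z*(gslope*|z2 z| )"
 by(intro AE_I2 tendsto_add t_mult[OF t_const] gmix_scale_limit[OF ep0 ep])
 show "AE z in mu. norm (w1 z*(ep n*gmix (z1 z/ep n))+w2 z*(ep n*gmix (z2 z/ep n))) <= gslope*|z1 z|+gslope*|z2 z|" for n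
 proof(rule AE_I2)
 fix z
 have "|w1 z| * |ep n*gmix (z1 z/ep n)| <= 1*(gslope*|z1 z| )" by(rule mult_mono[OF w1b gb]) auto
 moreover have "|w2 z| * |ep n*gmix (z2 z/ep n)| <= 1*(gslope*|z2 z| )" by(rule mult_mono[OF w2b gb]) auto
 ultimately show "norm (w1 z*(ep n*gmix (z1 z/ep n))+w2 z*(ep n*gmix (z2 z/ep n))) <= gslope*|z1 z|+gslope*|z2 z|"
 unfolding real_norm_def abs_mult[symmetric] by(intro otrans[OF abs_triangle_ineq]) simp
 qed
 qed
 have "(LINT z|mu. w1 z*(ep n*gmix (z1 z/ep n))+w2 z*(ep n*gmix (z2 z/ep n))) = ep n*L n" for n
 unfolding L_def int_mr0[symmetric] by(intro Bint_cong) (auto simp: algs)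
 with conv have conv': "(%n. ep n*L n) ----> (LINT z|mu. w1 z*(gslope*|z1 z| )+w2 z*(gslope*|z2 z| ))" by simp
 have "(%n. - (sqrt 2/2*K2*(k ^ n*\<psi> n))) ----> - (sqrt 2/2*K2*0)"
 unfolding \<psi>_def by(intro tendsto_minus t_mult t_const k(2))
 from LIMSEQ_le[OF this conv'] lower
 have "0 <= (LINT z|mu. w1 z*(gslope*|z1 z| )+w2 z*(gslope*|z2 z| ))" by auto
 also have "... = (LINT z|mu. gslope*(rdist z-kap * (S (fst z)+S (snd z))))"
 proof(rule Bint_cong[OF refl])
 fix z
 have a: "|z2 z| = S (fst z)+S (snd z)" by(simp add: z2_def)
 show "w1 z*(gslope*|z1 z| )+w2 z*(gslope*|z2 z| ) = gslope*(rdist z-kap * (S (fst z)+S (snd z)))"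
 unfolding a rdist_def z1_def w1_def w2_def kap_def by(simp add: algs)
 qed
 also have "... = gslope*((LINT z|mu. rdist z)-kap * (LINT z|mu. S (fst z)+S (snd z)))"
 proof -
 have "rdist = (%z. w1 z*|z1 z|+(1-w1 z)*|z2 z| )" by(rule ext) (simp add: rdist_def w1_def z1_def z2_def)
 hence rm: "rdist : bm (borel >< borel)" using zm0 bdm_m[OF wb0(1)] by simp
 have "igb mu rdist" by(rule tpt_dom(2)[OF tp rm]) (auto simp: rdist_def abs_le_iff)
 moreover have "igb mu (%z. S (fst z)+S (snd z))" using z2i(2) by(simp add: z2_def[abs_def])
 ultimately show ?thesis by simp
 qed
 finally show ?thesis using gslope_pos unfolding kap_def by(simp add: zero_le_mult_iff)
qed

text \<open>If the first point were almost surely at the origin, the cosine equation would make the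
  integral of sg*cos(t*S) over \<open>Lm\<close> zero along a sequence of t > 0. As t tends to 0
  this contradicts \<open>sg >= 1\<close> and the positive mass.\<close>

lemma not_concentrated_at_origin:
 assumes tp: "tpt rh (origin e) (origin e) mu Lm" and Lm: "measure Lm (space Lm) > 0"
 shows "(LINT z|mu. S (fst z)) > 0"
proof(rule ccontr)
 interpret mu: prob_space mu using tp by(simp add: tpt_def)
 interpret Lm: finite_measure Lm using tp by(simp add: tpt_def)
 assume "~ (LINT z|mu. S (fst z)) > 0"
 moreover have "(LINT z|mu. S (fst z)) >= 0" by(intro Bint_nonneg) simp
 ultimately have i0: "(LINT z|mu. S (fst z)) = 0" by simp
 have Sm: "(%z::'g*'g. S (fst z)) : bm (borel >< borel)" by measurable
 have "igb mu (%z. S (fst z))" by(rule tpt_dom(2)[OF tp Sm]) simp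
 hence z: "AE z in mu. S (fst z) = 0" using i0 int_0_AE[of mu "%z. S (fst z)"] by simp
 note [measurable] = tpt_m[OF tp Sm]
 have sgb: "bdm Lm (%z. sg (fst z))" by(intro tpt_b(2)[OF tp] bdm_fs sg_bdm)
 note [measurable] = bdm_m[OF sgb]
 obtain K where K: "!!z. z : space Lm ==> |sg (fst z)| <= K" using bdm_bound[OF sgb] by blast
 define t where "t n = inverse (real (Suc n))" for n
 have zero: "(LINT z|Lm. sg (fst z)*cos (t n*S (fst z))) = 0" for n
 proof -
 have "(LINT z|mu. cos (t n*S (fst z))) = (LINT z|mu. 1)" by(rule int_cong_AE) (use z in auto)
 thus ?thesis using tpt_cos(1)[OF tp, of "t n"] by(simp add: mu.prob_space t_def)
 qed
 have "(%n. (LINT z|Lm. sg (fst z)*cos (t n*S (fst z)))) ----> (LINT z|Lm. sg (fst z)*cos (0*S (fst z)))"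
 proof(rule dom_conv[where w = "%_. K"])
 show "AE z in Lm. (%n. sg (fst z)*cos (t n*S (fst z))) ----> sg (fst z)*cos (0*S (fst z))"
 unfolding t_def by(intro AE_I2 tendsto_intros LIMSEQ_inverse_real_of_nat)
 show "AE z in Lm. norm (sg (fst z)*cos (t n*S (fst z))) <= K" for n
 proof(rule AE_I2)
 fix z assume "z : space Lm"
 hence "|sg (fst z)| * |cos (t n*S (fst z))| <= K*1" using K by(intro mult_mono) (auto intro: otrans[OF abs_ge_zero K])
 thus "norm (sg (fst z)*cos (t n*S (fst z))) <= K" by(simp add: abs_mult)
 qed
 qed auto
 hence "(LINT z|Lm. sg (fst z)) = 0" unfolding zero by(simp add: LIMSEQ_const_iff)
 moreover have "(LINT z|Lm. 1) <= (LINT z|Lm. sg (fst z))"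
 by(rule int_mono) (use Lm.bdm_i[OF sgb] sg_ge_1 in auto)
 ultimately show False using Lm by simp
qed

end

section \<open>From the equation to two-point measures\<close>

lemma flow_mt:
 fixes X :: "real => real => 'm::topological_space => 'w => 'v"
 assumes jm: "jointly M A X" shows "(%(v, w). X s v x w) : time s t >< M ~> A"
 and "s <= t ==> X s t x : M ~> A"
proof -
 have id: "(%v. v) : bm (time s t)" by(intro m_restr1) simp
 have "(%y. (s, fst y, x, snd y)) : time s t >< M ~> restrict_space (borel >< (borel >< (borel >< M))) {(s, t, x, w). s <= t}"
 proof(rule measurable_restrict_space2)
 show "(%y. (s, fst y, x, snd y)) : time s t >< M ~> borel >< (borel >< (borel >< M))"
 using m_comp[OF measurable_fst id] by measurable
 qed (auto simp: sp_pair sp_restr)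
 from m_comp[OF this jm] show "(%(v, w). X s v x w) : time s t >< M ~> A" by(simp add: cpb)
 show "X s t x : M ~> A" if "s <= t"
 proof -
 have "(%w. (s, t, x, w)) : M ~> restrict_space (borel >< (borel >< (borel >< M))) {(s, t, x, w). s <= t}"
 using that by(intro measurable_restrict_space2) auto
 from m_comp[OF this jm] show ?thesis by(simp add: cpb)
 qed
qed

lemma bdm_ker:
 fixes f :: "'b => real"
 assumes L: "L : R ~> prob_algebra B" and f: "bdm B f" shows "bdm R (%a. (LINT y|(L a). f y))"
proof -
 obtain c where c: "c >= 0" "!!y. y : space B ==> |f y| <= c" using bdm_bound[OF f] by blast
 show ?thesis
 proof(rule bdmI[where c = c])
 show "(%a. (LINT y|(L a). f y)) : bm R"
 by(rule m_comp[OF measurable_prob_algebraD[OF L] integral_measurable_subprob_algebra[OF bdm_m[OF f]]])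
 fix a assume "a : space R"
 hence "L a : space (prob_algebra B)" using L by(auto dest: m_space)
 hence P: "prob_space (L a)" and S: "sets (L a) = sets B" by(auto simp: space_prob_algebra)
 interpret prob_space "L a" by fact
 have "bdm (L a) f" using f c(2) sets_sp[OF S] by(auto simp: bdm_def m_cong_sets[OF S refl])
 hence i: "igb (L a) f" by(rule bdm_i)
 have "|(LINT y|(L a). f y)| <= (LINT y|(L a). |f y| )" by(rule integral_abs_bound)
 also have "... <= (LINT y|(L a). c)" by(rule int_mono) (use i c(2) sets_sp[OF S] in auto)
 finally show "|(LINT y|(L a). f y)| <= c" by(simp add: prob_space)
 qed
qed

text \<open>Stated for finite measures because it serves both laws, which mix over the sample space,
  and occupation measures, which mix over a time interval.\<close>

lemma integral_bind_bdm:
 fixes f :: "'b => real"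
 assumes R: "finite_measure R" "space R ~= {}" and L: "L : R ~> prob_algebra B" and f: "bdm B f"
 shows "finite_measure (R \<bind> L)" "(LINT y|(R \<bind> L). f y) = (LINT a|R. (LINT y|(L a). f y))" "sets (R \<bind> L) = sets B"
 "measure (R \<bind> L) (space (R \<bind> L)) = measure R (space R)"
proof -
 interpret R: finite_measure R by fact
 note Ls = measurable_prob_algebraD[OF L]
 show S: "sets (R \<bind> L) = sets B" by(rule sets_bind[OF sets_kernel[OF Ls] R(2)])
 have sp: "space (R \<bind> L) = space B" by(rule sets_sp[OF S])
 have La: "prob_space (L a)" "sets (L a) = sets B" if "a : space R" for a
 using m_space[OF L that] by(auto simp: space_prob_algebra)
 have "emeasure (R \<bind> L) (space B) = (NN R (%a. emeasure (L a) (space B)))" by(rule emeasure_bind[OF R(2) Ls]) simp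
 also have "... = (NN R (%a. 1))"
 using prob_space.emeasure_space_1[OF La(1)] sets_sp[OF La(2)] by(intro nn_cong) metis
 finally have tot: "emeasure (R \<bind> L) (space B) = emeasure R (space R)" by simp
 show fm: "finite_measure (R \<bind> L)" by(rule finite_measureI) (simp add: sp tot R.emeasure_eq_measure)
 show "measure (R \<bind> L) (space (R \<bind> L)) = measure R (space R)" by(simp add: measure_def sp tot)
 interpret Q: finite_measure "R \<bind> L" by fact
 have bQ: "bdm (R \<bind> L) h" if "bdm B h" for h using that sp by(auto simp: bdm_def m_cong_sets[OF S refl])
 have bL: "igb (L a) h" if "bdm B h" "a : space R" for h a
 proof -
 interpret prob_space "L a" by(rule La(1)[OF that(2)])
 have "bdm (L a) h" using that(1) sets_sp[OF La(2)[OF that(2)]]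
 by(auto simp: bdm_def m_cong_sets[OF La(2)[OF that(2)] refl])
 thus ?thesis by(rule bdm_i)
 qed
 show "(LINT y|(R \<bind> L). f y) = (LINT a|R. (LINT y|(L a). f y))" using f
 proof(induction rule: bdm_induct)
 case (set A)
 have m: "(%a. measure (L a) A) : bm R" using Ls set by measurable
 have b: "igb R (%a. measure (L a) A)" by(rule R.integrable_const_bound[where B = 1])
 (use m La(1) in "auto intro!: AE_I2 prob_space.prob_le_1")
 have "(LINT y|(R \<bind> L). ind A y) = measure (R \<bind> L) A" using set S sets.sets_into_space[OF set] by(simp add: sp Int_absorb2)
 also have "... = enn2real (NN R (%a. ennreal (measure (L a) A)))"
 unfolding measure_def emeasure_bind[OF R(2) Ls set] by(intro arg_cong[where f = enn2real] nn_cong)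
 (metis La(1) finite_measure.emeasure_eq_measure measure_def prob_space_def)
 also have "... = (LINT a|R. measure (L a) A)" by(simp add: nn_eq[OF b])
 also have "... = (LINT a|R. (LINT y|(L a). ind A y))"
 using sets.sets_into_space[OF set] sets_sp[OF La(2)] by(intro Bint_cong) (auto simp: Int_absorb2)
 finally show ?case .
 next
 case (lin c u v)
 have "(LINT a|R. (LINT y|(L a). u y+c * v y)) = (LINT a|R. (LINT y|(L a). u y)+c*(LINT y|(L a). v y))"
 using bL lin(1,2) by(intro Bint_cong) auto
 also have "... = (LINT a|R. (LINT y|(L a). u y))+c*(LINT a|R. (LINT y|(L a). v y))"
 using R.bdm_i[OF bdm_ker[OF L lin(1)]] R.bdm_i[OF bdm_ker[OF L lin(2)]] by simp
 finally show ?case using lin(3,4) Q.bdm_i[OF bQ[OF lin(1)]] Q.bdm_i[OF bQ[OF lin(2)]] by simp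
 next
 case (cong u v)
 have "(LINT y|(R \<bind> L). v y) = (LINT y|(R \<bind> L). u y)" using cong.hyps by(intro Bint_cong) (auto simp: sp)
 moreover have "(LINT y|(L a). v y) = (LINT y|(L a). u y)" if "a : space R" for a
 using cong.hyps sets_sp[OF La(2)[OF that]] by(intro Bint_cong) auto
 hence "(LINT a|R. (LINT y|(L a). v y)) = (LINT a|R. (LINT y|(L a). u y))" by(rule Bint_cong[OF refl])
 ultimately show ?case using cong.IH by simp
 next
 case (lim U u c)
 have c: "|c| >= |U i y|" if "y : space B" for i y using lim.hyps(2)[OF that, of i] by linarith
 have l1: "(%i. (LINT y|(R \<bind> L). U i y)) ----> (LINT y|(R \<bind> L). u y)"
 by(rule dom_conv[where w = "%_. |c|"]) (use bdm_m[OF bQ] lim.hyps c in "auto simp: sp")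
 have l2: "(%i. (LINT y|(L a). U i y)) ----> (LINT y|(L a). u y)" if a: "a : space R" for a
 proof -
 interpret prob_space "L a" by(rule La(1)[OF a])
 show ?thesis by(rule dom_conv[where w = "%_. |c|"])
 (use bm_int[OF bL[OF _ a]] lim.hyps c sets_sp[OF La(2)[OF a]] in auto)
 qed
 have bd: "|(LINT y|(L a). U i y)| <= |c|" if a: "a : space R" for i a
 proof -
 interpret prob_space "L a" by(rule La(1)[OF a])
 have "|(LINT y|(L a). U i y)| <= (LINT y|(L a). |U i y| )" by(rule integral_abs_bound)
 also have "... <= (LINT y|(L a). |c| )"
 by(rule int_mono) (use bL[OF lim.hyps(1) a] c sets_sp[OF La(2)[OF a]] in auto)
 finally show ?thesis by(simp add: prob_space)
 qed
 have "(%i. (LINT a|R. (LINT y|(L a). U i y))) ----> (LINT a|R. (LINT y|(L a). u y))"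
 by(rule dom_conv[where w = "%_. |c|"]) (use bdm_m[OF bdm_ker[OF L]] lim.hyps l2 bd in auto)
 thus ?case using l1 lim.IH LIMSEQ_unique by simp
 qed
qed

lemma integral_lin_comb3:
 fixes f g h :: "'a => real"
 assumes "igb M f" "igb M g" "igb M h"
 shows "(LINT x|M. a*f x+b*g x+c*h x) = a*(LINT x|M. f x)+b*(LINT x|M. g x)+c*(LINT x|M. h x)"
 using assms by simp

section \<open>The filtration of a flow and its noises\<close>

lemma ff_space[simp]: "space (FF N M K W s t) = space M"
 by(simp add: flow_filtration_def space_measure_of_conv)

lemma sets_ff: "sets (FF N M K W s t) = sigma_sets (space M)
 ({K u v x -` A Int space M | u v x A. s <= u & u <= v & v <= t & A : sets (PA)}
 Un {W i u v -` A Int space M | i u v A. i : {1..N} & s <= u & u <= v & v <= t & A : sets borel})"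
 unfolding flow_filtration_def by(rule sets_measure_of) auto

lemma ff_sub:
 assumes "!!u v x. s <= u ==> u <= v ==> v <= t ==> K u v x : G ~> PA"
 and "!!i u v. i : {1..N} ==> s <= u ==> u <= v ==> v <= t ==> W i u v : bm G" and sp: "space G = space M"
 shows "sets (FF N M K W s t) <= sets G" unfolding sets_ff sp[symmetric]
 by(rule sets.sigma_sets_subset) (use m_sets[OF assms(1)] m_sets[OF assms(2)] in blast)

lemma K_ff:
 assumes "K u v x : space M \<rightarrow> space (PA)" "s <= u" "u <= v" "v <= t"
 shows "K u v x : FF N M K W s t ~> PA"
proof(rule measurableI)
 show "K u v x -` A Int space (FF N M K W s t) : sets (FF N M K W s t)" if "A : sets (PA)" for A
 unfolding sets_ff ff_space using assms(2-) that by(intro sigma_sets.Basic) blast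
qed (use assms(1) in auto)

lemma W_ff:
 assumes "i : {1..N}" "s <= u" "u <= v" "v <= t" shows "W i u v : bm (FF N M K W s t)"
proof(rule measurableI)
 show "W i u v -` A Int space (FF N M K W s t) : sets (FF N M K W s t)" if "A : sets borel" for A
 unfolding sets_ff ff_space using assms that by(intro sigma_sets.Basic) blast
qed auto

lemma noises_m:
 "independent_white_noises N M W ==> i : {1..N} ==> u <= v ==> W i u v : bm M"
 unfolding independent_white_noises_def white_noise_def by blast

context star
begin

lemma driven_sol:
 assumes P: "prob_space M" and Km: "!!s t x. s <= t ==> K s t x : M ~> PA" and sol: "solves_ISDE N e p M K W"
 shows "driven M (FF N M K W s) s N W"
proof -
 interpret prob_space M by fact
 have noises: "independent_white_noises N M W" using sol by(simp add: solves_ISDE_def)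
 show ?thesis
 proof
 show "independent_white_noises N M W" by fact
 show "brownian_motion_in M (FF N M K W s) s (W i s)" if "i : {1..N}" for i
 using sol that by(simp add: solves_ISDE_def)
 show "subalgebra M (FF N M K W s u)" for u unfolding suba_def
 using ff_sub[of s u K M N W M, OF Km noises_m[OF noises]] by simp
 show "sets (FF N M K W s u) <= sets (FF N M K W s v)" if "u <= v" for u v
 proof(rule ff_sub)
 show "K a b x : FF N M K W s v ~> PA" if "s <= a" "a <= b" "b <= u" for a b x
 using Km[of a b x] that `u \<le> v` by(intro K_ff) (auto dest: m_space)
 show "W i a b : bm (FF N M K W s v)" if "i : {1..N}" "s <= a" "a <= b" "b <= u" for i a b
 using that `u \<le> v` by(intro W_ff) auto
 qed simp
 show "W i u v : bm (FF N M K W s ww)" if "i : {1..N}" "s <= u" "u <= v" "v <= ww" for i u v ww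
 using that by(rule W_ff)
 qed
qed

lemma semimart_sol:
 assumes P: "prob_space M" and Km: "!!s t x. s <= t ==> K s t x : M ~> PA" and sol: "solves_ISDE N e p M K W"
 and jm: "(%(v, w). K s v x w) : time s t >< M ~> PA" and f: "stest f f1 f2"
 shows "bmf.semimart M (FF N M K W s) s {1..N} (%i. W i s) t (%u w. (LINT y|(K s u x w). f y)) (f x)
 (%u w. (LINT y|(K s u x w). f2 y)) (%i u w. (LINT y|(K s u x w). ind (ray e i) y*f1 y))"
proof -
 interpret D: driven M "FF N M K W s" s N W by(rule driven_sol[OF P Km sol])
 have fb: "bdm borel f" "bdm borel f1" "bdm borel f2" and ft: "f : test_functions N e p"
 and fd: "sder N e p 1 f = f1" "sder N e p 2 f = f2" using f by(auto simp: stest_def)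
 have ib: "bdm borel (%y. ind (ray e i) y*f1 y)" if "i : {1..N}" for i
 using that by(intro bdm_mult fb bdmI[where c = 1]) (auto simp: ind_def)
 have joint: "bdm (time s t >< M) (%(v, w). (LINT y|(K s v x w). h y))" if "bdm borel h" for h :: "'g => real"
 using bdm_ker[OF jm that] by(simp add: cpb)
 have ad: "bdm (FF N M K W s u) (%w. (LINT y|(K s u x w). h y))" if "bdm borel h" "s <= u" for h :: "'g => real" and u
 proof(rule bdm_ker[OF K_ff[where K = K and u = s and v = u and x = x] that(1)])
 show "K s u x : space M \<rightarrow> space (PA)" using Km[OF that(2), of x] by(auto dest: m_space)
 qed (use that in auto)
 have J: "EX J. (ALL i:{1..N}. ito_int M (FF N M K W s) (W i s) s u (%u w. (LINT y|(K s u x w). ind (ray e i) y*f1 y)) (J i)) &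
 (AE w in M. (LINT y|(K s u x w). f y) = f x+(SUM i:{1..N}. J i w)+1/2*(LINT v|(time s u). (LINT y|(K s v x w). f2 y)))"
 if u: "s <= u" for u
 proof -
 have r: "(LBINT v:{s..u}. h v) = (LINT v|(time s u). h v)" for h :: "real => real"
 by(simp add: set_int_def int_restr)
 obtain J where J: "ALL i:{1..N}. ito_int M (FF N M K W s) (W i s) s u (%u w. (LINT y|(K s u x w). ind (ray e i) y*f1 y)) (J i)"
 and eq: "AE w in M. igb (K s u x w) f & (LINT y|(K s u x w). f y) = f x+(SUM i:{1..N}. J i w)+1/2*(LBINT v:{s..u}. (LINT y|(K s v x w). f2 y))"
 using sol ft u unfolding solves_ISDE_def fd[symmetric] by blast
 show ?thesis by(intro exI[of _ J] conjI J) (use eq in "eventually_elim, simp add: r")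
 qed
 show ?thesis
 unfolding D.semimart_def using joint[OF fb(1)] joint[OF fb(3)] joint[OF ib] ad[OF fb(1)] ad[OF fb(3)] J by blast
qed

text \<open>\<open>eq\<close> represents the pairing of the two solutions by a measure
  \<open>mu u\<close> at each time. \<open>Lm\<close> is the mixture of these over time:
  \<open>pairing_m\<close> on rectangles makes \<open>mu\<close> measurable, and the product formula
  for a product of test functions is the two-point equation. The mass of \<open>Lm\<close> is
  recorded for \<open>not_concentrated_at_origin\<close>.\<close>

lemma two_pointI:
 assumes IP: "ito_pairing M F1 F2 s {1..N} B t T r" and st: "s <= t"
 and X: "!!f f1 f2. stest f f1 f2 ==> bmf.semimart M F1 s {1..N} B t (%u w. (LINT y|(K1 u w). f y)) (f x)
 (%u w. (LINT y|(K1 u w). f2 y)) (%i u w. (LINT y|(K1 u w). ind (ray e i) y*f1 y))"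
 and Y: "!!f f1 f2. stest f f1 f2 ==> bmf.semimart M F2 s {1..N} B t (%u w. (LINT y|(K2 u w). f y)) (f y0)
 (%u w. (LINT y|(K2 u w). f2 y)) (%i u w. (LINT y|(K2 u w). ind (ray e i) y*f1 y))"
 and jm: "(%(v, w). K1 v w) : time s t >< M ~> PA"
 "(%(v, w). K2 v w) : time s t >< M ~> PA"
 and mu: "!!u. u : {s..t} ==> prob_space (mu u)" "!!u. u : {s..t} ==> sets (mu u) = sets (borel >< (borel :: 'g measure))"
 and eq: "!!u f g. u : {s..t} ==> bdm borel f ==> bdm borel g ==>
 (LINT z|(mu u). f (fst z)*g (snd z)) = (LINT w|M. (LINT y|(K1 u w). f y)*T (%w. (LINT y|(K2 u w). g y)) w)"
 shows "EX Lm. tpt r x y0 (mu t) Lm & measure Lm (space Lm) = t-s"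
proof -
 interpret ito_pairing M F1 F2 s "{1..N}" B t T r by fact
 let ?R = "time s t"
 interpret R: finite_measure ?R by(rule fin_time)
 have spR: "space ?R = {s..t}" by(simp add: sp_restr)
 have joint: "bdm (?R >< M) (%(v, w). (LINT y|(K1 v w). h y))" "bdm (?R >< M) (%(v, w). (LINT y|(K2 v w). h y))"
 if "bdm borel h" for h :: "'g => real"
 using bdm_ker[OF jm(1) that] bdm_ker[OF jm(2) that] by(simp_all add: cpb)
 have mum: "mu : ?R ~> prob_algebra (borel >< borel)"
 proof(rule measurable_prob_algebra_generated[OF sets_pair_measure Int_stable_pair_measure_generator pair_measure_closed])
 show "prob_space (mu a)" "sets (mu a) = sets (borel >< borel)" if "a : space ?R" for a using mu[of a] that spR by auto
 fix C assume "C : {a \<times> b |a b. a : sets (borel :: 'g measure) & b : sets (borel :: 'g measure)}"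
 then obtain a b where C: "C = a \<times> b" "a : sets borel" "b : sets borel" by auto
 have ib: "bdm borel (ind c :: 'g => real)" if "c : sets borel" for c
 using that by(intro bdmI[where c = 1]) (auto simp: ind_def)
 have "emeasure (mu v) C = ennreal (LINT w|M. (LINT y|(K1 v w). ind a y)*T (%w. (LINT y|(K2 v w). ind b y)) w)" if "v : space ?R" for v
 proof -
 have v: "v : {s..t}" using that spR by simp
 interpret prob_space "mu v" by(rule mu(1)[OF v])
 have Cs: "C : sets (mu v)" unfolding mu(2)[OF v] C(1) using C(2,3) by simp
 have "emeasure (mu v) C = ennreal (LINT z|(mu v). (ind C z :: real))" using Cs by(simp add: emeasure_eq_measure)
 also have "(LINT z|(mu v). (ind C z :: real)) = (LINT z|(mu v). ind a (fst z)*ind b (snd z))"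
 by(intro Bint_cong) (auto simp: C(1) ind_def)
 finally show ?thesis unfolding eq[OF v ib[OF C(2)] ib[OF C(3)]] .
 qed
 moreover have "(%v. ennreal (LINT w|M. (LINT y|(K1 v w). ind a y)*T (%w. (LINT y|(K2 v w). ind b y)) w)) : bm ?R"
 by(intro m_comp[OF pairing_m measurable_ennreal] joint ib C)
 ultimately show "(%v. emeasure (mu v) C) : bm ?R" by(rule measurable_cong[THEN iffD2])
 qed
 define Lm where "Lm = ?R \<bind> mu"
 have ne: "space ?R ~= {}" using spR st by auto
 note B = integral_bind_bdm[OF R.finite_measure_axioms ne mum, folded Lm_def]
 have mass: "measure Lm (space Lm) = t-s"
 using B(4)[OF bdm_const[of _ 0]] st unfolding spR by(simp add: measure_restrict_space)
 have "tpt r x y0 (mu t) Lm" unfolding tpt_def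
 proof(intro conjI allI impI)
 show "prob_space (mu t)" "sets (mu t) = sets (borel >< borel)" using mu[of t] st by auto
 show "finite_measure Lm" "sets Lm = sets (borel >< borel)" using B(1,3)[OF bdm_const[of _ 0]] by auto
 fix f f1 f2 g g1 g2 assume f: "stest f f1 f2" and g: "stest g g1 g2"
 have fb: "bdm borel f" "bdm borel f1" "bdm borel f2" and gb: "bdm borel g" "bdm borel g1" "bdm borel g2"
 using f g by(auto simp: stest_def)
 have ib: "bdm borel (%y. ind (ray e i) y*h y)" if "bdm borel h" "i : {1..N}" for h :: "'g => real" and i
 using that(2) by(intro bdm_mult[OF _ that(1)] bdmI[where c = 1]) (auto simp: ind_def)
 let ?h = "%z. 1/2*(f2 (fst z)*g (snd z))+1/2*(f (fst z)*g2 (snd z)) +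
 r*(SUM i:{1..N}. (ind (ray e i) (fst z)*f1 (fst z))*(ind (ray e i) (snd z)*g1 (snd z)))"
 have pb: "bdm (borel >< borel) (%z. u (fst z) * v (snd z))" if "bdm borel u" "bdm borel v" for u v :: "'g => real"
 by(intro bdm_mult bdm_fs that)
 have hb: "bdm (borel >< borel) ?h"
 by(intro bdm_add bdm_cmult bdm_sum pb[OF fb(3) gb(1)] pb[OF fb(1) gb(3)] pb[OF ib[OF fb(2)] ib[OF gb(2)]])
 have hv: "1/2*be (%w. (LINT y|(K1 v w). f2 y)) (%w. (LINT y|(K2 v w). g y))+1/2*be (%w. (LINT y|(K1 v w). f y)) (%w. (LINT y|(K2 v w). g2 y))
 + r*(SUM i:{1..N}. be (%w. (LINT y|(K1 v w). ind (ray e i) y*f1 y)) (%w. (LINT y|(K2 v w). ind (ray e i) y*g1 y))) = (LINT z|(mu v). ?h z)"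
 if v: "v : {s..t}" for v
 proof -
 interpret prob_space "mu v" by(rule mu(1)[OF v])
 have pi: "igb (mu v) (%z. u (fst z)*ww (snd z))" if "bdm borel u" "bdm borel ww" for u ww :: "'g => real"
 using pb[OF that] sets_sp[OF mu(2)[OF v]]
 by(intro bdm_i) (auto simp: bdm_def m_cong_sets[OF mu(2)[OF v] refl])
 have si: "igb (mu v) (%z. SUM i:{1..N}. (ind (ray e i) (fst z)*f1 (fst z))*(ind (ray e i) (snd z)*g1 (snd z)))"
 by(intro Bintble_sum pi[OF ib[OF fb(2)] ib[OF gb(2)]])
 have "(LINT z|(mu v). ?h z) = 1/2*(LINT z|(mu v). f2 (fst z)*g (snd z))+1/2*(LINT z|(mu v). f (fst z)*g2 (snd z))
 + r*(LINT z|(mu v). (SUM i:{1..N}. (ind (ray e i) (fst z)*f1 (fst z))*(ind (ray e i) (snd z)*g1 (snd z))))"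
 by(rule integral_lin_comb3[OF pi[OF fb(3) gb(1)] pi[OF fb(1) gb(3)] si])
 also have "(LINT z|(mu v). (SUM i:{1..N}. (ind (ray e i) (fst z)*f1 (fst z))*(ind (ray e i) (snd z)*g1 (snd z))))
 = (SUM i:{1..N}. (LINT z|(mu v). (ind (ray e i) (fst z)*f1 (fst z))*(ind (ray e i) (snd z)*g1 (snd z))))"
 by(rule Bint_sum) (rule pi[OF ib[OF fb(2)] ib[OF gb(2)]])
 also have "... = (SUM i:{1..N}. be (%w. (LINT y|(K1 v w). ind (ray e i) y*f1 y)) (%w. (LINT y|(K2 v w). ind (ray e i) y*g1 y)))"
 by(intro sum.cong refl) (simp add: eq[OF v ib[OF fb(2)] ib[OF gb(2)]] be_def)
 finally show ?thesis by(simp add: eq[OF v fb(3) gb(1)] eq[OF v fb(1) gb(3)] be_def)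
 qed
 have "(LINT z|(mu t). f (fst z)*g (snd z)) = be (%w. (LINT y|(K1 t w). f y)) (%w. (LINT y|(K2 t w). g y))"
 unfolding be_def by(rule eq[OF _ fb(1) gb(1)]) (use st in auto)
 also have "... = f x*g y0+(LINT v|?R. (1/2*be (%w. (LINT y|(K1 v w). f2 y)) (%w. (LINT y|(K2 v w). g y))+1/2*be (%w. (LINT y|(K1 v w). f y)) (%w. (LINT y|(K2 v w). g2 y))
 + r*(SUM i:{1..N}. be (%w. (LINT y|(K1 v w). ind (ray e i) y*f1 y)) (%w. (LINT y|(K2 v w). ind (ray e i) y*g1 y)))))"
 by(rule product_formula[OF _ st X[OF f] Y[OF g]]) simp
 also have "(LINT v|?R. (1/2*be (%w. (LINT y|(K1 v w). f2 y)) (%w. (LINT y|(K2 v w). g y))+1/2*be (%w. (LINT y|(K1 v w). f y)) (%w. (LINT y|(K2 v w). g2 y))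
 + r*(SUM i:{1..N}. be (%w. (LINT y|(K1 v w). ind (ray e i) y*f1 y)) (%w. (LINT y|(K2 v w). ind (ray e i) y*g1 y))))) = (LINT v|?R. (LINT z|(mu v). ?h z))"
 by(intro Bint_cong refl hv) (simp add: spR)
 also have "... = (LINT z|Lm. ?h z)" by(rule B(2)[OF hb, symmetric])
 finally show "(LINT z|(mu t). f (fst z)*g (snd z)) = f x*g y0+(LINT z|Lm. ?h z)" .
 qed
 thus ?thesis using mass by blast
qed

end

section \<open>Conditioning on the noise\<close>

context finite_measure_subalgebra
begin

lemma ce_sqi:
 assumes V: "sqi M V"
 shows "sqi M (real_cond_exp M F V)" "(LINT w|M. (real_cond_exp M F V w)^2) <= (LINT w|M. (V w)^2)"
proof -
 have Vi: "igb M V" by(rule sqi_i[OF V])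
 have V2: "igb M (%w. (V w)^2)" by(rule sqi_square[OF V])
 have ae: "AE w in M. (real_cond_exp M F V w)^2 <= real_cond_exp M F (%w. (V w)^2) w"
 by(rule real_cond_exp_jensens_inequality(2)[OF Vi, where I = UNIV and q = "%x. x^2"]) (use V2 convex_power2 in auto)
 have i2: "igb M (real_cond_exp M F (%w. (V w)^2))" by(rule real_cond_exp_int(1)[OF V2])
 have i: "igb M (%w. (real_cond_exp M F V w)^2)"
 by(rule Bintble_bound[OF i2]) (use ae in "auto elim: ev_mono")
 thus "sqi M (real_cond_exp M F V)" by(simp add: sqi_def)
 show "(LINT w|M. (real_cond_exp M F V w)^2) <= (LINT w|M. (V w)^2)"
 using integral_mono_AE[OF i i2 ae] real_cond_exp_int(2)[OF V2] by simp
qed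

lemma ce_sa:
 assumes Z: "sqi M Z" and V: "sqi M V"
 shows "(LINT w|M. Z w * real_cond_exp M F V w) = (LINT w|M. real_cond_exp M F Z w * V w)"
proof -
 have a: "(LINT w|M. real_cond_exp M F V w * real_cond_exp M F Z w) = (LINT w|M. real_cond_exp M F V w * Z w)"
 by(rule real_cond_exp_intg(2)[OF sqi_mi[OF ce_sqi(1)[OF V] Z]]) (use Z in "auto simp: sqi_def")
 have b: "(LINT w|M. real_cond_exp M F Z w * real_cond_exp M F V w) = (LINT w|M. real_cond_exp M F Z w * V w)"
 by(rule real_cond_exp_intg(2)[OF sqi_mi[OF ce_sqi(1)[OF Z] V]]) (use V in "auto simp: sqi_def")
 show ?thesis using a b by(simp add: mcomm)
qed

end

text \<open>The two filtrations may come from different solutions and share only the noise.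
  Projection onto the noise is adapted by immersion and leaves noise increments unchanged, hence the
  constant 1.\<close>

lemma cond_pairing:
 assumes D1: "driven M F1 s N W" and D2: "driven M F2 s N W"
 shows "ito_pairing M F1 F2 s {1..N} (%i. W i s) t ((CE M N W s t)) 1"
proof -
 interpret D1: driven M F1 s N W by fact
 interpret D2: driven M F2 s N W by fact
 interpret C: finite_measure_subalgebra M "nalg M N W s t" by(rule D1.finite_subalg)
 show ?thesis
 proof unfold_locales
 fix V V' :: "'a => real" assume V: "sqi M V"
 show "sqi M ((CE M N W s t) V)" by(rule C.ce_sqi(1)[OF V])
 show "(LINT w|M. ((CE M N W s t) V w)^2) <= (LINT w|M. (V w)^2)" by(rule C.ce_sqi(2)[OF V])
 show "AE w in M. (CE M N W s t) (%w. V w+V' w) w = (CE M N W s t) V w+(CE M N W s t) V' w"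
 if V': "sqi M V'" by(rule C.real_cond_exp_add[OF D1.sqi_i[OF V] D1.sqi_i[OF V']])
 show "AE w in M. (CE M N W s t) (%w. c*V w) w = c*(CE M N W s t) V w" for c
 by(rule C.real_cond_exp_cmult[OF D1.sqi_i[OF V]])
 next
 show "AE w in M. (CE M N W s t) (%_. 1) w = 1" by(rule C.real_cond_exp_F_meas) auto
 next
 fix Z :: "'a => real" assume Z: "bdm M Z"
 have Zs: "sqi M Z" by(rule D1.sqi_bdm[OF Z])
 show "EX Z'. igb M Z' & (ALL V. bdm M V --> (LINT w|M. Z w * (CE M N W s t) V w) = (LINT w|M. Z' w * V w))"
 by(rule exI[of _ "(CE M N W s t) Z"])
 (use C.ce_sa[OF Zs D1.sqi_bdm] D1.sqi_i[OF C.ce_sqi(1)[OF Zs]] in blast)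
 next
 fix V u assume u: "s <= u" "u <= t" and V: "bdm (F2 u) V"
 obtain V0 where "bdm (nalg M N W s u) V0" "AE w in M. (CE M N W s t) V w = V0 w"
 by(rule D2.immersion_bounded[OF u V])
 thus "EX V'. bdm (F1 u) V' & (AE w in M. (CE M N W s t) V w = V' w)"
 using bdm_subalg[OF D1.nalg_F[OF u(1)]] by blast
 next
 fix i a b xi assume i: "i : {1..N}" and ab: "s <= a" "a <= b" "b <= t" and xi: "bdm (F2 a) xi"
 have xiM: "bdm M xi" by(rule D2.bdm_F[OF ab(1) xi])
 have dW: "(%w. W i s b w-W i s a w) : bm (nalg M N W s t)"
 using i ab by(intro borel_measurable_diff W_nalg) auto
 have int: "igb M (%w. (W i s b w-W i s a w)*xi w)"
 by(rule sqi_mi[OF D1.B_incr_sqi[OF i] D1.sqi_bdm[OF xiM]]) (use ab in auto)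
 have "AE w in M. (CE M N W s t) (%w. (W i s b w-W i s a w)*xi w) w = (W i s b w-W i s a w)*(CE M N W s t) xi w"
 by(rule C.real_cond_exp_mult[OF dW bdm_m[OF xiM] int])
 thus "AE w in M. (CE M N W s t) (%w. xi w * (W i s b w-W i s a w)) w = 1*((CE M N W s t) xi w * (W i s b w-W i s a w))"
 by(simp add: mcomm)
 qed
qed

section \<open>Removing the completion of the noise sigma-field\<close>

lemma sigma_sets_AE_approx:
 assumes A: "A : sigma_sets (space M) G" and sp: "space F = space M"
 and G: "!!A. A : G ==> EX A':sets F. AE w in M. w : A <-> w : A'"
 shows "EX A':sets F. AE w in M. w : A <-> w : A'" using A
proof induction
 case (Basic A)
 thus ?case by(rule G)
next
 case Empty
 thus ?case by(intro bexI[of _ "{}"]) auto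
next
 case (Compl A)
 then obtain A' where A': "A' : sets F" "AE w in M. w : A <-> w : A'" by blast
 have "AE w in M. w : space M-A <-> w : space F-A'" using A'(2) by eventually_elim (simp add: sp)
 thus ?case using A'(1) by blast
next
 case (Union A)
 then obtain A' where A': "!!i::nat. A' i : sets F" "!!i. AE w in M. w : A i <-> w : A' i" by metis
 have "AE w in M. ALL i. w : A i <-> w : A' i" using A'(2) by(simp add: AE_all_countable)
 hence "AE w in M. w : (UN i. A i) <-> w : (UN i. A' i)" by eventually_elim auto
 moreover have "(UN i. A' i) : sets F" using A'(1) by auto
 ultimately show ?case by blast
qed

context noise_filtration
begin

lemma sets_na: "sets (NA N M W a b) = sigma_sets (space M)
 ({W i u v -` A Int space M | i u v A. i : {1..N} & a <= u & u <= v & v <= b & A : sets borel} Un null_sets M)"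
 unfolding noise_algebra_def by(rule sets_measure_of) (use sets.sets_into_space in "auto simp: null_sets_def")

lemma space_noise_algebra[simp]: "space (NA N M W a b) = space M"
 by(simp add: noise_algebra_def space_measure_of_conv)

lemma noise_algebra_subalgebra: "subalgebra M (NA N M W a b)" unfolding suba_def sets_na
 using m_sets[OF W_meas] by(auto intro!: sets.sigma_sets_subset simp: null_sets_def)

lemma nalg_noise_algebra: "sets (nalg M N W a b) <= sets (NA N M W a b)"
proof(rule nalg_subset)
 fix i u v assume i: "i : {1..N}" "a <= u" "u <= v" "v <= b"
 show "W i u v : bm (NA N M W a b)"
 proof(rule measurableI)
 show "W i u v -` A Int space (NA N M W a b) : sets (NA N M W a b)" if "A : sets borel" for A
 unfolding sets_na space_noise_algebra using i that by(intro sigma_sets.Basic) blast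
 qed simp
qed simp

text \<open>Each set of the completed sigma-field differs by a null set from one of
  \<open>nalg\<close>, so both conditional expectations have the same set integrals.\<close>

lemma cond_exp_noise_algebra:
 assumes V: "bdm M V" shows "AE w in M. real_cond_exp M (NA N M W a b) V w = (CE M N W a b) V w"
proof -
 interpret C: finite_measure_subalgebra M "nalg M N W a b" by unfold_locales (rule nalg_sub)
 interpret D: finite_measure_subalgebra M "NA N M W a b" by unfold_locales (rule noise_algebra_subalgebra)
 have Vi: "igb M V" by(rule bdm_i[OF V])
 note [measurable] = bdm_m[OF V]
 have sub: "subalgebra (NA N M W a b) (nalg M N W a b)" using nalg_noise_algebra by(simp add: suba_def)
 show ?thesis
 proof(rule D.real_cond_exp_charact)
 fix A assume A: "A : sets (NA N M W a b)"
 have "EX A':sets (nalg M N W a b). AE w in M. w : A <-> w : A'" using A[unfolded sets_na] space_nalg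
 proof(rule sigma_sets_AE_approx)
 fix B assume "B : {W i u v -` A Int space M | i u v A. i : {1..N} & a <= u & u <= v & v <= b & A : sets borel} Un null_sets M"
 then consider i u v C where "B = W i u v -` C Int space M" "i : {1..N}" "a <= u" "u <= v" "v <= b" "C : sets borel" | "B : null_sets M" by blast
 thus "EX A':sets (nalg M N W a b). AE w in M. w : B <-> w : A'"
 proof cases
 case 1
 hence "B : sets (nalg M N W a b)" using m_sets[OF W_nalg[of i N a u v b W M] 1(6)] by simp
 thus ?thesis by blast
 next
 case 2
 hence "AE w in M. w : B <-> w : {}" using AE_not_in[OF 2] by simp
 thus ?thesis by blast
 qed
 qed
 then obtain A' where A': "A' : sets (nalg M N W a b)" "AE w in M. w : A <-> w : A'" by blast
 have AM: "A : sets M" "A' : sets M" using A A'(1) noise_algebra_subalgebra[of a b] nalg_sub[of a b] by(auto simp: suba_def)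
 have "(\<integral>w\<in>A. V w \<partial>M) = (\<integral>w\<in>A'. V w \<partial>M)" unfolding set_int_def
 proof(rule int_cong_AE)
 show "AE w in M. ind A w .* V w = ind A' w .* V w" using A'(2) by eventually_elim (simp add: ind_def)
 qed (use AM in auto)
 also have "... = (\<integral>w\<in>A'. (CE M N W a b) V w \<partial>M)" by(rule C.real_cond_exp_intA[OF Vi A'(1)])
 also have "... = (\<integral>w\<in>A. (CE M N W a b) V w \<partial>M)" unfolding set_int_def
 proof(rule int_cong_AE)
 show "AE w in M. ind A' w .* (CE M N W a b) V w = ind A w .* (CE M N W a b) V w"
 using A'(2) by eventually_elim (simp add: ind_def)
 qed (use AM in auto)
 finally show "(\<integral>w\<in>A. V w \<partial>M) = (\<integral>w\<in>A. (CE M N W a b) V w \<partial>M)" .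
 next
 show "(CE M N W a b) V : bm (NA N M W a b)" by(rule m_subalg[OF sub borel_measurable_cond_exp])
 qed (use Vi C.real_cond_exp_int(1)[OF Vi] in auto)
qed

text \<open>The defining property holds for each Borel set off its own null set, so the passage to
  functions is made under the integral. Once the conditional expectation is moved onto
  \<open>X\<close>, both sides are ordinary integrals in \<open>g\<close> and a monotone class
  argument applies.\<close>

lemma conditional_law_pairing:
 fixes ph :: "'w => 'm::topological_space"
 assumes law: "is_conditional_law M (NA N M W a b) ph kap" and ph: "ph : bm M" and kap: "kap : M ~> PA"
 and g: "bdm borel g" and X: "bdm M X"
 shows "(LINT w|M. X w * (LINT y|(kap w). g y)) = (LINT w|M. X w * (CE M N W a b) (%w. g (ph w)) w)"
proof -
 interpret C: finite_measure_subalgebra M "nalg M N W a b" by unfold_locales (rule nalg_sub)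
 have gphi: "bdm M (%w. g (ph w))" if "bdm borel g" for g :: "'m => real"
 using that m_comp[OF ph bdm_m[OF that]] by(auto simp: bdm_def)
 have Xs: "sqi M X" by(rule sqi_bdm[OF X])
 obtain d where d: "d >= 0" "!!w. w : space M ==> |X w| <= d" using bdm_bound[OF X] by blast
 define X' where "X' = (CE M N W a b) X"
 have X's: "sqi M X'" unfolding X'_def by(rule C.ce_sqi(1)[OF Xs])
 have X'i: "igb M X'" by(rule sqi_i[OF X's])
 have X'b: "igb M (%w. X' w * V w)" if "bdm M V" for V by(rule sqi_mi[OF X's sqi_bdm[OF that]])
 have kapP: "prob_space (kap w)" "sets (kap w) = sets borel" "space (kap w) = UNIV" if "w : space M" for w
 using m_space[OF kap that] by(auto simp: space_prob_algebra dest: sets_sp)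
 have kapi: "igb (kap w) h" if "bdm borel h" "w : space M" for h :: "'m => real" and w
 proof -
 interpret kap: prob_space "kap w" by(rule kapP(1)[OF that(2)])
 have "bdm (kap w) h" using that(1) kapP(3)[OF that(2)] by(auto simp: bdm_def m_cong_sets[OF kapP(2)[OF that(2)] refl])
 thus ?thesis by(rule kap.bdm_i)
 qed
 have "(LINT w|M. X w * (LINT y|(kap w). g y)) = (LINT w|M. X' w * g (ph w))" using g
 proof(induction rule: bdm_induct)
 case (set A)
 have iA: "bdm borel (ind A :: 'm => real)" using set by(intro bdmI[where c = 1]) (auto simp: ind_def)
 have "(LINT w|M. X w * (LINT y|(kap w). ind A y)) = (LINT w|M. X w * (CE M N W a b) (%w. ind A (ph w)) w)"
 proof(rule int_cong_AE)
 have "AE w in M. measure (kap w) A = real_cond_exp M (NA N M W a b) (%w. ind A (ph w)) w"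
 using law set by(simp add: is_conditional_law_def)
 thus "AE w in M. X w * (LINT y|(kap w). ind A y) = X w * (CE M N W a b) (%w. ind A (ph w)) w"
 using cond_exp_noise_algebra[OF gphi[OF iA], of a b] AE_space by eventually_elim (simp add: kapP(3))
 qed (use bdm_m[OF X] bdm_m[OF bdm_ker[OF kap iA]] in auto)
 thus ?case unfolding X'_def C.ce_sa[OF Xs sqi_bdm[OF gphi[OF iA]]] .
 next
 case (lin c u v)
 have "(LINT w|M. X w * (LINT y|(kap w). u y+c * v y)) = (LINT w|M. X w * (LINT y|(kap w). u y)+c*(X w * (LINT y|(kap w). v y)))"
 using kapi lin(1,2) by(intro Bint_cong) (auto simp: algs)
 also have "... = (LINT w|M. X w * (LINT y|(kap w). u y))+c*(LINT w|M. X w * (LINT y|(kap w). v y))"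
 using bdm_i[OF bdm_mult[OF X bdm_ker[OF kap lin(1)]]] bdm_i[OF bdm_mult[OF X bdm_ker[OF kap lin(2)]]] by simp
 also have "... = (LINT w|M. X' w * u (ph w)+c*(X' w * v (ph w)))"
 unfolding lin(3,4) using X'b[OF gphi[OF lin(1)]] X'b[OF gphi[OF lin(2)]] by simp
 finally show ?case by(simp add: algs)
 next
 case (cong u v)
 hence "u = v" by auto
 thus ?case using cong.IH by simp
 next
 case (lim U u c)
 have c: "|U i y| <= |c|" for i y using lim.hyps(2)[of y i] by simp
 have l0: "(%i. (LINT y|(kap w). U i y)) ----> (LINT y|(kap w). u y)" if w: "w : space M" for w
 proof -
 interpret kap: prob_space "kap w" by(rule kapP(1)[OF w])
 show ?thesis by(rule dom_conv[where w = "%_. |c|"]) (use bm_int[OF kapi[OF _ w]] lim.hyps c in auto)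
 qed
 have bd: "|(LINT y|(kap w). U i y)| <= |c|" if w: "w : space M" for i w
 proof -
 interpret kap: prob_space "kap w" by(rule kapP(1)[OF w])
 have "|(LINT y|(kap w). U i y)| <= (LINT y|(kap w). |U i y| )" by(rule integral_abs_bound)
 also have "... <= (LINT y|(kap w). |c| )" by(rule int_mono) (use kapi[OF lim.hyps(1) w] c in auto)
 finally show ?thesis by(simp add: kap.prob_space)
 qed
 have l1: "(%i. (LINT w|M. X w * (LINT y|(kap w). U i y))) ----> (LINT w|M. X w * (LINT y|(kap w). u y))"
 proof(rule dom_conv[where w = "%_. d*|c|"])
 show "AE w in M. (%i. X w * (LINT y|(kap w). U i y)) ----> X w * (LINT y|(kap w). u y)"
 by(intro AE_I2 t_mult t_const l0)
 show "AE w in M. norm (X w * (LINT y|(kap w). U i y)) <= d*|c|" for i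
 using d bd by(intro AE_I2) (auto simp: abs_mult intro!: mult_mono)
 qed (use bdm_m[OF X] bdm_m[OF bdm_ker[OF kap]] lim.hyps in auto)
 have l2: "(%i. (LINT w|M. X' w * U i (ph w))) ----> (LINT w|M. X' w * u (ph w))"
 proof(rule dom_conv[where w = "%w. |X' w| * |c|"])
 show "AE w in M. (%i. X' w * U i (ph w)) ----> X' w * u (ph w)"
 using lim.hyps(3) by(intro AE_I2 t_mult t_const) auto
 show "AE w in M. norm (X' w * U i (ph w)) <= |X' w| * |c|" for i
 using c by(intro AE_I2) (auto simp: abs_mult intro!: mlm)
 qed (use bm_int[OF X'b[OF gphi]] lim.hyps X'i in auto)
 show ?case using l1 l2 lim.IH LIMSEQ_unique by simp
 qed
 thus ?thesis unfolding X'_def C.ce_sa[OF Xs sqi_bdm[OF gphi[OF g]]] .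
qed

end

section \<open>Uniqueness for two rays\<close>

lemma integral_pair_product:
 fixes f :: "'a => real" and g :: "'b => real"
 assumes "prob_space P" "prob_space Q" "bdm P f" "bdm Q g"
 shows "(LINT z|(P >< Q). f (fst z)*g (snd z)) = (LINT x|P. f x)*(LINT y|Q. g y)"
proof -
 interpret P: prob_space P by fact
 interpret Q: prob_space Q by fact
 interpret PQ: pair_prob_space P Q ..
 have "bdm (P >< Q) (%z. f (fst z))" "bdm (P >< Q) (%z. g (snd z))"
 using assms(3,4) by(fastforce simp: bdm_def sp_pair)+
 hence "igb (P >< Q) (%z. f (fst z)*g (snd z))" by(intro PQ.bdm_i bdm_mult)
 hence "(LINT z|(P >< Q). f (fst z)*g (snd z)) = (LINT x|P. (LINT y|Q. f x*g y))"
 using PQ.integral_fst[of "%x y. f x*g y"] by(simp add: cpb)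
 thus ?thesis by simp
qed

lemma dirac_m:
 fixes ph :: "real => real => 'm::topological_space => 'w => 'm"
 assumes "(%(s, t, x, w). ph s t x w) : R ~> borel" shows "(%(s, t, x, w). dfl ph s t x w) : R ~> PA"
 using m_comp[OF assms measurable_return_prob_space] by(simp add: dirac_flow_def cpb)

text \<open>Up to a null set of the product, the first coordinate lies in \<open>A\<close> exactly
  when the second does; the two probabilities are those of \<open>A\<close> under \<open>P\<close>
  and under \<open>Q\<close>.\<close>

lemma product_diagonal_eq:
 assumes P: "prob_space P" "sets P = sets borel" and Q: "prob_space Q" "sets Q = sets borel"
 and AE: "AE z in P >< Q. fst z = snd z" shows "P = (Q :: 'g::second_countable_topology measure)"
proof(rule measure_eqI)
 interpret P: prob_space P by fact
 interpret Q: prob_space Q by fact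
 interpret PQ: pair_prob_space P Q ..
 fix A assume A: "A : sets P"
 have sp: "space P = UNIV" "space Q = UNIV" using sets_sp[OF P(2)] sets_sp[OF Q(2)] by auto
 have AQ: "A : sets Q" using A P Q by simp
 have "emeasure P A = emeasure (P >< Q) (A \<times> UNIV)"
 using Q.emeasure_pair_measure_Times[OF A sets.top] Q.emeasure_space_1 sp by simp
 also have "... = emeasure (P >< Q) (UNIV \<times> A)"
 proof(rule emeasure_eq_AE)
 show "AE z in P >< Q. z : A \<times> UNIV <-> z : UNIV \<times> A" using AE by eventually_elim auto
 qed (use A AQ sets.top[of P] sets.top[of Q] sp in auto)
 also have "... = emeasure Q A"
 using Q.emeasure_pair_measure_Times[OF sets.top[of P] AQ] P.emeasure_space_1 sp by simp
 finally show "emeasure P A = emeasure Q A" .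
qed (use P Q in simp)

context star
begin

text \<open>The mean of the product of \<open>K\<close> and \<open>KW\<close> is the pairing of
  \<open>K\<close> with the flow through conditional expectation, so the equation is needed for
  \<open>K\<close> and \<open>ph\<close> but not for \<open>KW\<close>. The resulting two-point
  measure has correlation 1 and starts on the diagonal, hence stays there, and product kernels
  carried by the diagonal have equal factors.\<close>

lemma two_ray_uniqueness:
 fixes ph :: "real => real => 'g => 'w => 'g"
 assumes N: "N = 2" and P: "prob_space M" and jphi: "jointly M borel ph" and jK: "jointly M (PA) K"
 and jKW: "jointly M (PA) KW" and sphi: "solves_ISDE N e p M (dfl ph) W" and sK: "solves_ISDE N e p M K W"
 and law: "!!s t x. s <= t ==> is_conditional_law M (NA N M W s t) (ph s t x) (KW s t x)" and st: "s <= t"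
 shows "AE w in M. K s t x w = KW s t x w"
proof -
 interpret prob_space M by fact
 note jd = dirac_m[OF jphi]
 have Km: "K s t x : M ~> PA" and KWm: "KW s t x : M ~> PA"
 and dm: "dfl ph s t x : M ~> PA" and phim: "ph s t x : bm M" if "s <= t" for s t x
 using flow_mt(2)[OF jK that] flow_mt(2)[OF jKW that] flow_mt(2)[OF jd that] flow_mt(2)[OF jphi that] by auto
 interpret D1: driven M "FF N M K W s" s N W by(rule driven_sol[OF P Km sK])
 interpret D2: driven M "FF N M (dfl ph) W s" s N W by(rule driven_sol[OF P dm sphi])
 define nu where "nu u w = K s u x w >< KW s u x w" for u w
 define mu where "mu u = M \<bind> nu u" for u
 have num: "nu u : M ~> prob_algebra (borel >< borel)" if "s <= u" for u
 unfolding nu_def using Km[OF that] KWm[OF that] by measurable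
 have B: "prob_space (mu u)" "sets (mu u) = sets (borel >< borel)" if u: "u : {s..t}" for u
 proof -
 note b = integral_bind_bdm[OF finite_measure_axioms not_empty num bdm_const[of _ 0], of u]
 show "sets (mu u) = sets (borel >< borel)" using b(3) u by(simp add: mu_def)
 have "finite_measure (mu u)" "measure (mu u) (space (mu u)) = 1" using b(1,4) u by(auto simp: mu_def prob_space)
 thus "prob_space (mu u)" by(intro prob_spaceI) (simp add: finite_measure.emeasure_eq_measure)
 qed
 have spK: "prob_space (L w)" "sets (L w) = sets borel" "space (L w) = UNIV" if "L : M ~> PA" "w : space M" for L :: "'w => 'g measure" and w
 using m_space[OF that] by(auto simp: space_prob_algebra dest: sets_sp)
 have bL: "bdm (L w) h" if "L : M ~> PA" "w : space M" "bdm borel h" for L :: "'w => 'g measure" and w and h :: "'g => real"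
 using that(3) spK(3)[OF that(1,2)] by(auto simp: bdm_def m_cong_sets[OF spK(2)[OF that(1,2)] refl])
 have eq: "(LINT z|(mu u). f (fst z)*g (snd z)) = (LINT w|M. (LINT y|(K s u x w). f y)*(CE M N W s t) (%w. (LINT y|(dfl ph s u x w). g y)) w)"
 if u: "u : {s..t}" and f: "bdm borel f" and g: "bdm borel g" for u f g
 proof -
 have su: "s <= u" "u <= t" using u by auto
 have dg: "(%w. (LINT y|(dfl ph s u x w). g y)) = (%w. g (ph s u x w))"
 using bdm_m[OF g] by(intro ext) (simp add: dirac_flow_def integral_return)
 have Xb: "bdm M (%w. (LINT y|(K s u x w). f y))" by(rule bdm_ker[OF Km[OF su(1)] f])
 have gF: "bdm (FF N M (dfl ph) W s u) (%w. g (ph s u x w))" unfolding dg[symmetric]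
 proof(rule bdm_ker[OF K_ff[where u = s and v = u and x = x] g])
 show "dfl ph s u x : space M \<rightarrow> space (PA)" using dm[OF su(1)] by(auto dest: m_space)
 qed (use su in auto)
 \<comment> \<open>\<open>KW\<close> at time \<open>u\<close> conditions on the noise up to
   \<open>u\<close>, the pairing on the noise up to \<open>t\<close>; immersion gives both the same
   version.\<close>
 obtain V0 where V0: "AE w in M. (CE M N W s t) (%w. g (ph s u x w)) w = V0 w"
 "AE w in M. (CE M N W s u) (%w. g (ph s u x w)) w = V0 w" by(rule D2.immersion_bounded[OF su gF])
 have "(LINT z|(mu u). f (fst z)*g (snd z)) = (LINT w|M. (LINT z|(nu u w). f (fst z)*g (snd z)))"
 unfolding mu_def by(rule integral_bind_bdm(2)[OF finite_measure_axioms not_empty num[OF su(1)]]) (intro bdm_mult bdm_fs f g)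
 also have "... = (LINT w|M. (LINT y|(K s u x w). f y)*(LINT y|(KW s u x w). g y))"
 proof(rule Bint_cong[OF refl])
 fix w assume w: "w : space M"
 show "(LINT z|(nu u w). f (fst z)*g (snd z)) = (LINT y|(K s u x w). f y)*(LINT y|(KW s u x w). g y)"
 unfolding nu_def
 by(rule integral_pair_product[OF spK(1)[OF Km[OF su(1)] w] spK(1)[OF KWm[OF su(1)] w] bL[OF Km[OF su(1)] w f] bL[OF KWm[OF su(1)] w g]])
 qed
 also have "... = (LINT w|M. (LINT y|(K s u x w). f y)*(CE M N W s u) (%w. g (ph s u x w)) w)"
 by(rule D1.conditional_law_pairing[OF law[OF su(1)] phim[OF su(1)] KWm[OF su(1)] g Xb])
 also have "... = (LINT w|M. (LINT y|(K s u x w). f y)*(CE M N W s t) (%w. g (ph s u x w)) w)"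
 proof(rule int_cong_AE)
 show "AE w in M. (LINT y|(K s u x w). f y)*(CE M N W s u) (%w. g (ph s u x w)) w = (LINT y|(K s u x w). f y)*(CE M N W s t) (%w. g (ph s u x w)) w"
 using V0 by eventually_elim simp
 qed (use bdm_m[OF Xb] in auto)
 finally show ?thesis unfolding dg .
 qed
 obtain Lm where tp: "tpt 1 x x (mu t) Lm"
 using two_pointI[OF cond_pairing[OF D1.driven_axioms D2.driven_axioms] st
 semimart_sol[OF P Km sK flow_mt(1)[OF jK]] semimart_sol[OF P dm sphi flow_mt(1)[OF jd]]
 flow_mt(1)[OF jK] flow_mt(1)[OF jd] B eq] by blast
 have "AE z in mu t. fst z = snd z" by(rule two_point_diagonal[OF N tp])
 hence "AE w in M. AE z in nu t w. fst z = snd z"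
 unfolding mu_def by(subst (asm) AE_bind[OF measurable_prob_algebraD[OF num[OF st]]]) auto
 thus ?thesis using AE_space
 proof eventually_elim
 case (elim w)
 show ?case by(rule product_diagonal_eq[OF spK(1)[OF Km[OF st] elim(2)] spK(2)[OF Km[OF st] elim(2)]
 spK(1)[OF KWm[OF st] elim(2)] spK(2)[OF KWm[OF st] elim(2)] elim(1)[unfolded nu_def]])
 qed
qed

end

section \<open>Modifications of solutions\<close>

lemma bdm_AE_approx:
 assumes sp: "space F = space M" "space F' = space M"
 and G: "!!A. A : sets F ==> EX A':sets F'. AE w in M. w : A <-> w : A'" and V: "bdm F V"
 shows "EX V'. bdm F' V' & (AE w in M. V w = V' w)" using V
proof(induction rule: bdm_induct)
 case (set A)
 then obtain A' where A': "A' : sets F'" "AE w in M. w : A <-> w : A'" using G by blast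
 have "bdm F' (ind A' :: _ => real)" using A' by(intro bdmI[where c = 1]) (auto simp: ind_def)
 moreover have "AE w in M. (ind A w :: real) = ind A' w" using A'(2) by eventually_elim (simp add: ind_def)
 ultimately show ?case by blast
next
 case (lin c u v)
 then obtain u' v' where u': "bdm F' u'" "AE w in M. u w = u' w" and v': "bdm F' v'" "AE w in M. v w = v' w" by blast
 have "AE w in M. u w+c * v w = u' w+c * v' w" using u'(2) v'(2) by eventually_elim simp
 moreover have "bdm F' (%w. u' w+c * v' w)" by(intro bdm_add bdm_cmult u' v')
 ultimately show ?case by blast
next
 case (cong u v)
 then obtain u' where u': "bdm F' u'" "AE w in M. u w = u' w" by blast
 have "AE w in M. v w = u' w" using u'(2) AE_space by eventually_elim (use cong.hyps sp in auto)
 thus ?case using u'(1) by blast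
next
 case (lim U u c)
 have "EX U'. ALL i. bdm F' (U' i) & (AE w in M. U i w = U' i w)" using lim.IH by(intro choice) blast
 then obtain U' where U': "!!i. bdm F' (U' i)" "!!i. AE w in M. U i w = U' i w" by blast
 \<comment> \<open>The replaced approximants converge only almost surely. \<open>lim\<close> is
   measurable regardless, and clipping keeps it bounded where its value is arbitrary.\<close>
 define V' where "V' w = max (- |c| ) (min |c| (lim (%i. U' i w)))" for w
 have m: "(%w. lim (%i. U' i w)) : bm F'" by(rule borel_measurable_lim_metric) (rule bdm_m[OF U'(1)])
 have "bdm F' V'" unfolding V'_def[abs_def] by(rule bdmI[where c = "|c|"]) (use m in auto)
 moreover have "AE w in M. ALL i. U i w = U' i w" using U'(2) by(simp add: AE_all_countable)
 hence "AE w in M. u w = V' w" using AE_space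
 proof eventually_elim
 case (elim w)
 have w: "w : space F" using elim sp by simp
 have "(%i. U' i w) ----> u w" using lim.hyps(3)[OF w] elim by simp
 hence l: "lim (%i. U' i w) = u w" by(rule limI)
 have "|U i w| <= |c|" for i using lim.hyps(2)[OF w, of i] by linarith
 hence "|u w| <= |c|" by(intro LIMSEQ_le_const2[OF tendsto_rabs[OF lim.hyps(3)[OF w]]]) blast
 hence "u w <= |c|" "- |c| <= u w" by linarith+
 thus ?case unfolding V'_def l by(simp add: min_absorb2 max_absorb2)
 qed
 ultimately show ?case by blast
qed

text \<open>A modification changes the filtration, so the approximating simple processes are
  replaced by ones adapted to the new one. Countably many random variables are exchanged in all, so
  one null set suffices.\<close>

lemma has_ito_integral_modification:
 assumes ap: "!!u V. s <= u ==> bdm (F u) V ==> EX V'. bdm (F' u) V' & (AE w in M. V w = V' w)"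
 and sp: "!!u. s <= u ==> space (F u) = space M" "!!u. s <= u ==> space (F' u) = space M"
 and ito: "ito_int M F B s t H X" and H': "(%(u, w). H' u w) : bm (restrict_space borel {s..t} >< M)"
 and eq: "AE w in M. AE u in time s t. H u w = H' u w" shows "ito_int M F' B s t H' X"
proof -
 obtain n ta xi where sim: "!!m. sproc M F s t (n m) (ta m) (xi m)"
 and c1: "(%m. \<integral>\<^sup>+w. (\<integral>\<^sup>+u\<in>{s..t}. ennreal ((H u w-sval (n m) (ta m) (xi m) u w)^2) \<partial>lborel) \<partial>M) ----> 0"
 and c2: "(%m. \<integral>\<^sup>+w. ennreal ((X w-sint B (n m) (ta m) (xi m) w)^2) \<partial>M) ----> 0"
 and Xm: "X : bm M" using ito unfolding has_ito_integral_def by blast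
 have tas: "s <= ta m k" if "k <= n m" for m k using that
 proof(induction k)
 case 0 thus ?case using sim[of m] by(simp add: sproc_def)
 next
 case (Suc k)
 hence "ta m k <= ta m (Suc k)" using sim[of m] by(simp add: sproc_def)
 thus ?case using Suc by auto
 qed
 define Q where "Q m k V' <-> bdm (F' (ta m k)) V' & (AE w in M. xi m k w = V' w)" for m k V'
 define xi' where "xi' m k = (SOME V'. Q m k V')" for m k
 have xi': "bdm (F' (ta m k)) (xi' m k)" "AE w in M. xi m k w = xi' m k w" if "k < n m" for m k
 proof -
 have "bdm (F (ta m k)) (xi m k)" using sim[of m] that sp(1)[OF tas[of k m]] by(simp add: sproc_def bdm_def)
 from ap[OF tas this] that have "EX V'. Q m k V'" by(auto simp: Q_def)
 hence "Q m k (xi' m k)" unfolding xi'_def by(rule someI_ex)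
 thus "bdm (F' (ta m k)) (xi' m k)" "AE w in M. xi m k w = xi' m k w" by(auto simp: Q_def)
 qed
 have sim': "sproc M F' s t (n m) (ta m) (xi' m)" for m
 using sim[of m] xi'(1)[of _ m] sp(2)[OF tas[of _ m]] by(simp add: sproc_def bdm_def)
 have "AE w in M. ALL m k. k < n m --> xi m k w = xi' m k w" using xi'(2) by(simp add: AE_all_countable)
 hence ae: "AE w in M. (ALL m u. sval (n m) (ta m) (xi m) u w = sval (n m) (ta m) (xi' m) u w)
 & (ALL m. sint B (n m) (ta m) (xi m) w = sint B (n m) (ta m) (xi' m) w)"
 by eventually_elim (auto simp: simple_value_def simple_integral_def intro!: sum.cong)
 have "(NN M (%w. (\<integral>\<^sup>+u\<in>{s..t}. ennreal ((H u w-sval (n m) (ta m) (xi m) u w)^2) \<partial>lborel)))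
 = (NN M (%w. (\<integral>\<^sup>+u\<in>{s..t}. ennreal ((H' u w-sval (n m) (ta m) (xi' m) u w)^2) \<partial>lborel)))" for m
 proof(rule nn_integral_cong_AE)
 show "AE w in M. (\<integral>\<^sup>+u\<in>{s..t}. ennreal ((H u w-sval (n m) (ta m) (xi m) u w)^2) \<partial>lborel)
 = (\<integral>\<^sup>+u\<in>{s..t}. ennreal ((H' u w-sval (n m) (ta m) (xi' m) u w)^2) \<partial>lborel)"
 using eq ae
 proof eventually_elim
 case (elim w)
 have "AE u in lborel. u : {s..t} --> H u w = H' u w" using elim(1) by(simp add: AE_restrict_space_iff)
 thus ?case using elim(2) by(intro nn_integral_cong_AE) (auto elim!: ev_mono simp: ind_def)
 qed
 qed
 with c1 have c1': "(%m. \<integral>\<^sup>+w. (\<integral>\<^sup>+u\<in>{s..t}. ennreal ((H' u w-sval (n m) (ta m) (xi' m) u w)^2) \<partial>lborel) \<partial>M) ----> 0" by simp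
 have "(NN M (%w. ennreal ((X w-sint B (n m) (ta m) (xi m) w)^2))) = (NN M (%w. ennreal ((X w-sint B (n m) (ta m) (xi' m) w)^2)))" for m
 by(rule nn_integral_cong_AE, use ae in eventually_elim, simp)
 with c2 have c2': "(%m. \<integral>\<^sup>+w. ennreal ((X w-sint B (n m) (ta m) (xi' m) w)^2) \<partial>M) ----> 0" by simp
 show ?thesis unfolding has_ito_integral_def
 by(intro conjI exI[of _ n] exI[of _ ta] exI[of _ xi'] allI H' Xm sim' c1' c2')
qed

lemma ff_approx:
 assumes mod: "!!s t x. s <= t ==> AE w in M. K s t x w = K' s t x w" and A: "A : sets (FF N M K W s t)"
 shows "EX A':sets (FF N M K' W s t). AE w in M. w : A <-> w : A'" using A[unfolded sets_ff] ff_space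
proof(rule sigma_sets_AE_approx)
 fix B assume "B : {K u v x -` A Int space M | u v x A. s <= u & u <= v & v <= t & A : sets (PA)}
 Un {W i u v -` A Int space M | i u v A. i : {1..N} & s <= u & u <= v & v <= t & A : sets borel}"
 hence "(EX u v x C. B = K u v x -` C Int space M & s <= u & u <= v & v <= t & C : sets (PA))
 \<or> B : {W i u v -` A Int space M | i u v A. i : {1..N} & s <= u & u <= v & v <= t & A : sets borel}"
 by(simp only: Un_iff mem_Collect_eq)
 thus "EX A':sets (FF N M K' W s t). AE w in M. w : B <-> w : A'"
 proof(elim disjE exE conjE)
 fix u v x C assume 1: "B = K u v x -` C Int space M" "s <= u" "u <= v" "v <= t" "C : sets (PA)"
 have "K' u v x -` C Int space M : sets (FF N M K' W s t)"
 unfolding sets_ff using 1(2-) by(intro sigma_sets.Basic) blast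
 moreover have "AE w in M. w : B <-> w : K' u v x -` C Int space M"
 using mod[OF 1(3), of x] by eventually_elim (simp add: 1(1))
 ultimately show ?thesis by(rule bexI[rotated])
 next
 assume "B : {W i u v -` A Int space M | i u v A. i : {1..N} & s <= u & u <= v & v <= t & A : sets borel}"
 hence "B : sets (FF N M K' W s t)" unfolding sets_ff by(intro sigma_sets.Basic) blast
 thus ?thesis by(intro bexI[of _ B]) auto
 qed
qed

context star
begin

lemma test_function_deriv_bdm:
 assumes f: "f : test_functions N e p" shows "bdm borel (sder N e p 1 f)" "bdm borel (sder N e p 2 f)"
proof -
 have main: "bdm borel (sder N e p k f)"
 if c: "!!i. i : {1..N} ==> continuous_on {0<..} ((deriv ^^ k) (%r. f (e i r)))"
 and b: "!!i. i : {1..N} ==> bounded ((deriv ^^ k) (%r. f (e i r)) ` {0<..})" for k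
 proof -
 define b' where "b' i r = ind {0<..} r .* (deriv ^^ k) (%r. f (e i r)) r" for i r
 have "sder N e p k f = sfun (sder N e p k f (origin e)) b'"
 by(rule ext) (simp add: sfun_def b'_def sder_no rad_pos)
 moreover have "bdm borel (sfun (sder N e p k f (origin e)) b')"
 proof -
 have "ALL i:{1..N}. EX K. ALL r>0. |(deriv ^^ k) (%r. f (e i r)) r| <= K"
 proof
 fix i assume "i : {1..N}"
 from b[OF this] obtain a where "ALL y:(deriv ^^ k) (%r. f (e i r)) ` {0<..}. norm y <= a" by(auto simp: bounded_iff)
 thus "EX K. ALL r>0. |(deriv ^^ k) (%r. f (e i r)) r| <= K" by(intro exI[of _ a]) auto
 qed
 then obtain K where K: "!!i r. i : {1..N} ==> r > 0 ==> |(deriv ^^ k) (%r. f (e i r)) r| <= K i" by metis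
 show ?thesis
 proof(rule sfun_bdm[where K = "SUM i:{1..N}. |K i|"])
 show "b' i : bm borel" if "i : {1..N}" for i
 unfolding b'_def[abs_def] by(rule borel_measurable_continuous_on_indicator[OF _ c[OF that]]) simp
 fix i r assume i: "i : {1..N}"
 have s: "|K i| <= (SUM i:{1..N}. |K i| )" using i by(intro member_le_sum) auto
 show "|b' i r| <= (SUM i:{1..N}. |K i| )"
 proof(cases "r > 0")
 case True
 have "|b' i r| <= |K i|" using K[OF i True] True by(simp add: b'_def)
 thus ?thesis using s by linarith
 next
 case False
 have "0 <= (SUM i:{1..N}. |K i| )" by(rule sum_nonneg) simp
 thus ?thesis using False by(simp add: b'_def)
 qed
 qed
 qed
 ultimately show ?thesis by simp
 qed
 have C: "ALL i:{1..N}. let g = (%r. f (e i r)) in (ALL r>0. g differentiable (at r)) & (ALL r>0. deriv g differentiable (at r)) &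
 continuous_on {0<..} (deriv (deriv g)) & bounded (deriv g ` {0<..}) & bounded (deriv (deriv g) ` {0<..})"
 using f unfolding test_functions_def C2b_def Let_def by blast
 show "bdm borel (sder N e p 1 f)"
 proof(rule main)
 fix i assume i: "i : {1..N}"
 have "ALL r>0. deriv (%r. f (e i r)) differentiable (at r)" using C i by(simp add: Let_def)
 thus "continuous_on {0<..} ((deriv ^^ 1) (%r. f (e i r)))"
 by(auto intro!: continuous_at_imp_continuous_on differentiable_imp_continuous_within)
 show "bounded ((deriv ^^ 1) (%r. f (e i r)) ` {0<..})" using C i by(simp add: Let_def)
 qed
 show "bdm borel (sder N e p 2 f)" by(rule main) (use C in "simp_all add: Let_def numeral_2_eq_2")
qed

text \<open>Needed for \<open>KW\<close>, which is not given as a solution but identified with one.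
  The drift integral requires equality at almost all times simultaneously; joint measurability and
  Fubini derive this from equality at fixed times.\<close>

lemma solves_ISDE_modification:
 assumes P: "prob_space M" and sol: "solves_ISDE N e p M K W" and jK: "jointly M (PA) K"
 and jK': "jointly M (PA) K'" and mod: "!!s t x. s <= t ==> AE w in M. K s t x w = K' s t x w"
 shows "solves_ISDE N e p M K' W"
proof -
 interpret prob_space M by fact
 have mod': "AE w in M. K' s t x w = K s t x w" if "s <= t" for s t x using mod[OF that, of x] by eventually_elim simp
 have noises: "independent_white_noises N M W" using sol by(simp add: solves_ISDE_def)
 have sub: "sets (FF N M K' W s u) <= events" for s u
 by(rule ff_sub[OF flow_mt(2)[OF jK'] noises_m[OF noises]]) auto
 have subK: "sets (FF N M K W s u) <= events" for s u
 by(rule ff_sub[OF flow_mt(2)[OF jK] noises_m[OF noises]]) auto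
 have bm: "brownian_motion_in M (FF N M K' W s) s (W i s)" if i: "i : {1..N}" for s i
 proof -
 have b: "brownian_motion_in M (FF N M K W s) s (W i s)" using sol i by(simp add: solves_ISDE_def)
 show ?thesis unfolding bmi_def
 proof(intro conjI allI impI)
 show "AE w in M. W i s s w = 0" using b by(simp add: bmi_def)
 show "W i s u : bm (FF N M K' W s u)" if "s <= u" for u using i that by(intro W_ff) auto
 fix u v assume uv: "s <= u & u < v"
 show "distributed M lborel (%w. W i s v w-W i s u w) (%x. ennreal (normal_density 0 (sqrt (v-u)) x))"
 using b uv by(simp add: bmi_def)
 have ind: "indep_set (sets (FF N M K W s u)) (sets (vimage_algebra (space M) (%w. W i s v w-W i s u w) borel))"
 using b uv by(simp add: bmi_def)
 have va: "sets (vimage_algebra (space M) (%w. W i s v w-W i s u w) borel) <= events"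
 using ind unfolding indep_set_def indep_sets_def by(auto split: bool.splits)
 show "indep_set (sets (FF N M K' W s u)) (sets (vimage_algebra (space M) (%w. W i s v w-W i s u w) borel))"
 proof(rule indep_setI[OF sub va])
 fix A C assume A: "A : sets (FF N M K' W s u)" and C: "C : sets (vimage_algebra (space M) (%w. W i s v w-W i s u w) borel)"
 obtain A' where A': "A' : sets (FF N M K W s u)" "AE w in M. w : A <-> w : A'"
 using ff_approx[OF mod' A] by blast
 have ev: "A : events" "A' : events" "C : events" using A A'(1) C sub subK va by blast+
 have "prob A = prob A'" by(rule finite_measure_eq_AE[OF A'(2) ev(1,2)])
 moreover have "prob (A Int C) = prob (A' Int C)"
 by(rule finite_measure_eq_AE) (use A'(2) ev in "auto elim: ev_mono")
 ultimately show "prob (A Int C) = prob A*prob C" using indep_setD[OF ind A'(1) C] by simp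
 qed
 qed
 qed
 have eqh: "AE w in M. AE u in time s t. (LINT y|(K s u x w). h y) = (LINT y|(K' s u x w). h y)"
 if h: "bdm borel h" for s t :: real and x and h :: "'g => real"
 proof -
 interpret R: finite_measure "time s t" by(rule fin_time)
 interpret PR: pair_sigma_finite "time s t" M ..
 have m: "(%z. (LINT y|(K s (fst z) x (snd z)). h y)) : bm (time s t >< M)"
 "(%z. (LINT y|(K' s (fst z) x (snd z)). h y)) : bm (time s t >< M)"
 using bdm_m[OF bdm_ker[OF flow_mt(1)[OF jK] h]]
 bdm_m[OF bdm_ker[OF flow_mt(1)[OF jK'] h]] by(simp_all add: cpb)
 have "AE u in time s t. AE w in M. (LINT y|(K s u x w). h y) = (LINT y|(K' s u x w). h y)"
 proof(rule AE_I2)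
 fix u assume "u : space (time s t)"
 hence "s <= u" by(simp add: sp_restr)
 from mod[OF this, of x] show "AE w in M. (LINT y|(K s u x w). h y) = (LINT y|(K' s u x w). h y)" by eventually_elim simp
 qed
 thus ?thesis by(subst (asm) PR.AE_commute) (use m in measurable)
 qed
 show ?thesis unfolding solves_ISDE_def
 proof(intro conjI allI ballI impI noises bm)
 fix s t :: real and x f assume f: "f : test_functions N e p" and st: "s <= t"
 note fb = test_function_deriv_bdm[OF f]
 have ib: "bdm borel (%y. ind (ray e i) y * sder N e p 1 f y)" if "i : {1..N}" for i
 using that by(intro bdm_mult[OF _ fb(1)] bdmI[where c = 1]) (auto simp: ind_def)
 obtain X where X: "!!i. i : {1..N} ==> ito_int M (FF N M K W s) (W i s) s t
 (%u w. (LINT y|(K s u x w). ind (ray e i) y * sder N e p 1 f y)) (X i)"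
 and eq: "AE w in M. igb (K s t x w) f & (LINT y|(K s t x w). f y) = f x+(SUM i:{1..N}. X i w)
 + 1/2*(LBINT u:{s..t}. (LINT y|(K s u x w). sder N e p 2 f y))"
 using sol f st unfolding solves_ISDE_def by blast
 have e2: "AE w in M. AE u in time s t. (LINT y|(K s u x w). sder N e p 2 f y) = (LINT y|(K' s u x w). sder N e p 2 f y)"
 by(rule eqh[OF fb(2)])
 have "ito_int M (FF N M K' W s) (W i s) s t (%u w. (LINT y|(K' s u x w). ind (ray e i) y * sder N e p 1 f y)) (X i)"
 if i: "i : {1..N}" for i
 proof(rule has_ito_integral_modification[OF _ _ _ X[OF i] _ eqh[OF ib[OF i]]])
 show "EX V'. bdm (FF N M K' W s u) V' & (AE w in M. V w = V' w)" if "bdm (FF N M K W s u) V" for u V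
 by(rule bdm_AE_approx[OF _ _ _ that]) (use ff_approx[OF mod] in auto)
 have "sets (restrict_space borel {s..t} >< M) = sets (time s t >< M)"
 by(intro sets_pair_measure_cong sets_restrict_space_cong) auto
 thus "(%(u, w). (LINT y|(K' s u x w). ind (ray e i) y * sder N e p 1 f y)) : bm (restrict_space borel {s..t} >< M)"
 using bdm_m[OF bdm_ker[OF flow_mt(1)[OF jK'] ib[OF i]]] by(simp add: cpb cong: m_cong_sets)
 qed auto
 moreover have "AE w in M. igb (K' s t x w) f & (LINT y|(K' s t x w). f y) = f x+(SUM i:{1..N}. X i w)
 + 1/2*(LBINT u:{s..t}. (LINT y|(K' s u x w). sder N e p 2 f y))" using eq mod[OF st, of x] e2 AE_space
 proof eventually_elim
 case (elim w)
 have r: "(LBINT v:{s..t}. h v) = (LINT v|(time s t). h v)" for h :: "real => real"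
 by(simp add: set_int_def int_restr)
 have sec: "(%u. (LINT y|(L s u x w). sder N e p 2 f y)) : bm (time s t)"
 if "(%(v, w). L s v x w) : time s t >< M ~> PA" for L using measurable_Pair1'[of w M "time s t"] elim(4)
 m_comp[OF measurable_Pair2'[of w M "time s t"] bdm_m[OF bdm_ker[OF that fb(2)]]] by(simp add: cpb)
 have "(LINT u|(time s t). (LINT y|(K s u x w). sder N e p 2 f y)) = (LINT u|(time s t). (LINT y|(K' s u x w). sder N e p 2 f y))"
 by(rule int_cong_AE[OF sec[of K] sec[of K'] elim(3)]) (rule flow_mt(1)[OF jK] flow_mt(1)[OF jK'])+
 thus ?case using elim(1) unfolding elim(2)[symmetric] r by simp
 qed
 ultimately show "EX I. (ALL i:{1..N}. ito_int M (FF N M K' W s) (W i s) s t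
 (%u w. (LINT y|(K' s u x w). ind (ray e i) y * sder N e p 1 f y)) (I i)) &
 (AE w in M. igb (K' s t x w) f &
 (LINT y|(K' s t x w). f y) = f x+(SUM i:{1..N}. I i w)
 + 1/2*(LBINT u:{s..t}. (LINT y|(K' s u x w). sder N e p 2 f y)))" by blast
 qed
qed

end

section \<open>The flow of Dirac kernels\<close>

lemma eventually_to_infinity:
 "eventually P (to_infinity :: 'm::t2_space filter) <-> (EX C. compact C & (ALL x. x \<notin> C --> P x))"
proof -
 have "eventually P (to_infinity :: 'm filter) <-> (EX C:{C. compact C}. eventually P (principal (- C)))"
 unfolding to_infinity_def
 proof(rule eventually_INF_base)
 fix A B :: "'m set" assume "A : {C. compact C}" "B : {C. compact C}"
 thus "EX C:{C. compact C}. principal (- C) <= inf (principal (- A)) (principal (- B))"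
 by(intro bexI[of _ "A Un B"]) (auto intro: compact_Un)
 qed auto
 thus ?thesis by(auto simp: eventually_principal)
qed

text \<open>\<open>f\<close> need not be uniformly continuous. \<open>A n\<close> collects the
  points within 1/(n+1) of which \<open>f\<close> changes by more than \<open>ep\<close>; these sets
  are open and decrease to the empty set, so \<open>Z0\<close> avoids \<open>A n\<close> with high
  probability, and off \<open>A n\<close> nearby points have nearby values.\<close>

lemma (in prob_space) tendsto_prob_continuous:
 fixes f :: "'m::{metric_space, second_countable_topology} => real" and Z :: "'i => 'a => 'm"
 assumes f: "continuous_on UNIV f" and ep: "ep > 0" and Z0: "Z0 : bm M"
 and Z: "\<forall>\<^sub>F i in F. Z i : bm M"
 and lim: "!!de. de > 0 ==> ((%i. prob {w\<in>space M. de < dist (Z i w) (Z0 w)}) ~~> 0) F"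
 shows "((%i. prob {w\<in>space M. ep < |f (Z i w)-f (Z0 w)| }) ~~> 0) F"
proof -
 define A where "A n = {z. EX z'. dist z' z < 1/real (Suc n) & ep < |f z'-f z| }" for n
 note [measurable] = Z0 bm_cont[OF f]
 have fc: "isCont f z" for z using f by(simp add: continuous_on_eq_continuous_at)
 have openA: "open (A n)" for n unfolding open_contains_ball
 proof safe
 fix z assume "z : A n"
 then obtain z' where z': "dist z' z < 1/real (Suc n)" "ep < |f z'-f z|" by(auto simp: A_def)
 define et where "et = |f z'-f z|-ep"
 have "et > 0" using z' by(simp add: et_def)
 then obtain d where d: "d > 0" "!!y. dist y z < d ==> dist (f y) (f z) < et"
 using fc[of z] unfolding continuous_at_eps_delta by blast
 show "EX r>0. ball z r <= A n"
 proof(intro exI[of _ "min d (1/real (Suc n)-dist z' z)"] conjI subsetI)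
 show "0 < min d (1/real (Suc n)-dist z' z)" using d z' by simp
 fix y assume y: "y : ball z (min d (1/real (Suc n)-dist z' z))"
 have yz: "dist y z < d" "dist y z < 1/real (Suc n)-dist z' z" using y by(auto simp: dist_commute)
 have "dist z' y < 1/real (Suc n)" using dist_triangle[of z' y z] yz(2) by(simp add: dist_commute)
 moreover have "ep < |f z'-f y|" using d(2)[OF yz(1)] unfolding dist_real_def et_def by linarith
 ultimately show "y : A n" by(auto simp: A_def)
 qed
 qed
 have [measurable]: "A n : sets borel" for n using openA by auto
 have "(%n. prob {w\<in>space M. Z0 w : A n}) ----> prob (\<Inter>n. {w\<in>space M. Z0 w : A n})"
 proof(rule finite_Lim_measure_decseq)
 have "A n <= A m" if "m <= n" for m n
 proof
 fix z assume "z : A n"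
 then obtain z' where z': "dist z' z < 1/real (Suc n)" "ep < |f z'-f z|" by(auto simp: A_def)
 have "1/real (Suc n) <= 1/real (Suc m)" using that by(intro divide_left_mono) auto
 thus "z : A m" using z' unfolding A_def by(intro CollectI exI[of _ z']) linarith
 qed
 thus "decseq (%n. {w\<in>space M. Z0 w : A n})" by(auto simp: decseq_def)
 qed auto
 also have "(\<Inter>n. {w\<in>space M. Z0 w : A n}) = {}"
 proof(rule ccontr)
 assume "~ ?thesis"
 then obtain w where w: "!!n. Z0 w : A n" by auto
 obtain d where d: "d > 0" "!!y. dist y (Z0 w) < d ==> dist (f y) (f (Z0 w)) < ep"
 using fc[of "Z0 w"] ep unfolding continuous_at_eps_delta by blast
 obtain n where n: "1/real (Suc n) < d" using nat_approx_posE[OF d(1)] by blast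
 obtain z' where "dist z' (Z0 w) < 1/real (Suc n)" "ep < |f z'-f (Z0 w)|" using w[of n] by(auto simp: A_def)
 thus False using d(2)[of z'] n by(auto simp: dist_real_def)
 qed
 finally have A0: "(%n. prob {w\<in>space M. Z0 w : A n}) ----> 0" by simp
 show ?thesis
 proof(rule tendstoI)
 fix et :: real assume et: "et > 0"
 have "\<forall>\<^sub>F n in sequentially. prob {w\<in>space M. Z0 w : A n} < et /2" by(rule order_tendstoD(2)[OF A0]) (use et in simp)
 then obtain n where n: "prob {w\<in>space M. Z0 w : A n} < et /2" by(auto simp: eventually_sequentially)
 define de where "de = 1/real (Suc n)/2"
 have "\<forall>\<^sub>F i in F. prob {w\<in>space M. de < dist (Z i w) (Z0 w)} < et /2"
 by(rule order_tendstoD(2)[OF lim]) (use et in "auto simp: de_def")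
 thus "\<forall>\<^sub>F i in F. dist (prob {w\<in>space M. ep < |f (Z i w)-f (Z0 w)| }) 0 < et" using Z
 proof eventually_elim
 case (elim i)
 note [measurable] = elim(2)
 have "{w\<in>space M. ep < |f (Z i w)-f (Z0 w)| } <= {w\<in>space M. de < dist (Z i w) (Z0 w)} Un {w\<in>space M. Z0 w : A n}"
 proof safe
 fix w assume w: "ep < |f (Z i w)-f (Z0 w)|" "Z0 w \<notin> A n"
 have "~ dist (Z i w) (Z0 w) < 1/real (Suc n)" using w by(auto simp: A_def)
 moreover have "de < 1/real (Suc n)" by(simp add: de_def fs)
 ultimately show "de < dist (Z i w) (Z0 w)" by linarith
 qed
 hence "prob {w\<in>space M. ep < |f (Z i w)-f (Z0 w)| } <= prob ({w\<in>space M. de < dist (Z i w) (Z0 w)} Un {w\<in>space M. Z0 w : A n})"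
 by(intro finite_measure_mono) auto
 also have "... <= prob {w\<in>space M. de < dist (Z i w) (Z0 w)}+prob {w\<in>space M. Z0 w : A n}"
 by(intro measure_Un_le) auto
 finally show ?case using elim(1) n by simp
 qed
 qed
qed

text \<open>This makes the flow of mappings itself a competitor in the uniqueness statement.\<close>

lemma dirac_flow_SFK:
 fixes ph :: "real => real => 'm => 'w => 'm::{metric_space, second_countable_topology}"
 assumes P: "prob_space M" and sfm: "stochastic_flow_of_mappings M ph"
 shows "stochastic_flow_of_kernels M (dfl ph)"
proof -
 interpret prob_space M by fact
 have h: "homogeneous_independent_family M borel ph" using sfm by(simp add: sfm_def)
 have jphi: "jointly M borel ph" using h unfolding hif_def by blast
 note phim = flow_mt(2)[OF jphi]
 have ig: "(LINT y|(dfl ph s t x w). f y) = f (ph s t x w)" if "f : bm borel" for f :: "'m => real" and s t x w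
 using that by(simp add: dirac_flow_def integral_return)
 define rh :: "('m => 'm) => ('m => 'm measure)" where "rh g = (%x. return borel (g x))" for g
 have rhm: "rh : (\<Pi>\<^sub>M x\<in>UNIV. borel) ~> (\<Pi>\<^sub>M x\<in>UNIV. PA)"
 unfolding rh_def by(intro measurable_PiM_single') (auto intro!: m_comp[OF measurable_component_singleton measurable_return_prob_space] simp: space_PiM space_prob_algebra prob_space_return)
 have m: "(%w x. ph s t x w) : M ~> (\<Pi>\<^sub>M x\<in>UNIV. borel)" if "s <= t" for s t
 using phim[OF that] by(intro measurable_PiM_single') auto
 have drh: "(%w x. dfl ph s t x w) = (%w. rh (%x. ph s t x w))" for s t by(simp add: rh_def dirac_flow_def fun_eq_iff)
 have hom: "homogeneous_independent_family M (PA) (dfl ph)" unfolding hif_def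
 proof(intro conjI allI impI)
 show "(%(s, t, x, w). dfl ph s t x w) : restrict_space (borel >< (borel >< (borel >< M))) {(s, t, x, w). s <= t} ~> PA"
 by(rule dirac_m[OF jphi])
 next
 fix s t h' :: real assume st: "s <= t"
 have e: "distr M (\<Pi>\<^sub>M x\<in>UNIV. borel) (%w x. ph (s+h') (t+h') x w) = distr M (\<Pi>\<^sub>M x\<in>UNIV. borel) (%w x. ph s t x w)"
 using h st unfolding hif_def by blast
 have d: "distr M (\<Pi>\<^sub>M x\<in>UNIV. PA) (%w x. dfl ph a b x w) = distr (distr M (\<Pi>\<^sub>M x\<in>UNIV. borel) (%w x. ph a b x w)) (\<Pi>\<^sub>M x\<in>UNIV. PA) rh"
 if "a <= b" for a b unfolding drh by(subst distr_distr[OF rhm m[OF that]]) (simp add: comp_def)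
 show "distr M (\<Pi>\<^sub>M x\<in>UNIV. PA) (%w x. dfl ph (s+h') (t+h') x w) = distr M (\<Pi>\<^sub>M x\<in>UNIV. PA) (%w x. dfl ph s t x w)"
 using st by(simp add: d e)
 next
 fix n and a b :: "nat => real" assume ab: "(ALL k<n. a k <= b k) & (ALL k. Suc k < n --> b k <= a (Suc k))"
 have "indep_vars (%_. \<Pi>\<^sub>M x\<in>UNIV. borel) (%k w x. ph (a k) (b k) x w) {..<n}"
 using h ab unfolding hif_def by blast
 hence "indep_vars (%_. \<Pi>\<^sub>M x\<in>UNIV. PA) (%k w. rh (%x. ph (a k) (b k) x w)) {..<n}"
 by(rule indep_vars_compose2) (rule rhm)
 thus "indep_vars (%_. \<Pi>\<^sub>M x\<in>UNIV. PA) (%k w x. dfl ph (a k) (b k) x w) {..<n}"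
 by(simp add: rh_def dirac_flow_def)
 qed
 show ?thesis unfolding sfk_def
 proof(intro conjI allI ballI impI hom)
 show "dfl ph s s x w = return borel x" if "w : space M" for s x w
 using sfm that by(simp add: sfm_def dirac_flow_def)
 next
 fix s t u :: real and x assume stu: "s <= t & t <= u"
 have "AE w in M. ph s u x w = ph t u (ph s t x w) w" using sfm stu by(auto simp: sfm_def)
 thus "AE w in M. dfl ph s u x w = dfl ph s t x w \<bind> (%y. dfl ph t u y w)" using AE_space
 proof eventually_elim
 case (elim w)
 have "(%y. (t, u, y, w)) : borel ~> restrict_space (borel >< (borel >< (borel >< M))) {(s, t, x, w). s <= t}"
 using stu elim(2) by(intro measurable_restrict_space2) auto
 from m_comp[OF this jphi] have "(%y. ph t u y w) : bm borel" by simp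
 hence "(%y. return borel (ph t u y w)) : borel ~> subprob_algebra borel" by(rule m_comp[OF _ return_measurable])
 from bind_return[OF this, of "ph s t x w"] show ?case using elim(1) by(simp add: dirac_flow_def)
 qed
 next
 fix s t :: real and x and f :: "'m => real" and ep :: real assume ep: "ep > 0" and a: "s <= t & continuous_on UNIV f & bounded (range f)"
 have fm: "f : bm borel" using a by(auto intro: bm_cont)
 have "((%i. prob {w\<in>space M. ep < \<bar>f ((case i of (s', t', x') => ph s' t' x') w)-f (ph s t x w)\<bar>}) ~~> 0) (at (s, t, x) within {(s', t', x'). s' <= t'})"
 proof(rule tendsto_prob_continuous[OF _ ep phim])
 show "\<forall>\<^sub>F i in at (s, t, x) within {(s', t', x'). s' <= t'}. (case i of (s', t', x') => ph s' t' x') : bm M"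
 using phim by(auto simp: eventually_at_filter intro!: always_eventually)
 fix de :: real assume "de > 0"
 hence "((%(s', t', x'). prob {w\<in>space M. de < dist (ph s' t' x' w) (ph s t x w)}) ~~> 0) (at (s, t, x) within {(s', t', x'). s' <= t'})"
 using sfm a by(simp add: sfm_def)
 thus "((%i. prob {w\<in>space M. de < dist ((case i of (s', t', x') => ph s' t' x') w) (ph s t x w)}) ~~> 0) (at (s, t, x) within {(s', t', x'). s' <= t'})"
 by(simp add: cpb)
 qed (use a in auto)
 thus "((%(s', t', x'). prob {w\<in>space M. ep < |(LINT y|(dfl ph s' t' x' w). f y)-(LINT y|(dfl ph s t x w). f y)| }) ~~> 0)
 (at (s, t, x) within {(s', t', x'). s' <= t'})" by(simp add: ig[OF fm] cpb)
 next
 fix s t :: real and f :: "'m => real" and ep :: real assume f: "f : C0" and ep: "ep > 0" and st: "s <= t"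
 have fc: "continuous_on UNIV f" "(f ~~> 0) to_infinity" using f by(auto simp: C0_def)
 have fm: "f : bm borel" by(rule bm_cont[OF fc(1)])
 have "\<forall>\<^sub>F x in to_infinity. dist (f x) 0 < ep" by(rule tendstoD[OF fc(2) ep])
 then obtain C where C: "compact C" "!!x. x \<notin> C ==> |f x| < ep" by(auto simp: eventually_to_infinity)
 have [measurable]: "C : sets borel" using C(1) by(simp add: borel_closed compact_imp_closed)
 note [measurable] = fm phim[OF st]
 have l: "((%x. prob {w\<in>space M. ph s t x w : C}) ~~> 0) to_infinity" using sfm st C(1) by(simp add: sfm_def)
 show "((%x. prob {w\<in>space M. ep < |(LINT y|(dfl ph s t x w). f y)| }) ~~> 0) to_infinity"
 proof(rule tendsto_sandwich[OF _ _ t_const l])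
 have "prob {w\<in>space M. ep < |f (ph s t x w)| } <= prob {w\<in>space M. ph s t x w : C}" for x
 proof(rule finite_measure_mono)
 show "{w\<in>space M. ep < |f (ph s t x w)| } <= {w\<in>space M. ph s t x w : C}" using C(2) by force
 qed measurable
 thus "\<forall>\<^sub>F x in to_infinity. prob {w\<in>space M. ep < |(LINT y|(dfl ph s t x w). f y)| } <= prob {w\<in>space M. ph s t x w : C}"
 by(simp add: ig[OF fm])
 qed simp
 qed
qed

section \<open>Rotations of the noise\<close>

text \<open>For rational c the set where \<open>V\<close> exceeds c is the preimage of some
  \<open>C c\<close>, and \<open>V\<close> is the supremum of the rationals below it. The supremum
  is taken in the extended reals, since off the range of \<open>Z\<close> it may be
  infinite.\<close>

lemma doob_dynkin:
 fixes V :: "'a => real"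
 assumes Z: "Z : \<Omega> \<rightarrow> space S" and V: "V : bm (vimage_algebra \<Omega> Z S)"
 shows "EX v:bm S. ALL w:\<Omega>. V w = v (Z w)"
proof -
 have sp: "space (vimage_algebra \<Omega> Z S) = \<Omega>" by simp
 have "EX C. C : sets S & {w\<in>\<Omega>. real_of_rat c < V w} = Z -` C Int \<Omega>" for c
 proof -
 have "{w\<in>space (vimage_algebra \<Omega> Z S). real_of_rat c < V w} : sets (vimage_algebra \<Omega> Z S)" using V by measurable
 thus ?thesis unfolding sets_vimage_algebra2[OF Z] sp by auto
 qed
 then obtain C where C: "!!c. C c : sets S" "!!c. {w\<in>\<Omega>. real_of_rat c < V w} = Z -` C c Int \<Omega>" by metis
 note [measurable] = C(1)
 define v where "v z = real_of_ereal (SUP c. if z : C c then ereal (real_of_rat c) else-\<infinity>)" for z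
 have vm: "v : bm S"
 unfolding v_def[abs_def] by(intro borel_measurable_real_of_ereal borel_measurable_SUP) (auto intro!: measurable_If)
 moreover have "V w = v (Z w)" if w: "w : \<Omega>" for w
 proof -
 have iff: "Z w : C c <-> real_of_rat c < V w" for c using C(2)[of c] w by blast
 have "(SUP c. if Z w : C c then ereal (real_of_rat c) else-\<infinity>) = ereal (V w)"
 proof(rule antisym)
 show "(SUP c. if Z w : C c then ereal (real_of_rat c) else-\<infinity>) <= ereal (V w)"
 by(rule SUP_least) (simp add: iff less_imp_le)
 show "ereal (V w) <= (SUP c. if Z w : C c then ereal (real_of_rat c) else-\<infinity>)"
 proof(rule dense_le)
 fix y assume y: "y < ereal (V w)"
 obtain x where x: "y < ereal x" "x < V w" using ereal_dense2[OF y] by auto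
 obtain c where c: "x < real_of_rat c" "real_of_rat c < V w" using of_rat_dense[OF x(2)] by blast
 have "y <= ereal (real_of_rat c)" using x(1) c(1) by(meson less_ereal.simps(1) less_imp_le less_trans)
 also have "... = (if Z w : C c then ereal (real_of_rat c) else-\<infinity>)" using c(2) iff by simp
 also have "... <= (SUP c. if Z w : C c then ereal (real_of_rat c) else-\<infinity>)" by(rule SUP_upper) simp
 finally show "y <= (SUP c. if Z w : C c then ereal (real_of_rat c) else-\<infinity>)" .
 qed
 qed
 thus ?thesis by(simp add: v_def)
 qed
 ultimately show ?thesis by blast
qed

lemma doob_dynkin_nalg:
 fixes V :: "'a => real"
 assumes "V : bm (nalg M N W a b)" shows "EX v:bm (nspc N a b). ALL w:space M. V w = v (nmap N W a b w)"
 using doob_dynkin[OF nmap_space assms[unfolded nalg_def]] .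

text \<open>On two independent copies and for r^2+q^2 = 1, a noise of the same law whose correlation
  with the first copy is \<open>r\<close>.\<close>

definition rotated :: "real => real => (nat => real => real => 'w => real) => nat => real => real => 'w*'w => real" where
 "rotated r q W i u v z = r*W i u v (fst z)+q*W i u v (snd z)"

lemma nmap_restr:
 assumes "a <= a'" "b' <= b" shows "nmap N W a' b' w = restrict (nmap N W a b w) (nset N a' b')"
 using assms by(auto simp: nmap_def nset_def fun_eq_iff)

lemma nrestr_m:
 assumes "a <= a'" "b' <= b" shows "(%z. restrict z (nset N a' b')) : nspc N a b ~> nspc N a' b'"
 unfolding nspc_def by(rule measurable_restrict_subset) (use assms in \<open>auto simp: nset_def\<close>)

context driven
begin

lemma rotated_measurable:
 assumes "!!i u v. i : {1..N} ==> a <= u ==> u <= v ==> v <= b ==> W i u v : bm G"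
 shows "nmap N (rotated r q W) a b : G >< M ~> nspc N a b"
proof(rule nmap_m)
 fix i u v assume i: "i : {1..N}" "a <= u" "u <= v" "v <= b"
 note [measurable] = assms[OF i] W_meas[OF i(1,3)]
 show "rotated r q W i u v : bm (G >< M)" unfolding rotated_def[abs_def] by measurable
qed

lemma noise_char:
 assumes K: "finite K" "K <= nset N s b"
 shows "EX V::real. ALL x. (LINT w|M. cis (x*(SUM j:K. th j*nz W j w))) = cor (exp (- (x^2*V/2)))"
proof -
 define \<iota> where "\<iota> j = fst j" for j :: "nat*real*real"
 define al where "al j = fst (snd j)" for j :: "nat*real*real"
 define ga where "ga j = snd (snd j)" for j :: "nat*real*real"
 have jK: "\<iota> j : {1..N}" "s <= al j" "al j <= ga j" if "j : K" for j
 using K(2) that by(auto simp: nset_def \<iota>_def al_def ga_def)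
 have at: "nz W j w = W (\<iota> j) (al j) (ga j) w" for j w by(simp add: nz_def \<iota>_def al_def ga_def split: prod.split)
 obtain V :: real where V: "!!x (Z :: 'w => complex). cbdm (F s) Z ==>
 (LINT w|M. Z w * cis (x*(SUM j:K. th j*W (\<iota> j) (al j) (ga j) w))) = cor (exp (- (x^2*V/2)))*(LINT w|M. Z w)"
 by(rule linear_functional_char[OF K(1) order_refl, where \<iota> = \<iota> and al = al and ga = ga and c = th]) (erule jK | blast)+
 have "cbdm (F s) (%_. 1)" by(auto simp: cbdm_def)
 from V[OF this] show ?thesis unfolding at by(intro exI[of _ V]) (simp add: prob_space)
qed

text \<open>A linear functional of variance V has characteristic function exp(-x^2*V/2), and
  r^2*V+q^2*V = V.\<close>

lemma rotated_law:
 assumes rq: "r^2+q^2 = 1"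
 shows "distr (M >< M) (nspc N s b) (nmap N (rotated r q W) s b) = distr M (nspc N s b) (nmap N W s b)"
proof -
 interpret MM: pair_prob_space M M ..
 have W_at: "nz W j : bm M" if "j : nset N s b" for j
 using that W_meas by(auto simp: nset_def nz_def[abs_def] split: prod.splits)
 have at: "nz (rotated r q W) j z = r*nz W j (fst z)+q*nz W j (snd z)" for j z
 by(simp add: nz_def rotated_def split: prod.split)
 have R_at: "nz (rotated r q W) j : bm (M >< M)" if "j : nset N s b" for j
 proof -
 note [measurable] = W_at[OF that]
 show ?thesis unfolding at[abs_def] by measurable
 qed
 have one: "density L (%_. ennreal 1) = L" for L :: "'x measure" by(simp add: density_1)
 have "distr (density (M >< M) (%_. ennreal 1)) (\<Pi>\<^sub>M j\<in>nset N s b. borel) (%z. \<lambda>j\<in>nset N s b. nz (rotated r q W) j z)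
 = distr (density M (%_. ennreal 1)) (\<Pi>\<^sub>M j\<in>nset N s b. borel) (%w. \<lambda>j\<in>nset N s b. nz W j w)"
 proof(rule distr_PiM_eqI_char[OF _ _ R_at W_at bdm_const _ bdm_const])
 fix K th assume K: "finite K" "K <= nset N s b"
 define L where "L w = (SUM j:K. th j*nz W j w)" for w
 have [measurable]: "L : bm M" unfolding L_def[abs_def] using K W_at by(intro bm_sum bm_times bm_const) auto
 obtain V :: real where V: "!!x. (LINT w|M. cis (x*L w)) = cor (exp (- (x^2*V/2)))"
 using noise_char[OF K, of th] unfolding L_def by blast
 have sum: "(SUM j:K. th j*nz (rotated r q W) j z) = r*L (fst z)+q*L (snd z)" for z
 by(simp add: at L_def sum.distrib sdl algs)
 have i: "igb (M >< M) (%(x, y). cis (r*L x)*cis (q*L y))"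
 proof(rule MM.integrable_const_bound[where B = 1])
 show "AE z in M >< M. norm (case z of (x, y) => cis (r*L x)*cis (q*L y)) <= 1"
 by(rule AE_I2) (simp add: case_prod_beta norm_mult)
 qed measurable
 have "(LINT z|(M >< M). 1 .* cis (SUM j:K. th j*nz (rotated r q W) j z)) = (LINT z|(M >< M). (case z of (x, y) => cis (r*L x)*cis (q*L y)))"
 unfolding sum by(intro Bint_cong) (auto simp: cis_mult)
 also have "... = (LINT x|M. (LINT y|M. cis (r*L x)*cis (q*L y)))" by(rule MM.integral_fst[OF i, symmetric])
 also have "... = cor (exp (- (r^2*V/2)))*cor (exp (- (q^2*V/2)))" by(simp add: V)
 also have "... = cor (exp (- ((r^2+q^2)*V/2)))"
 unfolding of_real_mult[symmetric] exp_add[symmetric] by(simp add: fs)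
 also have "... = (LINT w|M. 1 .* cis (SUM j:K. th j*nz W j w))" using V[of 1] by(simp add: rq L_def)
 finally show "(LINT z|(M >< M). 1 .* cis (SUM j:K. th j*nz (rotated r q W) j z)) = (LINT w|M. 1 .* cis (SUM j:K. th j*nz W j w))" .
 qed (auto intro: MM.finite_measure_axioms finite_measure_axioms)
 thus ?thesis unfolding one nspc_def nmap_def[abs_def] .
qed

end

locale rotated_noise = driven M F s N W
 for M :: "'w measure" and F :: "real => 'w measure" and s :: real and N :: nat
 and W :: "nat => real => real => 'w => real" +
 fixes t r q :: real
 assumes st: "s <= t" and rq: "r^2+q^2 = 1"
begin

abbreviation (input) "Z \<equiv> nmap N W s t"
abbreviation (input) "Zr \<equiv> nmap N (rotated r q W) s t"
abbreviation (input) "NS \<equiv> nspc N s t"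
abbreviation (input) "C V \<equiv> (CE M N W s t) V"

text \<open>The functional is pinned down only where the noise takes its values. The rotated noise
  has the same law, so this ambiguity remains negligible after rotation; see
  \<open>transfer_AE\<close>.\<close>

definition factor :: "('w => real) => (nat*real*real => real) => real" where
 "factor V = (SOME v. v : bm NS & (ALL w:space M. C V w = v (Z w)))"

definition lift :: "('w => real) => 'w*'w => real" where "lift V z = factor V (Zr z)"

text \<open>Mehler's formula after projection onto the noise: the functional is evaluated at the
  rotated noise and the independent copy is averaged out. For 0 < r <= 1 this is the
  Ornstein-Uhlenbeck semigroup at time -ln r.\<close>

definition T :: "('w => real) => 'w => real" where "T V w = (LINT w'|M. lift V (w, w'))"

sublocale MM: pair_prob_space M M ..
sublocale CE: finite_measure_subalgebra M "nalg M N W s t" by(rule finite_subalg)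

lemma Z_meas[measurable]: "Z : M ~> NS" by(rule nmap_m) (rule W_meas)

lemma Zr_meas[measurable]: "Zr : M >< M ~> NS" by(rule rotated_measurable) (rule W_meas)

lemma factor: "factor V : bm NS" "w : space M ==> C V w = factor V (Z w)"
proof -
 have "EX v. v : bm NS & (ALL w:space M. C V w = v (Z w))"
 using doob_dynkin_nalg[OF borel_measurable_cond_exp[of M "nalg M N W s t" V]] by blast
 from someI_ex[OF this, folded factor_def]
 show "factor V : bm NS" "w : space M ==> C V w = factor V (Z w)" by auto
qed

lemma lift_meas[measurable]: "lift V : bm (M >< M)" unfolding lift_def[abs_def] using factor(1) by measurable

lemma transfer_AE:
 assumes "Measurable.pred NS Q" "AE w in M. Q (Z w)" shows "AE z in M >< M. Q (Zr z)"
proof -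
 have "AE x in distr M NS Z. Q x" using assms by(subst AE_distr_iff) (auto simp: pred_def)
 hence "AE x in distr (M >< M) NS Zr. Q x" unfolding rotated_law[OF rq] .
 thus ?thesis using assms(1) by(subst (asm) AE_distr_iff) (auto simp: pred_def)
qed

lemma lift_eq:
 assumes a: "a : bm NS" and eq: "AE w in M. C V w = a (Z w)" shows "AE z in M >< M. lift V z = a (Zr z)"
proof -
 note [measurable] = a factor(1)
 have "AE w in M. factor V (Z w) = a (Z w)" using eq AE_space by eventually_elim (simp add: factor(2))
 moreover have "Measurable.pred NS (%b. factor V b = a b)"
 unfolding pred_def using factor(1) a by(rule borel_measurable_eq)
 ultimately show ?thesis using transfer_AE[of "%b. factor V b = a b"] by(simp add: lift_def)
qed

lemma integral_Zr:
 assumes a: "a : bm NS" shows "(LINT z|(M >< M). a (Zr z)) = (LINT w|M. a (Z w) :: real)"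
 and "igb (M >< M) (%z. a (Zr z)) <-> igb M (%w. a (Z w) :: real)"
proof -
 have "(LINT z|(M >< M). a (Zr z)) = (LINT x|(distr (M >< M) NS Zr). a x)" using a by(simp add: integral_distr)
 also have "... = (LINT w|M. a (Z w))" unfolding rotated_law[OF rq] using a by(simp add: integral_distr)
 finally show "(LINT z|(M >< M). a (Zr z)) = (LINT w|M. a (Z w))" .
 have "igb (M >< M) (%z. a (Zr z)) <-> igb (distr (M >< M) NS Zr) a" using a by(simp add: integrable_distr_eq)
 also have "... <-> igb M (%w. a (Z w))" unfolding rotated_law[OF rq] using a by(simp add: integrable_distr_eq)
 finally show "igb (M >< M) (%z. a (Zr z)) <-> igb M (%w. a (Z w))" .
qed

lemma lift_sqi:
 assumes V: "sqi M V" shows "sqi (M >< M) (lift V)" "(LINT z|(M >< M). (lift V z)^2) <= (LINT w|M. (V w)^2)"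
proof -
 have fm: "(%x. (factor V x)^2) : bm NS" using factor(1) by measurable
 have i: "igb M (%w. (factor V (Z w))^2)"
 using sqi_square[OF CE.ce_sqi(1)[OF V]] by(simp add: factor(2) cong: Bintble_cong)
 thus "sqi (M >< M) (lift V)" using integral_Zr(2)[OF fm] by(simp add: sqi_def lift_def)
 have "(LINT z|(M >< M). (lift V z)^2) = (LINT w|M. (factor V (Z w))^2)" unfolding lift_def by(rule integral_Zr(1)[OF fm])
 also have "... = (LINT w|M. (C V w)^2)" by(intro Bint_cong) (auto simp: factor(2))
 finally show "(LINT z|(M >< M). (lift V z)^2) <= (LINT w|M. (V w)^2)" using CE.ce_sqi(2)[OF V] by simp
qed

lemma lift_section: "sqi M V ==> AE w in M. igb M (%w'. lift V (w, w'))"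
 using MM.AE_integrable_fst'[OF MM.sqi_i[OF lift_sqi(1)]] by simp

lemma T_cong:
 assumes "AE z in M >< M. lift V z = a z" and a: "a : bm (M >< M)"
 shows "AE w in M. T V w = (LINT w'|M. a (w, w'))"
proof -
 have "AE w in M. AE w' in M. lift V (w, w') = a (w, w')" using MM.AE_pair[OF assms(1)] .
 thus ?thesis using AE_space
 proof eventually_elim
 case (elim w)
 show ?case unfolding T_def
 proof(rule int_cong_AE[OF _ _ elim(1)])
 show "(%w'. lift V (w, w')) : bm M" "(%w'. a (w, w')) : bm M"
 using measurable_Pair2[OF lift_meas elim(2)] measurable_Pair2[OF a elim(2)] by auto
 qed
 qed
qed

lemma T_meas[measurable]: "T V : bm M" unfolding T_def[abs_def] by measurable

lemma T_sqi:
 assumes V: "sqi M V" shows "sqi M (T V)" "(LINT w|M. (T V w)^2) <= (LINT w|M. (V w)^2)"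
proof -
 have i2: "igb (M >< M) (%(w, w'). (lift V (w, w'))^2)" using sqi_square[OF lift_sqi(1)[OF V]] by(simp add: cpb)
 have j: "AE w in M. (T V w)^2 <= (LINT w'|M. (lift V (w, w'))^2)" using MM.AE_integrable_fst[OF i2] AE_space
 proof eventually_elim
 case (elim w)
 have s: "sqi M (%w'. lift V (w, w'))" using elim measurable_Pair2[OF lift_meas elim(2)] by(simp add: sqi_def)
 have "0 <= variance (%w'. lift V (w, w'))" by(rule variance_positive)
 also have "... = (LINT w'|M. (lift V (w, w'))^2)-(LINT w'|M. lift V (w, w'))^2"
 by(rule variance_eq[OF sqi_i[OF s] sqi_square[OF s]])
 finally show ?case by(simp add: T_def)
 qed
 have i1: "igb M (%w. (LINT w'|M. (lift V (w, w'))^2))" by(rule MM.integrable_fst[OF i2])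
 have i: "igb M (%w. (T V w)^2)" by(rule Bintble_bound[OF i1]) (use j in "auto elim: ev_mono")
 thus "sqi M (T V)" by(simp add: sqi_def)
 have "(LINT w|M. (T V w)^2) <= (LINT w|M. (LINT w'|M. (lift V (w, w'))^2))" by(rule integral_mono_AE[OF i i1 j])
 also have "... = (LINT z|(M >< M). (lift V z)^2)" using MM.integral_fst[OF i2] by(simp add: cpb)
 finally show "(LINT w|M. (T V w)^2) <= (LINT w|M. (V w)^2)" using lift_sqi(2)[OF V] by linarith
qed

lemma T_eq:
 assumes a: "a : bm NS" and eq: "AE w in M. C V w = a (Z w)"
 shows "AE w in M. T V w = (LINT w'|M. a (Zr (w, w')))"
 by(rule T_cong[OF lift_eq[OF a eq]]) (use a in measurable)

lemma T_lin:
 assumes V: "sqi M V" "sqi M V'" and eq: "AE w in M. C U w = C V w+c*C V' w"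
 shows "AE w in M. T U w = T V w+c*T V' w"
proof -
 note [measurable] = factor(1)
 have "AE w in M. T U w = (LINT w'|M. factor V (Zr (w, w'))+c*factor V' (Zr (w, w')))"
 proof(rule T_eq)
 show "(%x. factor V x+c*factor V' x) : bm NS" by measurable
 show "AE w in M. C U w = factor V (Z w)+c*factor V' (Z w)" using eq AE_space by eventually_elim (simp add: factor(2))
 qed
 thus ?thesis using lift_section[OF V(1)] lift_section[OF V(2)] by eventually_elim (simp add: T_def lift_def)
qed

text \<open>By immersion, the functional of a variable known at time \<open>u\<close> involves the
  noise up to \<open>u\<close> only; its rotated version is then adapted as well.\<close>

lemma adapted_factor:
 assumes u: "s <= u" "u <= t" and V: "bdm (F u) V"
 shows "EX v c. v : bm (nspc N s u) & (ALL x. |v x| <= c) & (AE w in M. C V w = v (nmap N W s u w))"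
proof -
 obtain V0 where V0: "bdm (nalg M N W s u) V0" "AE w in M. C V w = V0 w" by(rule immersion_bounded[OF u V])
 obtain v where v: "v : bm (nspc N s u)" "!!w. w : space M ==> V0 w = v (nmap N W s u w)"
 using doob_dynkin_nalg[OF bdm_m[OF V0(1)]] by blast
 obtain c where c: "c >= 0" "!!w. w : space M ==> |V0 w| <= c" using bdm_bound[OF V0(1)] by auto
 define v' where "v' x = max (- c) (min c (v x))" for x
 have "v' : bm (nspc N s u)" unfolding v'_def[abs_def] using v(1) by measurable
 moreover have "|v' x| <= c" for x using c(1) by(auto simp: v'_def)
 moreover have "AE w in M. C V w = v' (nmap N W s u w)" using V0(2) AE_space
 proof eventually_elim
 case (elim w)
 have "v (nmap N W s u w) <= c" "- c <= v (nmap N W s u w)" using c(2)[OF elim(2)] v(2)[OF elim(2)] by linarith+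
 thus ?case using elim v(2) by(simp add: v'_def min_absorb2 max_absorb2)
 qed
 ultimately show ?thesis by blast
qed

lemma adapted_section:
 assumes u: "s <= u" "u <= t" and v: "v : bm (nspc N s u)" "!!x. |v x| <= c"
 shows "bdm (F u) (%w. (LINT w'|M. v (nmap N (rotated r q W) s u (w, w'))))"
 and "w : space M ==> bdm (F u) (%w'. v (nmap N (rotated r q W) s u (w, w')))"
proof -
 have m: "nmap N (rotated r q W) s u : nalg M N W s u >< M ~> nspc N s u"
 by(rule rotated_measurable) (rule W_nalg)
 have "bdm (nalg M N W s u) (%w. (LINT w'|M. v (nmap N (rotated r q W) s u (w, w'))))"
 proof(rule bdmI[where c = c])
 have "(%(w, w'). v (nmap N (rotated r q W) s u (w, w'))) : bm (nalg M N W s u >< M)"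
 using m_comp[OF m v(1)] by(simp add: cpb)
 thus "(%w. (LINT w'|M. v (nmap N (rotated r q W) s u (w, w')))) : bm (nalg M N W s u)"
 by(rule borel_measurable_lebesgue_integral)
 fix w
 have c0: "c >= 0" using v(2)[of undefined] by linarith
 show "|(LINT w'|M. v (nmap N (rotated r q W) s u (w, w')))| <= c"
 proof(cases "igb M (%w'. v (nmap N (rotated r q W) s u (w, w')))")
 case True
 have "|(LINT w'|M. v (nmap N (rotated r q W) s u (w, w')))| <= (LINT w'|M. |v (nmap N (rotated r q W) s u (w, w'))| )" by(rule integral_abs_bound)
 also have "... <= (LINT w'|M. c)" by(rule int_mono) (use True v(2) in auto)
 finally show ?thesis by(simp add: prob_space)
 qed (simp add: not_integrable_integral_eq c0)
 qed
 thus "bdm (F u) (%w. (LINT w'|M. v (nmap N (rotated r q W) s u (w, w'))))" by(rule bdm_subalg[OF nalg_F[OF u(1)]])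
 assume w: "w : space M"
 have "(%w'. nmap N (rotated r q W) s u (w, w')) : nalg M N W s u ~> nspc N s u"
 unfolding nmap_def[abs_def] nspc_def
 proof(rule measurable_restrict)
 fix j assume "j : nset N s u"
 then obtain i a b where j: "j = (i, a, b)" "i : {1..N}" "s <= a" "a <= b" "b <= u" by(auto simp: nset_def)
 note [measurable] = W_nalg[OF j(2-5), of W M]
 show "(%w'. nz (rotated r q W) j (w, w')) : bm (nalg M N W s u)" unfolding j nz_def rotated_def by simp
 qed
 hence "bdm (nalg M N W s u) (%w'. v (nmap N (rotated r q W) s u (w, w')))"
 by(intro bdmI[where c = c] m_comp[OF _ v(1)] v(2))
 thus "bdm (F u) (%w'. v (nmap N (rotated r q W) s u (w, w')))" by(rule bdm_subalg[OF nalg_F[OF u(1)]])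
qed

text \<open>The adjoint regards \<open>Y\<close> as a function of the first copy, conditions it on
  the rotated noise, and evaluates the resulting functional at the original noise, which has the
  same law.\<close>

lemma T_adj:
 assumes Y: "bdm M Y"
 shows "EX Y'. igb M Y' & (ALL V. bdm M V --> (LINT w|M. Y w * T V w) = (LINT w|M. Y' w * V w))"
proof -
 define A where "A = vimage_algebra (space (M >< M)) Zr NS"
 have Zrs: "Zr : space (M >< M) \<rightarrow> space NS" using m_space[OF Zr_meas] by blast
 have subA: "subalgebra (M >< M) A"
 unfolding suba_def A_def sets_vimage_algebra2[OF Zrs] using Zr_meas by(auto intro: m_sets)
 interpret CA: finite_measure_subalgebra "M >< M" A by unfold_locales (rule subA)
 have Yf: "bdm (M >< M) (%z. Y (fst z))" using Y by(fastforce simp: bdm_def sp_pair)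
 have Ys: "sqi (M >< M) (%z. Y (fst z))" by(rule MM.sqi_bdm[OF Yf])
 obtain h where h: "h : bm NS" "!!z. z : space (M >< M) ==> real_cond_exp (M >< M) A (%z. Y (fst z)) z = h (Zr z)"
 using doob_dynkin[OF Zrs borel_measurable_cond_exp[of "M >< M" A, unfolded A_def]] unfolding A_def by blast
 note [measurable] = h(1) factor(1)
 have h2: "igb (M >< M) (%z. (h (Zr z))^2)"
 using sqi_square[OF CA.ce_sqi(1)[OF Ys]] by(simp add: h(2) cong: Bintble_cong)
 have hs: "sqi M (%w. h (Z w))" using integral_Zr(2)[of "%x. (h x)^2"] h2 by(simp add: sqi_def)
 show ?thesis
 proof(intro exI[of _ "%w. h (Z w)"] conjI allI impI sqi_i[OF hs])
 fix V assume V: "bdm M V"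
 have Vs: "sqi M V" by(rule sqi_bdm[OF V])
 have li: "igb (M >< M) (%z. Y (fst z)*lift V z)" by(rule sqi_mi[OF Ys lift_sqi(1)[OF Vs]])
 have lA: "lift V : bm A"
 unfolding lift_def[abs_def] A_def by(rule m_comp[OF measurable_vimage_algebra1[OF Zrs] factor(1)])
 have "(LINT w|M. Y w * T V w) = (LINT w|M. (LINT w'|M. Y w * lift V (w, w')))" by(simp add: T_def)
 also have "... = (LINT z|(M >< M). lift V z*Y (fst z))"
 using MM.integral_fst[of "%w w'. Y w * lift V (w, w')"] li by(simp add: cpb mcomm)
 also have "... = (LINT z|(M >< M). lift V z*real_cond_exp (M >< M) A (%z. Y (fst z)) z)"
 by(rule CA.real_cond_exp_intg(2)[symmetric]) (use li lA bdm_m[OF Yf] in "auto simp: mult.commute")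
 also have "... = (LINT z|(M >< M). factor V (Zr z)*h (Zr z))" by(intro Bint_cong) (auto simp: h(2) lift_def)
 also have "... = (LINT w|M. factor V (Z w)*h (Z w))" by(rule integral_Zr(1)) measurable
 also have "... = (LINT w|M. h (Z w)*C V w)" by(intro Bint_cong) (auto simp: factor(2) mcomm)
 also have "... = (LINT w|M. h (Z w)*V w)"
 by(rule CE.real_cond_exp_intg(2)[OF sqi_mi[OF hs Vs] m_comp[OF nmap_nalg h(1)] bdm_m[OF V]])
 finally show "(LINT w|M. Y w * T V w) = (LINT w|M. h (Z w)*V w)" .
 qed
qed

text \<open>A rotated increment is \<open>r\<close> times the increment of the first copy plus
  \<open>q\<close> times that of the second. For a fixed first copy the other factor is known at
  time \<open>a\<close>, so the second part averages to zero.\<close>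

lemma T_incr:
 assumes i: "i : {1..N}" and ab: "s <= a" "a <= b" "b <= t" and xi: "bdm (F a) xi"
 shows "AE w in M. T (%w. xi w * (W i s b w-W i s a w)) w = r*(T xi w * (W i s b w-W i s a w))"
proof -
 have at: "a <= t" using ab by simp
 obtain v c where v: "v : bm (nspc N s a)" "!!x. |v x| <= c" "AE w in M. C xi w = v (nmap N W s a w)"
 using adapted_factor[OF ab(1) at xi] by blast
 have xiM: "bdm M xi" by(rule bdm_F[OF ab(1) xi])
 have res: "nmap N W' s a w = restrict (nmap N W' s t w) (nset N s a)" for W' :: "nat => real => real => 'b => real" and w
 by(rule nmap_restr[OF order_refl at])
 define v' where "v' x = v (restrict x (nset N s a))" for x
 have v'm[measurable]: "v' : bm NS"
 unfolding v'_def[abs_def] by(rule m_comp[OF nrestr_m[OF order_refl at] v(1)])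
 define d where "d x = x (i, s, b)-x (i, s, a)" for x :: "nat*real*real => real"
 have mem: "(i, s, b) : nset N s t" "(i, s, a) : nset N s t" using i ab by(auto simp: nset_def)
 have dm[measurable]: "d : bm NS" unfolding d_def[abs_def] nspc_def using mem by measurable
 have dW: "d (nmap N W' s t w) = W' i s b w-W' i s a w" for W' :: "nat => real => real => 'b => real" and w
 using mem by(simp add: d_def nmap_def nz_def)
 have dWs: "sqi M (%w. W i s b w-W i s a w)" by(rule B_incr_sqi[OF i]) (use ab in auto)
 have dWn: "(%w. W i s b w-W i s a w) : bm (nalg M N W s t)" using i ab by(intro borel_measurable_diff W_nalg) auto
 have "AE w in M. C (%w. (W i s b w-W i s a w)*xi w) w = (W i s b w-W i s a w)*C xi w"
 by(rule CE.real_cond_exp_mult[OF dWn bdm_m[OF xiM] sqi_mi[OF dWs sqi_bdm[OF xiM]]])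
 hence "AE w in M. C (%w. xi w * (W i s b w-W i s a w)) w = v' (Z w)*d (Z w)"
 using v(3) by eventually_elim (simp add: mcomm dW v'_def res[symmetric])
 from T_eq[OF _ this] have t1: "AE w in M. T (%w. xi w * (W i s b w-W i s a w)) w = (LINT w'|M. v' (Zr (w, w'))*d (Zr (w, w')))" by measurable
 have "AE w in M. C xi w = v' (Z w)" using v(3) by eventually_elim (simp add: v'_def res[symmetric])
 from T_eq[OF v'm this] have t2: "AE w in M. T xi w = (LINT w'|M. v' (Zr (w, w')))" .
 show ?thesis using t1 t2 AE_space
 proof eventually_elim
 case (elim w)
 have vb: "bdm (F a) (%w'. v' (Zr (w, w')))"
 using adapted_section(2)[OF ab(1) at v(1,2) elim(3)] by(simp add: v'_def res)
 have vM: "bdm M (%w'. v' (Zr (w, w')))" by(rule bdm_F[OF ab(1) vb])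
 have dZ: "d (Zr (w, w')) = r*(W i s b w-W i s a w)+q*(W i s b w'-W i s a w')" for w'
 by(simp add: dW rotated_def algs)
 have "(LINT w'|M. v' (Zr (w, w'))*d (Zr (w, w')))
 = (LINT w'|M. (r*(W i s b w-W i s a w)) * v' (Zr (w, w'))+q*(v' (Zr (w, w'))*(W i s b w'-W i s a w')))"
 unfolding dZ by(intro Bint_cong) (auto simp: algs)
 also have "... = (r*(W i s b w-W i s a w))*(LINT w'|M. v' (Zr (w, w')))+q*(LINT w'|M. v' (Zr (w, w'))*(W i s b w'-W i s a w'))"
 using bdm_i[OF vM] sqi_mi[OF sqi_bdm[OF vM] dWs] by simp
 also have "(LINT w'|M. v' (Zr (w, w'))*(W i s b w'-W i s a w')) = 0" by(rule B_mart[OF i ab(1,2) vb])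
 finally show ?case using elim by simp
 qed
qed

lemma rotated_pairing: "ito_pairing M F F s {1..N} (%i. W i s) t T r"
proof unfold_locales
 fix V V' :: "'w => real" assume V: "sqi M V"
 show "sqi M (T V)" by(rule T_sqi(1)[OF V])
 show "(LINT w|M. (T V w)^2) <= (LINT w|M. (V w)^2)" by(rule T_sqi(2)[OF V])
 show "AE w in M. T (%w. V w+V' w) w = T V w+T V' w" if V': "sqi M V'"
 using T_lin[OF V V', of "%w. V w+V' w" 1] CE.real_cond_exp_add[OF sqi_i[OF V] sqi_i[OF V']] by simp
 show "AE w in M. T (%w. c*V w) w = c*T V w" for c
 proof -
 have "AE w in M. C (%w. c*V w) w = C V w+(c-1)*C V w"
 using CE.real_cond_exp_cmult[OF sqi_i[OF V], of c] by eventually_elim (simp add: algs)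
 from T_lin[OF V V this] show ?thesis by eventually_elim (simp add: algs)
 qed
next
 have "AE w in M. C (%_. 1) w = 1" by(rule CE.real_cond_exp_F_meas) auto
 from T_eq[OF _ this] show "AE w in M. T (%_. 1) w = 1" by(simp add: prob_space)
next
 show "EX Z'. igb M Z' & (ALL V. bdm M V --> (LINT w|M. Y w * T V w) = (LINT w|M. Z' w * V w))" if "bdm M Y" for Y
 by(rule T_adj[OF that])
next
 fix V u assume u: "s <= u" "u <= t" and V: "bdm (F u) V"
 obtain v c where v: "v : bm (nspc N s u)" "!!x. |v x| <= c" "AE w in M. C V w = v (nmap N W s u w)"
 using adapted_factor[OF u V] by blast
 have res: "nmap N W' s u w = restrict (nmap N W' s t w) (nset N s u)" for W' :: "nat => real => real => 'b => real" and w
 by(rule nmap_restr[OF order_refl u(2)])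
 have "AE w in M. T V w = (LINT w'|M. v (restrict (Zr (w, w')) (nset N s u)))"
 by(rule T_eq[OF m_comp[OF nrestr_m[OF order_refl u(2)] v(1)]]) (use v(3) res[of W] in simp)
 hence "AE w in M. T V w = (LINT w'|M. v (nmap N (rotated r q W) s u (w, w')))" by(simp add: res)
 thus "EX V'. bdm (F u) V' & (AE w in M. T V w = V' w)" using adapted_section(1)[OF u v(1,2)] by blast
next
 show "AE w in M. T (%w. xi w * (W i s b w-W i s a w)) w = r*(T xi w * (W i s b w-W i s a w))"
 if "i : {1..N}" "s <= a" "a <= b" "b <= t" "bdm (F a) xi" for i a b xi by(rule T_incr[OF that])
qed

end

section \<open>Continuity of the rotations\<close>

locale rotated_sequence = driven M F s N W
 for M :: "'w measure" and F :: "real => 'w measure" and s :: real and N :: nat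
 and W :: "nat => real => real => 'w => real" +
 fixes t :: real and r q :: "nat => real"
 assumes st: "s <= t" and rq: "!!n. (r n)^2+(q n)^2 = 1" and r_lim: "r ----> 1" and q_lim: "q ----> 0"
begin

abbreviation (input) "Z \<equiv> nmap N W s t"
abbreviation (input) "Zr n \<equiv> nmap N (rotated (r n) (q n) W) s t"
abbreviation (input) "NS \<equiv> nspc N s t"

sublocale MM: pair_prob_space M M ..

lemma rn: "rotated_noise M F s N W t (r n) (q n)" by unfold_locales (rule st, rule rq)

lemma r0: "rotated_noise M F s N W t 1 0" by unfold_locales (use st in auto)

text \<open>The first copy is itself a rotation, by the angle zero, so the transfer lemmas of
  \<open>rotated_noise\<close> apply to it as well.\<close>

lemma Z0: "nmap N (rotated 1 0 W) s t z = Z (fst z)"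
 by(auto simp: nmap_def nz_def rotated_def fun_eq_iff split: prod.split)

lemma Z_meas[measurable]: "Z : M ~> NS" by(rule rotated_noise.Z_meas[OF r0])

lemma Zr_meas[measurable]: "Zr n : M >< M ~> NS" by(rule rotated_noise.Zr_meas[OF rn])

lemma int_fst:
 assumes "a : bm NS" shows "(LINT z|(M >< M). a (Z (fst z))) = (LINT w|M. a (Z w) :: real)"
 "igb (M >< M) (%z. a (Z (fst z))) <-> igb M (%w. a (Z w) :: real)"
 using rotated_noise.integral_Zr[OF r0 assms] unfolding Z0 by auto

lemma int_rot:
 assumes "a : bm NS" shows "(LINT z|(M >< M). a (Zr n z)) = (LINT w|M. a (Z w) :: real)"
 "igb (M >< M) (%z. a (Zr n z)) <-> igb M (%w. a (Z w) :: real)"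
 using rotated_noise.integral_Zr[OF rn assms] by auto

definition good :: "((nat*real*real => real) => real) => bool" where
 "good h <-> h : bm NS & igb M (%w. h (Z w)) &
 (%n. (LINT z|(M >< M). |h (Z (fst z))-h (Zr n z)| )) ----> 0"

lemma good_di:
 fixes h :: "(nat*real*real => real) => real"
 assumes "h : bm NS" "igb M (%w. h (Z w))" shows "igb (M >< M) (%z. |h (Z (fst z))-h (Zr n z)| )"
 using int_fst(2)[OF assms(1)] int_rot(2)[OF assms(1)] assms(2) by auto

text \<open>All rotated noises have one law, so replacing \<open>h\<close> by \<open>g m\<close>
  costs the same error for every n; three errors of a third each suffice.\<close>

lemma good_L1_limit:
 assumes g: "!!m. good (g m)" and h: "h : bm NS" "igb M (%w. h (Z w))"
 and lim: "(%m. (LINT w|M. |g m (Z w)-h (Z w)| )) ----> 0" shows "good h"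
proof -
 have "(%n. (LINT z|(M >< M). |h (Z (fst z))-h (Zr n z)| )) ----> 0"
 proof(rule LIMSEQ_I)
 fix et :: real assume et: "et > 0"
 have "\<forall>\<^sub>F m in sequentially. (LINT w|M. |g m (Z w)-h (Z w)| ) < et /3" by(rule order_tendstoD(2)[OF lim]) (use et in simp)
 then obtain m where m: "(LINT w|M. |g m (Z w)-h (Z w)| ) < et /3" by(auto simp: eventually_sequentially)
 have gm: "g m : bm NS" "igb M (%w. g m (Z w))" using g[of m] by(auto simp: good_def)
 have "\<forall>\<^sub>F n in sequentially. (LINT z|(M >< M). |g m (Z (fst z))-g m (Zr n z)| ) < et /3"
 by(rule order_tendstoD(2)[of _ 0]) (use et g[of m] in "auto simp: good_def")
 then obtain n0 where n0: "!!n. n >= n0 ==> (LINT z|(M >< M). |g m (Z (fst z))-g m (Zr n z)| ) < et /3" by(auto simp: eventually_sequentially)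
 define d where "d x = |g m x-h x|" for x
 have d: "d : bm NS" unfolding d_def[abs_def] using gm(1) h(1) by measurable
 have di: "igb M (%w. d (Z w))" unfolding d_def using gm(2) h(2) by auto
 have "norm ((LINT z|(M >< M). |h (Z (fst z))-h (Zr n z)| )-0) < et" if n: "n >= n0" for n
 proof -
 have i: "igb (M >< M) (%z. d (Z (fst z)))" "igb (M >< M) (%z. d (Zr n z))"
 "igb (M >< M) (%z. |g m (Z (fst z))-g m (Zr n z)| )"
 using int_fst(2)[OF d] int_rot(2)[OF d] di good_di[OF gm] by auto
 have "(LINT z|(M >< M). |h (Z (fst z))-h (Zr n z)| ) <= (LINT z|(M >< M). d (Z (fst z))+|g m (Z (fst z))-g m (Zr n z)|+d (Zr n z))"
 by(rule int_mono[OF good_di[OF h]]) (use i in "auto simp: d_def")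
 also have "... = (LINT w|M. d (Z w))+(LINT z|(M >< M). |g m (Z (fst z))-g m (Zr n z)| )+(LINT w|M. d (Z w))"
 using i by(simp add: int_fst(1)[OF d] int_rot(1)[OF d])
 also have "... < et" using m n0[OF n] by(simp add: d_def)
 finally show ?thesis by(simp add: Bint_nonneg)
 qed
 thus "EX no. ALL n>=no. norm ((LINT z|(M >< M). |h (Z (fst z))-h (Zr n z)| )-0) < et" by blast
 qed
 thus ?thesis using h by(simp add: good_def)
qed

lemma good_lin:
 assumes g: "good g" and h: "good h" shows "good (%x. g x+c*h x)"
proof -
 have gm: "g : bm NS" "igb M (%w. g (Z w))" and hm: "h : bm NS" "igb M (%w. h (Z w))"
 using g h by(auto simp: good_def)
 have m: "(%x. g x+c*h x) : bm NS" using gm hm by measurable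
 have i: "igb M (%w. g (Z w)+c*h (Z w))" using gm hm by simp
 have "(%n. (LINT z|(M >< M). |(g (Z (fst z))+c*h (Z (fst z)))-(g (Zr n z)+c*h (Zr n z))| )) ----> 0"
 proof(rule tendsto_sandwich[OF _ _ t_const])
 have le: "(LINT z|(M >< M). |(g (Z (fst z))+c*h (Z (fst z)))-(g (Zr n z)+c*h (Zr n z))| )
 <= (LINT z|(M >< M). |g (Z (fst z))-g (Zr n z)| )+|c| * (LINT z|(M >< M). |h (Z (fst z))-h (Zr n z)| )" for n
 proof -
 have "(LINT z|(M >< M). |(g (Z (fst z))+c*h (Z (fst z)))-(g (Zr n z)+c*h (Zr n z))| )
 <= (LINT z|(M >< M). |g (Z (fst z))-g (Zr n z)|+|c| * |h (Z (fst z))-h (Zr n z)| )"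
 proof(rule int_mono[OF good_di[OF m i]])
 show "igb (M >< M) (%z. |g (Z (fst z))-g (Zr n z)|+|c| * |h (Z (fst z))-h (Zr n z)| )"
 using good_di[OF gm] good_di[OF hm] by simp
 fix z
 have "(g (Z (fst z))+c*h (Z (fst z)))-(g (Zr n z)+c*h (Zr n z)) = (g (Z (fst z))-g (Zr n z))+c*(h (Z (fst z))-h (Zr n z))"
 by(simp add: algs)
 thus "|(g (Z (fst z))+c*h (Z (fst z)))-(g (Zr n z)+c*h (Zr n z))| <= |g (Z (fst z))-g (Zr n z)|+|c| * |h (Z (fst z))-h (Zr n z)|"
 using abs_triangle_ineq[of "g (Z (fst z))-g (Zr n z)" "c*(h (Z (fst z))-h (Zr n z))"] by(simp add: abs_mult)
 qed
 thus ?thesis using good_di[OF gm, of n] good_di[OF hm, of n] by simp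
 qed
 thus "\<forall>\<^sub>F n in sequentially. (LINT z|(M >< M). |(g (Z (fst z))+c*h (Z (fst z)))-(g (Zr n z)+c*h (Zr n z))| )
 <= (LINT z|(M >< M). |g (Z (fst z))-g (Zr n z)| )+|c| * (LINT z|(M >< M). |h (Z (fst z))-h (Zr n z)| )" by simp
 have "(%n. (LINT z|(M >< M). |g (Z (fst z))-g (Zr n z)| )+|c| * (LINT z|(M >< M). |h (Z (fst z))-h (Zr n z)| )) ----> 0+|c| * 0"
 using g h by(intro tendsto_add t_mult t_const) (auto simp: good_def)
 thus "(%n. (LINT z|(M >< M). |g (Z (fst z))-g (Zr n z)| )+|c| * (LINT z|(M >< M). |h (Z (fst z))-h (Zr n z)| )) ----> 0" by simp
 qed (simp add: Bint_nonneg)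
 thus ?thesis using m i by(simp add: good_def)
qed

lemma coordinate_measurable: "j : nset N s t ==> (%z. z j) : bm NS"
 unfolding nspc_def by(rule measurable_component_singleton)

lemma good_const: "good (%_. c)" by(simp add: good_def)

lemma good_continuous_product:
 assumes K: "finite K" "K <= nset N s t" and g: "!!j. continuous_on UNIV (g j)" "!!j x. 0 <= g j x" "!!j x. g j x <= (1::real)"
 shows "good (%z. PROD j:K. g j (z j))"
proof -
 have m: "(%z. PROD j:K. g j (z j)) : bm NS"
 using K by(intro borel_measurable_prod m_comp[OF coordinate_measurable bm_cont[OF g(1)]]) auto
 have b: "0 <= (PROD j:K. g j (z j))" "(PROD j:K. g j (z j)) <= 1" for z :: "nat*real*real => real"
 using g by(auto intro!: prod_nonneg prod_le_1)
 have i: "igb M (%w. PROD j:K. g j (Z w j))"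
 by(rule bdm_i, rule bdmI[where c = 1], rule m_comp[OF Z_meas m]) (use b in auto)
 have "(%n. (LINT z|(M >< M). |(PROD j:K. g j (Z (fst z) j))-(PROD j:K. g j (Zr n z j))| )) ----> (LINT z|(M >< M). 0)"
 proof(rule dom_conv[where w = "%_. 1"])
 show "(%z. |(PROD j:K. g j (Z (fst z) j))-(PROD j:K. g j (Zr n z j))| ) : bm (M >< M)" for n
 using bm_int[OF good_di[OF m i]] .
 show "AE z in M >< M. (%n. |(PROD j:K. g j (Z (fst z) j))-(PROD j:K. g j (Zr n z j))| ) ----> 0"
 proof(rule AE_I2)
 fix z
 have c: "(%n. g j (Zr n z j)) ----> g j (Z (fst z) j)" if "j : K" for j
 proof(rule continuous_on_tendsto_compose[OF g(1)])
 have "(%n. r n*nz W j (fst z)+q n*nz W j (snd z)) ----> 1*nz W j (fst z)+0*nz W j (snd z)"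
 by(intro tendsto_add t_mult t_const r_lim q_lim)
 thus "(%n. Zr n z j) ----> Z (fst z) j"
 using that K(2) by(auto simp: nmap_def nz_def rotated_def split: prod.splits)
 qed auto
 have "(%n. |(PROD j:K. g j (Z (fst z) j))-(PROD j:K. g j (Zr n z j))| ) ----> |(PROD j:K. g j (Z (fst z) j))-(PROD j:K. g j (Z (fst z) j))|"
 by(intro tendsto_rabs tendsto_diff t_const tendsto_prod c)
 thus "(%n. |(PROD j:K. g j (Z (fst z) j))-(PROD j:K. g j (Zr n z j))| ) ----> 0" by simp
 qed
 show "AE z in M >< M. norm |(PROD j:K. g j (Z (fst z) j))-(PROD j:K. g j (Zr n z j))| <= 1" for n
 proof(rule AE_I2)
 fix z
 show "norm |(PROD j:K. g j (Z (fst z) j))-(PROD j:K. g j (Zr n z j))| <= 1"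
 using b[of "Z (fst z)"] b[of "Zr n z"] by(simp add: abs_le_iff)
 qed
 qed auto
 thus ?thesis using m i by(simp add: good_def)
qed

definition "nbox K a = {z : space NS. ALL j:K. a j < z j}" for K :: "(nat*real*real) set" and a :: "nat*real*real => real"

lemma box_sets: "finite K ==> K <= nset N s t ==> nbox K a : sets NS"
proof -
 assume K: "finite K" "K <= nset N s t"
 have "{z : space NS. a j < z j} : sets NS" if "j : K" for j
 using bm_const coordinate_measurable[of j] that K by(intro borel_measurable_less) auto
 hence "{z : space NS. ALL j:K. a j < z j} : sets NS" using K(1) by(intro sets.sets_Collect_finite_All) auto
 thus ?thesis by(simp add: nbox_def)
qed

lemma good_cong:
 assumes "good h" and eq: "!!x. x : space NS ==> h x = h' x" shows "good h'"
proof -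
 have s: "Z w : space NS" if "w : space M" for w using m_space[OF Z_meas that] .
 have s': "Zr n z : space NS" if "z : space (M >< M)" for z n using m_space[OF Zr_meas that] .
 have "(LINT z|(M >< M). |h (Z (fst z))-h (Zr n z)| ) = (LINT z|(M >< M). |h' (Z (fst z))-h' (Zr n z)| )" for n
 by(intro Bint_cong) (use eq s s' in "auto simp: sp_pair")
 moreover have "igb M (%w. h (Z w)) = igb M (%w. h' (Z w))" using eq s by(intro Bintble_cong) auto
 moreover have "h : bm NS <-> h' : bm NS" using eq by(rule measurable_cong)
 ultimately show ?thesis using assms(1) by(simp add: good_def)
qed

lemma good_limit:
 assumes g: "!!m. good (g m)" and h: "h : bm NS" and k: "igb M (%w. k (Z w))"
 and le: "!!m x. x : space NS ==> |g m x| <= k x" and lim: "!!x. x : space NS ==> (%m. g m x) ----> h x"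
 shows "good h"
proof(rule good_L1_limit[OF g h])
 have s: "Z w : space NS" if "w : space M" for w using m_space[OF Z_meas that] .
 have m: "(%w. g m (Z w)) : bm M" "(%w. h (Z w)) : bm M" for m using g[of m] h by(auto simp: good_def)
 show "igb M (%w. h (Z w))"
 by(rule integrable_dominated_convergence[where s = "%m w. g m (Z w)", OF m(2) m(1) k]) (simp_all add: le lim s)
 have "(%m. (LINT w|M. |g m (Z w)-h (Z w)| )) ----> (LINT w|M. 0)"
 proof(rule dom_conv[where w = "%w. 2*k (Z w)"])
 show "(%w. |g m (Z w)-h (Z w)| ) : bm M" for m using m(1)[of m] m(2) by measurable
 show "AE w in M. (%m. |g m (Z w)-h (Z w)| ) ----> 0" by(intro AE_I2 tendsto_rabs_zero LIM_zero lim s)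
 show "AE w in M. norm |g m (Z w)-h (Z w)| <= 2*k (Z w)" for m
 proof(rule AE_I2)
 fix w assume "w : space M"
 hence "|g m (Z w)| <= k (Z w)" "|h (Z w)| <= k (Z w)"
 using le s LIMSEQ_le_const2[OF tendsto_rabs[OF lim[OF s]]] by auto
 thus "norm |g m (Z w)-h (Z w)| <= 2*k (Z w)" by simp
 qed
 qed (use k in auto)
 thus "(%m. (LINT w|M. |g m (Z w)-h (Z w)| )) ----> 0" by simp
qed

text \<open>Products of continuous ramps increase to the indicator, because the box is open on its
  lower sides.\<close>

lemma good_box:
 assumes K: "finite K" "K <= nset N s t" shows "good (ind (nbox K a))"
proof -
 define f where "f m x = max 0 (min 1 (real m*x))" for m and x :: real
 have f: "continuous_on UNIV (%x. f m (x-b))" "0 <= f m x" "f m x <= 1" for m x b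
 unfolding f_def by(auto intro!: continuous_intros)
 have fl: "(%m. f m x) ----> (if 0 < x then 1 else 0)" for x
 proof(cases "0 < x")
 case True
 have "\<forall>\<^sub>F m in sequentially. f m x = 1"
 using eventually_ge_at_top[of "nat \<lceil>1/x\<rceil>"]
 proof eventually_elim
 case (elim m)
 hence "1/x <= real m" by linarith
 hence "1 <= real m*x" using True by(simp add: pos_divide_le_eq)
 thus ?case by(simp add: f_def)
 qed
 thus ?thesis using True by(simp add: tendsto_eventually)
 next
 case False
 hence "f m x = 0" for m by(simp add: f_def mult_nonneg_nonpos max_absorb1 min.coboundedI2)
 thus ?thesis using False by simp
 qed
 show ?thesis
 proof(rule good_limit[where k = "%_. 1"])
 show "good (%z. PROD j:K. f m (z j-a j))" for m by(rule good_continuous_product[OF K, of "%j x. f m (x-a j)"]) (use f in auto)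
 show "ind (nbox K a) : bm NS" using box_sets[OF K, of a] by measurable
 fix z assume z: "z : space NS"
 show "|PROD j:K. f m (z j-a j)| <= 1" for m
 using f(2,3) by(subst abs_of_nonneg) (auto intro!: prod_nonneg prod_le_1)
 have "(PROD j:K. if 0 < z j-a j then 1 else 0 :: real) = ind (nbox K a) z"
 proof(cases "z : nbox K a")
 case False
 then obtain j where j: "j : K" "~ a j < z j" using z by(auto simp: nbox_def)
 have "(PROD j:K. if 0 < z j-a j then 1 else 0 :: real) = 0" by(rule prod_zero[OF K(1)]) (use j in auto)
 thus ?thesis using False by simp
 qed (simp add: nbox_def)
 moreover have "(%m. PROD j:K. f m (z j-a j)) ----> (PROD j:K. if 0 < z j-a j then 1 else 0)" by(intro tendsto_prod fl)
 ultimately show "(%m. PROD j:K. f m (z j-a j)) ----> ind (nbox K a) z" by simp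
 qed auto
qed

lemma sets_NS_boxes: "sets NS = sigma_sets (space NS) {nbox K a | K a. finite K & K <= nset N s t}" (is "_ = sigma_sets _ ?G")
proof
 have sub: "?G <= Pow (space NS)" by(auto simp: nbox_def)
 define \<Sigma> where "\<Sigma> = sigma (space NS) ?G"
 have sS: "sets \<Sigma> = sigma_sets (space NS) ?G" "space \<Sigma> = space NS" using sub by(auto simp: \<Sigma>_def)
 show "sigma_sets (space NS) ?G <= sets NS" by(rule sets.sigma_sets_subset) (auto simp: box_sets)
 have "sets (\<Pi>\<^sub>M j\<in>nset N s t. borel :: real measure) <= sets \<Sigma>"
 proof(rule sets_PiM_in_sets)
 show sp: "space \<Sigma> = (\<Pi>\<^sub>E i\<in>nset N s t. space (borel :: real measure))" by(simp add: sS nspc_def space_PiM)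
 fix j and A :: "real set" assume j: "j : nset N s t" and A: "A : sets borel"
 have "(%z. z j) : bm \<Sigma>" unfolding borel_measurable_iff_greater
 proof
 fix c :: real
 have "{ww : space \<Sigma>. c < ww j} = nbox {j} (%_. c)" by(auto simp: nbox_def sS)
 also have "... : sets \<Sigma>" unfolding sS using j by(intro sigma_sets.Basic) auto
 finally show "{ww : space \<Sigma>. c < ww j} : sets \<Sigma>" .
 qed
 from m_sets[OF this A] show "{x : space \<Sigma>. x j : A} : sets \<Sigma>" by(simp add: vimage_def Int_def conj_commute)
 qed
 thus "sets NS <= sigma_sets (space NS) ?G" unfolding sS(1)[symmetric] by(simp add: nspc_def)
qed

lemma good_bounded:
 assumes h: "bdm NS h" shows "good h" using h sets_NS_boxes
proof(rule bdm_induct_generator)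
 let ?G = "{nbox K a | K a. finite K & K <= nset N s t}"
 show "Int_stable ?G"
 proof(rule Int_stableI)
 fix A B assume "A : ?G" "B : ?G"
 then obtain K a L b where K: "A = nbox K a" "finite K" "K <= nset N s t" and L: "B = nbox L b" "finite L" "L <= nset N s t" by blast
 define c where "c j = (if j : K & j : L then max (a j) (b j) else if j : K then a j else b j)" for j
 have "A Int B = nbox (K Un L) c" unfolding K(1) L(1)
 proof(intro set_eqI iffI)
 fix x assume "x : nbox K a Int nbox L b"
 thus "x : nbox (K Un L) c" by(auto simp: nbox_def c_def)
 next
 fix x assume x: "x : nbox (K Un L) c"
 have "a j < x j" if "j : K" for j using x that by(cases "j : L") (auto simp: nbox_def c_def dest!: bspec[of _ _ j])
 moreover have "b j < x j" if "j : L" for j using x that by(cases "j : K") (auto simp: nbox_def c_def dest!: bspec[of _ _ j])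
 ultimately show "x : nbox K a Int nbox L b" using x by(auto simp: nbox_def)
 qed
 thus "A Int B : ?G" using K L by blast
 qed
 show "?G <= Pow (space NS)" unfolding nbox_def by blast
 show "good (ind A)" if "A : ?G" for A using that good_box by auto
 show "good (%_. 1)" by(rule good_const)
 show "good (%x. u x+c * v x)" if "good u" "good v" for c u v using that by(rule good_lin)
 show "good v" if "good u" "!!x. x : space NS ==> u x = v x" for u v using that by(rule good_cong)
 show "good u" if "!!i x. x : space NS ==> |U i x| <= c" "!!i. good (U i)" "!!x. x : space NS ==> (%i. U i x) ----> u x" "bdm NS u"
 for U u and c :: real by(rule good_limit[OF that(2) bdm_m[OF that(4)], of "%_. c"]) (use that in auto)
qed

lemma good_integrable:
 assumes hm: "h : bm NS" and hi: "igb M (%w. h (Z w))" shows "good h"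
proof(rule good_limit[OF _ hm])
 show "good (%x. max (- real m) (min (real m) (h x)))" for m
 by(rule good_bounded, rule bdmI[where c = "real m"]) (use hm in auto)
 show "igb M (%w. |h (Z w)| )" using hi by simp
 fix x
 show "|max (- real m) (min (real m) (h x))| <= |h x|" for m by auto
 have "\<forall>\<^sub>F m in sequentially. max (- real m) (min (real m) (h x)) = h x"
 using eventually_ge_at_top[of "nat \<lceil>|h x|\<rceil>"] by eventually_elim linarith
 thus "(%m. max (- real m) (min (real m) (h x))) ----> h x" by(rule tendsto_eventually)
qed

end

section \<open>Three or more rays\<close>

context driven
begin

text \<open>If the conditional law is a point mass at \<open>ph\<close>, then integrating
  \<open>g\<close> against it gives \<open>g (ph w)\<close> itself. For \<open>X\<close>, the
  difference between \<open>g (ph w)\<close> and its conditional expectation, this yields E[X^2] =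
  0.\<close>

lemma conditional_law_dirac:
 fixes ph :: "'w => 'm::topological_space"
 assumes law: "is_conditional_law M (NA N M W s u) ph kap" and ph: "ph : bm M" and kap: "kap : M ~> PA"
 and eq: "AE w in M. kap w = return borel (ph w)"
 and g: "bdm borel g" and u: "s <= u" "u <= t" and gF: "bdm (F u) (%w. g (ph w))"
 shows "AE w in M. (CE M N W s t) (%w. g (ph w)) w = g (ph w)"
proof -
 obtain V where V: "bdm (nalg M N W s u) V" "AE w in M. (CE M N W s t) (%w. g (ph w)) w = V w"
 "AE w in M. (CE M N W s u) (%w. g (ph w)) w = V w" by(rule immersion_bounded[OF u gF])
 have VM: "bdm M V" by(rule bdm_subalg[OF nalg_sub V(1)])
 have gM: "bdm M (%w. g (ph w))" by(rule bdm_subalg[OF F_sub gF]) (use u in auto)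
 define X where "X w = g (ph w)+(-1)*V w" for w
 have XM: "bdm M X" unfolding X_def by(intro bdm_add bdm_mult bdm_const gM VM)
 have "(LINT w|M. X w * g (ph w)) = (LINT w|M. X w * (LINT y|(kap w). g y))"
 proof(rule int_cong_AE)
 show "AE w in M. X w * g (ph w) = X w * (LINT y|(kap w). g y)"
 using eq by eventually_elim (simp add: integral_return bdm_m[OF g])
 qed (use bdm_m[OF XM] bdm_m[OF gM] bdm_m[OF bdm_ker[OF kap g]] in auto)
 also have "... = (LINT w|M. X w * (CE M N W s u) (%w. g (ph w)) w)"
 by(rule conditional_law_pairing[OF law ph kap g XM])
 also have "... = (LINT w|M. X w * V w)"
 proof(rule int_cong_AE)
 show "AE w in M. X w * (CE M N W s u) (%w. g (ph w)) w = X w * V w" using V(3) by eventually_elim simp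
 qed (use bdm_m[OF XM] bdm_m[OF VM] in auto)
 finally have "(LINT w|M. X w * g (ph w)-X w * V w) = 0"
 using bdm_i[OF bdm_mult[OF XM gM]] bdm_i[OF bdm_mult[OF XM VM]] by simp
 hence "(LINT w|M. (X w)^2) = 0" by(simp add: X_def p2es algs)
 hence "AE w in M. (X w)^2 = 0" using bdm_i[OF bdm_mult[OF XM XM]] by(subst (asm) int_0_AE) (auto simp: p2es)
 with V(2) show ?thesis by eventually_elim (simp add: X_def)
qed

end

context star
begin

text \<open>A real coding of the star graph, which reduces \<open>'g\<close>-valued functions of the noises to real
 ones.\<close>

definition code :: "'g => real" where "code = sfun 0 (%i r. real i+r/(1+r))"

text \<open>The integer part is the ray and the fractional part r/(1+r) the radius; the origin has
  code 0, which is no index of a ray. \<open>max 0\<close> makes the second argument of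
  \<open>e\<close> meaningful and the map continuous on the whole line.\<close>

definition decode :: "real => 'g" where
 "decode z = (if nat \<lfloor>z\<rfloor> : {1..N} then e (nat \<lfloor>z\<rfloor>) (max 0 (frac z/(1-frac z))) else origin e)"

lemma code_bdm: "bdm borel code" unfolding code_def
proof(rule sfun_bdm[where K = "real N+1"])
 fix i and r :: real assume "i : {1..N}" "r >= 0"
 hence "real i <= real N" "r/(1+r) <= 1" "0 <= r/(1+r)" by(auto simp: divide_le_eq_1)
 thus "|real i+r/(1+r)| <= real N+1" by simp
qed auto

lemma decode_code: "decode (code x) = x"
proof(cases "x = origin e")
 case True
 thus ?thesis by(simp add: decode_def code_def sfun_def)
next
 case False
 define r where "r = rad x"
 have r: "r > 0" using rad_pos[OF False] by(simp add: r_def)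
 have c: "code x = real (idx x)+r/(1+r)" using False by(simp add: code_def sfun_def r_def)
 have b: "0 <= r/(1+r)" "r/(1+r) < 1" using r by(auto simp: fs)
 have fl: "\<lfloor>code x\<rfloor> = int (idx x)" unfolding c using b by(simp add: floor_eq_iff)
 hence f: "frac (code x) = r/(1+r)" by(simp add: frac_def c)
 have "frac (code x)/(1-frac (code x)) = r" unfolding f using r by(simp add: fs)
 thus ?thesis using fl r ray_idx(1,3)[OF False] by(simp add: decode_def r_def)
qed

lemma decode_measurable[measurable]: "decode : bm borel"
proof -
 have e: "(%y. e i (max 0 y)) : bm borel" if i: "i : {1..N}" for i
 proof(rule bm_cont, rule continuous_onI)
 fix x ep :: real assume "ep > 0"
 thus "EX d>0. ALL x':UNIV. dist x' x < d --> dist (e i (max 0 x')) (e i (max 0 x)) <= ep"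
 by(intro exI[of _ ep]) (auto simp: e_dist[OF i] dist_real_def)
 qed
 have "(%z. if k : {1..N} then e k (max 0 (frac z/(1-frac z))) else origin e) : bm borel" for k
 proof(cases "k : {1..N}")
 case True
 have "(%z :: real. frac z/(1-frac z)) : bm borel" unfolding frac_def by measurable
 from m_comp[OF this e[OF True]] show ?thesis using True by simp
 qed auto
 thus ?thesis unfolding decode_def[abs_def] by(rule measurable_compose_countable) measurable
qed

text \<open>These real functions dominate \<open>rdist\<close> by their differences, so the L1
  continuity of rotations can be applied ray by ray.\<close>

definition on_ray :: "nat => 'g => real" where "on_ray k = sfun 0 (%i r. if i = k then r/p i else 0)"

lemma on_ray_eq: "on_ray k x = (if x ~= origin e & idx x = k then S x else 0)"
 by(auto simp: on_ray_def S_def sfun_def)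

lemma on_ray_measurable[measurable]: "on_ray k : bm borel" unfolding on_ray_def by measurable

lemma rdist_le: "rdist z <= (SUM k:{1..N}. |on_ray k (fst z)-on_ray k (snd z)| )"
proof -
 obtain x y where z: "z = (x, y)" by fastforce
 have single: "g k <= (SUM k:{1..N}. g k)" if "k : {1..N}" "!!k. 0 <= g k" for g :: "nat => real" and k
 using that by(intro member_le_sum) auto
 have pair: "g k+g l <= (SUM k:{1..N}. g k)" if "k : {1..N}" "l : {1..N}" "k ~= l" "!!k. 0 <= g k" for g :: "nat => real" and k l
 using sum_mono2[of "{1..N}" "{k, l}" g] that by auto
 let ?g = "%k. |on_ray k x-on_ray k y|"
 consider "x = origin e" "y = origin e" | "x = origin e" "y ~= origin e" | "x ~= origin e" "y = origin e"
 | "x ~= origin e" "y ~= origin e" "idx x = idx y" | "x ~= origin e" "y ~= origin e" "idx x ~= idx y" by blast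
 hence "rdist (x, y) <= sum ?g {1..N}"
 proof cases
 case 1 thus ?thesis by(simp add: rdist_def sray_def sum_nonneg)
 next
 case 2 thus ?thesis using single[of "idx y" ?g, OF ray_idx(1)] by(simp add: rdist_def sray_def on_ray_eq)
 next
 case 3 thus ?thesis using single[of "idx x" ?g, OF ray_idx(1)] by(simp add: rdist_def sray_def on_ray_eq)
 next
 case 4 thus ?thesis using single[of "idx x" ?g, OF ray_idx(1)] by(simp add: rdist_def sray_def on_ray_eq)
 next
 case 5 thus ?thesis using pair[of "idx x" "idx y" ?g, OF ray_idx(1) ray_idx(1)] by(simp add: rdist_def sray_def on_ray_eq)
 qed
 thus ?thesis by(simp add: z)
qed

lemma rdist_m[measurable]: "rdist : bm (borel >< borel)" unfolding rdist_def[abs_def] by measurable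

text \<open>If the flow is a functional of the noise, its position at time 1 and the same functional
  of a rotated noise have a two-point measure of correlation \<open>r n < 1\<close>. By
  \<open>two_point_separation\<close> their mean distance stays above a fixed positive number when N
  >= 3, while it tends to zero as \<open>r n\<close> tends to 1.\<close>

lemma wiener_solution_two_rays:
 fixes ph :: "real => real => 'g => 'w => 'g"
 assumes P: "prob_space M" and jphi: "jointly M borel ph" and jKW: "jointly M (PA) KW"
 and sphi: "solves_ISDE N e p M (dfl ph) W"
 and law: "!!s t x. s <= t ==> is_conditional_law M (NA N M W s t) (ph s t x) (KW s t x)"
 and eq: "!!s t x. s <= t ==> AE w in M. dfl ph s t x w = KW s t x w" shows "N = 2"
proof(rule ccontr)
 assume "N ~= 2"
 hence N3: "N >= 3" using N2 by simp
 interpret prob_space M by fact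
 note jd = dirac_m[OF jphi]
 have KWm: "KW s t x : M ~> PA" and dm: "dfl ph s t x : M ~> PA"
 and phim: "ph s t x : bm M" if "s <= t" for s t x
 using flow_mt(2)[OF jKW that] flow_mt(2)[OF jd that] flow_mt(2)[OF jphi that] by auto
 let ?F = "FF N M (dfl ph) W 0"
 interpret D: driven M ?F 0 N W by(rule driven_sol[OF P dm sphi])
 define X where "X u = ph 0 u (origin e)" for u
 \<comment> \<open>Strictly below 1, as the separation bound demands, and tending to 1.\<close>
 define r where "r n = 1-1/(real n+2)" for n
 define q where "q n = sqrt (1-(r n)^2)" for n
 have r: "0 <= r n" "r n < 1" for n by(auto simp: r_def fs)
 have r_lim: "r ----> 1" unfolding r_def by real_asymp
 have "q ----> sqrt (1-1\<^sup>2)" unfolding q_def by(intro tendsto_intros r_lim)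
 hence q_lim: "q ----> 0" by simp
 have rq: "(r n)^2+(q n)^2 = 1" for n using r[of n] by(simp add: q_def power_le_one)
 interpret R: rotated_sequence M ?F 0 N W 1 r q by unfold_locales (use rq r_lim q_lim in auto)
 have XF: "bdm (?F u) (%w. g (X u w))" if u: "0 <= u" and g: "bdm borel g" for u g
 proof -
 have dg: "(%w. g (X u w)) = (%w. (LINT y|(dfl ph 0 u (origin e) w). g y))"
 using bdm_m[OF g] by(intro ext) (simp add: dirac_flow_def integral_return X_def)
 show ?thesis unfolding dg
 proof(rule bdm_ker[OF K_ff[where u = 0 and v = u and x = "origin e"] g])
 show "dfl ph 0 u (origin e) : space M \<rightarrow> space (PA)" using dm[OF u] by(auto dest: m_space)
 qed (use u in auto)
 qed
 \<comment> \<open>For every time u the functional is written on the noise over all of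
   \<open>[0, 1]\<close>, so that one rotation acts on all of them.\<close>
 have "EX h. h : R.NS ~> borel & (AE w in M. X u w = h (R.Z w))" if u: "u : {0..1}" for u
 proof -
 have u': "0 <= u" "u <= 1" using u by auto
 have "AE w in M. KW 0 u (origin e) w = return borel (X u w)"
 using eq[OF u'(1), of "origin e"] by eventually_elim (simp add: dirac_flow_def X_def)
 from D.conditional_law_dirac[OF law[OF u'(1), of "origin e", folded X_def] _ KWm[OF u'(1)] this code_bdm u' XF[OF u'(1) code_bdm]]
 have AE: "AE w in M. (CE M N W 0 1) (%w. code (X u w)) w = code (X u w)"
 using phim[OF u'(1)] by(simp add: X_def)
 obtain v where v: "v : bm R.NS" "!!w. w : space M ==> (CE M N W 0 1) (%w. code (X u w)) w = v (R.Z w)"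
 using doob_dynkin_nalg[OF borel_measurable_cond_exp[of M "nalg M N W 0 1" "%w. code (X u w)"]] by blast
 have "AE w in M. X u w = decode (v (R.Z w))"
 using AE AE_space by eventually_elim (simp add: v(2)[symmetric] decode_code)
 moreover have "(%z. decode (v z)) : R.NS ~> borel" using v(1) by measurable
 ultimately show ?thesis by(intro exI[of _ "%z. decode (v z)"] conjI)
 qed
 then obtain xh where xh: "!!u. u : {0..1} ==> xh u : R.NS ~> borel" "!!u. u : {0..1} ==> AE w in M. X u w = xh u (R.Z w)"
 by metis
 define mu where "mu n u = distr (M >< M) (borel >< borel) (%z. (xh u (R.Z (fst z)), xh u (R.Zr n z)))" for n u
 have xm: "(%z. (xh u (R.Z (fst z)), xh u (R.Zr n z))) : M >< M ~> borel >< borel" if "u : {0..1}" for n u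
 using xh(1)[OF that] R.Z_meas R.Zr_meas[of n] by measurable
 have mu: "prob_space (mu n u)" "sets (mu n u) = sets (borel >< borel)" if "u : {0..1}" for n u
 unfolding mu_def by(rule R.MM.prob_space_distr[OF xm[OF that]]) simp
 have eqn: "(LINT z|(mu n u). f (fst z)*g (snd z)) = (LINT w|M. (LINT y|(dfl ph 0 u (origin e) w). f y) *
 rotated_noise.T M 0 N W 1 (r n) (q n) (%w. (LINT y|(dfl ph 0 u (origin e) w). g y)) w)"
 if u: "u : {0..1}" and f: "bdm borel f" and g: "bdm borel g" for n u f g
 proof -
 interpret Q: rotated_noise M ?F 0 N W 1 "r n" "q n" by(rule R.rn)
 have dg: "(LINT y|(dfl ph 0 u (origin e) w). h y) = h (X u w)" if "bdm borel h" for h :: "'g => real" and w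
 using bdm_m[OF that] by(simp add: dirac_flow_def integral_return X_def)
 note [measurable] = bdm_m[OF f] bdm_m[OF g] xh(1)[OF u]
 have a: "(%z. g (xh u z)) : bm R.NS" by measurable
 have gX: "(%w. g (X u w)) : bm M" "(%w. f (X u w)) : bm M" using phim[of 0 u] u by(auto simp: X_def)
 have CV: "AE w in M. (CE M N W 0 1) (%w. g (X u w)) w = g (xh u (R.Z w))"
 proof -
 have am: "(%w. g (xh u (R.Z w))) : bm (nalg M N W 0 1)" by(rule m_comp[OF nmap_nalg a])
 have ab: "bdm M (%w. g (xh u (R.Z w)))" using g am by(auto simp: bdm_def)
 have "AE w in M. (CE M N W 0 1) (%w. g (X u w)) w = (CE M N W 0 1) (%w. g (xh u (R.Z w))) w"
 proof(rule Q.CE.real_cond_exp_cong)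
 show "AE w in M. g (X u w) = g (xh u (R.Z w))" using xh(2)[OF u] by eventually_elim simp
 qed (use gX bdm_m[OF ab] in auto)
 moreover have "AE w in M. (CE M N W 0 1) (%w. g (xh u (R.Z w))) w = g (xh u (R.Z w))"
 by(rule Q.CE.real_cond_exp_F_meas[OF bdm_i[OF ab] am])
 ultimately show ?thesis by eventually_elim simp
 qed
 have "(LINT z|(mu n u). f (fst z)*g (snd z)) = (LINT z|(M >< M). f (xh u (R.Z (fst z)))*g (xh u (R.Zr n z)))"
 unfolding mu_def by(subst integral_distr[OF xm[OF u]]) auto
 also have "... = (LINT w|M. (LINT w'|M. f (xh u (R.Z w))*g (xh u (R.Zr n (w, w')))))"
 proof -
 have "bdm (M >< M) (%z. f (xh u (R.Z (fst z)))*g (xh u (R.Zr n z)))"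
 proof(rule bdm_mult)
 show "bdm (M >< M) (%z. f (xh u (R.Z (fst z))))" using f unfolding bdm_def by auto
 show "bdm (M >< M) (%z. g (xh u (R.Zr n z)))" using g unfolding bdm_def by auto
 qed
 from R.MM.integral_fst'[OF R.MM.bdm_i[OF this]] show ?thesis by simp
 qed
 also have "... = (LINT w|M. f (X u w)*Q.T (%w. g (X u w)) w)"
 proof(rule int_cong_AE)
 show "AE w in M. (LINT w'|M. f (xh u (R.Z w))*g (xh u (R.Zr n (w, w')))) = f (X u w)*Q.T (%w. g (X u w)) w"
 using Q.T_eq[OF a CV] xh(2)[OF u] by eventually_elim simp
 show "(%w. f (X u w)*Q.T (%w. g (X u w)) w) : bm M" using gX unfolding Q.T_def by measurable
 qed measurable
 finally show ?thesis unfolding dg[OF f] dg[OF g] .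
 qed
 have "EX Lm. tpt (r n) (origin e) (origin e) (mu n 1) Lm & measure Lm (space Lm) = 1-0" for n
 by(rule two_pointI[OF rotated_noise.rotated_pairing[OF R.rn] _ semimart_sol[OF P dm sphi flow_mt(1)[OF jd]]
 semimart_sol[OF P dm sphi flow_mt(1)[OF jd]] flow_mt(1)[OF jd] flow_mt(1)[OF jd] mu eqn]) auto
 then obtain Lm where tp: "!!n. tpt (r n) (origin e) (origin e) (mu n 1) (Lm n)" and Lm: "!!n. measure (Lm n) (space (Lm n)) = 1"
 by(simp only: diff_zero) metis
 have 1: "1 : {0..1 :: real}" by simp
 note [measurable] = xh(1)[OF 1]
 define h where "h z = S (xh 1 z)" for z
 have hm: "h : bm R.NS" unfolding h_def[abs_def] by measurable
 have S1: "(LINT z|(mu n 1). S (fst z)) = (LINT w|M. h (R.Z w))" for n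
 unfolding mu_def by(subst integral_distr[OF xm[OF 1]]) (auto simp: h_def R.int_fst(1)[OF hm, unfolded h_def])
 have pos: "(LINT w|M. h (R.Z w)) > 0" using not_concentrated_at_origin[OF tp[of 0]] Lm[of 0] S1[of 0] by simp
 \<comment> \<open>A Bochner integral different from zero belongs to an integrable function.\<close>
 hence hi: "igb M (%w. h (R.Z w))" using not_integrable_integral_eq by fastforce
 define G where "G k n = (LINT z|(M >< M). |on_ray k (xh 1 (R.Z (fst z)))-on_ray k (xh 1 (R.Zr n z))| )" for k n
 have om: "(%z. on_ray k (xh 1 z)) : bm R.NS" for k by measurable
 have oi: "igb M (%w. on_ray k (xh 1 (R.Z w)))" for k
 by(rule Bintble_bound[OF hi]) (use om[of k] in "auto simp: h_def on_ray_eq")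
 have "(%n. SUM k:{1..N}. G k n) ----> (SUM k:{1..N}. 0)"
 by(rule tendsto_sum) (use R.good_integrable[OF om oi] in "simp add: R.good_def G_def")
 hence lim: "(%n. SUM k:{1..N}. G k n) ----> 0" by simp
 have N: "0 < 1-2/real N" using N3 by(simp add: fs)
 have le: "(1-2/real N)*(LINT w|M. h (R.Z w)) <= (SUM k:{1..N}. G k n)" for n
 proof -
 note di = R.good_di[OF om oi]
 have i: "igb (M >< M) (%z. h (R.Z (fst z)))" "igb (M >< M) (%z. h (R.Zr n z))"
 using R.int_fst(2)[OF hm] R.int_rot(2)[OF hm] hi by auto
 have "(LINT z|(mu n 1). S (fst z)+S (snd z)) = (LINT z|(M >< M). h (R.Z (fst z))+h (R.Zr n z))"
 unfolding mu_def by(subst integral_distr[OF xm[OF 1]]) (auto simp: h_def)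
 also have "... = 2*(LINT w|M. h (R.Z w))" using i by(simp add: R.int_fst(1)[OF hm] R.int_rot(1)[OF hm])
 finally have "(1-2/real N)*(LINT w|M. h (R.Z w)) <= (1-2/real N)*(LINT z|(mu n 1). S (fst z)+S (snd z))"
 using N pos by(intro mlm) auto
 also have "... <= (LINT z|(mu n 1). rdist z)" by(rule two_point_separation[OF r tp])
 also have "... = (LINT z|(M >< M). rdist (xh 1 (R.Z (fst z)), xh 1 (R.Zr n z)))"
 unfolding mu_def by(subst integral_distr[OF xm[OF 1]]) auto
 also have "... <= (LINT z|(M >< M). (SUM k:{1..N}. |on_ray k (xh 1 (R.Z (fst z)))-on_ray k (xh 1 (R.Zr n z))| ))"
 proof(rule int_mono)
 show "igb (M >< M) (%z. SUM k:{1..N}. |on_ray k (xh 1 (R.Z (fst z)))-on_ray k (xh 1 (R.Zr n z))| )"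
 by(intro Bintble_sum di)
 thus "igb (M >< M) (%z. rdist (xh 1 (R.Z (fst z)), xh 1 (R.Zr n z)))"
 proof(rule Bintble_bound)
 show "(%z. rdist (xh 1 (R.Z (fst z)), xh 1 (R.Zr n z))) : bm (M >< M)" by(rule m_comp[OF xm[OF 1] rdist_m])
 have "0 <= rdist z" for z by(simp add: rdist_def)
 thus "AE z in M >< M. norm (rdist (xh 1 (R.Z (fst z)), xh 1 (R.Zr n z))) <= norm (SUM k:{1..N}. |on_ray k (xh 1 (R.Z (fst z)))-on_ray k (xh 1 (R.Zr n z))| )"
 using rdist_le by(intro AE_I2) (auto simp: sum_nonneg)
 qed
 fix z show "rdist (xh 1 (R.Z (fst z)), xh 1 (R.Zr n z)) <= (SUM k:{1..N}. |on_ray k (xh 1 (R.Z (fst z)))-on_ray k (xh 1 (R.Zr n z))| )"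
 using rdist_le[of "(xh 1 (R.Z (fst z)), xh 1 (R.Zr n z))"] by simp
 qed
 also have "... = (SUM k:{1..N}. G k n)" unfolding G_def by(rule Bint_sum) (rule di)
 finally show ?thesis .
 qed
 have "(1-2/real N)*(LINT w|M. h (R.Z w)) <= 0" by(rule LIMSEQ_le_const[OF lim]) (use le in blast)
 thus False using N pos by(simp add: mult_le_0_iff)
qed

end

theorem corollary2p8:
 fixes N :: nat and e :: "nat \<Rightarrow> real \<Rightarrow> 'g::{metric_space, second_countable_topology}"
 and p :: "nat \<Rightarrow> real" and M :: "'w measure"
 and \<phi> :: "real \<Rightarrow> real \<Rightarrow> 'g \<Rightarrow> 'w \<Rightarrow> 'g"
 and W :: "nat \<Rightarrow> real \<Rightarrow> real \<Rightarrow> 'w \<Rightarrow> real"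
 and KW :: "real \<Rightarrow> real \<Rightarrow> 'g \<Rightarrow> 'w \<Rightarrow> 'g measure"
 assumes "N \<ge> 2"
 and "star_graph N e"
 and "\<forall>i\<in>{1..N}. 0 < p i \<and> p i < 1"
 and "(\<Sum>i\<in>{1..N}. p i) = 1"
 and "prob_space M"
 and "stochastic_flow_of_mappings M \<phi>"
 and "solves_ISDE N e p M (dirac_flow \<phi>) W"
 and "stochastic_flow_of_kernels M KW"
 and "\<forall>s t x. s \<le> t \<longrightarrow> is_conditional_law M (noise_algebra N M W s t) (\<phi> s t x) (KW s t x)"
 shows "(solves_ISDE N e p M KW W \<and>
 (\<forall>K. stochastic_flow_of_kernels M K \<and> solves_ISDE N e p M K W \<longrightarrow> modification M K KW))
 \<longleftrightarrow> N = 2"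
proof -
 note mod = modification_def
 interpret star N e p by unfold_locales (use assms(1-4) in auto)
 have jphi: "(%(s, t, x, \<omega>). \<phi> s t x \<omega>) : restrict_space (borel >< (borel >< (borel >< M))) {(s, t, x, \<omega>). s <= t} ~> borel"
 using assms(6) by(simp add: sfm_def hif_def)
 have jK: "(%(s, t, x, \<omega>). K s t x \<omega>) : restrict_space (borel >< (borel >< (borel >< M))) {(s, t, x, \<omega>). s <= t} ~> PA"
 if "stochastic_flow_of_kernels M K" for K :: "real => real => 'g => 'w => 'g measure"
 using that by(simp add: sfk_def hif_def)
 have law: "is_conditional_law M (NA N M W s t) (\<phi> s t x) (KW s t x)" if "s <= t" for s t x
 using assms(9) that by blast
 note dirac = dirac_flow_SFK[OF assms(5,6)]
 show ?thesis
 proof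
 assume "N = 2"
 \<comment> \<open>Applied to the Dirac flow this shows that \<open>KW\<close> is a modification of
   a solution, hence a solution; applied to an arbitrary solution it gives uniqueness.\<close>
 note unique = two_ray_uniqueness[OF this assms(5) jphi jK jK[OF assms(8)] assms(7) _ law]
 have "solves_ISDE N e p M KW W"
 by(rule solves_ISDE_modification[OF assms(5,7) jK[OF dirac] jK[OF assms(8)] unique[OF dirac assms(7)]])
 thus "solves_ISDE N e p M KW W & (ALL K. stochastic_flow_of_kernels M K & solves_ISDE N e p M K W --> modification M K KW)"
 unfolding mod using unique by blast
 next
 assume "solves_ISDE N e p M KW W & (ALL K. stochastic_flow_of_kernels M K & solves_ISDE N e p M K W --> modification M K KW)"
 \<comment> \<open>The Dirac flow is itself a solution, so uniqueness makes the flow of mappings a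
   functional of the noise.\<close>
 hence "modification M (dfl \<phi>) KW" using dirac assms(7) by blast
 thus "N = 2"
 by(intro wiener_solution_two_rays[OF assms(5) jphi jK[OF assms(8)] assms(7) law]) (auto simp: mod)
 qed
qed

end
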